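(* Let $N\ge 2$, let $\Omega$ be a ball in $\mathbb{R}^N$, and let $k\in\{0,\ldots,N-2\}$. Let $p_0>1$, $\alpha,\beta\in\mathbb{R}$, $\varkappa\ge0$ be such that $\alpha+\beta>p_0+\varkappa$. Let $\varphi$ and $\psi$ be two Orlicz functions such that $\varphi(t)\sim t^{p_0}\ln^{-\beta}t$ and $\psi(t)\sim t^{p_0}\ln^{\alpha}t$ for large $t$. Then there exists a nonnegative function $a=a(x)$ on $\Omega$ with modulus of continuity $C\ln^{-\varkappa}(1/t)$ (for some constant $C$, for small $t$) such that for the integrand $\Phi(x,t)=\varphi(t)+a(x)\psi(t)$ one has $$H^{d,\Phi(\cdot)}(\Omega,\Lambda^{k})\neq W^{d,\Phi(\cdot)}(\Omega,\Lambda^{k}),$$ and there is $b\in L^{\Phi^*(\cdot)}(\Omega,\Lambda^{N-k-1})$ for which the Lavrentiev gap $$\inf_{\omega\in W^{d,\Phi(\cdot)}_c(\Omega,\Lambda^{k})}\mathcal F_{\Phi,b}(\omega)<\inf_{\omega\in C_0^\infty(\Omega,\Lambda^{k})}\mathcal F_{\Phi,b}(\omega)$$ holds.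
   Context: An Orlicz function is a convex, left-continuous $\varphi:[0,\infty)\to[0,\infty]$ with $\varphi(0)=0$, $\lim_{t\to0}\varphi(t)/t=0$, $\lim_{t\to\infty}\varphi(t)/t=\infty$. Here $f\sim g$ means that each is bounded by a constant multiple of the other. $\Lambda^k$ denotes the exterior $k$-forms on $\mathbb{R}^N$ with Euclidean norm $|\cdot|$. For a generalized Orlicz function $\Phi(x,t)$, $\Phi^*(x,s)=\sup_{t\ge0}(st-\Phi(x,t))$, and $L^{\Phi(\cdot)}(\Omega,\Lambda^k)$ is the space of measurable $k$-forms $f$ with finite Luxemburg norm $\inf\{\lambda>0:\int_\Omega\Phi(x,|f|/\lambda)\,dV\le1\}$. $W^{d,\Phi(\cdot)}(\Omega,\Lambda^k)$ is the space of $\omega\in L^1(\Omega,\Lambda^k)$ having a weak exterior differential $d\omega\in L^{\Phi(\cdot)}(\Omega,\Lambda^{k+1})$ (weak: $\int_\Omega \omega\wedge d\xi=(-1)^{k+1}\int_\Omega d\omega\wedge\xi$ for all $\xi\in C_0^\infty(\Omega,\Lambda^{N-k-1})$), with norm $\|\omega\|_{L^1}+\|d\omega\|_{L^{\Phi(\cdot)}}$. $H^{d,\Phi(\cdot)}(\Omega,\Lambda^k)$ is the closure in $W^{d,\Phi(\cdot)}(\Omega,\Lambda^k)$ of the smooth forms belonging to that space. $W^{d,\Phi(\cdot)}_c(\Omega,\Lambda^k)$ is the set of forms in $W^{d,\Phi(\cdot)}(\Omega,\Lambda^k)$ with compact support in $\Omega$. The functional is $\mathcal F_{\Phi,b}(\omega)=\int_\Omega\Phi(x,|d\omega|)\,dV+\int_\Omega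 b\wedge d\omega$. *)

theory Defs
  imports "HOL-Analysis.Analysis"
begin

section \<open>Exterior algebra and differential forms\<close>

text \<open>
  The exterior algebra of the dual of \<open>\<real>\<^sup>N\<close> is represented by its coordinates with respect
  to the basis \<open>dx\<^sub>I = dx\<^bsub>i1\<^esub> \<and> \<dots> \<and> dx\<^bsub>im\<^esub>\<close> with \<open>I = {i1 < \<dots> < im}\<close>, indexed by the
  subsets of the index type.  The norm of the Cartesian product type is then the Euclidean
  norm for which the \<open>dx\<^sub>I\<close> are orthonormal, and the coordinate at \<open>UNIV\<close> is the coefficient
  of the volume form \<open>dx\<^sub>1 \<and> \<dots> \<and> dx\<^sub>N\<close>.
\<close>

text \<open>The notation \<open>real ^ 'n\<close> would force the sort \<open>finite\<close> on \<open>'n\<close>, but the ordering of the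
  indices is needed below for the signs; it fixes the orientation.\<close>

type_synonym 'n space = "(real, 'n) vec"
type_synonym 'n ext = "real ^ ('n set)"
type_synonym 'n form = "'n space \<Rightarrow> 'n ext"

definition covectors :: "nat \<Rightarrow> ('n::finite) ext set" where
  "covectors k = {v. \<forall>I. card I \<noteq> k \<longrightarrow> v $ I = 0}"

text \<open>For disjoint \<open>I\<close>, \<open>J\<close> one has \<open>dx\<^sub>I \<and> dx\<^sub>J = shuffle_sign I J \<cdot> dx\<^bsub>I \<union> J\<^esub>\<close>: the exponent
  counts the transpositions that sort the concatenation of \<open>I\<close> and \<open>J\<close>.\<close>

definition shuffle_sign :: "('n::{finite,linorder}) set \<Rightarrow> 'n set \<Rightarrow> real" where
  "shuffle_sign I J = (-1) ^ card {(i, j). i \<in> I \<and> j \<in> J \<and> j < i}"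

definition wedge :: "('n::{finite,linorder}) ext \<Rightarrow> 'n ext \<Rightarrow> 'n ext" where
  "wedge v w = (\<chi> K. \<Sum>I\<in>Pow K. shuffle_sign I (K - I) * v $ I * w $ (K - I))"

text \<open>\<open>d\<omega> = \<Sum>\<^sub>i dx\<^sub>i \<and> \<partial>\<^sub>i\<omega>\<close>\<close>

definition ext_d :: "('n::{finite,linorder}) form \<Rightarrow> 'n form" where
  "ext_d \<omega> x =
    (\<Sum>i\<in>UNIV. wedge (axis {i} 1) (frechet_derivative \<omega> (at x) (axis i 1)))"

definition integral_top :: "'n space set \<Rightarrow> ('n::finite) form \<Rightarrow> real" where
  "integral_top \<Omega> \<omega> = (LINT x | lebesgue_on \<Omega>. \<omega> x $ UNIV)"


section \<open>Smooth forms\<close>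

text \<open>Intended for open \<open>S\<close>.\<close>

primrec Ck_on :: "nat \<Rightarrow> 'a::real_normed_vector set \<Rightarrow> ('a \<Rightarrow> 'b::real_normed_vector) \<Rightarrow> bool" where
  "Ck_on 0 S f \<longleftrightarrow> continuous_on S f"
| "Ck_on (Suc m) S f \<longleftrightarrow>
     (\<forall>x\<in>S. f differentiable (at x)) \<and>
     (\<forall>v. Ck_on m S (\<lambda>x. frechet_derivative f (at x) v))"

definition smooth_on :: "'a::real_normed_vector set \<Rightarrow> ('a \<Rightarrow> 'b::real_normed_vector) \<Rightarrow> bool" where
  "smooth_on S f \<longleftrightarrow> (\<forall>m. Ck_on m S f)"

definition smooth_forms :: "'n space set \<Rightarrow> nat \<Rightarrow> ('n::finite) form set" where
  "smooth_forms \<Omega> k = {\<omega>. smooth_on \<Omega> \<omega> \<and> (\<forall>x\<in>\<Omega>. \<omega> x \<in> covectors k)}"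

text \<open>Elements of \<open>C\<^sub>0\<^sup>\<infinity>(\<Omega>, \<Lambda>\<^sup>k)\<close>, extended by zero to the whole space.\<close>

definition test_forms :: "'n space set \<Rightarrow> nat \<Rightarrow> ('n::finite) form set" where
  "test_forms \<Omega> k = {\<xi>. smooth_on UNIV \<xi> \<and> (\<forall>x. \<xi> x \<in> covectors k) \<and>
     (\<exists>K. compact K \<and> K \<subseteq> \<Omega> \<and> (\<forall>x. x \<notin> K \<longrightarrow> \<xi> x = 0))}"


section \<open>Orlicz functions\<close>

text \<open>Only the values on \<open>[0,\<infinity>)\<close> matter.\<close>

definition orlicz_function :: "(real \<Rightarrow> ennreal) \<Rightarrow> bool" where
  "orlicz_function \<phi> \<longleftrightarrow>
     (\<forall>s\<ge>0. \<forall>t\<ge>0. \<forall>u\<in>{0..1}.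
        \<phi> ((1 - u) * s + u * t) \<le> ennreal (1 - u) * \<phi> s + ennreal u * \<phi> t) \<and>
     (\<forall>t>0. (\<phi> \<longlongrightarrow> \<phi> t) (at_left t)) \<and>
     \<phi> 0 = 0 \<and>
     ((\<lambda>t. \<phi> t / ennreal t) \<longlongrightarrow> 0) (at_right 0) \<and>
     ((\<lambda>t. \<phi> t / ennreal t) \<longlongrightarrow> \<infinity>) at_top"

definition comparable_at_top :: "(real \<Rightarrow> ennreal) \<Rightarrow> (real \<Rightarrow> real) \<Rightarrow> bool" where
  "comparable_at_top \<phi> g \<longleftrightarrow>
     (\<exists>C>0. \<forall>\<^sub>F t in at_top. \<phi> t \<le> ennreal (C * g t) \<and> ennreal (g t) \<le> ennreal C * \<phi> t)"

text \<open>Subtraction on \<open>ennreal\<close> is truncated at \<open>0\<close>; since the term for \<open>t = 0\<close> is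
  \<open>0\<close> whenever \<open>\<Phi> x 0 = 0\<close>, this does not change the supremum.\<close>

definition conjugate :: "('a \<Rightarrow> real \<Rightarrow> ennreal) \<Rightarrow> 'a \<Rightarrow> real \<Rightarrow> ennreal" where
  "conjugate \<Phi> x s = (SUP t\<in>{0..}. ennreal (s * t) - \<Phi> x t)"


section \<open>Function spaces of forms\<close>

text \<open>
  Spaces are sets of representatives, of which only the values on \<open>\<Omega>\<close> matter; each space
  below is closed under changing a representative (among forms of the same degree)
  on a null set.
\<close>

definition luxemburg_norm ::
    "('n space \<Rightarrow> real \<Rightarrow> ennreal) \<Rightarrow> 'n space set \<Rightarrow> ('n::finite) form \<Rightarrow> ennreal" where
  "luxemburg_norm \<Phi> \<Omega> f =
     (INF l\<in>{l. 0 < l \<and> (\<integral>\<^sup>+ x. \<Phi> x (norm (f x) / l) \<partial>lebesgue_on \<Omega>) \<le> 1}. ennreal l)"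

definition Orlicz_forms ::
    "('n space \<Rightarrow> real \<Rightarrow> ennreal) \<Rightarrow> 'n space set \<Rightarrow> nat \<Rightarrow> ('n::finite) form set" where
  "Orlicz_forms \<Phi> \<Omega> k = {f. f \<in> borel_measurable (lebesgue_on \<Omega>) \<and>
     (\<forall>x\<in>\<Omega>. f x \<in> covectors k) \<and> luxemburg_norm \<Phi> \<Omega> f < \<infinity>}"

definition L1_forms :: "'n space set \<Rightarrow> nat \<Rightarrow> ('n::finite) form set" where
  "L1_forms \<Omega> k = {f. integrable (lebesgue_on \<Omega>) f \<and> (\<forall>x\<in>\<Omega>. f x \<in> covectors k)}"

text \<open>\<open>\<eta>\<close> is a weak exterior differential of the \<open>k\<close>-form \<open>\<omega>\<close>; both are required to be locally
  integrable so that the integrals are meaningful.\<close>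

definition has_weak_d ::
    "'n space set \<Rightarrow> nat \<Rightarrow> ('n::{finite,linorder}) form \<Rightarrow> 'n form \<Rightarrow> bool" where
  "has_weak_d \<Omega> k \<omega> \<eta> \<longleftrightarrow>
     (\<forall>x\<in>\<Omega>. \<omega> x \<in> covectors k \<and> \<eta> x \<in> covectors (k + 1)) \<and>
     (\<forall>K. compact K \<and> K \<subseteq> \<Omega> \<longrightarrow> integrable (lebesgue_on K) \<omega> \<and> integrable (lebesgue_on K) \<eta>) \<and>
     (\<forall>\<xi>\<in>test_forms \<Omega> (CARD('n) - k - 1).
        integral_top \<Omega> (\<lambda>x. wedge (\<omega> x) (ext_d \<xi> x)) =
          (-1) ^ (k + 1) * integral_top \<Omega> (\<lambda>x. wedge (\<eta> x) (\<xi> x)))"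

text \<open>The weak differential is unique up to null sets; \<open>weak_d\<close> selects a representative.\<close>

definition weak_d ::
    "'n space set \<Rightarrow> nat \<Rightarrow> ('n::{finite,linorder}) form \<Rightarrow> 'n form" where
  "weak_d \<Omega> k \<omega> = (SOME \<eta>. has_weak_d \<Omega> k \<omega> \<eta>)"

definition W_d ::
    "('n space \<Rightarrow> real \<Rightarrow> ennreal) \<Rightarrow> 'n space set \<Rightarrow> nat \<Rightarrow>
      ('n::{finite,linorder}) form set" where
  "W_d \<Phi> \<Omega> k =
     {\<omega> \<in> L1_forms \<Omega> k. \<exists>\<eta>\<in>Orlicz_forms \<Phi> \<Omega> (k + 1). has_weak_d \<Omega> k \<omega> \<eta>}"

definition W_d_norm ::
    "('n space \<Rightarrow> real \<Rightarrow> ennreal) \<Rightarrow> 'n space set \<Rightarrow> nat \<Rightarrow>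
      ('n::{finite,linorder}) form \<Rightarrow> ennreal" where
  "W_d_norm \<Phi> \<Omega> k \<omega> =
     (\<integral>\<^sup>+ x. ennreal (norm (\<omega> x)) \<partial>lebesgue_on \<Omega>) + luxemburg_norm \<Phi> \<Omega> (weak_d \<Omega> k \<omega>)"

definition H_d ::
    "('n space \<Rightarrow> real \<Rightarrow> ennreal) \<Rightarrow> 'n space set \<Rightarrow> nat \<Rightarrow>
      ('n::{finite,linorder}) form set" where
  "H_d \<Phi> \<Omega> k = {\<omega> \<in> W_d \<Phi> \<Omega> k.
     \<forall>\<epsilon>>0. \<exists>\<eta>\<in>W_d \<Phi> \<Omega> k \<inter> smooth_forms \<Omega> k.
       W_d_norm \<Phi> \<Omega> k (\<lambda>x. \<omega> x - \<eta> x) < ennreal \<epsilon>}"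

definition W_d_c ::
    "('n space \<Rightarrow> real \<Rightarrow> ennreal) \<Rightarrow> 'n space set \<Rightarrow> nat \<Rightarrow>
      ('n::{finite,linorder}) form set" where
  "W_d_c \<Phi> \<Omega> k = {\<omega> \<in> W_d \<Phi> \<Omega> k.
     \<exists>K. compact K \<and> K \<subseteq> \<Omega> \<and> (AE x in lebesgue_on \<Omega>. x \<notin> K \<longrightarrow> \<omega> x = 0)}"

definition functional ::
    "('n space \<Rightarrow> real \<Rightarrow> ennreal) \<Rightarrow> ('n::{finite,linorder}) form \<Rightarrow> 'n space set \<Rightarrow> nat \<Rightarrow>
      'n form \<Rightarrow> ereal" where
  "functional \<Phi> b \<Omega> k \<omega> =
     enn2ereal (\<integral>\<^sup>+ x. \<Phi> x (norm (weak_d \<Omega> k \<omega> x)) \<partial>lebesgue_on \<Omega>) +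
     ereal (integral_top \<Omega> (\<lambda>x. wedge (b x) (weak_d \<Omega> k \<omega> x)))"


section \<open>Moduli of continuity\<close>

definition has_modulus_near_0 ::
    "'a::metric_space set \<Rightarrow> ('a \<Rightarrow> real) \<Rightarrow> (real \<Rightarrow> real) \<Rightarrow> bool" where
  "has_modulus_near_0 S a \<mu> \<longleftrightarrow>
     (\<exists>\<delta>>0. \<forall>x\<in>S. \<forall>y\<in>S. 0 < dist x y \<and> dist x y < \<delta> \<longrightarrow> \<bar>a x - a y\<bar> \<le> \<mu> (dist x y))"

end

theory Submission
  imports Defs "HOL-Real_Asymp.Real_Asymp"
begin

text \<open>
  Fix two coordinates \<open>s, t\<close> centred at \<open>x0\<close>, split the remaining ones into \<open>J\<close> with \<open>|J| = k\<close> and \<open>L\<close>, and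
  put \<open>u = \<theta> f dx\<^sub>J\<close> and \<open>b = d(\<zeta> g dx\<^sub>L)\<close>, where \<open>f\<close>, \<open>g\<close> are functions of \<open>s, t\<close> and \<open>\<zeta>\<close>, \<open>\<theta>\<close> are
  cutoffs with \<open>\<theta> = 1\<close> on the support of \<open>\<zeta>\<close>. Being exact with compact support, \<open>b\<close> satisfies
  \<open>\<integral> b \<and> d\<eta> = 0\<close> for every smooth \<open>\<eta>\<close>. The functions are built from a Cantor set \<open>K\<close> on the line \<open>t = 0\<close>:
  one of them jumps across \<open>K\<close>, the other is, on this line, the Cantor function of \<open>K\<close>, so that
  \<open>\<integral> b \<and> du \<noteq> 0\<close>, while the gradients live on sets \<open>A\<^sub>n\<close> for \<open>f\<close> and \<open>B\<^sub>n\<close> for \<open>g\<close> whose mutual distance is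
  comparable with the side \<open>l\<^sub>n\<close> of the \<open>n\<close>-th generation.

  The weight \<open>a = \<omega>(dist(\<cdot>, \<Union>\<^sub>n A\<^sub>n))\<close> vanishes where \<open>du\<close> is large, so only \<open>\<phi>\<close> has to control \<open>du\<close>, and it is at
  least \<open>\<omega>(c l\<^sub>n)\<close> on \<open>B\<^sub>n\<close>, so \<open>a \<psi>\<close> controls \<open>b\<close> by duality. With gradients of size \<open>v\<^sub>n\<close> and \<open>s\<^sub>n\<close>
  and stages of measure \<open>\<mu>\<^sub>n\<close> one has \<open>\<mu>\<^sub>n v\<^sub>n s\<^sub>n \<approx> 1\<close>, and the branching of \<open>K\<close> is tuned such that
  \<open>\<mu>\<^sub>n v\<^sub>n\<^sup>p \<approx> n\<^sup>\<sigma>\<close> for \<open>p = p0\<close>. The two modulars are then finite if \<open>\<kappa> - \<alpha> + p0 - 1 < \<sigma> < \<beta> - 1\<close>.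
  Whether \<open>f\<close> is the jump or the Cantor function depends on whether \<open>p0\<close> is below or above \<open>2\<close>.
\<close>

section \<open>Weak partial derivatives\<close>

text \<open>Since \<open>l n = l0 / M ^ n\<close>, the logarithms of \<open>1 / l n\<close> and of
  the gradients are comparable with \<open>n\<close>, and every logarithm in the statement becomes a
  power of \<open>n\<close>. The modular of \<open>du\<close> behaves like the sum of
  \<open>n^(\<sigma> - \<beta>)\<close>. For \<open>b\<close>, where
  \<open>s = 1 / (\<mu> v)\<close>, the choice \<open>T = n^\<delta> v\<close> in Young's inequality
  costs the sum of \<open>\<mu> s T = n^\<delta>\<close>, so \<open>\<delta> < -1\<close>, while
  \<open>s T \<le> \<omega> \<psi>(T)\<close> amounts to
  \<open>\<sigma> + \<alpha> - \<kappa> + \<delta> (p - 1) > 0\<close>; this is the origin of the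
  lower bound for \<open>\<sigma>\<close>. Some \<open>\<sigma>\<close> fits between the bounds
  exactly when \<open>\<alpha> + \<beta> > p + \<kappa>\<close>. With \<open>N\<close> intervals of
  length \<open>l\<close> a stage has measure about \<open>N l^2\<close>. If \<open>f\<close> is the
  jump, then \<open>v = 1 / l\<close>, and \<open>\<mu> v^p = N l^(2 - p)\<close> asks for
  \<open>N\<close> of order \<open>l^(p - 2) n^\<sigma>\<close>. If \<open>f\<close> is the Cantor
  function, then \<open>v = 1 / (N l)\<close>, and \<open>N^(1 - p) l^(2 - p)\<close> asks for
  \<open>N\<close> of order \<open>l^(-(p - 2) / (p - 1)) n^(-\<sigma> / (p - 1))\<close>. As
  \<open>N \<ge> 1\<close>, the first works for \<open>p < 2\<close> and the second for
  \<open>p > 2\<close>; at \<open>p = 2\<close> only the power of \<open>n\<close> is left, and the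
  sign of \<open>\<sigma>\<close> decides.\<close>

definition pd :: "'n::finite \<Rightarrow> (real^'n \<Rightarrow> real) \<Rightarrow> real^'n \<Rightarrow> real" where
  "pd j w x = frechet_derivative w (at x) (axis j 1)"

definition C1_on :: "(real^'n::finite) set \<Rightarrow> (real^'n \<Rightarrow> real) \<Rightarrow> bool" where
  "C1_on S w \<longleftrightarrow> (\<forall>x\<in>S. w differentiable (at x)) \<and> (\<forall>j. continuous_on S (pd j w))"

lemma pd_eq: "(w has_derivative w') (at x) \<Longrightarrow> pd j w x = w' (axis j 1)"
  unfolding pd_def using frechet_derivative_at by metis

lemma C1_onD: "C1_on S w \<Longrightarrow> x \<in> S \<Longrightarrow> w differentiable (at x)"
  "C1_on S w \<Longrightarrow> continuous_on S (pd j w)"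
  "C1_on S w \<Longrightarrow> continuous_on S w"
  unfolding C1_on_def
  by (auto intro: continuous_at_imp_continuous_on differentiable_imp_continuous_within)

lemma C1_on_subset: "C1_on S w \<Longrightarrow> T \<subseteq> S \<Longrightarrow> C1_on T w"
  unfolding C1_on_def by (auto intro: continuous_on_subset)

lemma pd_mult:
  assumes "v differentiable (at x)" "w differentiable (at x)"
  shows "pd j (\<lambda>x. v x * w x) x = v x * pd j w x + pd j v x * w x"
proof -
  have v: "(v has_derivative frechet_derivative v (at x)) (at x)"
    and w: "(w has_derivative frechet_derivative w (at x)) (at x)"
    using assms by (simp_all add: frechet_derivative_works[symmetric])
  show ?thesis
    by (subst pd_eq[OF has_derivative_mult[OF v w]]) (simp add: pd_def)
qed

lemma C1_on_mult:
  assumes "C1_on S v" "C1_on S w"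
  shows "C1_on S (\<lambda>x. v x * w x)"
proof -
  have "continuous_on S (pd j (\<lambda>x. v x * w x))" for j
  proof -
    have "continuous_on S (\<lambda>x. v x * pd j w x + pd j v x * w x)"
      by (intro continuous_intros C1_onD(2,3) assms)
    then show ?thesis
      by (rule continuous_on_eq) (use assms in \<open>auto simp: pd_mult C1_on_def\<close>)
  qed
  then show ?thesis using assms unfolding C1_on_def by auto
qed

lemma pd_const [simp]: "pd j (\<lambda>x. c) x = 0"
  by (subst pd_eq[of _ "\<lambda>_. 0"]) auto

lemma C1_on_const: "C1_on S (\<lambda>x. c)"
  unfolding C1_on_def by (simp add: continuous_on_eq[OF continuous_on_const, of S 0])

lemma pd_comp_coord:
  assumes "(\<alpha> has_real_derivative d) (at (x $ i - c))"
  shows "(\<lambda>x. \<alpha> (x $ i - c)) differentiable (at x)"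
    "pd j (\<lambda>x. \<alpha> (x $ i - c)) x = (if j = i then d else 0)"
proof -
  have 1: "((\<lambda>x. x $ i - c) has_derivative (\<lambda>h. h $ i)) (at x)"
    by (auto intro!: derivative_eq_intros bounded_linear_imp_has_derivative)
  have 2: "((\<lambda>x. \<alpha> (x $ i - c)) has_derivative (\<lambda>h. d * (h $ i))) (at x)"
    using has_derivative_compose[OF 1, of \<alpha> "(*) d"] assms
    by (simp add: has_field_derivative_def)
  show "(\<lambda>x. \<alpha> (x $ i - c)) differentiable (at x)" using 2 unfolding differentiable_def by blast
  show "pd j (\<lambda>x. \<alpha> (x $ i - c)) x = (if j = i then d else 0)"
    by (subst pd_eq[OF 2]) (auto simp: axis_def)
qed

lemma C1_on_comp_coord:
  assumes "\<And>t. (\<alpha> has_real_derivative \<alpha>' t) (at t)" "continuous_on UNIV \<alpha>'"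
  shows "C1_on S (\<lambda>x. \<alpha> (x $ i - c))"
proof -
  have "continuous_on S (\<lambda>x. if j = i then \<alpha>' (x $ i - c) else 0)" for j
    by (cases "j = i") (auto intro!: continuous_on_compose2[OF assms(2)] continuous_intros)
  then have "continuous_on S (pd j (\<lambda>x. \<alpha> (x $ i - c)))" for j
    by (rule continuous_on_eq) (simp add: pd_comp_coord(2)[OF assms(1)])
  then show ?thesis unfolding C1_on_def by (auto intro: pd_comp_coord(1)[OF assms(1)])
qed

lemma
  assumes "\<And>i. C1_on S (f i)" "finite I"
  shows C1_on_prod: "C1_on S (\<lambda>x. \<Prod>i\<in>I. f i x)"
    and pd_prod_0: "x \<in> S \<Longrightarrow> (\<And>i. i \<in> I \<Longrightarrow> pd j (f i) x = 0) \<Longrightarrow> pd j (\<lambda>x. \<Prod>i\<in>I. f i x) x = 0"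
proof -
  have "C1_on S (\<lambda>x. \<Prod>i\<in>I. f i x) \<and> (x \<in> S \<longrightarrow> (\<forall>i\<in>I. pd j (f i) x = 0) \<longrightarrow> pd j (\<lambda>x. \<Prod>i\<in>I. f i x) x = 0)"
    using assms(2)
  proof induction
    case empty then show ?case by (simp add: C1_on_const)
  next
    case (insert a I)
    then show ?case
      by (auto simp: C1_on_mult assms(1) pd_mult C1_onD(1)[OF assms(1)] C1_onD(1))
  qed
  then show "C1_on S (\<lambda>x. \<Prod>i\<in>I. f i x)"
    "x \<in> S \<Longrightarrow> (\<And>i. i \<in> I \<Longrightarrow> pd j (f i) x = 0) \<Longrightarrow> pd j (\<lambda>x. \<Prod>i\<in>I. f i x) x = 0" by blast+
qed

lemma
  assumes "open S" "x \<in> S" "\<And>y. y \<in> S \<Longrightarrow> v y = w y"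
  shows pd_cong_open: "pd j v x = pd j w x"
    and differentiable_cong_open: "w differentiable (at x) \<Longrightarrow> v differentiable (at x)"
proof -
  have e: "(v has_derivative D) (at x) \<longleftrightarrow> (w has_derivative D) (at x)" for D
    using has_derivative_transform_within_open[OF _ assms(1,2), of v D UNIV w]
      has_derivative_transform_within_open[OF _ assms(1,2), of w D UNIV v] assms(3) by auto
  then show "pd j v x = pd j w x" unfolding pd_def frechet_derivative_def by simp
  show "w differentiable (at x) \<Longrightarrow> v differentiable (at x)"
    using e unfolding differentiable_def by blast
qed

lemma C1_on_cong:
  assumes "open S" "\<And>y. y \<in> S \<Longrightarrow> v y = w y" "C1_on S w"
  shows "C1_on S v"
  unfolding C1_on_def
proof (intro conjI ballI allI)
  show "v differentiable (at x)" if "x \<in> S" for x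
    by (rule differentiable_cong_open[OF assms(1) that _ C1_onD(1)[OF assms(3) that]]) (rule assms(2))
  show "continuous_on S (pd j v)" for j
    by (rule continuous_on_eq[OF C1_onD(2)[OF assms(3)]])
      (rule pd_cong_open[OF assms(1), symmetric], use assms(2) in auto)
qed

lemma C1_on_Un:
  assumes "open S" "open T" "C1_on S w" "C1_on T w"
  shows "C1_on (S \<union> T) w"
  using assms unfolding C1_on_def by (auto intro: continuous_on_open_Un)

text \<open>\<open>\<Omega>\<close> and the complement of \<open>K\<close> are open and cover the
  space; on the first the extension is \<open>w\<close>, on the second it is
  \<open>0\<close>.\<close>

lemma
  assumes "open \<Omega>" "C1_on \<Omega> w" "compact K" "K \<subseteq> \<Omega>" "\<And>x. x \<in> \<Omega> \<Longrightarrow> x \<notin> K \<Longrightarrow> w x = 0"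
  shows C1_extend_zero: "C1_on UNIV (\<lambda>x. if x \<in> \<Omega> then w x else 0)"
    and pd_extend_zero: "pd j (\<lambda>x. if x \<in> \<Omega> then w x else 0) x = (if x \<in> \<Omega> then pd j w x else 0)"
    and pd_zero_outside: "x \<in> \<Omega> \<Longrightarrow> x \<notin> K \<Longrightarrow> pd j w x = 0"
proof -
  let ?v = "\<lambda>x. if x \<in> \<Omega> then w x else 0"
  have oK: "open (- K)" using assms(3) by (simp add: compact_imp_closed open_Compl)
  have 1: "C1_on \<Omega> ?v" by (rule C1_on_cong[OF assms(1) _ assms(2)]) auto
  have 2: "C1_on (- K) ?v" by (rule C1_on_cong[OF oK _ C1_on_const[of _ 0]]) (use assms(5) in auto)
  have "\<Omega> \<union> - K = UNIV" using assms(4) by auto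
  then show "C1_on UNIV ?v" using C1_on_Un[OF assms(1) oK 1 2] by simp
  have a: "pd j ?v x = pd j w x" if "x \<in> \<Omega>" for x by (rule pd_cong_open[OF assms(1) that]) auto
  have b: "pd j ?v x = 0" if "x \<notin> K" for x
    using pd_cong_open[OF oK, of x ?v "\<lambda>_. 0" j] that assms(5) by auto
  show "pd j ?v x = (if x \<in> \<Omega> then pd j w x else 0)" using a b assms(4) by auto
  show "x \<in> \<Omega> \<Longrightarrow> x \<notin> K \<Longrightarrow> pd j w x = 0" using a b by metis
qed

lemma line_deriv:
  assumes "w differentiable (at (x + s *\<^sub>R axis j 1))"
  shows "((\<lambda>s. w (x + s *\<^sub>R axis j 1)) has_real_derivative pd j w (x + s *\<^sub>R axis j 1)) (at s)"
proof -
  let ?D = "frechet_derivative w (at (x + s *\<^sub>R axis j 1))"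
  have D: "(w has_derivative ?D) (at (x + s *\<^sub>R axis j 1))"
    using assms by (simp add: frechet_derivative_works[symmetric])
  have 1: "((\<lambda>s. x + s *\<^sub>R axis j 1) has_derivative (\<lambda>h. h *\<^sub>R axis j 1)) (at s)"
    by (auto intro!: derivative_eq_intros)
  have "((\<lambda>s. w (x + s *\<^sub>R axis j 1)) has_derivative (\<lambda>h. ?D (h *\<^sub>R axis j 1))) (at s)"
    using has_derivative_compose[OF 1 D] .
  moreover have "?D (h *\<^sub>R axis j 1) = pd j w (x + s *\<^sub>R axis j 1) * h" for h
    using linear_scale[OF has_derivative_linear[OF D]] unfolding pd_def by simp
  ultimately have "((\<lambda>s. w (x + s *\<^sub>R axis j 1)) has_derivative (\<lambda>h. pd j w (x + s *\<^sub>R axis j 1) * h)) (at s)"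
    by simp
  then show ?thesis unfolding has_field_derivative_def .
qed

section \<open>The integral of a partial derivative with compact support\<close>

lemma lebesgue_integral_shift:
  fixes f :: "'a::euclidean_space \<Rightarrow> real"
  assumes "f \<in> borel_measurable borel"
  shows "(LINT x|lborel. f (c + x)) = (LINT x|lborel. f x)"
proof -
  have "integral\<^sup>L lborel f = integral\<^sup>L (distr lborel borel ((+) c)) f" by (simp add: lborel_distr_plus)
  also have "\<dots> = (LINT x|lborel. f (c + x))" using assms by (subst integral_distr) auto
  finally show ?thesis by simp
qed

lemma integrable_compact_support:
  fixes w :: "real^'n::finite \<Rightarrow> real"
  assumes "continuous_on UNIV w" "compact K" "\<And>x. x \<notin> K \<Longrightarrow> w x = 0"
  shows "integrable lborel w"
proof -
  have "integrable lborel (\<lambda>x. indicat_real K x *\<^sub>R w x)"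
    using borel_integrable_compact[OF assms(2) continuous_on_subset[OF assms(1)]] by blast
  moreover have "(\<lambda>x. indicat_real K x *\<^sub>R w x) = w"
    using assms(3) by (intro ext) (auto simp: indicator_def)
  ultimately show ?thesis by simp
qed

text \<open>Translation invariance of Lebesgue measure makes the integral of every difference quotient
  vanish; no Fubini argument is needed.\<close>

lemma integral_pd_eq_0_lborel:
  assumes w: "C1_on UNIV w" and K: "compact K" "\<And>x. x \<notin> K \<Longrightarrow> w x = 0"
  shows "(LINT x|lborel. pd j w x) = 0"
proof -
  let ?e = "axis j 1 :: real^'a"
  have z: "pd j w x = 0" if "x \<notin> K" for x
    using pd_zero_outside[OF open_UNIV w K(1)] K(2) that by auto
  have "bounded (pd j w ` K)"
    using compact_continuous_image[OF continuous_on_subset[OF C1_onD(2)[OF w]] K(1)]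
    by (simp add: compact_imp_bounded)
  then obtain B0 where "\<And>x. x \<in> K \<Longrightarrow> \<bar>pd j w x\<bar> \<le> B0" unfolding bounded_iff by auto
  then have B: "\<bar>pd j w x\<bar> \<le> max B0 0" for x using z by (cases "x \<in> K") fastforce+
  define B where "B = max B0 0"
  obtain \<rho> where \<rho>: "K \<subseteq> cball 0 \<rho>" using compact_imp_bounded[OF K(1)] by (metis bounded_iff mem_cball_0 subsetI)
  let ?t = "\<lambda>n. 1 / real (Suc n)"
  let ?q = "\<lambda>n x. (w (?t n *\<^sub>R ?e + x) - w x) / ?t n"
  have wm[measurable]: "w \<in> borel_measurable borel"
    using C1_onD(3)[OF w] by (rule borel_measurable_continuous_onI)
  have pm[measurable]: "pd j w \<in> borel_measurable borel"
    using C1_onD(2)[OF w] by (rule borel_measurable_continuous_onI)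
  have wi: "integrable lborel w" by (rule integrable_compact_support[OF C1_onD(3)[OF w] K])
  have "(LINT x|lborel. ?q n x) = 0" for n
  proof -
    have i: "integrable lborel (\<lambda>x. w (?t n *\<^sub>R ?e + x))"
      using wi integrable_distr_eq[of "(+) (?t n *\<^sub>R ?e)" lborel borel w]
      by (simp add: lborel_distr_plus)
    show ?thesis using lebesgue_integral_shift[OF wm, of "?t n *\<^sub>R ?e"] wi i by simp
  qed
  moreover have "(\<lambda>n. LINT x|lborel. ?q n x) \<longlonglongrightarrow> (LINT x|lborel. pd j w x)"
  \<comment> \<open>Step lengths are at most \<open>1\<close>, so all quotients live in the ball of
    radius \<open>\<rho> + 1\<close>; the mean value theorem bounds them by
    \<open>B\<close>.\<close>
  proof (rule integral_dominated_convergence[where w = "\<lambda>x. B * indicator (cball 0 (\<rho> + 1)) x"])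
    show "integrable lborel (\<lambda>x::real^'a. B * indicator (cball 0 (\<rho> + 1)) x :: real)"
      using emeasure_bounded_finite[OF bounded_cball, of "0 :: real^'a" "\<rho> + 1"]
      by (intro integrable_mult_right integrable_real_indicator) auto
    have "(\<lambda>n. ?q n x) \<longlonglongrightarrow> pd j w x" for x
    proof -
      have "((\<lambda>s. w (x + s *\<^sub>R ?e)) has_real_derivative pd j w x) (at 0)"
        using line_deriv[of w x 0 j] C1_onD(1)[OF w] by auto
      then have "((\<lambda>h. (w (x + h *\<^sub>R ?e) - w x) / h) \<longlongrightarrow> pd j w x) (at 0)"
        by (simp add: DERIV_def)
      then have "((\<lambda>h. (w (x + h *\<^sub>R ?e) - w x) / h) \<longlongrightarrow> pd j w x) (at_right 0)"
        by (rule filterlim_mono) (auto simp: at_within_le_at)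
      moreover have "filterlim ?t (at_right 0) sequentially" by real_asymp
      ultimately have "(\<lambda>n. (w (x + ?t n *\<^sub>R ?e) - w x) / ?t n) \<longlonglongrightarrow> pd j w x"
        by (rule filterlim_compose)
      then show ?thesis by (simp add: add.commute)
    qed
    then show "AE x in lborel. (\<lambda>n. ?q n x) \<longlonglongrightarrow> pd j w x" by simp
    have "norm (?q n x) \<le> B * indicator (cball 0 (\<rho> + 1)) x" for n x
    proof -
      have t: "0 < ?t n" "?t n \<le> 1" by auto
      obtain s where s: "w (x + ?t n *\<^sub>R ?e) - w (x + 0 *\<^sub>R ?e) = (?t n - 0) * pd j w (x + s *\<^sub>R ?e)"
        using MVT2[of 0 "?t n" "\<lambda>s. w (x + s *\<^sub>R ?e)" "\<lambda>s. pd j w (x + s *\<^sub>R ?e)"] t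
          line_deriv[OF C1_onD(1)[OF w UNIV_I]] by blast
      have 1: "norm (?q n x) \<le> B" using s B t unfolding B_def by (simp add: add.commute)
      have "norm (?q n x) = 0" if "x \<notin> cball 0 (\<rho> + 1)"
      proof -
        have n: "norm x > \<rho> + 1" using that by auto
        have "norm (?t n *\<^sub>R ?e) \<le> 1" by (simp add: norm_axis_1)
        moreover have "norm x \<le> norm (?t n *\<^sub>R ?e + x) + norm (?t n *\<^sub>R ?e)"
          using norm_triangle_ineq4[of "?t n *\<^sub>R ?e + x" "?t n *\<^sub>R ?e"] by simp
        ultimately have "norm (?t n *\<^sub>R ?e + x) > \<rho>" using n by linarith
        then have "?t n *\<^sub>R ?e + x \<notin> K" "x \<notin> K" using \<rho> n by auto
        then show ?thesis by (simp add: K(2))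
      qed
      then show ?thesis using 1 by (cases "x \<in> cball 0 (\<rho> + 1)") auto
    qed
    then show "AE x in lborel. norm (?q n x) \<le> B * indicator (cball 0 (\<rho> + 1)) x" for n by simp
  qed measurable
  ultimately show ?thesis by (simp add: LIMSEQ_const_iff)
qed

lemma
  fixes f :: "'a::euclidean_space \<Rightarrow> 'b::euclidean_space"
  assumes "S \<in> sets lebesgue" "\<And>x. x \<notin> S \<Longrightarrow> f x = 0"
  shows integral_lebesgue_on_eq: "integral\<^sup>L (lebesgue_on S) f = integral\<^sup>L lebesgue f"
    and integrable_lebesgue_on_eq: "integrable (lebesgue_on S) f \<longleftrightarrow> integrable lebesgue f"
proof -
  have "(\<lambda>x. if x \<in> S then f x else 0) = f" using assms(2) by auto
  then show "integral\<^sup>L (lebesgue_on S) f = integral\<^sup>L lebesgue f"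
    "integrable (lebesgue_on S) f \<longleftrightarrow> integrable lebesgue f"
    using Lebesgue_Measure.integral_restrict_UNIV[OF assms(1), of f]
      Lebesgue_Measure.integrable_restrict_UNIV[OF assms(1), of f] by simp_all
qed

lemma integral_pd_eq_0:
  assumes w: "C1_on UNIV w" and K: "compact K" "\<And>x. x \<notin> K \<Longrightarrow> w x = 0"
  shows "(LINT x|lebesgue. pd j w x) = 0"
  using integral_pd_eq_0_lborel[OF assms] C1_onD(2)[OF w, THEN borel_measurable_continuous_onI]
  by (simp add: integral_completion)

section \<open>Weak derivatives tested with \<open>C^1\<close> functions\<close>

definition loc_int :: "(real^'n::finite) set \<Rightarrow> (real^'n \<Rightarrow> real) \<Rightarrow> bool" where
  "loc_int \<Omega> v \<longleftrightarrow> (\<forall>K. compact K \<and> K \<subseteq> \<Omega> \<longrightarrow> integrable (lebesgue_on K) v)"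

text \<open>Only \<open>C^1\<close> regularity: the cutoffs used below are built from piecewise
  quadratic functions, and a cutoff times a smooth differential must still be an admissible test.
  Smooth tests are covered by \<open>test_forms_C1\<close>.\<close>

definition C1_tests :: "(real^'n::finite) set \<Rightarrow> (real^'n \<Rightarrow> real) set" where
  "C1_tests \<Omega> = {w. C1_on UNIV w \<and> (\<exists>K. compact K \<and> K \<subseteq> \<Omega> \<and> (\<forall>x. x \<notin> K \<longrightarrow> w x = 0))}"

definition weak_pd ::
    "(real^'n::finite) set \<Rightarrow> 'n \<Rightarrow> (real^'n \<Rightarrow> real) \<Rightarrow> (real^'n \<Rightarrow> real) \<Rightarrow> bool" where
  "weak_pd \<Omega> j v v' \<longleftrightarrow> loc_int \<Omega> v \<and> loc_int \<Omega> v' \<and>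
     (\<forall>w\<in>C1_tests \<Omega>. (LINT x|lebesgue_on \<Omega>. v x * pd j w x) = - (LINT x|lebesgue_on \<Omega>. v' x * w x))"

lemma integrable_mult_continuous:
  fixes v w :: "real^'n::finite \<Rightarrow> real"
  assumes "compact K" "integrable (lebesgue_on K) v" "continuous_on K w"
  shows "integrable (lebesgue_on K) (\<lambda>x. v x * w x)"
proof -
  have K: "K \<in> sets lebesgue" using assms(1) by (simp add: compact_imp_closed lebesgue_closedin borel_closed)
  have "bounded (w ` K)" using assms by (simp add: compact_continuous_image compact_imp_bounded)
  then obtain B where B: "\<And>x. x \<in> K \<Longrightarrow> \<bar>w x\<bar> \<le> B" unfolding bounded_iff by auto
  show ?thesis
  proof (rule Bochner_Integration.integrable_bound[of _ "\<lambda>x. B * v x"])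
    show "integrable (lebesgue_on K) (\<lambda>x. B * v x)" using assms by simp
    show "(\<lambda>x. v x * w x) \<in> borel_measurable (lebesgue_on K)"
      using assms continuous_imp_measurable_on_sets_lebesgue[OF assms(3) K] by (intro borel_measurable_times) auto
    have "norm (v x * w x) \<le> norm (B * v x)" if "x \<in> K" for x
      using mult_mono[of "\<bar>w x\<bar>" "\<bar>B\<bar>" "\<bar>v x\<bar>" "\<bar>v x\<bar>"] B[OF that]
      by (auto simp: abs_mult mult.commute intro: order_trans[OF _ abs_ge_self])
    then show "AE x in lebesgue_on K. norm (v x * w x) \<le> norm (B * v x)" by (auto intro!: AE_I2)
  qed
qed

lemma loc_int_continuous:
  fixes v :: "real^'n::finite \<Rightarrow> real"
  assumes "continuous_on \<Omega> v" shows "loc_int \<Omega> v"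
  unfolding loc_int_def
proof (intro allI impI, elim conjE)
  fix K assume K: "compact K" "K \<subseteq> \<Omega>"
  then have KS: "K \<in> sets lebesgue" by (simp add: compact_imp_closed borel_closed)
  have c: "continuous_on K v" using assms K continuous_on_subset by blast
  have "integrable lborel (\<lambda>x. indicator K x *\<^sub>R v x)" by (rule borel_integrable_compact[OF K(1) c])
  then have "integrable lebesgue (\<lambda>x. indicator K x *\<^sub>R v x)" by (subst integrable_completion) auto
  then show "integrable (lebesgue_on K) v" using KS by (simp add: integrable_restrict_space)
qed

lemma loc_int_mult: "loc_int \<Omega> v \<Longrightarrow> continuous_on \<Omega> w \<Longrightarrow> loc_int \<Omega> (\<lambda>x. v x * w x)"
  unfolding loc_int_def by (metis integrable_mult_continuous continuous_on_subset)

lemma loc_int_add: "loc_int \<Omega> v \<Longrightarrow> loc_int \<Omega> w \<Longrightarrow> loc_int \<Omega> (\<lambda>x. v x + w x)"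
  unfolding loc_int_def by auto

lemma integrable_test:
  fixes v w :: "real^'n::finite \<Rightarrow> real"
  assumes "loc_int \<Omega> v" "\<Omega> \<in> sets lebesgue" "compact K" "K \<subseteq> \<Omega>" "continuous_on K w" "\<And>x. x \<notin> K \<Longrightarrow> w x = 0"
  shows "integrable (lebesgue_on \<Omega>) (\<lambda>x. v x * w x)"
proof -
  have K: "K \<in> sets lebesgue" using assms by (simp add: compact_imp_closed borel_closed)
  have "integrable (lebesgue_on K) (\<lambda>x. v x * w x)"
    using assms integrable_mult_continuous unfolding loc_int_def by blast
  then have "integrable lebesgue (\<lambda>x. v x * w x)"
    using integrable_lebesgue_on_eq[OF K, of "\<lambda>x. v x * w x"] assms(6) by simp
  then show ?thesis
    by (subst integrable_lebesgue_on_eq[OF assms(2)]) (use assms(4,6) in auto)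
qed

lemma C1_testsE:
  assumes "w \<in> C1_tests \<Omega>"
  obtains K where "C1_on UNIV w" "compact K" "K \<subseteq> \<Omega>" "\<And>x. x \<notin> K \<Longrightarrow> w x = 0" "\<And>x j. x \<notin> K \<Longrightarrow> pd j w x = 0"
proof -
  obtain K where K: "C1_on UNIV w" "compact K" "K \<subseteq> \<Omega>" "\<And>x. x \<notin> K \<Longrightarrow> w x = 0"
    using assms unfolding C1_tests_def by auto
  then have "\<And>x j. x \<notin> K \<Longrightarrow> pd j w x = 0" using pd_zero_outside[of UNIV w K] by auto
  then show ?thesis using K that by blast
qed

lemma integrable_C1_tests:
  assumes "loc_int \<Omega> v" "\<Omega> \<in> sets lebesgue" "w \<in> C1_tests \<Omega>"
  shows "integrable (lebesgue_on \<Omega>) (\<lambda>x. v x * w x)" "integrable (lebesgue_on \<Omega>) (\<lambda>x. v x * pd j w x)"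
proof -
  obtain K where K: "C1_on UNIV w" "compact K" "K \<subseteq> \<Omega>" "\<And>x. x \<notin> K \<Longrightarrow> w x = 0" "\<And>x j. x \<notin> K \<Longrightarrow> pd j w x = 0"
    using C1_testsE[OF assms(3)] by metis
  show "integrable (lebesgue_on \<Omega>) (\<lambda>x. v x * w x)"
    by (rule integrable_test[OF assms(1,2) K(2,3) continuous_on_subset[OF C1_onD(3)[OF K(1)]] K(4)]) auto
  show "integrable (lebesgue_on \<Omega>) (\<lambda>x. v x * pd j w x)"
    by (rule integrable_test[OF assms(1,2) K(2,3) continuous_on_subset[OF C1_onD(2)[OF K(1)]] K(5)]) auto
qed

lemma open_lebesgue: "open S \<Longrightarrow> S \<in> sets lebesgue" by (simp add: borel_open)

text \<open>Integration by parts: \<open>v * w\<close>, extended by zero, is a compactly supported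
  \<open>C^1\<close> function on the whole space, so \<open>integral_pd_eq_0\<close> applies to it
  and the Leibniz rule splits the result.\<close>

lemma weak_pd_C1:
  assumes "open \<Omega>" "C1_on \<Omega> v" shows "weak_pd \<Omega> j v (pd j v)"
  unfolding weak_pd_def
proof (intro conjI ballI)
  show lv: "loc_int \<Omega> v" "loc_int \<Omega> (pd j v)" using assms C1_onD loc_int_continuous by blast+
  fix w assume wt: "w \<in> C1_tests \<Omega>"
  obtain K where K: "C1_on UNIV w" "compact K" "K \<subseteq> \<Omega>" "\<And>x. x \<notin> K \<Longrightarrow> w x = 0"
    using C1_testsE[OF wt] by metis
  have S: "\<Omega> \<in> sets lebesgue" by (rule open_lebesgue[OF assms(1)])
  have vw: "C1_on \<Omega> (\<lambda>x. v x * w x)"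
    by (rule C1_on_mult[OF assms(2) C1_on_subset[OF K(1)]]) simp
  let ?P = "\<lambda>x. if x \<in> \<Omega> then v x * w x else 0"
  have z: "x \<in> \<Omega> \<Longrightarrow> x \<notin> K \<Longrightarrow> v x * w x = 0" for x using K(4) by simp
  have "(LINT x|lebesgue. pd j ?P x) = 0"
    by (rule integral_pd_eq_0[OF C1_extend_zero[OF assms(1) vw K(2,3) z] K(2)]) (use K in auto)
  also have "pd j ?P = (\<lambda>x. if x \<in> \<Omega> then v x * pd j w x + pd j v x * w x else 0)"
    by (intro ext) (simp add: pd_extend_zero[OF assms(1) vw K(2,3) z] pd_mult C1_onD(1)[OF assms(2)] C1_onD(1)[OF K(1)])
  finally have "(LINT x|lebesgue_on \<Omega>. v x * pd j w x + pd j v x * w x) = 0"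
    by (subst (asm) Lebesgue_Measure.integral_restrict_UNIV[OF S])
  then show "(LINT x|lebesgue_on \<Omega>. v x * pd j w x) = - (LINT x|lebesgue_on \<Omega>. pd j v x * w x)"
    using integrable_C1_tests[OF lv(1) S wt] integrable_C1_tests[OF lv(2) S wt]
    by (subst (asm) Bochner_Integration.integral_add) auto
qed

text \<open>\<open>\<zeta> * w\<close> is again a test function for \<open>g\<close>; the Leibniz
  term with \<open>pd j \<zeta>\<close> is moved to the right-hand side.\<close>

lemma weak_pd_mult_C1:
  assumes g: "weak_pd \<Omega> j g g'" and \<zeta>: "C1_on UNIV \<zeta>" and S: "\<Omega> \<in> sets lebesgue"
  shows "weak_pd \<Omega> j (\<lambda>x. \<zeta> x * g x) (\<lambda>x. \<zeta> x * g' x + pd j \<zeta> x * g x)"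
  unfolding weak_pd_def
proof (intro conjI ballI)
  have lg: "loc_int \<Omega> g" "loc_int \<Omega> g'" using g unfolding weak_pd_def by auto
  have 1: "loc_int \<Omega> (\<lambda>x. g x * \<zeta> x)" "loc_int \<Omega> (\<lambda>x. g' x * \<zeta> x)" "loc_int \<Omega> (\<lambda>x. g x * pd j \<zeta> x)"
    using C1_onD(2,3)[OF \<zeta>] by (intro loc_int_mult lg continuous_on_subset[of UNIV _ \<Omega>]; simp)+
  then show l2: "loc_int \<Omega> (\<lambda>x. \<zeta> x * g x)" "loc_int \<Omega> (\<lambda>x. \<zeta> x * g' x + pd j \<zeta> x * g x)"
    by (auto simp: mult.commute[of "\<zeta> _"] mult.commute[of "pd _ _ _"] intro: loc_int_add)
  fix w assume wt: "w \<in> C1_tests \<Omega>"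
  obtain K where K: "C1_on UNIV w" "compact K" "K \<subseteq> \<Omega>" "\<And>x. x \<notin> K \<Longrightarrow> w x = 0"
    using C1_testsE[OF wt] by metis
  have zw: "(\<lambda>x. \<zeta> x * w x) \<in> C1_tests \<Omega>"
    unfolding C1_tests_def using K by (auto intro!: C1_on_mult \<zeta>)
  have "(LINT x|lebesgue_on \<Omega>. g x * pd j (\<lambda>x. \<zeta> x * w x) x) = - (LINT x|lebesgue_on \<Omega>. g' x * (\<zeta> x * w x))"
    using g zw unfolding weak_pd_def by blast
  also have "(\<lambda>x. g x * pd j (\<lambda>x. \<zeta> x * w x) x) = (\<lambda>x. \<zeta> x * g x * pd j w x + (g x * pd j \<zeta> x) * w x)"
    by (intro ext) (simp add: pd_mult C1_onD(1)[OF \<zeta>] C1_onD(1)[OF K(1)] algebra_simps)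
  finally have "(LINT x|lebesgue_on \<Omega>. \<zeta> x * g x * pd j w x) =
     - (LINT x|lebesgue_on \<Omega>. g' x * (\<zeta> x * w x)) - (LINT x|lebesgue_on \<Omega>. (g x * pd j \<zeta> x) * w x)"
    using integrable_C1_tests[OF l2(1) S wt] integrable_C1_tests[OF 1(3) S wt]
    by (subst (asm) Bochner_Integration.integral_add) auto
  also have "\<dots> = - (LINT x|lebesgue_on \<Omega>. (\<zeta> x * g' x + pd j \<zeta> x * g x) * w x)"
  proof -
    have "(\<lambda>x. (\<zeta> x * g' x + pd j \<zeta> x * g x) * w x) = (\<lambda>x. g' x * (\<zeta> x * w x) + g x * pd j \<zeta> x * w x)"
      by (simp add: algebra_simps)
    moreover have "integrable (lebesgue_on \<Omega>) (\<lambda>x. g' x * (\<zeta> x * w x))"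
      using integrable_C1_tests(1)[OF 1(2) S wt] by (simp add: mult.assoc)
    ultimately show ?thesis using integrable_C1_tests(1)[OF 1(3) S wt] by simp
  qed
  finally show "(LINT x|lebesgue_on \<Omega>. \<zeta> x * g x * pd j w x) =
    - (LINT x|lebesgue_on \<Omega>. (\<zeta> x * g' x + pd j \<zeta> x * g x) * w x)" .
qed

lemma weak_pd_zero: "weak_pd \<Omega> j (\<lambda>x. 0) (\<lambda>x. 0)"
  unfolding weak_pd_def by (simp add: loc_int_def)

lemma integrable_imp_loc_int:
  assumes "integrable (lebesgue_on \<Omega>) v" "\<Omega> \<in> sets lebesgue" shows "loc_int \<Omega> v"
  unfolding loc_int_def
proof (intro allI impI, elim conjE)
  fix K assume K: "compact K" "K \<subseteq> \<Omega>"
  have KS: "K \<in> sets lebesgue" using K by (simp add: compact_imp_closed borel_closed)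
  have "set_integrable lebesgue \<Omega> v" using assms by (simp add: set_integrable_def integrable_restrict_space)
  then have "set_integrable lebesgue K v" using KS K(2) by (rule set_integrable_subset)
  then show "integrable (lebesgue_on K) v" using KS by (simp add: set_integrable_def integrable_restrict_space)
qed

lemma summable_eventually_0:
  fixes f :: "nat \<Rightarrow> real" assumes "\<exists>N. \<forall>n\<ge>N. f n = 0" shows "summable f"
proof -
  obtain N where "\<And>n. n \<ge> N \<Longrightarrow> f n = 0" using assms by blast
  then show ?thesis by (intro summable_finite[of "{..<N}"]) (auto simp: not_less)
qed

text \<open>Eventual vanishing of the terms gives pointwise summability; summability of the
  \<open>L^1\<close> norms, together with the bound on \<open>h\<close>, justifies exchanging sum
  and integral.\<close>

lemma integral_suminf_test:
  fixes f :: "nat \<Rightarrow> real^'n::finite \<Rightarrow> real"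
  assumes f: "\<And>n. integrable (lebesgue_on \<Omega>) (f n)" "summable (\<lambda>n. LINT x|lebesgue_on \<Omega>. \<bar>f n x\<bar>)"
    and ae: "AE x in lebesgue_on \<Omega>. \<exists>N. \<forall>n\<ge>N. f n x = 0"
    and h: "h \<in> borel_measurable (lebesgue_on \<Omega>)" "\<And>x. \<bar>h x\<bar> \<le> B"
  shows "(LINT x|lebesgue_on \<Omega>. (\<Sum>n. f n x) * h x) = (\<Sum>n. LINT x|lebesgue_on \<Omega>. f n x * h x)"
    "summable (\<lambda>n. LINT x|lebesgue_on \<Omega>. f n x * h x)"
proof -
  have B0: "0 \<le> B" using h(2)[of 0] by linarith
  have le: "\<bar>f n x * h x\<bar> \<le> B * \<bar>f n x\<bar>" for n x
    using mult_left_mono[OF h(2), of "\<bar>f n x\<bar>" x] by (simp add: abs_mult mult.commute)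
  have i: "integrable (lebesgue_on \<Omega>) (\<lambda>x. f n x * h x)" for n
    by (rule Bochner_Integration.integrable_bound[of _ "\<lambda>x. B * f n x"])
      (use f(1) h le B0 in \<open>auto simp: abs_mult\<close>)
  have s: "summable (\<lambda>n. LINT x|lebesgue_on \<Omega>. norm (f n x * h x))"
  proof (rule summable_comparison_test'[OF summable_mult[OF f(2), of B], of 0])
    fix n
    have "(LINT x|lebesgue_on \<Omega>. norm (f n x * h x)) \<le> (LINT x|lebesgue_on \<Omega>. B * \<bar>f n x\<bar>)"
      by (rule integral_mono) (use i f(1) le in auto)
    then show "norm (LINT x|lebesgue_on \<Omega>. norm (f n x * h x)) \<le> B * (LINT x|lebesgue_on \<Omega>. \<bar>f n x\<bar>)"
      by simp
  qed
  have a: "AE x in lebesgue_on \<Omega>. summable (\<lambda>n. norm (f n x * h x))"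
    using ae by eventually_elim (rule summable_eventually_0, fastforce)
  have "(LINT x|lebesgue_on \<Omega>. (\<Sum>n. f n x * h x)) = (\<Sum>n. LINT x|lebesgue_on \<Omega>. f n x * h x)"
    by (rule integral_suminf[OF i a s])
  moreover have "(LINT x|lebesgue_on \<Omega>. (\<Sum>n. f n x * h x)) = (LINT x|lebesgue_on \<Omega>. (\<Sum>n. f n x) * h x)"
  proof (rule integral_cong_AE)
    have [measurable]: "f n \<in> borel_measurable (lebesgue_on \<Omega>)" for n using f(1) by auto
    note [measurable] = h(1)
    show "(\<lambda>x. \<Sum>n. f n x * h x) \<in> borel_measurable (lebesgue_on \<Omega>)" by measurable
    show "(\<lambda>x. (\<Sum>n. f n x) * h x) \<in> borel_measurable (lebesgue_on \<Omega>)" by measurable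
    show "AE x in lebesgue_on \<Omega>. (\<Sum>n. f n x * h x) = (\<Sum>n. f n x) * h x"
      using ae by eventually_elim
        (rule suminf_mult2[symmetric], rule summable_eventually_0, fastforce)
  qed
  ultimately show "(LINT x|lebesgue_on \<Omega>. (\<Sum>n. f n x) * h x) = (\<Sum>n. LINT x|lebesgue_on \<Omega>. f n x * h x)"
    by simp
  show "summable (\<lambda>n. LINT x|lebesgue_on \<Omega>. f n x * h x)"
    by (rule summable_norm_cancel, rule summable_comparison_test'[OF s, of 0]) (simp add: integral_norm_bound)
qed

text \<open>Integration by parts holds term by term and survives the summation because values and
  derivatives are both summable in \<open>L^1\<close>. The sum itself may be discontinuous, which is
  what allows a jump across the Cantor set.\<close>

lemma weak_pd_suminf:
  fixes W :: "nat \<Rightarrow> real^'n::finite \<Rightarrow> real"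
  assumes \<Omega>: "open \<Omega>" and W: "\<And>n. C1_on UNIV (W n)"
    and i: "\<And>n. integrable (lebesgue_on \<Omega>) (W n)" "\<And>n. integrable (lebesgue_on \<Omega>) (pd j (W n))"
    and s: "summable (\<lambda>n. LINT x|lebesgue_on \<Omega>. \<bar>W n x\<bar>)" "summable (\<lambda>n. LINT x|lebesgue_on \<Omega>. \<bar>pd j (W n) x\<bar>)"
    and ae: "AE x in lebesgue_on \<Omega>. \<exists>N. \<forall>n\<ge>N. W n x = 0"
      "AE x in lebesgue_on \<Omega>. \<exists>N. \<forall>n\<ge>N. pd j (W n) x = 0"
  shows "weak_pd \<Omega> j (\<lambda>x. \<Sum>n. W n x) (\<lambda>x. \<Sum>n. pd j (W n) x)"
  unfolding weak_pd_def
proof (intro conjI ballI)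
  have S: "\<Omega> \<in> sets lebesgue" by (rule open_lebesgue[OF \<Omega>])
  have l: "loc_int \<Omega> (\<lambda>x. \<Sum>n. f n x)"
    if "\<And>n. integrable (lebesgue_on \<Omega>) (f n)" "summable (\<lambda>n. LINT x|lebesgue_on \<Omega>. \<bar>f n x\<bar>)"
      "AE x in lebesgue_on \<Omega>. \<exists>N. \<forall>n\<ge>N. f n x = 0" for f :: "nat \<Rightarrow> real^'n \<Rightarrow> real"
  proof (rule integrable_imp_loc_int[OF Bochner_Integration.integrable_suminf S])
    show "AE x in lebesgue_on \<Omega>. summable (\<lambda>n. norm (f n x))"
      using that(3) by eventually_elim (rule summable_eventually_0, fastforce)
  qed (use that in auto)
  show "loc_int \<Omega> (\<lambda>x. \<Sum>n. W n x)" "loc_int \<Omega> (\<lambda>x. \<Sum>n. pd j (W n) x)"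
    by (rule l[OF i(1) s(1) ae(1)], rule l[OF i(2) s(2) ae(2)])
  fix w assume wt: "w \<in> C1_tests \<Omega>"
  obtain K where K: "C1_on UNIV w" "compact K" "K \<subseteq> \<Omega>" "\<And>x. x \<notin> K \<Longrightarrow> w x = 0" "\<And>x j. x \<notin> K \<Longrightarrow> pd j w x = 0"
    using C1_testsE[OF wt] by metis
  have bd: "\<exists>B. \<forall>x. \<bar>h x\<bar> \<le> B" if "continuous_on UNIV h" "\<And>x. x \<notin> K \<Longrightarrow> h x = 0" for h :: "real^'n \<Rightarrow> real"
  proof -
    have "bounded (h ` K)"
      using compact_continuous_image[OF continuous_on_subset[OF that(1)] K(2)] by (simp add: compact_imp_bounded)
    then obtain B0 where B0: "\<And>x. x \<in> K \<Longrightarrow> \<bar>h x\<bar> \<le> B0" unfolding bounded_iff by auto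
    have "\<bar>h x\<bar> \<le> max B0 0" for x
      using B0[of x] that(2)[of x] by (cases "x \<in> K") (auto simp: le_max_iff_disj)
    then show ?thesis by blast
  qed
  have m: "h \<in> borel_measurable (lebesgue_on \<Omega>)" if "continuous_on UNIV h" for h :: "real^'n \<Rightarrow> real"
    by (rule continuous_imp_measurable_on_sets_lebesgue[OF continuous_on_subset[OF that] S]) simp
  obtain B1 where B1: "\<And>x. \<bar>w x\<bar> \<le> B1" using bd[OF C1_onD(3)[OF K(1)] K(4)] by auto
  obtain B2 where B2: "\<And>x. \<bar>pd j w x\<bar> \<le> B2" using bd[OF C1_onD(2)[OF K(1)] K(5)] by auto
  have "(LINT x|lebesgue_on \<Omega>. (\<Sum>n. W n x) * pd j w x) = (\<Sum>n. LINT x|lebesgue_on \<Omega>. W n x * pd j w x)"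
    by (rule integral_suminf_test(1)[OF i(1) s(1) ae(1) m[OF C1_onD(2)[OF K(1)]] B2])
  also have "\<dots> = (\<Sum>n. - (LINT x|lebesgue_on \<Omega>. pd j (W n) x * w x))"
    using weak_pd_C1[OF \<Omega> C1_on_subset[OF W]] wt unfolding weak_pd_def by (intro suminf_cong) blast
  also have "\<dots> = - (\<Sum>n. LINT x|lebesgue_on \<Omega>. pd j (W n) x * w x)"
    by (rule suminf_minus[OF integral_suminf_test(2)[OF i(2) s(2) ae(2) m[OF C1_onD(3)[OF K(1)]] B1]])
  also have "\<dots> = - (LINT x|lebesgue_on \<Omega>. (\<Sum>n. pd j (W n) x) * w x)"
    by (simp only: integral_suminf_test(1)[OF i(2) s(2) ae(2) m[OF C1_onD(3)[OF K(1)]] B1])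
  finally show "(LINT x|lebesgue_on \<Omega>. (\<Sum>n. W n x) * pd j w x) = - (LINT x|lebesgue_on \<Omega>. (\<Sum>n. pd j (W n) x) * w x)" .
qed

section \<open>The weak exterior differential\<close>

lemma shuffle_sign_Un_left:
  assumes "I \<inter> I' = {}"
  shows "shuffle_sign (I \<union> I') J = shuffle_sign I J * shuffle_sign I' J"
proof -
  have "{(i, j). i \<in> I \<union> I' \<and> j \<in> J \<and> j < i} =
      {(i, j). i \<in> I \<and> j \<in> J \<and> j < i} \<union> {(i, j). i \<in> I' \<and> j \<in> J \<and> j < i}" by auto
  moreover have "card ({(i, j). i \<in> I \<and> j \<in> J \<and> j < i} \<union> {(i, j). i \<in> I' \<and> j \<in> J \<and> j < i}) = card {(i, j). i \<in> I \<and> j \<in> J \<and> j < i} + card {(i, j). i \<in> I' \<and> j \<in> J \<and> j < i}"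
    by (rule card_Un_disjoint) (use assms in auto)
  ultimately show ?thesis unfolding shuffle_sign_def power_add[symmetric] by (simp only:)
qed

lemma shuffle_sign_Un_right:
  assumes "J \<inter> J' = {}"
  shows "shuffle_sign I (J \<union> J') = shuffle_sign I J * shuffle_sign I J'"
proof -
  have "{(i, j). i \<in> I \<and> j \<in> J \<union> J' \<and> j < i} =
      {(i, j). i \<in> I \<and> j \<in> J \<and> j < i} \<union> {(i, j). i \<in> I \<and> j \<in> J' \<and> j < i}" by auto
  moreover have "card ({(i, j). i \<in> I \<and> j \<in> J \<and> j < i} \<union> {(i, j). i \<in> I \<and> j \<in> J' \<and> j < i}) = card {(i, j). i \<in> I \<and> j \<in> J \<and> j < i} + card {(i, j). i \<in> I \<and> j \<in> J' \<and> j < i}"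
    by (rule card_Un_disjoint) (use assms in auto)
  ultimately show ?thesis unfolding shuffle_sign_def power_add[symmetric] by (simp only:)
qed

lemma abs_shuffle_sign [simp]: "\<bar>shuffle_sign I J\<bar> = 1"
  by (simp add: shuffle_sign_def power_abs)

text \<open>Every element of \<open>I\<close> is an inversion with \<open>i\<close> in exactly one
  of the two orders, so the two inversion counts add up to \<open>card I\<close>.\<close>

lemma shuffle_sign_flip:
  fixes i :: "'n::{finite,linorder}"
  assumes "i \<notin> I"
  shows "shuffle_sign I {i} = (-1) ^ card I * shuffle_sign {i} I"
proof -
  let ?A = "{a \<in> I. i < a}" and ?B = "{a \<in> I. a < i}"
  have "{(a, b). a \<in> I \<and> b \<in> {i} \<and> b < a} = (\<lambda>a. (a, i)) ` ?A" by auto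
  then have 1: "card {(a, b). a \<in> I \<and> b \<in> {i} \<and> b < a} = card ?A"
    by (simp add: card_image inj_on_def)
  have "{(a, b). a \<in> {i} \<and> b \<in> I \<and> b < a} = (\<lambda>a. (i, a)) ` ?B" by auto
  then have 2: "card {(a, b). a \<in> {i} \<and> b \<in> I \<and> b < a} = card ?B"
    by (simp add: card_image inj_on_def)
  have "I = ?A \<union> ?B" using assms by (auto simp: not_less_iff_gr_or_eq)
  moreover have "card (?A \<union> ?B) = card ?A + card ?B" by (rule card_Un_disjoint) auto
  ultimately have "card I = card ?A + card ?B" by (simp only:)
  then show ?thesis unfolding shuffle_sign_def 1 2 by (simp add: power_add mult.assoc flip: power_mult_distrib)
qed

lemma wedge_top: "wedge v w $ UNIV = (\<Sum>I\<in>UNIV. shuffle_sign I (- I) * v $ I * w $ (- I))"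
  by (simp add: wedge_def Compl_eq_Diff_UNIV)

lemma wedge_axis:
  "wedge (axis {i} 1) v $ K = (if i \<in> K then shuffle_sign {i} (K - {i}) * v $ (K - {i}) else 0)"
proof -
  have "(\<Sum>I\<in>Pow K. shuffle_sign I (K - I) * axis {i} 1 $ I * v $ (K - I)) =
     (\<Sum>I\<in>Pow K. if I = {i} then shuffle_sign {i} (K - {i}) * v $ (K - {i}) else 0)"
    by (intro sum.cong) (auto simp: axis_def)
  also have "\<dots> = (if i \<in> K then shuffle_sign {i} (K - {i}) * v $ (K - {i}) else 0)"
    by (subst sum.delta) auto
  finally show ?thesis by (simp add: wedge_def)
qed

text \<open>The differential \<open>d\<omega>\<close> of a form for which \<open>p I i\<close> stands for the partial derivative
  \<open>\<partial>\<^sub>i\<omega>\<^sub>I\<close>, classical or weak.\<close>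

definition dform :: "('n set \<Rightarrow> 'n \<Rightarrow> 'n space \<Rightarrow> real) \<Rightarrow> ('n::{finite,linorder}) form" where
  "dform p x = (\<chi> K. \<Sum>i\<in>K. shuffle_sign {i} (K - {i}) * p (K - {i}) i x)"

lemma pd_component:
  assumes "\<omega> differentiable (at x)"
  shows "(\<lambda>y. \<omega> y $ I) differentiable (at x)"
    "pd i (\<lambda>y. \<omega> y $ I) x = frechet_derivative \<omega> (at x) (axis i 1) $ I"
proof -
  have "(\<omega> has_derivative frechet_derivative \<omega> (at x)) (at x)"
    using assms by (simp add: frechet_derivative_works[symmetric])
  then have *: "((\<lambda>y. \<omega> y $ I) has_derivative (\<lambda>h. frechet_derivative \<omega> (at x) h $ I)) (at x)"
    by (rule bounded_linear.has_derivative[OF bounded_linear_vec_nth])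
  then show "(\<lambda>y. \<omega> y $ I) differentiable (at x)" unfolding differentiable_def by blast
  show "pd i (\<lambda>y. \<omega> y $ I) x = frechet_derivative \<omega> (at x) (axis i 1) $ I"
    by (rule pd_eq[OF *])
qed

lemma ext_d_eq_dform:
  assumes "\<omega> differentiable (at x)"
  shows "ext_d \<omega> x = dform (\<lambda>I i. pd i (\<lambda>y. \<omega> y $ I)) x"
  unfolding vec_eq_iff ext_d_def dform_def
  by (auto simp: wedge_axis pd_component(2)[OF assms] sum.If_cases intro!: sum.cong)

lemma dform_covectors:
  fixes p :: "('n::{finite,linorder}) set \<Rightarrow> 'n \<Rightarrow> 'n space \<Rightarrow> real"
  assumes "\<And>I i. card I \<noteq> k \<Longrightarrow> p I i x = 0" shows "dform p x \<in> covectors (k + 1)"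
proof -
  have "card (K - {i}) \<noteq> k" if "card K \<noteq> k + 1" "i \<in> K" for i and K :: "'n set"
  proof -
    have "Suc (card (K - {i})) = card K" by (rule card_Suc_Diff1[OF _ that(2)]) simp
    then show ?thesis using that(1) by linarith
  qed
  then have "p (K - {i}) i x = 0" if "card K \<noteq> k + 1" "i \<in> K" for i and K :: "'n set"
    using that assms by blast
  note p0 = this
  have "(\<Sum>i\<in>K. shuffle_sign {i} (K - {i}) * p (K - {i}) i x) = 0" if K: "card K \<noteq> k + 1" for K
  proof (rule sum.neutral, rule ballI)
    fix i assume "i \<in> K"
    from p0[OF K this] show "shuffle_sign {i} (K - {i}) * p (K - {i}) i x = 0" by simp
  qed
  then show ?thesis unfolding covectors_def dform_def mem_Collect_eq vec_lambda_beta by blast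
qed

lemma sum_insert_swap:
  fixes f :: "('n::finite) set \<Rightarrow> 'n \<Rightarrow> real"
  shows "(\<Sum>K\<in>UNIV. \<Sum>i\<in>K. f K i) = (\<Sum>I\<in>UNIV. \<Sum>i\<in>- I. f (insert i I) i)"
proof -
  have "(\<Sum>K\<in>UNIV. \<Sum>i\<in>K. f K i) = (\<Sum>(K, i)\<in>Sigma UNIV (\<lambda>K. K). f K i)"
    by (rule sum.Sigma) auto
  also have "\<dots> = (\<Sum>(I, i)\<in>Sigma UNIV (\<lambda>I. - I). f (insert i I) i)"
    by (rule sum.reindex_bij_witness[of _ "\<lambda>(I, i). (insert i I, i)" "\<lambda>(K, i). (K - {i}, i)"])
      (auto simp: insert_absorb)
  also have "\<dots> = (\<Sum>I\<in>UNIV. \<Sum>i\<in>- I. f (insert i I) i)"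
    by (rule sum.Sigma[symmetric]) auto
  finally show ?thesis .
qed

lemma integral_top_eq_sum:
  assumes "\<And>I. integrable (lebesgue_on \<Omega>) (\<lambda>x. v x $ I * w x $ (- I))"
  shows "integral_top \<Omega> (\<lambda>x. wedge (v x) (w x)) =
    (\<Sum>I\<in>UNIV. shuffle_sign I (- I) * (LINT x|lebesgue_on \<Omega>. v x $ I * w x $ (- I)))"
  unfolding integral_top_def wedge_top mult.assoc using assms
  by (subst Bochner_Integration.integral_sum) auto

text \<open>The sign in \<open>d(\<omega> \<and> \<xi>) = d\<omega> \<and> \<xi> + (-1)^k \<omega>
  \<and> d\<xi>\<close>, on basis elements: it arises from moving \<open>i\<close> past the
  \<open>card I\<close> indices of \<open>I\<close>.\<close>

lemma shuffle_sign_stokes: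
  assumes "i \<notin> I"
  shows "shuffle_sign (insert i I) (- insert i I) * shuffle_sign {i} I * (-1) ^ card I =
    shuffle_sign I (- I) * shuffle_sign {i} (- I - {i})"
proof -
  let ?R = "- insert i I"
  have "shuffle_sign (insert i I) ?R = shuffle_sign {i} ?R * shuffle_sign I ?R"
    using shuffle_sign_Un_left[of "{i}" I ?R] assms by simp
  moreover have "shuffle_sign I (- I) = shuffle_sign I {i} * shuffle_sign I ?R"
  proof -
    have "- I = {i} \<union> ?R" using assms by auto
    then have "shuffle_sign I (- I) = shuffle_sign I ({i} \<union> ?R)" by (rule arg_cong)
    then show ?thesis using shuffle_sign_Un_right[of "{i}" ?R I] by auto
  qed
  moreover have "- I - {i} = ?R" by auto
  ultimately show ?thesis by (simp add: shuffle_sign_flip[OF assms])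
qed

text \<open>Both sides expand into the integrals \<open>P I i\<close> with
  \<open>i \<notin> I\<close>: in each of them the weak partial derivative moves from
  \<open>\<xi>\<close> to \<open>\<omega>\<close>, \<open>shuffle_sign_stokes\<close> matches the
  signs, and the terms with \<open>card I \<noteq> k\<close> vanish.\<close>

lemma stokes_components:
  fixes \<omega> \<xi> :: "('n::{finite,linorder}) form"
  assumes \<Omega>: "\<Omega> \<in> sets lebesgue"
    and w: "\<And>I i. weak_pd \<Omega> i (\<lambda>x. \<omega> x $ I) (p I i)"
    and k: "\<And>I i x. x \<in> \<Omega> \<Longrightarrow> card I \<noteq> k \<Longrightarrow> p I i x = 0"
    and \<xi>: "\<And>I. (\<lambda>x. \<xi> x $ I) \<in> C1_tests \<Omega>"
  shows "integral_top \<Omega> (\<lambda>x. wedge (\<omega> x) (dform (\<lambda>I i. pd i (\<lambda>y. \<xi> y $ I)) x)) =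
    (-1) ^ (k + 1) * integral_top \<Omega> (\<lambda>x. wedge (dform p x) (\<xi> x))"
proof -
  have li: "loc_int \<Omega> (\<lambda>x. \<omega> x $ I)" "loc_int \<Omega> (p I i)" for I i
    using w unfolding weak_pd_def by auto
  note i1 = integrable_C1_tests(2)[OF li(1) \<Omega> \<xi>] and i2 = integrable_C1_tests(1)[OF li(2) \<Omega> \<xi>]
  define P where "P I i = (LINT x|lebesgue_on \<Omega>. p I i x * \<xi> x $ (- insert i I))" for I i
  have P: "P I i = 0" if "card I \<noteq> k" for I i
    unfolding P_def using k[OF _ that] by (intro integral_eq_zero_AE) (auto intro!: AE_I2)
  have wP: "(LINT x|lebesgue_on \<Omega>. \<omega> x $ I * pd i (\<lambda>y. \<xi> y $ (- I - {i})) x) = - P I i" for I i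
  proof -
    have "- I - {i} = - insert i I" by auto
    then show ?thesis using w[of i I] \<xi>[of "- insert i I"] unfolding weak_pd_def P_def by simp
  qed
  have s: "v * (\<Sum>i\<in>A. c i * f i) = (\<Sum>i\<in>A. c i * (v * f i))" for v :: real and c f and A :: "'n set"
    by (simp add: sum_distrib_left mult_ac)
  have L: "(\<lambda>x. \<omega> x $ I * dform (\<lambda>I i. pd i (\<lambda>y. \<xi> y $ I)) x $ (- I)) =
     (\<lambda>x. \<Sum>i\<in>- I. shuffle_sign {i} (- I - {i}) * (\<omega> x $ I * pd i (\<lambda>y. \<xi> y $ (- I - {i})) x))" for I
    unfolding dform_def by (simp add: s)
  have R: "(\<lambda>x. dform p x $ K * \<xi> x $ (- K)) =
     (\<lambda>x. \<Sum>i\<in>K. shuffle_sign {i} (K - {i}) * (p (K - {i}) i x * \<xi> x $ (- K)))" for K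
    unfolding dform_def by (intro ext) (simp add: sum_distrib_left sum_distrib_right mult_ac)
  have iL: "integrable (lebesgue_on \<Omega>) (\<lambda>x. \<omega> x $ I * dform (\<lambda>I i. pd i (\<lambda>y. \<xi> y $ I)) x $ (- I))" for I
    unfolding L using i1 by (intro Bochner_Integration.integrable_sum integrable_mult_right) auto
  have iR: "integrable (lebesgue_on \<Omega>) (\<lambda>x. dform p x $ K * \<xi> x $ (- K))" for K
    unfolding R using i2 by (intro Bochner_Integration.integrable_sum integrable_mult_right) auto
  have "integral_top \<Omega> (\<lambda>x. wedge (\<omega> x) (dform (\<lambda>I i. pd i (\<lambda>y. \<xi> y $ I)) x)) =
    (\<Sum>I\<in>UNIV. \<Sum>i\<in>- I. shuffle_sign I (- I) * shuffle_sign {i} (- I - {i}) * (- P I i))"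
    unfolding integral_top_eq_sum[OF iL] L using i1 wP
    by (subst Bochner_Integration.integral_sum) (auto simp: sum_distrib_left mult.assoc)
  also have "\<dots> = (\<Sum>I\<in>UNIV. \<Sum>i\<in>- I. (-1) ^ (k + 1) * (shuffle_sign (insert i I) (- insert i I) * shuffle_sign {i} I * P I i))"
  proof (intro sum.cong refl)
    fix I :: "'n set" and i assume i: "i \<in> - I"
    show "shuffle_sign I (- I) * shuffle_sign {i} (- I - {i}) * (- P I i) =
      (-1) ^ (k + 1) * (shuffle_sign (insert i I) (- insert i I) * shuffle_sign {i} I * P I i)"
      using shuffle_sign_stokes[of i I] i P[of I i] by (cases "card I = k") (auto simp: mult_ac)
  qed
  \<comment> \<open>Writing \<open>I\<close> as \<open>insert i I - {i}\<close> prepares the change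
    of the summation index to \<open>K = insert i I\<close>.\<close>
  also have "\<dots> = (-1) ^ (k + 1) * (\<Sum>I\<in>UNIV. \<Sum>i\<in>- I. shuffle_sign (insert i I) (- insert i I) *
      shuffle_sign {i} (insert i I - {i}) * P (insert i I - {i}) i)"
    unfolding sum_distrib_left by (intro sum.cong) (auto simp: Diff_insert_absorb)
  also have "\<dots> = (-1) ^ (k + 1) * (\<Sum>K\<in>UNIV. \<Sum>i\<in>K. shuffle_sign K (- K) * shuffle_sign {i} (K - {i}) * P (K - {i}) i)"
    by (subst sum_insert_swap[symmetric]) simp
  also have "(\<Sum>K\<in>UNIV. \<Sum>i\<in>K. shuffle_sign K (- K) * shuffle_sign {i} (K - {i}) * P (K - {i}) i) =
      integral_top \<Omega> (\<lambda>x. wedge (dform p x) (\<xi> x))"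
  proof -
    have "integrable (lebesgue_on \<Omega>) (\<lambda>x. p (K - {i}) i x * \<xi> x $ (- K))" if "i \<in> K" for K i
      using i2[of "K - {i}" i "- K"] .
    moreover have "P (K - {i}) i = (LINT x|lebesgue_on \<Omega>. p (K - {i}) i x * \<xi> x $ (- K))" if "i \<in> K" for K i
      using that by (simp add: P_def insert_absorb)
    ultimately show ?thesis
      unfolding integral_top_eq_sum[OF iR] R
      by (intro sum.cong refl, subst Bochner_Integration.integral_sum) (auto simp: sum_distrib_left mult.assoc)
  qed
  finally show ?thesis .
qed

lemma integrable_vec_components:
  fixes f :: "'a \<Rightarrow> real^'m::finite"
  assumes "\<And>i. integrable M (\<lambda>x. f x $ i)" shows "integrable M f"
proof -
  have "f = (\<lambda>x. \<Sum>i\<in>UNIV. f x $ i *\<^sub>R axis i 1)"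
    by (intro ext) (simp add: basis_expansion scalar_mult_eq_scaleR[symmetric])
  moreover have "integrable M (\<lambda>x. \<Sum>i\<in>UNIV. f x $ i *\<^sub>R axis i (1::real))"
    using assms by (intro Bochner_Integration.integrable_sum integrable_scaleR_left) auto
  ultimately show ?thesis by simp
qed

lemma measurable_vec_components:
  fixes f :: "'a \<Rightarrow> real^'m::finite"
  assumes "\<And>i. (\<lambda>x. f x $ i) \<in> borel_measurable M" shows "f \<in> borel_measurable M"
proof -
  have "f = (\<lambda>x. \<Sum>i\<in>UNIV. f x $ i *\<^sub>R axis i 1)"
    by (intro ext) (simp add: basis_expansion scalar_mult_eq_scaleR[symmetric])
  moreover have "(\<lambda>x. \<Sum>i\<in>UNIV. f x $ i *\<^sub>R axis i (1::real)) \<in> borel_measurable M"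
    using assms by (intro borel_measurable_sum borel_measurable_scaleR) auto
  ultimately show ?thesis by simp
qed

lemma smooth_on_C1:
  fixes \<omega> :: "('n::finite) form"
  assumes "smooth_on S \<omega>" "open S"
  shows "x \<in> S \<Longrightarrow> \<omega> differentiable (at x)" "C1_on S (\<lambda>x. \<omega> x $ I)" "C1_on S (pd i (\<lambda>x. \<omega> x $ I))"
proof -
  have 2: "Ck_on (Suc (Suc 0)) S \<omega>" using assms(1) unfolding smooth_on_def by blast
  have c: "Ck_on (Suc 0) S f \<Longrightarrow> C1_on S (\<lambda>x. f x $ I)" for f :: "'n form" and I
  proof -
    assume f: "Ck_on (Suc 0) S f"
    have "continuous_on S (\<lambda>x. frechet_derivative f (at x) (axis j 1) $ I)" for j
      using f by (auto intro: continuous_intros)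
    then have "continuous_on S (pd j (\<lambda>x. f x $ I))" for j
      by (rule continuous_on_eq) (use f in \<open>auto simp: pd_component(2)\<close>)
    then show ?thesis using f unfolding C1_on_def by (auto intro: pd_component(1))
  qed
  show d: "x \<in> S \<Longrightarrow> \<omega> differentiable (at x)" for x using 2 by auto
  have 3: "Ck_on (Suc 0) S (\<lambda>x. frechet_derivative \<omega> (at x) v)" for v using 2 by (metis Ck_on.simps(2))
  show "C1_on S (pd i (\<lambda>x. \<omega> x $ I))"
    by (rule C1_on_cong[OF assms(2) _ c[OF 3]]) (rule pd_component(2)[OF d])
  have "Ck_on (Suc 0) S \<omega>" using assms(1) unfolding smooth_on_def by blast
  then show "C1_on S (\<lambda>x. \<omega> x $ I)" by (rule c)
qed

lemma smooth_on_subset: "smooth_on S \<omega> \<Longrightarrow> T \<subseteq> S \<Longrightarrow> smooth_on T \<omega>"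
proof -
  have "T \<subseteq> S \<Longrightarrow> Ck_on m S f \<Longrightarrow> Ck_on m T f" for m and f :: "'a \<Rightarrow> 'b"
    by (induction m arbitrary: f) (auto intro: continuous_on_subset)
  then show "smooth_on S \<omega> \<Longrightarrow> T \<subseteq> S \<Longrightarrow> smooth_on T \<omega>" unfolding smooth_on_def by blast
qed

lemma test_forms_C1:
  fixes \<xi> :: "('n::finite) form"
  assumes "\<xi> \<in> test_forms \<Omega> m"
  shows "(\<lambda>x. \<xi> x $ I) \<in> C1_tests \<Omega>" "\<xi> differentiable (at x)"
proof -
  obtain K where K: "smooth_on UNIV \<xi>" "compact K" "K \<subseteq> \<Omega>" "\<And>x. x \<notin> K \<Longrightarrow> \<xi> x = 0"
    using assms unfolding test_forms_def by auto
  show "\<xi> differentiable (at x)" by (rule smooth_on_C1(1)[OF K(1)]) auto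
  have "C1_on UNIV (\<lambda>x. \<xi> x $ I)" by (rule smooth_on_C1(2)[OF K(1)]) auto
  then show "(\<lambda>x. \<xi> x $ I) \<in> C1_tests \<Omega>" unfolding C1_tests_def using K by auto
qed

text \<open>The route from weak partial derivatives of the coefficients to
  \<open>has_weak_d\<close>; smooth forms and the form \<open>u\<close> of the construction both go
  through it.\<close>

lemma has_weak_d_dform:
  fixes \<omega> :: "('n::{finite,linorder}) form"
  assumes \<Omega>: "\<Omega> \<in> sets lebesgue"
    and w: "\<And>I i. weak_pd \<Omega> i (\<lambda>x. \<omega> x $ I) (p I i)"
    and k: "\<And>I i x. x \<in> \<Omega> \<Longrightarrow> card I \<noteq> k \<Longrightarrow> p I i x = 0"
    and c: "\<And>x. x \<in> \<Omega> \<Longrightarrow> \<omega> x \<in> covectors k"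
  shows "has_weak_d \<Omega> k \<omega> (dform p)"
  unfolding has_weak_d_def
proof (intro conjI ballI allI impI)
  fix x assume "x \<in> \<Omega>"
  then show "\<omega> x \<in> covectors k" "dform p x \<in> covectors (k + 1)" using c k dform_covectors by blast+
next
  fix K assume K: "compact K \<and> K \<subseteq> \<Omega>"
  have li: "integrable (lebesgue_on K) (\<lambda>x. \<omega> x $ I)" "integrable (lebesgue_on K) (p I i)" for I i
    using w K unfolding weak_pd_def loc_int_def by auto
  show "integrable (lebesgue_on K) \<omega>" by (rule integrable_vec_components[OF li(1)])
  show "integrable (lebesgue_on K) (dform p)"
    by (rule integrable_vec_components) (auto simp: dform_def intro!: Bochner_Integration.integrable_sum li(2))
next
  fix \<xi> :: "'n form" assume \<xi>: "\<xi> \<in> test_forms \<Omega> (CARD('n) - k - 1)"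
  show "integral_top \<Omega> (\<lambda>x. wedge (\<omega> x) (ext_d \<xi> x)) = (-1) ^ (k + 1) * integral_top \<Omega> (\<lambda>x. wedge (dform p x) (\<xi> x))"
    using stokes_components[OF \<Omega> w k test_forms_C1(1)[OF \<xi>]]
    by (simp add: ext_d_eq_dform[OF test_forms_C1(2)[OF \<xi>]])
qed

section \<open>Symmetry of second derivatives and \<open>dd = 0\<close>\<close>

lemma pd_sum:
  assumes "finite A" "\<And>a. a \<in> A \<Longrightarrow> f a differentiable (at x)"
  shows "(\<lambda>y. \<Sum>a\<in>A. c a * f a y) differentiable (at x)"
    "pd i (\<lambda>y. \<Sum>a\<in>A. c a * f a y) x = (\<Sum>a\<in>A. c a * pd i (f a) x)"
proof -
  have "((\<lambda>y. \<Sum>a\<in>A. c a * f a y) has_derivative (\<lambda>h. \<Sum>a\<in>A. c a * frechet_derivative (f a) (at x) h)) (at x)"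
    using assms by (intro has_derivative_sum has_derivative_mult_right) (simp add: frechet_derivative_works[symmetric])
  note * = this
  then show "(\<lambda>y. \<Sum>a\<in>A. c a * f a y) differentiable (at x)" unfolding differentiable_def by blast
  show "pd i (\<lambda>y. \<Sum>a\<in>A. c a * f a y) x = (\<Sum>a\<in>A. c a * pd i (f a) x)"
    unfolding pd_eq[OF *] by (simp add: pd_def)
qed

lemma C1_on_sum:
  assumes "finite A" "\<And>a. a \<in> A \<Longrightarrow> C1_on S (f a)"
  shows "C1_on S (\<lambda>y. \<Sum>a\<in>A. c a * f a y)"
  unfolding C1_on_def
proof (intro conjI ballI allI)
  show "(\<lambda>y. \<Sum>a\<in>A. c a * f a y) differentiable (at x)" if "x \<in> S" for x
    by (rule pd_sum(1)[OF assms(1)]) (use C1_onD(1)[OF assms(2)] that in auto)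
  have "continuous_on S (\<lambda>y. \<Sum>a\<in>A. c a * pd i (f a) y)" for i
    by (intro continuous_intros) (use C1_onD(2)[OF assms(2)] in auto)
  then show "continuous_on S (pd i (\<lambda>y. \<Sum>a\<in>A. c a * f a y))" for i
    by (rule continuous_on_eq)
      (rule pd_sum(2)[OF assms(1), symmetric], use C1_onD(1)[OF assms(2)] in auto)
qed

text \<open>The mean value theorem twice: in direction \<open>i\<close> for the increment of
  \<open>w\<close> in direction \<open>j\<close>, then in direction \<open>j\<close> for
  \<open>pd i w\<close>. The second difference is symmetric in \<open>i\<close> and
  \<open>j\<close>, which is what \<open>pd_commute\<close> exploits.\<close>

lemma second_difference:
  assumes w: "\<And>a b. 0 \<le> a \<Longrightarrow> a \<le> s \<Longrightarrow> 0 \<le> b \<Longrightarrow> b \<le> s \<Longrightarrow> w differentiable (at (x + a *\<^sub>R axis i 1 + b *\<^sub>R axis j 1))"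
    and pw: "\<And>a b. 0 \<le> a \<Longrightarrow> a \<le> s \<Longrightarrow> 0 \<le> b \<Longrightarrow> b \<le> s \<Longrightarrow> pd i w differentiable (at (x + a *\<^sub>R axis i 1 + b *\<^sub>R axis j 1))"
    and s: "0 < s"
  obtains a b where "0 \<le> a" "a \<le> s" "0 \<le> b" "b \<le> s"
    "w (x + s *\<^sub>R axis i 1 + s *\<^sub>R axis j 1) - w (x + s *\<^sub>R axis i 1) - w (x + s *\<^sub>R axis j 1) + w x
      = s * s * pd j (pd i w) (x + a *\<^sub>R axis i 1 + b *\<^sub>R axis j 1)"
proof -
  let ?u = "\<lambda>t. w ((x + s *\<^sub>R axis j 1) + t *\<^sub>R axis i 1) - w (x + t *\<^sub>R axis i 1)"
  let ?u' = "\<lambda>t. pd i w ((x + s *\<^sub>R axis j 1) + t *\<^sub>R axis i 1) - pd i w (x + t *\<^sub>R axis i 1)"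
  have "(?u has_real_derivative ?u' t) (at t)" if "0 \<le> t" "t \<le> s" for t
  proof (intro DERIV_diff line_deriv)
    show "w differentiable at (x + s *\<^sub>R axis j 1 + t *\<^sub>R axis i 1)"
      using w[of t s] that s by (simp add: add_ac)
    show "w differentiable at (x + t *\<^sub>R axis i 1)" using w[of t 0] that s by simp
  qed
  then obtain a where a: "0 < a" "a < s" "?u s - ?u 0 = (s - 0) * ?u' a"
    using MVT2[OF s, of ?u ?u'] by blast
  have "((\<lambda>t. pd i w (x + a *\<^sub>R axis i 1 + t *\<^sub>R axis j 1)) has_real_derivative
      pd j (pd i w) (x + a *\<^sub>R axis i 1 + t *\<^sub>R axis j 1)) (at t)" if "0 \<le> t" "t \<le> s" for t
    using pw[of a t] a that by (intro line_deriv) auto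
  then obtain b where b: "0 < b" "b < s"
    "pd i w (x + a *\<^sub>R axis i 1 + s *\<^sub>R axis j 1) - pd i w (x + a *\<^sub>R axis i 1 + 0 *\<^sub>R axis j 1)
      = (s - 0) * pd j (pd i w) (x + a *\<^sub>R axis i 1 + b *\<^sub>R axis j 1)"
    using MVT2[OF s, of "\<lambda>t. pd i w (x + a *\<^sub>R axis i 1 + t *\<^sub>R axis j 1)"
        "\<lambda>t. pd j (pd i w) (x + a *\<^sub>R axis i 1 + t *\<^sub>R axis j 1)"] by blast
  have "?u s - ?u 0 = s * (s * pd j (pd i w) (x + a *\<^sub>R axis i 1 + b *\<^sub>R axis j 1))"
    using a(3) b(3) by (simp add: add_ac)
  then show ?thesis using a b that[of a b] by (simp add: algebra_simps)
qed

text \<open>Schwarz's theorem. The same second difference is \<open>s * s\<close> times a value of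
  each mixed derivative close to \<open>x\<close>, so by continuity the two cannot differ at
  \<open>x\<close>.\<close>

lemma pd_commute:
  assumes \<Omega>: "open \<Omega>" "x \<in> \<Omega>" and w: "C1_on \<Omega> w" "C1_on \<Omega> (pd i w)" "C1_on \<Omega> (pd j w)"
  shows "pd i (pd j w) x = pd j (pd i w) x"
proof (rule ccontr)
  let ?A = "pd i (pd j w)" and ?B = "pd j (pd i w)"
  assume ne: "?A x \<noteq> ?B x"
  define \<epsilon> where "\<epsilon> = \<bar>?A x - ?B x\<bar> / 2"
  have e: "\<epsilon> > 0" using ne unfolding \<epsilon>_def by simp
  have "isCont ?A x" "isCont ?B x"
    using C1_onD(2)[OF w(3), of i] C1_onD(2)[OF w(2), of j] \<Omega> by (auto simp: continuous_on_eq_continuous_at)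
  then have "\<exists>d>0. \<forall>y. dist y x < d \<longrightarrow> dist (?A y) (?A x) < \<epsilon>" "\<exists>d>0. \<forall>y. dist y x < d \<longrightarrow> dist (?B y) (?B x) < \<epsilon>"
    unfolding continuous_at_eps_delta using e by blast+
  then obtain d1 d2 where d: "d1 > 0" "d2 > 0" "\<And>y. dist y x < d1 \<Longrightarrow> \<bar>?A y - ?A x\<bar> < \<epsilon>"
    "\<And>y. dist y x < d2 \<Longrightarrow> \<bar>?B y - ?B x\<bar> < \<epsilon>"
    unfolding dist_real_def by blast
  obtain d3 where d3: "d3 > 0" "ball x d3 \<subseteq> \<Omega>" using \<Omega> open_contains_ball by blast
  define m where "m = min d1 (min d2 d3)"
  \<comment> \<open>Two moves of length at most \<open>s\<close> stay within distance
    \<open>2 * s < m\<close> of \<open>x\<close>.\<close>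
  define s where "s = m / 4"
  have m: "m > 0" "m \<le> d1" "m \<le> d2" "m \<le> d3" using d d3 unfolding m_def by auto
  then have s: "s > 0" unfolding s_def by auto
  have near: "dist (x + a *\<^sub>R axis i' 1 + b *\<^sub>R axis j' 1) x < m"
    if "0 \<le> a" "a \<le> s" "0 \<le> b" "b \<le> s" for a b i' j'
  proof -
    have "dist (x + a *\<^sub>R axis i' 1 + b *\<^sub>R axis j' 1) x = norm (a *\<^sub>R axis i' 1 + b *\<^sub>R axis j' (1::real))"
      by (simp add: dist_norm algebra_simps)
    also have "\<dots> \<le> a + b"
      using norm_triangle_ineq[of "a *\<^sub>R axis i' 1" "b *\<^sub>R axis j' (1::real)"] that by (simp add: norm_axis_1)
    also have "\<dots> < m" using that m(1) s_def by linarith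
    finally show ?thesis .
  qed
  have in\<Omega>: "x + a *\<^sub>R axis i' 1 + b *\<^sub>R axis j' 1 \<in> \<Omega>"
    if "0 \<le> a" "a \<le> s" "0 \<le> b" "b \<le> s" for a b i' j'
  proof -
    have "x + a *\<^sub>R axis i' 1 + b *\<^sub>R axis j' 1 \<in> ball x d3"
      using near[OF that, of i' j'] m(4) by (simp add: dist_commute)
    then show ?thesis using d3(2) by blast
  qed
  obtain a b where ab: "0 \<le> a" "a \<le> s" "0 \<le> b" "b \<le> s"
    "w (x + s *\<^sub>R axis i 1 + s *\<^sub>R axis j 1) - w (x + s *\<^sub>R axis i 1) - w (x + s *\<^sub>R axis j 1) + w x
      = s * s * ?B (x + a *\<^sub>R axis i 1 + b *\<^sub>R axis j 1)"
    by (rule second_difference[of s w x i j, OF C1_onD(1)[OF w(1) in\<Omega>] C1_onD(1)[OF w(2) in\<Omega>] s])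
  obtain a' b' where ab': "0 \<le> a'" "a' \<le> s" "0 \<le> b'" "b' \<le> s"
    "w (x + s *\<^sub>R axis j 1 + s *\<^sub>R axis i 1) - w (x + s *\<^sub>R axis j 1) - w (x + s *\<^sub>R axis i 1) + w x
      = s * s * ?A (x + a' *\<^sub>R axis j 1 + b' *\<^sub>R axis i 1)"
    by (rule second_difference[of s w x j i, OF C1_onD(1)[OF w(1) in\<Omega>] C1_onD(1)[OF w(3) in\<Omega>] s])
  have "s * s * ?B (x + a *\<^sub>R axis i 1 + b *\<^sub>R axis j 1) = s * s * ?A (x + a' *\<^sub>R axis j 1 + b' *\<^sub>R axis i 1)"
  proof -
    have "x + s *\<^sub>R axis j 1 + s *\<^sub>R axis i 1 = x + s *\<^sub>R axis i 1 + s *\<^sub>R axis j (1::real)"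
      by (simp add: add_ac)
    from ab'(5)[unfolded this] show ?thesis using ab(5) by linarith
  qed
  then have "?B (x + a *\<^sub>R axis i 1 + b *\<^sub>R axis j 1) = ?A (x + a' *\<^sub>R axis j 1 + b' *\<^sub>R axis i 1)"
    using s by simp
  moreover have "\<bar>?B (x + a *\<^sub>R axis i 1 + b *\<^sub>R axis j 1) - ?B x\<bar> < \<epsilon>"
    using near[OF ab(1-4), of i j] m(3) by (intro d(4)) linarith
  moreover have "\<bar>?A (x + a' *\<^sub>R axis j 1 + b' *\<^sub>R axis i 1) - ?A x\<bar> < \<epsilon>"
    using near[OF ab'(1-4), of j i] m(2) by (intro d(3)) linarith
  moreover have "False" if "u = v" "\<bar>u - b\<bar> < \<bar>a - b\<bar> / 2" "\<bar>v - a\<bar> < \<bar>a - b\<bar> / 2" for u v a b :: real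
    using that abs_triangle_ineq[of "a - u" "u - b"] abs_minus_commute[of a u] by auto
  ultimately show False unfolding \<epsilon>_def by blast
qed

lemma shuffle_sign_swap:
  fixes i j :: "'n::{finite,linorder}"
  assumes "i \<noteq> j" shows "shuffle_sign {j} {i} = - shuffle_sign {i} {j}"
  using shuffle_sign_flip[of i "{j}"] assms by simp

lemma sum_antisym_0:
  fixes f :: "'a \<Rightarrow> 'a \<Rightarrow> real"
  assumes "finite K" "\<And>i j. i \<in> K \<Longrightarrow> j \<in> K \<Longrightarrow> i \<noteq> j \<Longrightarrow> f i j = - f j i"
  shows "(\<Sum>i\<in>K. \<Sum>j\<in>K - {i}. f i j) = 0"
proof -
  have e: "(\<Sum>i\<in>K. \<Sum>j\<in>K - {i}. g i j) = (\<Sum>i\<in>K. \<Sum>j\<in>K. if i = j then 0 else g i j)" for g :: "'a \<Rightarrow> 'a \<Rightarrow> real"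
  proof (rule sum.cong[OF refl])
    fix i assume "i \<in> K"
    show "(\<Sum>j\<in>K - {i}. g i j) = (\<Sum>j\<in>K. if i = j then 0 else g i j)"
      by (rule sum.mono_neutral_cong_left) (use assms(1) in auto)
  qed
  have "(\<Sum>i\<in>K. \<Sum>j\<in>K - {i}. f i j) = (\<Sum>i\<in>K. \<Sum>j\<in>K. if i = j then 0 else f i j)" by (rule e)
  also have "\<dots> = (\<Sum>i\<in>K. \<Sum>j\<in>K. - (if j = i then 0 else f j i))"
  proof (rule sum.cong[OF refl], rule sum.cong[OF refl])
    fix i j assume "i \<in> K" "j \<in> K"
    then show "(if i = j then 0 else f i j) = - (if j = i then 0 else f j i)"
      using assms(2)[of i j] by simp
  qed
  also have "\<dots> = - (\<Sum>j\<in>K. \<Sum>i\<in>K. if j = i then 0 else f j i)"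
    by (subst sum.swap) (simp add: sum_negf)
  also have "\<dots> = - (\<Sum>i\<in>K. \<Sum>j\<in>K - {i}. f i j)" by (simp only: e)
  finally show ?thesis by simp
qed

text \<open>The terms for \<open>(i, j)\<close> and \<open>(j, i)\<close> cancel: the mixed partial
  derivatives agree, while the product of the signs changes with the order in which \<open>i\<close>
  and \<open>j\<close> are split off.\<close>

lemma dform_dform_eq_0:
  fixes \<eta> :: "('n::{finite,linorder}) form"
  assumes \<Omega>: "open \<Omega>" "x \<in> \<Omega>" and \<eta>: "smooth_on \<Omega> \<eta>"
  shows "dform (\<lambda>I i. pd i (\<lambda>y. dform (\<lambda>I i. pd i (\<lambda>y. \<eta> y $ I)) y $ I)) x = 0"
proof -
  note C = smooth_on_C1(2,3)[OF \<eta> \<Omega>(1)]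
  have p: "pd i (\<lambda>y. dform (\<lambda>I i. pd i (\<lambda>y. \<eta> y $ I)) y $ I) x =
      (\<Sum>j\<in>I. shuffle_sign {j} (I - {j}) * pd i (pd j (\<lambda>y. \<eta> y $ (I - {j}))) x)" for i I
    unfolding dform_def vec_lambda_beta by (rule pd_sum) (use C1_onD(1)[OF C(2) \<Omega>(2)] in auto)
  have "dform (\<lambda>I i. pd i (\<lambda>y. dform (\<lambda>I i. pd i (\<lambda>y. \<eta> y $ I)) y $ I)) x $ K = 0" for K
  proof -
    have "dform (\<lambda>I i. pd i (\<lambda>y. dform (\<lambda>I i. pd i (\<lambda>y. \<eta> y $ I)) y $ I)) x $ K =
      (\<Sum>i\<in>K. \<Sum>j\<in>K - {i}. shuffle_sign {i} (K - {i}) * shuffle_sign {j} (K - {i} - {j}) *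
        pd i (pd j (\<lambda>y. \<eta> y $ (K - {i} - {j}))) x)"
      by (subst dform_def) (simp add: p sum_distrib_left mult.assoc)
    also have "\<dots> = 0"
    proof (rule sum_antisym_0)
      fix i j assume ij: "i \<in> K" "j \<in> K" "i \<noteq> j"
      let ?R = "K - {i} - {j}"
      have split: "shuffle_sign {a} (K - {a}) = shuffle_sign {a} {b} * shuffle_sign {a} (K - {a} - {b})"
        if "b \<in> K" "a \<noteq> b" for a b
      proof -
        have "K - {a} = {b} \<union> (K - {a} - {b})" using that by auto
        then have "shuffle_sign {a} (K - {a}) = shuffle_sign {a} ({b} \<union> (K - {a} - {b}))" by (rule arg_cong)
        then show ?thesis using shuffle_sign_Un_right[of "{b}" "K - {a} - {b}" "{a}"] by auto
      qed
      have R: "K - {j} - {i} = ?R" by auto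
      have "shuffle_sign {i} (K - {i}) = shuffle_sign {i} {j} * shuffle_sign {i} ?R" using split ij by blast
      moreover have "shuffle_sign {j} (K - {j}) = shuffle_sign {j} {i} * shuffle_sign {j} ?R"
        using split[of i j] ij R by simp
      moreover have "pd i (pd j (\<lambda>y. \<eta> y $ ?R)) x = pd j (pd i (\<lambda>y. \<eta> y $ ?R)) x"
        by (rule pd_commute[OF \<Omega> C(1) C(2) C(2)])
      ultimately show "shuffle_sign {i} (K - {i}) * shuffle_sign {j} (K - {i} - {j}) *
          pd i (pd j (\<lambda>y. \<eta> y $ (K - {i} - {j}))) x =
        - (shuffle_sign {j} (K - {j}) * shuffle_sign {i} (K - {j} - {i}) *
          pd j (pd i (\<lambda>y. \<eta> y $ (K - {j} - {i}))) x)"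
        using shuffle_sign_swap[OF ij(3)] by (simp add: R)
    qed simp
    finally show ?thesis .
  qed
  then show ?thesis by (simp add: vec_eq_iff)
qed

lemma wedge_zero_left [simp]: "wedge 0 w = 0" and wedge_zero_right [simp]: "wedge v 0 = 0"
  by (simp_all add: wedge_def vec_eq_iff)

lemma dform_0: "(\<And>I i. p I i x = 0) \<Longrightarrow> dform p x = 0"
  by (simp add: dform_def vec_eq_iff)

text \<open>An exact form with compact support annihilates every exact smooth form: apply the definition of
  the weak differential to \<open>\<zeta> d\<eta>\<close>, where the cutoff \<open>\<zeta>\<close> is \<open>1\<close> near the support, and use \<open>dd\<eta> = 0\<close>.\<close>

lemma integral_dform_wedge_ext_d_eq_0:
  fixes \<omega> \<eta> :: "('n::{finite,linorder}) form"
  assumes \<Omega>: "open \<Omega>"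
    and w: "\<And>I i. weak_pd \<Omega> i (\<lambda>x. \<omega> x $ I) (p I i)"
    and m: "\<And>I i x. x \<in> \<Omega> \<Longrightarrow> card I \<noteq> m \<Longrightarrow> p I i x = 0"
    and K: "\<And>x. x \<in> \<Omega> \<Longrightarrow> x \<notin> K \<Longrightarrow> \<omega> x = 0" "\<And>x I i. x \<in> \<Omega> \<Longrightarrow> x \<notin> K \<Longrightarrow> p I i x = 0"
    and \<zeta>: "C1_on UNIV \<zeta>" "compact K2" "K2 \<subseteq> \<Omega>" "\<And>x. x \<notin> K2 \<Longrightarrow> \<zeta> x = 0"
    and U: "open U" "K \<subseteq> U" "\<And>x. x \<in> U \<Longrightarrow> \<zeta> x = 1"
    and \<eta>: "smooth_on \<Omega> \<eta>"
  shows "integral_top \<Omega> (\<lambda>x. wedge (dform p x) (ext_d \<eta> x)) = 0"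
proof -
  let ?q = "dform (\<lambda>I i. pd i (\<lambda>y. \<eta> y $ I))"
  define \<xi> :: "'n form" where "\<xi> x = (\<chi> I. if x \<in> \<Omega> then \<zeta> x * ?q x $ I else 0)" for x
  note C = smooth_on_C1(2,3)[OF \<eta> \<Omega>]
  have q: "C1_on \<Omega> (\<lambda>x. ?q x $ I)" for I
    unfolding dform_def vec_lambda_beta by (intro C1_on_sum C) auto
  have \<xi>c: "(\<lambda>x. \<xi> x $ I) = (\<lambda>x. if x \<in> \<Omega> then \<zeta> x * ?q x $ I else 0)" for I
    by (simp add: \<xi>_def)
  have "(\<lambda>x. \<xi> x $ I) \<in> C1_tests \<Omega>" for I
    unfolding C1_tests_def \<xi>c
    using C1_extend_zero[OF \<Omega> C1_on_mult[OF C1_on_subset[OF \<zeta>(1)] q] \<zeta>(2,3)] \<zeta>(2-4) by auto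
  note T = this
  have st: "integral_top \<Omega> (\<lambda>x. wedge (\<omega> x) (dform (\<lambda>I i. pd i (\<lambda>y. \<xi> y $ I)) x)) =
    (-1) ^ (m + 1) * integral_top \<Omega> (\<lambda>x. wedge (dform p x) (\<xi> x))"
    by (rule stokes_components[OF open_lebesgue[OF \<Omega>] w m T])
  have "integral_top \<Omega> (\<lambda>x. wedge (dform p x) (\<xi> x)) = integral_top \<Omega> (\<lambda>x. wedge (dform p x) (ext_d \<eta> x))"
    unfolding integral_top_def
  proof (rule Bochner_Integration.integral_cong[OF refl])
    fix x assume "x \<in> space (lebesgue_on \<Omega>)"
    then have x: "x \<in> \<Omega>" by simp
    show "wedge (dform p x) (\<xi> x) $ UNIV = wedge (dform p x) (ext_d \<eta> x) $ UNIV"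
    proof (cases "x \<in> K")
      case True
      then have "\<xi> x = ext_d \<eta> x"
        using U x by (auto simp: \<xi>_def vec_eq_iff ext_d_eq_dform[OF smooth_on_C1(1)[OF \<eta> \<Omega> x]])
      then show ?thesis by simp
    next
      case False
      then show ?thesis using dform_0[of p x] K(2)[OF x False] by simp
    qed
  qed
  moreover have "integral_top \<Omega> (\<lambda>x. wedge (\<omega> x) (dform (\<lambda>I i. pd i (\<lambda>y. \<xi> y $ I)) x)) = 0"
    unfolding integral_top_def
  proof (rule integral_eq_zero_AE, rule AE_I2)
    fix x assume "x \<in> space (lebesgue_on \<Omega>)"
    then have x: "x \<in> \<Omega>" by simp
    show "wedge (\<omega> x) (dform (\<lambda>I i. pd i (\<lambda>y. \<xi> y $ I)) x) $ UNIV = 0"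
    proof (cases "x \<in> K")
      case True
      have "pd i (\<lambda>y. \<xi> y $ I) x = pd i (\<lambda>y. ?q y $ I) x" for I i
        by (rule pd_cong_open[of "U \<inter> \<Omega>"]) (use \<Omega> U x True in \<open>auto simp: \<xi>_def\<close>)
      then have "dform (\<lambda>I i. pd i (\<lambda>y. \<xi> y $ I)) x = dform (\<lambda>I i. pd i (\<lambda>y. ?q y $ I)) x"
        by (simp add: dform_def)
      then show ?thesis using dform_dform_eq_0[OF \<Omega> x \<eta>] by simp
    next
      case False
      then show ?thesis using K(1)[OF x] by simp
    qed
  qed
  ultimately show ?thesis using st by simp
qed

section \<open>Uniqueness of the weak differential\<close>

text \<open>The factor \<open>inverse t ^ j\<close> makes the family closed under differentiation up
  to linear combinations, so smoothness of the classical flat function (\<open>j = 0\<close>)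
  follows by an induction with \<open>j\<close> arbitrary.\<close>

definition flat_exp :: "nat \<Rightarrow> real \<Rightarrow> real" where
  "flat_exp j t = (if t > 0 then exp (- inverse t) * inverse t ^ j else 0)"

lemma flat_exp_tendsto_0: "(flat_exp j \<longlongrightarrow> 0) (at 0)"
proof -
  have "((\<lambda>u::real. u ^ j / exp u) \<longlongrightarrow> 0) at_top"
    by (rule tendsto_power_div_exp_0)
  moreover have "filterlim (\<lambda>t::real. inverse t) at_top (at_right 0)"
    by (rule filterlim_inverse_at_top_right)
  ultimately have "((\<lambda>t. inverse t ^ j / exp (inverse t)) \<longlongrightarrow> 0) (at_right (0::real))"
    by (rule filterlim_compose)
  then have "(flat_exp j \<longlongrightarrow> 0) (at_right 0)"
    by (rule Lim_transform_eventually)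
      (auto simp: flat_exp_def exp_minus field_simps eventually_at_filter)
  moreover have "(flat_exp j \<longlongrightarrow> 0) (at_left 0)"
    by (rule Lim_transform_eventually[OF tendsto_const]) (auto simp: flat_exp_def eventually_at_filter)
  ultimately show ?thesis by (simp add: filterlim_at_split)
qed

lemma DERIV_flat_exp:
  "(flat_exp j has_real_derivative flat_exp (j + 2) t - real j * flat_exp (j + 1) t) (at t)"
proof (cases t "0::real" rule: linorder_cases)
  case less
  have "((\<lambda>t. 0) has_real_derivative 0) (at t)" by simp
  then have "(flat_exp j has_real_derivative 0) (at t)"
    by (rule has_field_derivative_transform_within_open[of _ _ _ "{..<0}"]) (use less in \<open>auto simp: flat_exp_def\<close>)
  then show ?thesis using less by (simp add: flat_exp_def)
next
  case equal
  \<comment> \<open>The difference quotient at \<open>0\<close> is \<open>flat_exp (j + 1)\<close>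
    itself, whose limit is known.\<close>
  have "((\<lambda>h. (flat_exp j (0 + h) - flat_exp j 0) / h) \<longlongrightarrow> 0) (at 0)"
    by (rule Lim_transform_eventually[OF flat_exp_tendsto_0[of "j + 1"]])
      (auto simp: flat_exp_def eventually_at_filter field_simps)
  then show ?thesis unfolding DERIV_def equal by (simp add: flat_exp_def)
next
  case greater
  let ?u = "inverse t"
  have u: "(inverse has_real_derivative - (?u ^ 2)) (at t)"
    using DERIV_inverse[of t UNIV] greater by (simp add: numeral_2_eq_2)
  have "((\<lambda>t. exp (- inverse t) * inverse t ^ j) has_real_derivative
     (exp (- ?u) * - (- (?u ^ 2))) * ?u ^ j + (real j * (- (?u ^ 2) * ?u ^ (j - Suc 0))) * exp (- ?u)) (at t)"
    by (rule DERIV_mult[OF DERIV_chain2[OF DERIV_exp DERIV_minus[OF u]] DERIV_power[OF u]])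
  also have "(exp (- ?u) * - (- (?u ^ 2))) * ?u ^ j + (real j * (- (?u ^ 2) * ?u ^ (j - Suc 0))) * exp (- ?u) =
      flat_exp (j + 2) t - real j * flat_exp (j + 1) t"
    using greater by (cases j) (simp_all add: flat_exp_def power2_eq_square del: power_inverse)
  finally show ?thesis
    by (rule has_field_derivative_transform_within_open[of _ _ _ "{0<..}"])
      (use greater in \<open>auto simp: flat_exp_def\<close>)
qed

lemma Ck_on_Suc_imp: "Ck_on (Suc m) S f \<Longrightarrow> Ck_on m S f"
  by (induction m arbitrary: f)
    (auto intro: continuous_at_imp_continuous_on differentiable_imp_continuous_within)

lemma Ck_on_const: "Ck_on m UNIV (\<lambda>x. c)"
  by (induction m arbitrary: c) auto

lemma frechet_derivative_add:
  assumes "f differentiable (at x)" "g differentiable (at x)"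
  shows "frechet_derivative (\<lambda>x. f x + g x) (at x) v = frechet_derivative f (at x) v + frechet_derivative g (at x) v"
  using frechet_derivative_at[OF has_derivative_add[OF assms[unfolded frechet_derivative_works]]] by metis

lemma frechet_derivative_mult:
  fixes f g :: "'a::real_normed_vector \<Rightarrow> real"
  assumes "f differentiable (at x)" "g differentiable (at x)"
  shows "frechet_derivative (\<lambda>x. f x * g x) (at x) v = f x * frechet_derivative g (at x) v + frechet_derivative f (at x) v * g x"
  using frechet_derivative_at[OF has_derivative_mult[OF assms[unfolded frechet_derivative_works]]] by metis

lemma Ck_on_add: "Ck_on m UNIV f \<Longrightarrow> Ck_on m UNIV g \<Longrightarrow> Ck_on m UNIV (\<lambda>x. f x + g x)"
proof (induction m arbitrary: f g)
  case 0 then show ?case by (auto intro: continuous_intros)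
next
  case (Suc m)
  then have d: "f differentiable (at x)" "g differentiable (at x)" for x by auto
  then have "(\<lambda>x. frechet_derivative (\<lambda>x. f x + g x) (at x) v) =
      (\<lambda>x. frechet_derivative f (at x) v + frechet_derivative g (at x) v)" for v
    by (simp add: frechet_derivative_add)
  then show ?case using Suc d by auto
qed

lemma Ck_on_mult:
  fixes f g :: "'a::real_normed_vector \<Rightarrow> real"
  shows "Ck_on m UNIV f \<Longrightarrow> Ck_on m UNIV g \<Longrightarrow> Ck_on m UNIV (\<lambda>x. f x * g x)"
proof (induction m arbitrary: f g)
  case 0 then show ?case by (auto intro: continuous_intros)
next
  case (Suc m)
  then have d: "f differentiable (at x)" "g differentiable (at x)" for x by auto
  then have "(\<lambda>x. frechet_derivative (\<lambda>x. f x * g x) (at x) v) =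
      (\<lambda>x. f x * frechet_derivative g (at x) v + frechet_derivative f (at x) v * g x)" for v
    by (simp add: frechet_derivative_mult)
  moreover have "Ck_on m UNIV (\<lambda>x. f x * frechet_derivative g (at x) v + frechet_derivative f (at x) v * g x)" for v
    using Suc.prems Ck_on_Suc_imp by (intro Ck_on_add Suc.IH) auto
  ultimately show ?case using d by auto
qed

lemma Ck_on_linear_comp:
  assumes "bounded_linear h" shows "Ck_on m UNIV f \<Longrightarrow> Ck_on m UNIV (\<lambda>x. h (f x))"
proof (induction m arbitrary: f)
  case 0 then show ?case by (auto intro: bounded_linear.continuous_on[OF assms])
next
  case (Suc m)
  then have "((\<lambda>x. h (f x)) has_derivative (\<lambda>v. h (frechet_derivative f (at x) v))) (at x)" for x
    by (intro bounded_linear.has_derivative[OF assms]) (simp add: frechet_derivative_works[symmetric])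
  note * = this
  have "(\<lambda>x. frechet_derivative (\<lambda>x. h (f x)) (at x) v) = (\<lambda>x. h (frechet_derivative f (at x) v))" for v
    using frechet_derivative_at[OF *] by metis
  moreover have "(\<lambda>x. h (f x)) differentiable (at x)" for x using * unfolding differentiable_def by blast
  ultimately show ?case using Suc by auto
qed

lemma Ck_on_bounded_linear: "bounded_linear f \<Longrightarrow> Ck_on m UNIV f"
proof (cases m)
  case 0 assume "bounded_linear f" then show ?thesis using 0 by (auto intro: linear_continuous_on)
next
  case (Suc n) assume f: "bounded_linear f"
  have *: "(f has_derivative f) (at x)" for x by (rule bounded_linear_imp_has_derivative[OF f])
  have "frechet_derivative f (at x) = f" for x using frechet_derivative_at[OF *] by metis
  moreover have "f differentiable (at x)" for x using * unfolding differentiable_def by blast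
  ultimately show ?thesis using Suc Ck_on_const by auto
qed

lemma Ck_on_flat_exp:
  fixes q :: "'a::real_normed_vector \<Rightarrow> real"
  assumes "\<And>m. Ck_on m UNIV q"
  shows "Ck_on m UNIV (\<lambda>x. flat_exp j (q x))"
proof (induction m arbitrary: j)
  case 0
  have "continuous_on UNIV (flat_exp j)"
    by (intro continuous_at_imp_continuous_on ballI DERIV_isCont[OF DERIV_flat_exp])
  moreover have "continuous_on UNIV q" using assms[of 0] by simp
  ultimately show ?case by (auto intro: continuous_on_compose2)
next
  case (Suc m)
  let ?D = "\<lambda>x v. (flat_exp (j + 2) (q x) + (- real j) * flat_exp (j + 1) (q x)) * frechet_derivative q (at x) v"
  have q: "Ck_on (Suc m) UNIV q" by (rule assms)
  have *: "((\<lambda>x. flat_exp j (q x)) has_derivative ?D x) (at x)" for x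
  proof -
    have "(q has_derivative frechet_derivative q (at x)) (at x)"
      using q by (simp add: frechet_derivative_works[symmetric])
    from has_derivative_compose[OF this DERIV_flat_exp[unfolded has_field_derivative_def]]
    show ?thesis by simp
  qed
  have "(\<lambda>x. frechet_derivative (\<lambda>x. flat_exp j (q x)) (at x) v) = (\<lambda>x. ?D x v)" for v
    using frechet_derivative_at[OF *] by metis
  moreover have "Ck_on m UNIV (\<lambda>x. ?D x v)" for v
    using q by (intro Ck_on_mult Ck_on_add Suc.IH Ck_on_const) auto
  moreover have "(\<lambda>x. flat_exp j (q x)) differentiable (at x)" for x using * unfolding differentiable_def by blast
  ultimately show ?case by auto
qed

lemma Ck_on_polynomial: "real_polynomial_function p \<Longrightarrow> Ck_on m UNIV p"
  by (induction rule: real_polynomial_function.induct)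
    (auto intro: Ck_on_bounded_linear Ck_on_const Ck_on_add Ck_on_mult)

text \<open>Multiplying by a fixed bump turns polynomials into test functions, so that density
  of polynomials suffices; no mollification is needed.\<close>

lemma AE_eq_0_cball:
  fixes h :: "real^'n::finite \<Rightarrow> real"
  assumes h: "loc_int (ball c r) h" and \<rho>: "0 < \<rho>" "\<rho> < r"
    and 0: "\<And>\<xi> K. smooth_on UNIV \<xi> \<Longrightarrow> compact K \<Longrightarrow> K \<subseteq> ball c r \<Longrightarrow> (\<And>x. x \<notin> K \<Longrightarrow> \<xi> x = 0) \<Longrightarrow>
      (LINT x|lebesgue_on (ball c r). h x * \<xi> x) = 0"
  shows "AE x in lebesgue. x \<in> ball c \<rho> \<longrightarrow> h x = 0"
proof -
  let ?\<Omega> = "ball c r" and ?C = "cball c \<rho>"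
  \<comment> \<open>\<open>B x = flat_exp 0 (q x)\<close> will be the bump: \<open>q\<close> is a
    polynomial, so \<open>B\<close> is smooth, and it is positive exactly inside the ball.\<close>
  define q where "q x = \<rho>\<^sup>2 - (\<Sum>b\<in>Basis. ((x - c) \<bullet> b)\<^sup>2)" for x :: "real^'n"
  have q: "q x = \<rho>\<^sup>2 - (norm (x - c))\<^sup>2" for x
    unfolding q_def power2_norm_eq_inner by (simp add: euclidean_inner[of "x - c" "x - c"] power2_eq_square)
  have rp: "real_polynomial_function q"
  proof -
    have eq: "q = (\<lambda>x. \<rho>\<^sup>2 - (\<Sum>b\<in>Basis. (x \<bullet> b + - (c \<bullet> b))\<^sup>2))"
      unfolding q_def by (simp add: inner_diff_left)
    have "real_polynomial_function (\<lambda>x::real^'n. \<rho>\<^sup>2 - (\<Sum>b\<in>Basis. (x \<bullet> b + - (c \<bullet> b))\<^sup>2))"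
      by (intro real_polynomial_function_diff real_polynomial_function_sum real_polynomial_function_power
          real_polynomial_function.intros bounded_linear_inner_left) auto
    then show ?thesis by (simp only: eq)
  qed
  define B where "B x = flat_exp 0 (q x)" for x
  have Bs: "Ck_on m UNIV B" for m
    unfolding B_def by (rule Ck_on_flat_exp[OF Ck_on_polynomial[OF rp]])
  have Bc: "continuous_on UNIV B" using Bs[of 0] by simp
  have B0: "B x = 0" if "x \<notin> ?C" for x
  proof -
    have "norm (x - c) > \<rho>" using that by (simp add: dist_norm norm_minus_commute)
    then have "\<rho>\<^sup>2 < (norm (x - c))\<^sup>2" using \<rho> by (intro power_strict_mono) auto
    then show ?thesis by (simp add: B_def flat_exp_def q)
  qed
  have Bp: "B x > 0" if "x \<in> ball c \<rho>" for x
  proof -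
    have "norm (x - c) < \<rho>" using that by (simp add: dist_norm norm_minus_commute)
    then have "(norm (x - c))\<^sup>2 < \<rho>\<^sup>2" by (intro power_strict_mono) auto
    then show ?thesis by (simp add: B_def flat_exp_def q)
  qed
  have Bnn: "B x \<ge> 0" for x by (simp add: B_def flat_exp_def)
  have CO: "compact ?C" "?C \<subseteq> ?\<Omega>" using \<rho> by auto
  have S: "?\<Omega> \<in> sets lebesgue" by (rule open_lebesgue) simp
  define g where "g x = h x * B x" for x
  have gw: "integrable (lebesgue_on ?\<Omega>) (\<lambda>x. g x * w x)" if "continuous_on ?C w" for w
    using integrable_test[OF h S CO, of "\<lambda>x. B x * w x"] B0 that
      continuous_on_mult[OF continuous_on_subset[OF Bc] that]
    by (simp add: g_def mult.assoc)
  have g1: "integrable (lebesgue_on ?\<Omega>) g" using gw[of "\<lambda>_. 1"] by simp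
  have poly: "(LINT x|lebesgue_on ?\<Omega>. g x * p x) = 0" if "real_polynomial_function p" for p
  proof -
    have "smooth_on UNIV (\<lambda>x. B x * p x)"
      unfolding smooth_on_def by (intro allI Ck_on_mult Bs Ck_on_polynomial that)
    from 0[OF this CO] show ?thesis using B0 by (simp add: g_def mult.assoc)
  qed
  \<comment> \<open>\<open>g\<close> annihilates polynomials; their uniform density on the closed
    ball extends this to continuous functions.\<close>
  have cont: "(LINT x|lebesgue_on ?\<Omega>. g x * w x) = 0" if w: "continuous_on ?C w" for w
  proof (rule ccontr)
    assume ne: "(LINT x|lebesgue_on ?\<Omega>. g x * w x) \<noteq> 0"
    let ?I = "LINT x|lebesgue_on ?\<Omega>. \<bar>g x\<bar>"
    have I: "?I \<ge> 0" by simp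
    \<comment> \<open>\<open>?I + 1\<close> in place of \<open>?I\<close> covers the case that
      \<open>g\<close> vanishes almost everywhere.\<close>
    define e where "e = \<bar>LINT x|lebesgue_on ?\<Omega>. g x * w x\<bar> / (?I + 1)"
    have "?I + 1 > 0" using I by linarith
    then have e: "e > 0" using ne unfolding e_def by (intro divide_pos_pos) auto
    obtain p where p: "real_polynomial_function p" "\<And>x. x \<in> ?C \<Longrightarrow> \<bar>w x - p x\<bar> < e"
      using Stone_Weierstrass_real_polynomial_function[OF CO(1) w e] by blast
    have pc: "continuous_on ?C p" by (rule continuous_on_subset[OF _ subset_UNIV]) (use Ck_on_polynomial[OF p(1), of 0] in simp)
    have "(LINT x|lebesgue_on ?\<Omega>. g x * w x) = (LINT x|lebesgue_on ?\<Omega>. g x * w x) - (LINT x|lebesgue_on ?\<Omega>. g x * p x)"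
      using poly[OF p(1)] by simp
    also have "\<dots> = (LINT x|lebesgue_on ?\<Omega>. g x * w x - g x * p x)"
      using gw[OF w] gw[OF pc] by simp
    also have "\<bar>\<dots>\<bar> \<le> (LINT x|lebesgue_on ?\<Omega>. \<bar>g x * w x - g x * p x\<bar>)" by (rule integral_abs_bound)
    also have "\<dots> \<le> (LINT x|lebesgue_on ?\<Omega>. e * \<bar>g x\<bar>)"
    proof (rule integral_mono)
      fix x
      show "\<bar>g x * w x - g x * p x\<bar> \<le> e * \<bar>g x\<bar>"
      proof (cases "x \<in> ?C")
        case True
        then have "\<bar>g x\<bar> * \<bar>w x - p x\<bar> \<le> \<bar>g x\<bar> * e" using p(2) by (intro mult_left_mono) (auto intro: less_imp_le)
        then show ?thesis by (simp add: abs_mult[symmetric] right_diff_distrib mult.commute)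
      next
        case False then show ?thesis using B0 by (simp add: g_def)
      qed
    qed (use gw[OF w] gw[OF pc] g1 in auto)
    also have "\<dots> = e * ?I" by simp
    also have "\<dots> < e * (?I + 1)" using e by simp
    also have "\<dots> = \<bar>LINT x|lebesgue_on ?\<Omega>. g x * w x\<bar>"
    proof -
      have "?I + 1 \<noteq> 0" using I by linarith
      then show ?thesis unfolding e_def by simp
    qed
    finally show False by simp
  qed
  have gO: "g x = 0" if "x \<notin> ?\<Omega>" for x
  proof -
    have "x \<notin> ?C" using that CO(2) by blast
    then show ?thesis by (simp add: g_def B0)
  qed
  have gL: "integrable lebesgue g" using g1 integrable_lebesgue_on_eq[OF S, of g] gO by blast
  have contL: "(LINT x|lebesgue. g x * w x) = 0" if "continuous_on UNIV w" for w
    using cont[OF continuous_on_subset[OF that]] integral_lebesgue_on_eq[OF S, of "\<lambda>x. g x * w x"] gO by simp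
  have K0: "(LINT x|lebesgue. g x * indicator K x) = 0" if K: "closed K" for K
  proof (cases "K = {}")
    case False
    \<comment> \<open>Continuous functions that decrease to the indicator of the closed set
      \<open>K\<close>.\<close>
    let ?w = "\<lambda>m x. max 0 (1 - real m * infdist x K)"
    have wc: "continuous_on UNIV (?w m)" for m by (intro continuous_intros)
    have "(\<lambda>m. LINT x|lebesgue. g x * ?w m x) \<longlonglongrightarrow> (LINT x|lebesgue. g x * indicator K x)"
    proof (rule integral_dominated_convergence[where w = "\<lambda>x. \<bar>g x\<bar>"])
      show "(\<lambda>x. g x * indicator K x) \<in> borel_measurable lebesgue"
        using gL K by (intro borel_measurable_times borel_measurable_indicator) auto
      show "(\<lambda>x. g x * ?w m x) \<in> borel_measurable lebesgue" for m
        using gL continuous_imp_measurable_on_sets_lebesgue[OF wc, of m] by (intro borel_measurable_times) auto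
      have "norm (g x * ?w m x) \<le> \<bar>g x\<bar>" for m x
        using mult_left_mono[of "?w m x" 1 "\<bar>g x\<bar>"] infdist_nonneg[of x K] by (auto simp: abs_mult)
      then show "AE x in lebesgue. norm (g x * ?w m x) \<le> \<bar>g x\<bar>" for m by simp
      have "(\<lambda>m. ?w m x) \<longlonglongrightarrow> indicator K x" for x
      proof (cases "x \<in> K")
        case False
        then have "infdist x K > 0"
          using K \<open>K \<noteq> {}\<close> infdist_nonneg[of x K] in_closed_iff_infdist_zero[OF K] by fastforce
        then have "\<forall>\<^sub>F m in sequentially. 1 / infdist x K < real m"
          using filterlim_real_sequentially unfolding filterlim_at_top_dense by blast
        then have "\<forall>\<^sub>F m in sequentially. indicator K x = ?w m x"
          by eventually_elim (use \<open>infdist x K > 0\<close> False in \<open>auto simp: field_simps\<close>)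
        then show ?thesis by (rule Lim_transform_eventually[OF tendsto_const])
      qed simp
      then show "AE x in lebesgue. (\<lambda>m. g x * ?w m x) \<longlonglongrightarrow> g x * indicator K x"
        by (intro AE_I2 tendsto_mult tendsto_const)
    qed (use gL in auto)
    then show ?thesis by (simp add: contL[OF wc] LIMSEQ_const_iff)
  qed simp
  \<comment> \<open>Inner regularity: closed subsets of the set where \<open>s * g\<close> is
    positive carry zero integral, hence are null, and they exhaust that set up to arbitrarily small
    measure. It is used with \<open>s = 1\<close> and \<open>s = -1\<close>.\<close>
  have null: "{x. s * g x > 0} \<in> null_sets lebesgue" for s :: real
  proof -
    let ?A = "{x. s * g x > 0}"
    have "(\<lambda>x. s * g x) \<in> borel_measurable lebesgue" using gL by (intro borel_measurable_times) auto
    from borel_measurable_less[OF borel_measurable_const[of 0] this]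
    have A: "?A \<in> sets lebesgue" by simp
    have "\<exists>T. closed T \<and> T \<subseteq> ?A \<and> ?A - T \<in> lmeasurable \<and> emeasure lebesgue (?A - T) < ennreal (1 / real (Suc n))" for n
      using sets_lebesgue_inner_closed[OF A, of "1 / real (Suc n)"] by (metis of_nat_0_less_iff zero_less_Suc zero_less_divide_1_iff)
    then obtain T where T: "\<And>n. closed (T n)" "\<And>n. T n \<subseteq> ?A" "\<And>n. ?A - T n \<in> lmeasurable"
      "\<And>n. emeasure lebesgue (?A - T n) < ennreal (1 / real (Suc n))" by metis
    have Tn: "T n \<in> null_sets lebesgue" for n
    proof -
      have TS: "T n \<in> sets lebesgue" using T(1) by simp
      have i: "integrable lebesgue (\<lambda>x. s * g x * indicator (T n) x)"
        using integrable_mult_indicator[OF TS, of "\<lambda>x. s * g x"] gL by (simp add: mult.commute)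
      have "(LINT x|lebesgue. s * g x * indicator (T n) x) = 0"
        using K0[OF T(1)] by (simp add: mult.assoc)
      then have "AE x in lebesgue. s * g x * indicator (T n) x = 0"
        by (subst (asm) integral_nonneg_eq_0_iff_AE[OF i]) (use T(2) in \<open>auto simp: indicator_def subset_iff less_imp_le\<close>)
      then have "AE x in lebesgue. x \<notin> T n" by eventually_elim (use T(2) in \<open>force simp: indicator_def\<close>)
      then show ?thesis using TS by (simp add: AE_iff_null_sets)
    qed
    have "emeasure lebesgue ?A \<le> ennreal (1 / real (Suc n))" for n
    proof -
      have "emeasure lebesgue ?A \<le> emeasure lebesgue ((?A - T n) \<union> T n)"
        using A T(1)[of n] by (intro emeasure_mono) auto
      also have "\<dots> = emeasure lebesgue (?A - T n)"
        by (rule emeasure_Un_null_set[OF _ Tn]) (use A T(1)[of n] in auto)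
      finally show ?thesis using T(4)[of n] by simp
    qed
    moreover have "(\<lambda>n. ennreal (1 / real (Suc n))) \<longlonglongrightarrow> ennreal 0"
      by (rule tendsto_ennrealI) real_asymp
    ultimately have "emeasure lebesgue ?A \<le> 0" by (intro LIMSEQ_le_const[where X = "\<lambda>n. ennreal (1 / real (Suc n))"]) auto
    then show ?thesis using A by auto
  qed
  have "AE x in lebesgue. x \<notin> {x. 1 * g x > 0}" "AE x in lebesgue. x \<notin> {x. (-1) * g x > 0}"
    by (rule AE_not_in[OF null])+
  then show ?thesis
  proof eventually_elim
    case (elim x)
    then have "g x = 0" by auto
    then show ?case using Bp[of x] by (auto simp: g_def)
  qed
qed

lemma AE_eq_0_ball:
  fixes h :: "real^'n::finite \<Rightarrow> real"
  assumes h: "loc_int (ball c r) h"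
    and 0: "\<And>\<xi> K. smooth_on UNIV \<xi> \<Longrightarrow> compact K \<Longrightarrow> K \<subseteq> ball c r \<Longrightarrow> (\<And>x. x \<notin> K \<Longrightarrow> \<xi> x = 0) \<Longrightarrow>
      (LINT x|lebesgue_on (ball c r). h x * \<xi> x) = 0"
  shows "AE x in lebesgue_on (ball c r). h x = 0"
proof -
  have S: "ball c r \<in> sets lebesgue" by (rule open_lebesgue) simp
  \<comment> \<open>\<open>Suc (Suc n)\<close> keeps the radius positive at
    \<open>n = 0\<close>.\<close>
  have "AE x in lebesgue. x \<in> ball c (r * (1 - 1 / real (Suc (Suc n)))) \<longrightarrow> h x = 0" for n
  proof (cases "r > 0")
    case True
    show ?thesis by (rule AE_eq_0_cball[OF h _ _ 0]) (use True in \<open>auto simp: field_simps intro: add_pos_nonneg\<close>)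
  next
    case False
    then have "r * (1 - 1 / real (Suc (Suc n))) \<le> 0" by (intro mult_nonpos_nonneg) auto
    then show ?thesis by (auto simp: ball_eq_empty[THEN iffD2])
  qed
  then have "AE x in lebesgue. \<forall>n. x \<in> ball c (r * (1 - 1 / real (Suc (Suc n)))) \<longrightarrow> h x = 0"
    unfolding AE_all_countable by blast
  then have "AE x in lebesgue. x \<in> ball c r \<longrightarrow> h x = 0"
  proof eventually_elim
    case (elim x)
    show ?case
    proof
      assume x: "x \<in> ball c r"
      have "(\<lambda>n. r * (1 - 1 / real (Suc (Suc n)))) \<longlonglongrightarrow> r" by real_asymp
      then have "\<forall>\<^sub>F n in sequentially. dist c x < r * (1 - 1 / real (Suc (Suc n)))"
        using x by (intro order_tendstoD(1)) auto
      then obtain n where "dist c x < r * (1 - 1 / real (Suc (Suc n)))"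
        unfolding eventually_sequentially by blast
      then show "h x = 0" using elim by (auto simp: mem_ball)
    qed
  qed
  then show ?thesis using S by (subst AE_restrict_space_iff) auto
qed

text \<open>The test form with the single component \<open>\<xi>\<close> at \<open>- K\<close>
  pairs, up to sign, with the component \<open>K\<close> only; this reduces the claim to
  \<open>AE_eq_0_ball\<close> for the difference of two components.\<close>

lemma has_weak_d_unique:
  fixes \<eta> \<eta>' :: "('n::{finite,linorder}) form"
  assumes 1: "has_weak_d (ball c r) k \<omega> \<eta>" and 2: "has_weak_d (ball c r) k \<omega> \<eta>'"
  shows "AE x in lebesgue_on (ball c r). \<eta> x = \<eta>' x"
proof -
  let ?\<Omega> = "ball c r"
  have S: "?\<Omega> \<in> sets lebesgue" by (rule open_lebesgue) simp
  have l: "loc_int ?\<Omega> (\<lambda>x. \<theta> x $ K)" if "has_weak_d ?\<Omega> k \<omega> \<theta>" for \<theta> :: "'n form" and K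
    using that unfolding has_weak_d_def loc_int_def
    by (auto intro: integrable_bounded_linear[OF bounded_linear_vec_nth])
  have top: "integral_top ?\<Omega> (\<lambda>x. wedge (\<theta> x) (axis (- K) (\<xi> x))) =
      shuffle_sign K (- K) * (LINT x|lebesgue_on ?\<Omega>. \<theta> x $ K * \<xi> x)" for \<theta> :: "'n form" and K and \<xi> :: "'n space \<Rightarrow> real"
  proof -
    have "wedge (\<theta> x) (axis (- K) (\<xi> x)) $ UNIV = shuffle_sign K (- K) * (\<theta> x $ K * \<xi> x)" for x
    proof -
      have "wedge (\<theta> x) (axis (- K) (\<xi> x)) $ UNIV =
          (\<Sum>I\<in>UNIV. if I = K then shuffle_sign K (- K) * (\<theta> x $ K * \<xi> x) else 0)"
        unfolding wedge_top by (intro sum.cong) (auto simp: axis_def)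
      then show ?thesis by simp
    qed
    then show ?thesis by (simp add: integral_top_def)
  qed
  have "AE x in lebesgue_on ?\<Omega>. \<eta> x $ K = \<eta>' x $ K" for K
  proof (cases "card K = k + 1")
    case True
    have "AE x in lebesgue_on ?\<Omega>. \<eta> x $ K - \<eta>' x $ K = 0"
    proof (rule AE_eq_0_ball)
      have "loc_int ?\<Omega> (\<lambda>x. - (\<eta>' x $ K))" using l[OF 2, of K] unfolding loc_int_def by auto
      from loc_int_add[OF l[OF 1, of K] this] show "loc_int ?\<Omega> (\<lambda>x. \<eta> x $ K - \<eta>' x $ K)" by simp
      fix \<xi> :: "'n space \<Rightarrow> real" and C assume \<xi>: "smooth_on UNIV \<xi>" "compact C" "C \<subseteq> ?\<Omega>" "\<And>x. x \<notin> C \<Longrightarrow> \<xi> x = 0"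
      let ?x = "\<lambda>x. axis (- K) (\<xi> x) :: 'n ext"
      have card: "card (- K) = CARD('n) - k - 1" using True by (simp add: Compl_eq_Diff_UNIV card_Diff_subset)
      have bl: "bounded_linear (\<lambda>t::real. axis (- K) t :: 'n ext)"
        by (rule linear_conv_bounded_linear[THEN iffD1], rule linearI) (auto simp: axis_def vec_eq_iff)
      have "?x \<in> test_forms ?\<Omega> (CARD('n) - k - 1)"
        unfolding test_forms_def smooth_on_def
      proof (intro CollectI conjI allI exI)
        show "Ck_on m UNIV ?x" for m
          using Ck_on_linear_comp[OF bl] \<xi>(1) unfolding smooth_on_def by blast
        show "?x x \<in> covectors (CARD('n) - k - 1)" for x
          using card by (auto simp: covectors_def axis_def)
        show "compact C" "C \<subseteq> ?\<Omega>" by fact+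
        show "x \<notin> C \<longrightarrow> ?x x = 0" for x using \<xi>(4) by (auto simp: axis_def vec_eq_iff)
      qed
      then have ie: "integral_top ?\<Omega> (\<lambda>x. wedge (\<eta> x) (?x x)) = integral_top ?\<Omega> (\<lambda>x. wedge (\<eta>' x) (?x x))"
        using 1 2 unfolding has_weak_d_def by simp
      have e: "(LINT x|lebesgue_on ?\<Omega>. \<eta> x $ K * \<xi> x) = (LINT x|lebesgue_on ?\<Omega>. \<eta>' x $ K * \<xi> x)"
      proof -
        have "shuffle_sign K (- K) \<noteq> 0" using abs_shuffle_sign[of K "- K"] by (metis abs_zero zero_neq_one)
        then show ?thesis using ie unfolding top by simp
      qed
      have "continuous_on C \<xi>"
        using \<xi>(1) continuous_on_subset[of UNIV \<xi> C] unfolding smooth_on_def by (metis Ck_on.simps(1) subset_UNIV)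
      then have "integrable (lebesgue_on ?\<Omega>) (\<lambda>x. \<eta> x $ K * \<xi> x)" "integrable (lebesgue_on ?\<Omega>) (\<lambda>x. \<eta>' x $ K * \<xi> x)"
        using integrable_test[OF l[OF 1] S \<xi>(2,3) _ \<xi>(4)] integrable_test[OF l[OF 2] S \<xi>(2,3) _ \<xi>(4)] by auto
      then show "(LINT x|lebesgue_on ?\<Omega>. (\<eta> x $ K - \<eta>' x $ K) * \<xi> x) = 0"
        using e by (simp add: left_diff_distrib)
    qed
    then show ?thesis by simp
  next
    case False
    then show ?thesis using 1 2 unfolding has_weak_d_def covectors_def by (auto intro!: AE_I2)
  qed
  then have "AE x in lebesgue_on ?\<Omega>. \<forall>K. \<eta> x $ K = \<eta>' x $ K"
    by (subst AE_all_countable) (auto intro: countable_finite)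
  then show ?thesis by (simp add: vec_eq_iff)
qed

section \<open>A criterion for the gap\<close>

lemma complete_lebesgue_on: "S \<in> sets lebesgue \<Longrightarrow> complete_measure (lebesgue_on S)"
proof (rule complete_measure.intro)
  fix A B assume S: "S \<in> sets lebesgue" and A: "B \<subseteq> A" "A \<in> null_sets (lebesgue_on S)"
  then have "A \<in> null_sets lebesgue" "A \<subseteq> S" using null_sets_restrict_space[of S lebesgue A] by auto
  then have "B \<in> sets lebesgue" "B \<subseteq> S" using A completion.complete by blast+
  then show "B \<in> sets (lebesgue_on S)" using S by (auto simp: sets_restrict_space_iff)
qed

lemma measurable_cong_AE_lebesgue_on:
  fixes f g :: "'a::euclidean_space \<Rightarrow> 'b::topological_space"
  assumes S: "S \<in> sets lebesgue" and g: "g \<in> borel_measurable (lebesgue_on S)"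
    and ae: "AE x in lebesgue_on S. f x = g x"
  shows "f \<in> borel_measurable (lebesgue_on S)"
proof (rule measurableI)
  fix A :: "'b set" assume A: "A \<in> sets borel"
  show "f -` A \<inter> space (lebesgue_on S) \<in> sets (lebesgue_on S)"
  proof (rule complete_measure.in_sets_AE[OF complete_lebesgue_on[OF S]])
    show "g -` A \<inter> space (lebesgue_on S) \<in> sets (lebesgue_on S)" using g A by (rule measurable_sets)
    show "AE x in lebesgue_on S. (x \<in> g -` A \<inter> space (lebesgue_on S)) = (x \<in> f -` A \<inter> space (lebesgue_on S))"
      using ae by eventually_elim auto
  qed auto
qed simp

text \<open>By completeness either both functions are measurable or neither is, and in the latter
  case both integrals take the default value \<open>0\<close>. The form without measurability
  assumptions suits \<open>weak_d\<close>, an arbitrary choice among the weak differentials.\<close>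

lemma integral_cong_AE_lebesgue_on:
  fixes f g :: "'a::euclidean_space \<Rightarrow> real"
  assumes S: "S \<in> sets lebesgue" and ae: "AE x in lebesgue_on S. f x = g x"
  shows "integral\<^sup>L (lebesgue_on S) f = integral\<^sup>L (lebesgue_on S) g"
proof (cases "g \<in> borel_measurable (lebesgue_on S)")
  case True
  show ?thesis by (rule integral_cong_AE[OF measurable_cong_AE_lebesgue_on[OF S True ae] True ae])
next
  case False
  have "AE x in lebesgue_on S. g x = f x" using ae by eventually_elim simp
  then have "f \<notin> borel_measurable (lebesgue_on S)" using measurable_cong_AE_lebesgue_on[OF S] False by blast
  then have "\<not> integrable (lebesgue_on S) f" "\<not> integrable (lebesgue_on S) g" using False by auto
  then show ?thesis by (simp add: not_integrable_integral_eq)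
qed

lemma orlicz_scale:
  assumes "orlicz_function \<phi>" "0 \<le> u" "u \<le> 1" "0 \<le> t"
  shows "\<phi> (u * t) \<le> ennreal u * \<phi> t"
proof -
  have "\<phi> ((1 - u) * 0 + u * t) \<le> ennreal (1 - u) * \<phi> 0 + ennreal u * \<phi> t" "\<phi> 0 = 0"
    using assms unfolding orlicz_function_def by auto
  then show ?thesis by simp
qed

lemma orlicz_mono:
  assumes "orlicz_function \<phi>" "0 \<le> s" "s \<le> t" shows "\<phi> s \<le> \<phi> t"
proof (cases "t = 0")
  case False
  then have t: "0 < t" using assms by simp
  have "\<phi> (s / t * t) \<le> ennreal (s / t) * \<phi> t" using assms t by (intro orlicz_scale) auto
  also have "\<dots> \<le> 1 * \<phi> t" using assms t by (intro mult_right_mono) auto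
  finally show ?thesis using t by simp
qed (use assms in simp)

lemma orlicz_measurable:
  assumes "orlicz_function \<phi>" "f \<in> borel_measurable M" "\<And>x. 0 \<le> f x"
  shows "(\<lambda>x. \<phi> (f x)) \<in> borel_measurable M"
proof -
  \<comment> \<open>Nothing is known about \<open>\<phi>\<close> on negative arguments, hence
    \<open>max 0\<close>; on the half-line monotonicity makes superlevel sets intervals.\<close>
  have "(\<lambda>t. \<phi> (max 0 t)) \<in> borel_measurable borel"
  proof (rule borel_measurableI_greater)
    fix y
    have "is_interval {t. y < \<phi> (max 0 t)}"
      unfolding is_interval_1
      by (auto intro: less_le_trans[OF _ orlicz_mono[OF assms(1)]])
    then show "{t \<in> space borel. y < \<phi> (max 0 t)} \<in> sets borel"
      using real_interval_borel_measurable by simp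
  qed
  from measurable_compose[OF assms(2) this] show ?thesis using assms(3) by (simp add: max_absorb2)
qed

lemma wedge_UNIV_le:
  fixes v w :: "('n::{finite,linorder}) ext"
  shows "\<bar>wedge v w $ UNIV\<bar> \<le> real CARD('n set) * (norm v * norm w)"
proof -
  have "\<bar>wedge v w $ UNIV\<bar> \<le> (\<Sum>I\<in>UNIV. \<bar>shuffle_sign I (- I) * v $ I * w $ (- I)\<bar>)"
    unfolding wedge_top by (rule sum_abs)
  also have "\<dots> \<le> (\<Sum>I\<in>(UNIV :: 'n set set). norm v * norm w)"
    by (intro sum_mono) (auto simp: abs_mult intro!: mult_mono component_le_norm_cart)
  also have "\<dots> = real CARD('n set) * (norm v * norm w)" by simp
  finally show ?thesis .
qed

lemma wedge_measurable:
  assumes "v \<in> borel_measurable M" "w \<in> borel_measurable M"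
  shows "(\<lambda>x. wedge (v x) (w x) $ I) \<in> borel_measurable M"
proof -
  have "(\<lambda>x. f x $ i) \<in> borel_measurable M" if "f \<in> borel_measurable M" for f :: "'a \<Rightarrow> 'b ext" and i
    by (rule measurable_compose[OF that]) simp
  then show ?thesis unfolding wedge_def vec_lambda_beta using assms
    by (intro borel_measurable_sum borel_measurable_times) auto
qed

lemma wedge_diff_left: "wedge (v - v') w = wedge v w - wedge v' w"
  and wedge_diff_right: "wedge v (w - w') = wedge v w - wedge v w'"
  and wedge_scaleR_left: "wedge (c *\<^sub>R v) w = c *\<^sub>R wedge v w"
  by (auto simp: wedge_def vec_eq_iff sum_subtractf[symmetric] sum_distrib_left algebra_simps intro!: sum.cong)

lemma has_weak_d_diff:
  fixes \<omega> \<omega>' :: "('n::{finite,linorder}) form"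
  assumes S: "\<Omega> \<in> sets lebesgue" and 1: "has_weak_d \<Omega> k \<omega> \<eta>" and 2: "has_weak_d \<Omega> k \<omega>' \<eta>'"
  shows "has_weak_d \<Omega> k (\<lambda>x. \<omega> x - \<omega>' x) (\<lambda>x. \<eta> x - \<eta>' x)"
proof -
  have l: "loc_int \<Omega> (\<lambda>x. \<theta> x $ K)"
    if "\<forall>K. compact K \<and> K \<subseteq> \<Omega> \<longrightarrow> integrable (lebesgue_on K) \<theta>" for \<theta> :: "'n form" and K
    using that unfolding loc_int_def by (auto intro: integrable_bounded_linear[OF bounded_linear_vec_nth])
  have li: "loc_int \<Omega> (\<lambda>x. \<omega> x $ K)" "loc_int \<Omega> (\<lambda>x. \<omega>' x $ K)" "loc_int \<Omega> (\<lambda>x. \<eta> x $ K)" "loc_int \<Omega> (\<lambda>x. \<eta>' x $ K)" for K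
    by (rule l; use 1 2 in \<open>simp add: has_weak_d_def\<close>)+
  have i1: "integrable (lebesgue_on \<Omega>) (\<lambda>x. wedge (\<theta> x) (\<xi> x) $ UNIV)"
    if "\<And>K. loc_int \<Omega> (\<lambda>x. \<theta> x $ K)" "\<xi> \<in> test_forms \<Omega> m" for \<theta> \<xi> :: "'n form" and m
    unfolding wedge_top mult.assoc
    by (intro Bochner_Integration.integrable_sum integrable_mult_right integrable_C1_tests(1)[OF that(1) S test_forms_C1(1)[OF that(2)]])
  have i2: "integrable (lebesgue_on \<Omega>) (\<lambda>x. wedge (\<theta> x) (ext_d \<xi> x) $ UNIV)"
    if "\<And>K. loc_int \<Omega> (\<lambda>x. \<theta> x $ K)" "\<xi> \<in> test_forms \<Omega> m" for \<theta> \<xi> :: "'n form" and m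
  proof -
    have "integrable (lebesgue_on \<Omega>) (\<lambda>x. \<Sum>I\<in>UNIV. shuffle_sign I (- I) *
        (\<Sum>i\<in>- I. shuffle_sign {i} (- I - {i}) * (\<theta> x $ I * pd i (\<lambda>y. \<xi> y $ (- I - {i})) x)))"
      by (intro Bochner_Integration.integrable_sum integrable_mult_right
          integrable_C1_tests(2)[OF that(1) S test_forms_C1(1)[OF that(2)]])
    moreover have "wedge (\<theta> x) (ext_d \<xi> x) $ UNIV = (\<Sum>I\<in>UNIV. shuffle_sign I (- I) *
        (\<Sum>i\<in>- I. shuffle_sign {i} (- I - {i}) * (\<theta> x $ I * pd i (\<lambda>y. \<xi> y $ (- I - {i})) x)))" for x
      unfolding wedge_top ext_d_eq_dform[OF test_forms_C1(2)[OF that(2)]] dform_def vec_lambda_beta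
      by (simp add: sum_distrib_left mult_ac)
    ultimately show ?thesis by simp
  qed
  show ?thesis unfolding has_weak_d_def
  proof (intro conjI ballI allI impI)
    fix x assume "x \<in> \<Omega>"
    then show "\<omega> x - \<omega>' x \<in> covectors k" "\<eta> x - \<eta>' x \<in> covectors (k + 1)"
      using 1 2 unfolding has_weak_d_def covectors_def by auto
  next
    fix K assume "compact K \<and> K \<subseteq> \<Omega>"
    then show "integrable (lebesgue_on K) (\<lambda>x. \<omega> x - \<omega>' x)" "integrable (lebesgue_on K) (\<lambda>x. \<eta> x - \<eta>' x)"
      using 1 2 unfolding has_weak_d_def by auto
  next
    fix \<xi> :: "'n form" assume \<xi>: "\<xi> \<in> test_forms \<Omega> (CARD('n) - k - 1)"
    have "integral_top \<Omega> (\<lambda>x. wedge (\<omega> x) (ext_d \<xi> x)) - integral_top \<Omega> (\<lambda>x. wedge (\<omega>' x) (ext_d \<xi> x)) =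
        (-1) ^ (k + 1) * (integral_top \<Omega> (\<lambda>x. wedge (\<eta> x) (\<xi> x)) - integral_top \<Omega> (\<lambda>x. wedge (\<eta>' x) (\<xi> x)))"
      using 1 2 \<xi> unfolding has_weak_d_def right_diff_distrib by simp
    then show "integral_top \<Omega> (\<lambda>x. wedge (\<omega> x - \<omega>' x) (ext_d \<xi> x)) =
        (-1) ^ (k + 1) * integral_top \<Omega> (\<lambda>x. wedge (\<eta> x - \<eta>' x) (\<xi> x))"
      unfolding integral_top_def wedge_diff_left
      using i1[OF li(3) \<xi>] i1[OF li(4) \<xi>] i2[OF li(1) \<xi>] i2[OF li(2) \<xi>] by simp
  qed
qed

lemma has_weak_d_weak_d: "has_weak_d \<Omega> k \<omega> \<eta> \<Longrightarrow> has_weak_d \<Omega> k \<omega> (weak_d \<Omega> k \<omega>)"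
  unfolding weak_d_def by (rule someI[of "has_weak_d \<Omega> k \<omega>"])

lemma AE_weak_d_eq:
  "has_weak_d (ball c r) k \<omega> \<eta> \<Longrightarrow> AE x in lebesgue_on (ball c r). weak_d (ball c r) k \<omega> x = \<eta> x"
  by (rule has_weak_d_unique[OF has_weak_d_weak_d])

lemma has_weak_d_smooth:
  fixes \<eta> :: "('n::{finite,linorder}) form"
  assumes \<Omega>: "open \<Omega>" and \<eta>: "\<eta> \<in> smooth_forms \<Omega> k"
  shows "has_weak_d \<Omega> k \<eta> (dform (\<lambda>I i. pd i (\<lambda>y. \<eta> y $ I)))"
proof (rule has_weak_d_dform[OF open_lebesgue[OF \<Omega>]])
  have s: "smooth_on \<Omega> \<eta>" and c: "\<And>x. x \<in> \<Omega> \<Longrightarrow> \<eta> x \<in> covectors k" using \<eta> unfolding smooth_forms_def by auto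
  show "weak_pd \<Omega> i (\<lambda>x. \<eta> x $ I) (pd i (\<lambda>y. \<eta> y $ I))" for i I
    by (rule weak_pd_C1[OF \<Omega> smooth_on_C1(2)[OF s \<Omega>]])
  show "\<eta> x \<in> covectors k" if "x \<in> \<Omega>" for x by (rule c[OF that])
  show "pd i (\<lambda>y. \<eta> y $ I) x = 0" if "x \<in> \<Omega>" "card I \<noteq> k" for I i x
    using pd_cong_open[OF \<Omega> that(1), of "\<lambda>y. \<eta> y $ I" "\<lambda>_. 0" i] c that(2) unfolding covectors_def by auto
qed

lemma dform_smooth_eq:
  "open \<Omega> \<Longrightarrow> \<eta> \<in> smooth_forms \<Omega> k \<Longrightarrow> x \<in> \<Omega> \<Longrightarrow> dform (\<lambda>I i. pd i (\<lambda>y. \<eta> y $ I)) x = ext_d \<eta> x"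
  using ext_d_eq_dform smooth_on_C1(1) unfolding smooth_forms_def by fastforce

lemma dform_smooth_measurable:
  fixes \<eta> :: "('n::{finite,linorder}) form"
  assumes \<Omega>: "open \<Omega>" and \<eta>: "\<eta> \<in> smooth_forms \<Omega> k"
  shows "dform (\<lambda>I i. pd i (\<lambda>y. \<eta> y $ I)) \<in> borel_measurable (lebesgue_on \<Omega>)"
proof (rule measurable_vec_components)
  fix K :: "'n set"
  have s: "smooth_on \<Omega> \<eta>" using \<eta> unfolding smooth_forms_def by auto
  have "pd i (\<lambda>y. \<eta> y $ I) \<in> borel_measurable (lebesgue_on \<Omega>)" for i I
    by (rule continuous_imp_measurable_on_sets_lebesgue[OF C1_onD(2)[OF smooth_on_C1(2)[OF s \<Omega>]] open_lebesgue[OF \<Omega>]])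
  then show "(\<lambda>x. dform (\<lambda>I i. pd i (\<lambda>y. \<eta> y $ I)) x $ K) \<in> borel_measurable (lebesgue_on \<Omega>)"
    unfolding dform_def vec_lambda_beta by (intro borel_measurable_sum borel_measurable_times) auto
qed

lemma test_forms_subset_smooth_forms: "test_forms \<Omega> k \<subseteq> smooth_forms \<Omega> k"
  unfolding test_forms_def smooth_forms_def by (auto intro: smooth_on_subset)

text \<open>Pairing with \<open>b\<close> vanishes on smooth differentials but not on
  \<open>du\<close>, and \<open>young\<close> makes it continuous in the Luxemburg norm of the
  differential, so \<open>u\<close> is not a limit of smooth forms. For the gap, a multiple of
  \<open>b\<close> makes the functional negative at \<open>u\<close>, while on test forms only the
  nonnegative modular is left. The integrable majorant \<open>H\<close> of the conjugate function
  spares computing that function.\<close>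

lemma gap_criterion:
  fixes u du b :: "('n::{finite,linorder}) form" and H :: "'n space \<Rightarrow> ennreal" and \<phi> \<psi> :: "real \<Rightarrow> ennreal"
  assumes \<Omega>: "\<Omega> = ball c r" and or: "orlicz_function \<phi>" "orlicz_function \<psi>"
    and a: "a \<in> borel_measurable (lebesgue_on \<Omega>)"
    and \<Phi>: "\<Phi> = (\<lambda>x t. \<phi> t + ennreal (a x) * \<psi> t)"
    and u: "u \<in> L1_forms \<Omega> k" "has_weak_d \<Omega> k u du" "compact K" "K \<subseteq> \<Omega>" "\<And>x. x \<in> \<Omega> \<Longrightarrow> x \<notin> K \<Longrightarrow> u x = 0"
    and du: "du \<in> borel_measurable (lebesgue_on \<Omega>)" "(\<integral>\<^sup>+ x. \<Phi> x (norm (du x)) \<partial>lebesgue_on \<Omega>) < \<infinity>"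
    and b: "b \<in> borel_measurable (lebesgue_on \<Omega>)" "\<And>x. x \<in> \<Omega> \<Longrightarrow> b x \<in> covectors (CARD('n) - k - 1)"
    and H: "H \<in> borel_measurable (lebesgue_on \<Omega>)" "(\<integral>\<^sup>+ x. H x \<partial>lebesgue_on \<Omega>) < \<infinity>"
    and young: "\<And>x t. x \<in> \<Omega> \<Longrightarrow> 0 \<le> t \<Longrightarrow> ennreal (norm (b x) * t) \<le> H x + \<Phi> x t"
    and zero: "\<And>\<eta>. \<eta> \<in> smooth_forms \<Omega> k \<Longrightarrow> integral_top \<Omega> (\<lambda>x. wedge (b x) (ext_d \<eta> x)) = 0"
    and nonzero: "integral_top \<Omega> (\<lambda>x. wedge (b x) (du x)) \<noteq> 0"
  shows "H_d \<Phi> \<Omega> k \<noteq> W_d \<Phi> \<Omega> k \<and>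
    (\<exists>b\<in>Orlicz_forms (conjugate \<Phi>) \<Omega> (CARD('n) - k - 1).
        (INF \<omega>\<in>W_d_c \<Phi> \<Omega> k. functional \<Phi> b \<Omega> k \<omega>) < (INF \<omega>\<in>test_forms \<Omega> k. functional \<Phi> b \<Omega> k \<omega>))"
proof -
  have op: "open \<Omega>" by (simp add: \<Omega>)
  have S: "\<Omega> \<in> sets lebesgue" by (rule open_lebesgue[OF op])
  define C where "C = real CARD('n set)"
  have C: "C \<ge> 0" by (simp add: C_def)
  define h where "h = enn2real (\<integral>\<^sup>+ x. H x \<partial>lebesgue_on \<Omega>)"
  have h: "(\<integral>\<^sup>+ x. H x \<partial>lebesgue_on \<Omega>) = ennreal h" "h \<ge> 0" using H(2) by (simp_all add: h_def)
  define I where "I = enn2real (\<integral>\<^sup>+ x. \<Phi> x (norm (du x)) \<partial>lebesgue_on \<Omega>)"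
  have I: "(\<integral>\<^sup>+ x. \<Phi> x (norm (du x)) \<partial>lebesgue_on \<Omega>) = ennreal I" "I \<ge> 0" using du(2) by (simp_all add: I_def)
  define P where "P = integral_top \<Omega> (\<lambda>x. wedge (b x) (du x))"
  have P: "P \<noteq> 0" using nonzero by (simp add: P_def)
  have \<Phi>m: "(\<lambda>x. \<Phi> x (norm (\<theta> x) / l)) \<in> borel_measurable (lebesgue_on \<Omega>)"
    if "\<theta> \<in> borel_measurable (lebesgue_on \<Omega>)" "l > 0" for \<theta> :: "'n form" and l
  proof -
    have "(\<lambda>x. norm (\<theta> x) / l) \<in> borel_measurable (lebesgue_on \<Omega>)" using that by measurable
    then have "(\<lambda>x. \<phi> (norm (\<theta> x) / l)) \<in> borel_measurable (lebesgue_on \<Omega>)"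
      "(\<lambda>x. \<psi> (norm (\<theta> x) / l)) \<in> borel_measurable (lebesgue_on \<Omega>)"
      using that or by (intro orlicz_measurable; simp)+
    then show ?thesis using a unfolding \<Phi> by measurable
  qed
  \<comment> \<open>A Hoelder inequality in modular form: \<open>young\<close> at
    \<open>norm (\<theta> x) / l\<close>, integrated over \<open>\<Omega>\<close>. The pointwise
    bound on the wedge product costs the factor \<open>C\<close>.\<close>
  have hoelder: "integrable (lebesgue_on \<Omega>) (\<lambda>x. wedge (b x) (\<theta> x) $ UNIV)"
    "\<bar>integral_top \<Omega> (\<lambda>x. wedge (b x) (\<theta> x))\<bar> \<le> C * l * (h + M)"
    if \<theta>: "\<theta> \<in> borel_measurable (lebesgue_on \<Omega>)" and l: "l > 0" and M: "M \<ge> 0"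
      "(\<integral>\<^sup>+ x. \<Phi> x (norm (\<theta> x) / l) \<partial>lebesgue_on \<Omega>) \<le> ennreal M" for \<theta> :: "'n form" and l M
  proof -
    have Cl: "C * l \<ge> 0" using C l by simp
    have "(\<integral>\<^sup>+ x. ennreal (norm (wedge (b x) (\<theta> x) $ UNIV)) \<partial>lebesgue_on \<Omega>) \<le>
        (\<integral>\<^sup>+ x. ennreal (C * l) * (H x + \<Phi> x (norm (\<theta> x) / l)) \<partial>lebesgue_on \<Omega>)"
    proof (rule nn_integral_mono)
      fix x assume "x \<in> space (lebesgue_on \<Omega>)"
      then have x: "x \<in> \<Omega>" by simp
      have "norm (wedge (b x) (\<theta> x) $ UNIV) \<le> C * (norm (b x) * norm (\<theta> x))"
        using wedge_UNIV_le[of "b x" "\<theta> x"] by (simp add: C_def)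
      also have "\<dots> = C * l * (norm (b x) * (norm (\<theta> x) / l))" using l by simp
      finally have "ennreal (norm (wedge (b x) (\<theta> x) $ UNIV)) \<le> ennreal (C * l * (norm (b x) * (norm (\<theta> x) / l)))"
        by (rule ennreal_leI)
      also have "\<dots> = ennreal (C * l) * ennreal (norm (b x) * (norm (\<theta> x) / l))"
        using Cl l by (intro ennreal_mult) auto
      also have "\<dots> \<le> ennreal (C * l) * (H x + \<Phi> x (norm (\<theta> x) / l))"
        using x l by (intro mult_left_mono young) auto
      finally show "ennreal (norm (wedge (b x) (\<theta> x) $ UNIV)) \<le> ennreal (C * l) * (H x + \<Phi> x (norm (\<theta> x) / l))" .
    qed
    also have "\<dots> = ennreal (C * l) * (ennreal h + (\<integral>\<^sup>+ x. \<Phi> x (norm (\<theta> x) / l) \<partial>lebesgue_on \<Omega>))"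
      using \<Phi>m[OF \<theta> l] H(1) by (simp add: nn_integral_cmult nn_integral_add h(1))
    also have "\<dots> \<le> ennreal (C * l) * (ennreal h + ennreal M)"
      by (intro mult_left_mono add_left_mono M) auto
    also have "\<dots> = ennreal (C * l * (h + M))" using Cl h M by (simp add: ennreal_mult ennreal_plus)
    finally have le: "(\<integral>\<^sup>+ x. ennreal (norm (wedge (b x) (\<theta> x) $ UNIV)) \<partial>lebesgue_on \<Omega>) \<le> ennreal (C * l * (h + M))" .
    show i: "integrable (lebesgue_on \<Omega>) (\<lambda>x. wedge (b x) (\<theta> x) $ UNIV)"
      by (rule integrableI_bounded[OF wedge_measurable[OF b(1) \<theta>]]) (rule le_less_trans[OF le], simp)
    have "ennreal (norm (integral_top \<Omega> (\<lambda>x. wedge (b x) (\<theta> x)))) \<le> ennreal (C * l * (h + M))"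
      unfolding integral_top_def by (rule order_trans[OF integral_norm_bound_ennreal[OF i] le])
    then show "\<bar>integral_top \<Omega> (\<lambda>x. wedge (b x) (\<theta> x))\<bar> \<le> C * l * (h + M)"
      using Cl h M by (subst (asm) ennreal_le_iff) auto
  qed
  have scale: "\<Phi> x (t / m) \<le> ennreal (1 / m) * \<Phi> x t" if "m \<ge> 1" "t \<ge> 0" for x t m
  proof -
    have "\<phi> (1 / m * t) \<le> ennreal (1 / m) * \<phi> t" "\<psi> (1 / m * t) \<le> ennreal (1 / m) * \<psi> t"
      by (rule orlicz_scale[OF or(1)] orlicz_scale[OF or(2)]; use that in simp)+
    then have "\<phi> (1 / m * t) + ennreal (a x) * \<psi> (1 / m * t) \<le>
        ennreal (1 / m) * \<phi> t + ennreal (a x) * (ennreal (1 / m) * \<psi> t)"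
      by (intro add_mono mult_left_mono) auto
    then show ?thesis unfolding \<Phi> by (simp add: distrib_left mult_ac)
  qed
  have uW: "u \<in> W_d \<Phi> \<Omega> k"
  proof -
    \<comment> \<open>By convexity, dividing the argument by \<open>m \<ge> 1\<close> divides the
      modular by at least \<open>m\<close>, which brings it down to at most
      \<open>1\<close>.\<close>
    define m where "m = max 1 I"
    have m: "m \<ge> 1" "I \<le> m" by (auto simp: m_def)
    have "(\<integral>\<^sup>+ x. \<Phi> x (norm (du x) / m) \<partial>lebesgue_on \<Omega>) \<le> (\<integral>\<^sup>+ x. ennreal (1 / m) * \<Phi> x (norm (du x)) \<partial>lebesgue_on \<Omega>)"
      by (intro nn_integral_mono scale m) auto
    also have "\<dots> = ennreal (1 / m) * ennreal I"
      using \<Phi>m[OF du(1), of 1] by (simp add: nn_integral_cmult I(1))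
    also have "\<dots> = ennreal (I / m)" using m I by (simp add: ennreal_mult[symmetric])
    also have "\<dots> \<le> 1" using m I by (auto simp: divide_le_eq_1)
    finally have "luxemburg_norm \<Phi> \<Omega> du \<le> ennreal m"
      unfolding luxemburg_norm_def using m by (intro INF_lower) auto
    then have "luxemburg_norm \<Phi> \<Omega> du < \<infinity>" by (rule le_less_trans) simp
    then have "du \<in> Orlicz_forms \<Phi> \<Omega> (k + 1)"
      using du(1) u(2) unfolding Orlicz_forms_def has_weak_d_def by auto
    then show ?thesis unfolding W_d_def using u(1,2) by auto
  qed
  let ?D = "\<lambda>\<eta>::'n form. dform (\<lambda>I i. pd i (\<lambda>y. \<eta> y $ I))"
  have zD: "integral_top \<Omega> (\<lambda>x. wedge (b x) (?D \<eta> x)) = 0" if \<eta>: "\<eta> \<in> smooth_forms \<Omega> k" for \<eta>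
  proof -
    have "integral_top \<Omega> (\<lambda>x. wedge (b x) (?D \<eta> x)) = integral_top \<Omega> (\<lambda>x. wedge (b x) (ext_d \<eta> x))"
      unfolding integral_top_def
      by (rule Bochner_Integration.integral_cong[OF refl]) (use dform_smooth_eq[OF op \<eta>] in simp)
    then show ?thesis using zero[OF \<eta>] by simp
  qed
  note idu = hoelder(1)[OF du(1) zero_less_one I(2)]
  have idu: "integrable (lebesgue_on \<Omega>) (\<lambda>x. wedge (b x) (du x) $ UNIV)" by (rule idu) (simp add: I(1))
  have top_AE: "integral_top \<Omega> (\<lambda>x. wedge (b' x) (\<theta> x)) = integral_top \<Omega> (\<lambda>x. wedge (b' x) (\<theta>' x))"
    if "AE x in lebesgue_on \<Omega>. \<theta> x = \<theta>' x" for \<theta> \<theta>' b' :: "'n form"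
    unfolding integral_top_def using that
    by (intro integral_cong_AE_lebesgue_on[OF S]) (elim eventually_mono, simp)
  have uH: "u \<notin> H_d \<Phi> \<Omega> k"
  proof
    assume uH: "u \<in> H_d \<Phi> \<Omega> k"
    \<comment> \<open>With this choice the Hoelder bound
      \<open>\<bar>P\<bar> \<le> C * l * (h + 1)\<close> contradicts \<open>l < \<epsilon>\<close>;
      the extra \<open>1\<close> keeps the denominator positive.\<close>
    define \<epsilon> where "\<epsilon> = \<bar>P\<bar> / (C * (h + 1) + 1)"
    have pos: "C * (h + 1) + 1 > 0" using C h by (simp add: add_nonneg_pos)
    have \<epsilon>: "\<epsilon> > 0" using P pos by (simp add: \<epsilon>_def)
    obtain \<eta> where \<eta>: "\<eta> \<in> smooth_forms \<Omega> k" "W_d_norm \<Phi> \<Omega> k (\<lambda>x. u x - \<eta> x) < ennreal \<epsilon>"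
      using uH \<epsilon> unfolding H_d_def by blast
    define \<theta> where "\<theta> x = du x - ?D \<eta> x" for x
    have "has_weak_d \<Omega> k (\<lambda>x. u x - \<eta> x) \<theta>"
      unfolding \<theta>_def by (rule has_weak_d_diff[OF S u(2) has_weak_d_smooth[OF op \<eta>(1)]])
    then have ae: "AE x in lebesgue_on \<Omega>. weak_d \<Omega> k (\<lambda>x. u x - \<eta> x) x = \<theta> x"
      unfolding \<Omega> by (rule AE_weak_d_eq)
    have \<theta>m: "\<theta> \<in> borel_measurable (lebesgue_on \<Omega>)"
      unfolding \<theta>_def by (intro borel_measurable_diff du(1) dform_smooth_measurable[OF op \<eta>(1)])
    have "luxemburg_norm \<Phi> \<Omega> (weak_d \<Omega> k (\<lambda>x. u x - \<eta> x)) < ennreal \<epsilon>"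
      using \<eta>(2) unfolding W_d_norm_def by (rule le_less_trans[rotated]) simp
    then obtain l where l: "0 < l" "ennreal l < ennreal \<epsilon>"
      "(\<integral>\<^sup>+ x. \<Phi> x (norm (weak_d \<Omega> k (\<lambda>x. u x - \<eta> x) x) / l) \<partial>lebesgue_on \<Omega>) \<le> 1"
      unfolding luxemburg_norm_def INF_less_iff by auto
    have "(\<integral>\<^sup>+ x. \<Phi> x (norm (\<theta> x) / l) \<partial>lebesgue_on \<Omega>) =
        (\<integral>\<^sup>+ x. \<Phi> x (norm (weak_d \<Omega> k (\<lambda>x. u x - \<eta> x) x) / l) \<partial>lebesgue_on \<Omega>)"
      by (rule nn_integral_cong_AE) (use ae in \<open>eventually_elim, simp\<close>)
    then have l1: "(\<integral>\<^sup>+ x. \<Phi> x (norm (\<theta> x) / l) \<partial>lebesgue_on \<Omega>) \<le> ennreal 1" using l(3) by simp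
    have l\<epsilon>: "l < \<epsilon>" using l \<epsilon> by (simp add: ennreal_less_iff)
    note ho = hoelder[OF \<theta>m l(1) zero_le_one l1]
    have D: "(\<lambda>x. wedge (b x) (?D \<eta> x) $ UNIV) = (\<lambda>x. wedge (b x) (du x) $ UNIV - wedge (b x) (\<theta> x) $ UNIV)"
      by (simp add: \<theta>_def wedge_diff_right)
    have "0 = P - integral_top \<Omega> (\<lambda>x. wedge (b x) (\<theta> x))"
      using zD[OF \<eta>(1)] unfolding integral_top_def D P_def using idu ho(1) by simp
    then have "\<bar>P\<bar> \<le> C * l * (h + 1)" using ho(2) by simp
    also have "\<dots> = l * (C * (h + 1))" by simp
    also have "\<dots> \<le> l * (C * (h + 1) + 1)" using l by simp
    also have "\<dots> < \<epsilon> * (C * (h + 1) + 1)" using l\<epsilon> pos by (intro mult_strict_right_mono) auto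
    also have "\<dots> = \<bar>P\<bar>" using pos by (simp add: \<epsilon>_def)
    finally show False by simp
  qed
  \<comment> \<open>Makes the value of the functional at \<open>u\<close> equal to
    \<open>I + \<mu> * P = -1\<close>.\<close>
  define \<mu> where "\<mu> = - (I + 1) / P"
  have \<mu>: "\<mu> \<noteq> 0" "\<mu> * P = - (I + 1)" using P I by (auto simp: \<mu>_def)
  define b' where "b' x = \<mu> *\<^sub>R b x" for x
  have b'm: "b' \<in> borel_measurable (lebesgue_on \<Omega>)" unfolding b'_def using b(1) by measurable
  have b'cov: "\<forall>x\<in>\<Omega>. b' x \<in> covectors (CARD('n) - k - 1)" using b(2) by (auto simp: b'_def covectors_def)
  have top_b': "integral_top \<Omega> (\<lambda>x. wedge (b' x) (\<theta> x)) = \<mu> * integral_top \<Omega> (\<lambda>x. wedge (b x) (\<theta> x))" for \<theta> :: "'n form"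
    unfolding integral_top_def b'_def wedge_scaleR_left by simp
  have b'O: "b' \<in> Orlicz_forms (conjugate \<Phi>) \<Omega> (CARD('n) - k - 1)"
  proof -
    \<comment> \<open>The same rescaling as for \<open>u\<close>, now for the conjugate modular,
      whose majorant has integral \<open>h\<close>; the factor \<open>\<bar>\<mu>\<bar>\<close> in
      \<open>l\<close> undoes the scaling of \<open>b\<close>.\<close>
    define m where "m = max 1 h"
    have m: "m \<ge> 1" "h \<le> m" by (auto simp: m_def)
    define l where "l = \<bar>\<mu>\<bar> * m"
    have l: "l > 0" using \<mu>(1) m by (simp add: l_def)
    have "(\<integral>\<^sup>+ x. conjugate \<Phi> x (norm (b' x) / l) \<partial>lebesgue_on \<Omega>) \<le> (\<integral>\<^sup>+ x. ennreal (1 / m) * H x \<partial>lebesgue_on \<Omega>)"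
    proof (rule nn_integral_mono)
      fix x assume "x \<in> space (lebesgue_on \<Omega>)"
      then have x: "x \<in> \<Omega>" by simp
      have n: "norm (b' x) / l = norm (b x) / m" using \<mu>(1) by (simp add: b'_def l_def)
      show "conjugate \<Phi> x (norm (b' x) / l) \<le> ennreal (1 / m) * H x"
        unfolding conjugate_def n
      proof (rule SUP_least)
        fix t :: real assume "t \<in> {0..}"
        then have t: "t \<ge> 0" by simp
        have "ennreal (norm (b x) / m * t) = ennreal (1 / m) * ennreal (norm (b x) * t)"
          using m t by (simp add: ennreal_mult[symmetric])
        also have "\<dots> \<le> ennreal (1 / m) * (H x + \<Phi> x t)" by (intro mult_left_mono young x t) auto
        also have "\<dots> = ennreal (1 / m) * \<Phi> x t + ennreal (1 / m) * H x" by (simp add: distrib_left add.commute)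
        also have "\<dots> \<le> 1 * \<Phi> x t + ennreal (1 / m) * H x"
          using m by (intro add_right_mono mult_right_mono) auto
        finally show "ennreal (norm (b x) / m * t) - \<Phi> x t \<le> ennreal (1 / m) * H x"
          by (simp add: ennreal_minus_le_iff)
      qed
    qed
    also have "\<dots> = ennreal (1 / m) * ennreal h" using H(1) by (simp add: nn_integral_cmult h(1))
    also have "\<dots> = ennreal (h / m)" using m h by (simp add: ennreal_mult[symmetric])
    also have "\<dots> \<le> 1" using m h by (auto simp: divide_le_eq_1)
    finally have "luxemburg_norm (conjugate \<Phi>) \<Omega> b' \<le> ennreal l"
      unfolding luxemburg_norm_def using l by (intro INF_lower) auto
    then have "luxemburg_norm (conjugate \<Phi>) \<Omega> b' < \<infinity>" by (rule le_less_trans) simp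
    then show ?thesis using b'm b'cov unfolding Orlicz_forms_def by auto
  qed
  have test: "0 \<le> functional \<Phi> b' \<Omega> k \<omega>" if "\<omega> \<in> test_forms \<Omega> k" for \<omega>
  proof -
    have s: "\<omega> \<in> smooth_forms \<Omega> k" using that test_forms_subset_smooth_forms by blast
    have "AE x in lebesgue_on \<Omega>. weak_d \<Omega> k \<omega> x = ?D \<omega> x"
      using has_weak_d_smooth[OF op s] unfolding \<Omega> by (rule AE_weak_d_eq)
    then have "integral_top \<Omega> (\<lambda>x. wedge (b' x) (weak_d \<Omega> k \<omega> x)) = 0"
      using top_AE[of "weak_d \<Omega> k \<omega>" "?D \<omega>" b'] top_b' zD[OF s] by simp
    then show ?thesis unfolding functional_def by simp
  qed
  have "u \<in> W_d_c \<Phi> \<Omega> k"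
    unfolding W_d_c_def using uW u(3-5) by (auto intro!: exI[of _ K] AE_I2)
  moreover have "functional \<Phi> b' \<Omega> k u < 0"
  proof -
    have ae: "AE x in lebesgue_on \<Omega>. weak_d \<Omega> k u x = du x"
      using u(2) unfolding \<Omega> by (rule AE_weak_d_eq)
    have "(\<integral>\<^sup>+ x. \<Phi> x (norm (weak_d \<Omega> k u x)) \<partial>lebesgue_on \<Omega>) = (\<integral>\<^sup>+ x. \<Phi> x (norm (du x)) \<partial>lebesgue_on \<Omega>)"
      by (rule nn_integral_cong_AE) (use ae in \<open>eventually_elim, simp\<close>)
    then have "functional \<Phi> b' \<Omega> k u = ereal I + ereal (\<mu> * P)"
      unfolding functional_def top_AE[OF ae] top_b' P_def[symmetric] using I by simp
    then show ?thesis using \<mu>(2) by simp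
  qed
  ultimately have "(INF \<omega>\<in>W_d_c \<Phi> \<Omega> k. functional \<Phi> b' \<Omega> k \<omega>) < 0"
    by (meson INF_lower le_less_trans)
  also have "0 \<le> (INF \<omega>\<in>test_forms \<Omega> k. functional \<Phi> b' \<Omega> k \<omega>)" by (intro INF_greatest test)
  finally show ?thesis using uW uH b'O by blast
qed

section \<open>A Cantor set and the two competing functions\<close>

lemma DERIV_max0_squared: "((\<lambda>t. (max 0 t)\<^sup>2) has_real_derivative 2 * max 0 t) (at (t::real))"
proof (cases t "0::real" rule: linorder_cases)
  case less
  have "((\<lambda>t. 0::real) has_real_derivative 0) (at t)" by simp
  then have "((\<lambda>t. (max 0 t)\<^sup>2) has_real_derivative 0) (at t)"
    by (rule has_field_derivative_transform_within_open[of _ _ _ "{..<0}"]) (use less in auto)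
  then show ?thesis using less by simp
next
  case equal
  have "((\<lambda>h::real. max 0 h) \<longlongrightarrow> max 0 0) (at 0)" by (intro tendsto_intros)
  then have "((\<lambda>h. ((max 0 (0 + h))\<^sup>2 - (max 0 (0::real))\<^sup>2) / h) \<longlongrightarrow> max 0 0) (at 0)"
    by (rule Lim_transform_eventually) (auto simp: eventually_at_filter max_def power2_eq_square)
  then show ?thesis unfolding DERIV_def equal by simp
next
  case greater
  have "((\<lambda>t. t\<^sup>2) has_real_derivative 2 * t) (at t)" by (auto intro!: derivative_eq_intros)
  then have "((\<lambda>t. (max 0 t)\<^sup>2) has_real_derivative 2 * t) (at t)"
    by (rule has_field_derivative_transform_within_open[of _ _ _ "{0<..}"]) (use greater in auto)
  then show ?thesis using greater by simp
qed

text \<open>A \<open>C\<^sup>1\<close> function rising from \<open>0\<close> to \<open>1\<close> on the unit interval.\<close>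

definition ramp :: "real \<Rightarrow> real" where
  "ramp t = 2 * (max 0 t)\<^sup>2 - 4 * (max 0 (t - 1/2))\<^sup>2 + 2 * (max 0 (t - 1))\<^sup>2"

definition ramp' :: "real \<Rightarrow> real" where
  "ramp' t = 4 * max 0 t - 8 * max 0 (t - 1/2) + 4 * max 0 (t - 1)"

lemma DERIV_ramp: "(ramp has_real_derivative ramp' t) (at t)"
proof -
  have s: "((\<lambda>t. (max 0 (t - c))\<^sup>2) has_real_derivative 2 * max 0 (t - c)) (at t)" for c t :: real
  proof -
    have "((\<lambda>t. t - c) has_real_derivative 1) (at t)" by (auto intro!: derivative_eq_intros)
    from DERIV_chain2[where f = "\<lambda>u. (max 0 u)\<^sup>2", OF DERIV_max0_squared this] show ?thesis by simp
  qed
  have "((\<lambda>t. 2 * (max 0 (t - 0))\<^sup>2 - 4 * (max 0 (t - 1/2))\<^sup>2 + 2 * (max 0 (t - 1))\<^sup>2) has_real_derivative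
     2 * (2 * max 0 (t - 0)) - 4 * (2 * max 0 (t - 1/2)) + 2 * (2 * max 0 (t - 1))) (at t)"
    by (intro DERIV_add DERIV_diff DERIV_cmult s)
  then show ?thesis unfolding ramp_def ramp'_def by simp
qed

lemma continuous_on_ramp': "continuous_on S ramp'"
  unfolding ramp'_def by (intro continuous_intros)

lemma ramp_eq:
  "t \<le> 0 \<Longrightarrow> ramp t = 0" "t \<ge> 1 \<Longrightarrow> ramp t = 1"
  "0 \<le> t \<Longrightarrow> t \<le> 1/2 \<Longrightarrow> ramp t = 2 * t\<^sup>2" "1/2 \<le> t \<Longrightarrow> t \<le> 1 \<Longrightarrow> ramp t = 1 - 2 * (1 - t)\<^sup>2"
  by (auto simp: ramp_def power2_eq_square algebra_simps)

lemma ramp'_eq_0: "t \<le> 0 \<or> t \<ge> 1 \<Longrightarrow> ramp' t = 0"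
  by (auto simp: ramp'_def)

lemma ramp'_bounds: "0 \<le> ramp' t" "ramp' t \<le> 2" "0 < t \<Longrightarrow> t < 1 \<Longrightarrow> 0 < ramp' t"
  by (auto simp: ramp'_def max_def)

lemma ramp_bounds: "0 \<le> ramp t" "ramp t \<le> 1"
proof -
  consider "t \<le> 0" | "t \<ge> 1" | "0 \<le> t" "t \<le> 1/2" | "1/2 \<le> t" "t \<le> 1" by linarith
  then have "0 \<le> ramp t \<and> ramp t \<le> 1"
  proof cases
    case 3
    have "t\<^sup>2 \<le> (1/2)\<^sup>2" using 3 by (intro power_mono) auto
    then show ?thesis using 3 by (simp add: ramp_eq power2_eq_square)
  next
    case 4
    have "(1 - t)\<^sup>2 \<le> (1/2)\<^sup>2" using 4 by (intro power_mono) auto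
    then show ?thesis using 4 by (simp add: ramp_eq(4)[OF 4] power2_eq_square)
  qed (auto simp: ramp_eq)
  then show "0 \<le> ramp t" "ramp t \<le> 1" by auto
qed

definition plateau :: "real \<Rightarrow> real" where
  "plateau t = ramp (2 * t + 2) * ramp (2 - 2 * t)"

definition plateau' :: "real \<Rightarrow> real" where
  "plateau' t = 2 * (ramp' (2 * t + 2) * ramp (2 - 2 * t)) - 2 * (ramp' (2 - 2 * t) * ramp (2 * t + 2))"

lemma DERIV_plateau: "(plateau has_real_derivative plateau' t) (at t)"
proof -
  have "((\<lambda>t. ramp (2 * t + 2)) has_real_derivative ramp' (2 * t + 2) * 2) (at t)"
    by (rule DERIV_chain2[OF DERIV_ramp]) (auto intro!: derivative_eq_intros)
  moreover have "((\<lambda>t. ramp (2 - 2 * t)) has_real_derivative ramp' (2 - 2 * t) * (- 2)) (at t)"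
    by (rule DERIV_chain2[OF DERIV_ramp]) (auto intro!: derivative_eq_intros)
  ultimately show ?thesis
    unfolding plateau_def plateau'_def using DERIV_mult by (fastforce simp: algebra_simps)
qed

lemma continuous_on_ramp: "continuous_on S ramp"
  by (intro continuous_at_imp_continuous_on ballI DERIV_isCont[OF DERIV_ramp])

lemma continuous_on_plateau': "continuous_on S plateau'"
  unfolding plateau'_def
  by (intro continuous_intros continuous_on_compose2[OF continuous_on_ramp[of UNIV]]
      continuous_on_compose2[OF continuous_on_ramp'[of UNIV]]) auto

lemma plateau_eq:
  "\<bar>t\<bar> \<le> 1/2 \<Longrightarrow> plateau t = 1" "\<bar>t\<bar> \<ge> 1 \<Longrightarrow> plateau t = 0"
  by (auto simp: plateau_def ramp_eq abs_le_iff abs_if split: if_splits)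

lemma plateau'_eq_0: "\<bar>t\<bar> \<le> 1/2 \<or> \<bar>t\<bar> \<ge> 1 \<Longrightarrow> plateau' t = 0"
  by (auto simp: plateau'_def ramp_eq ramp'_eq_0 abs_if split: if_splits)

lemma plateau_bounds: "0 \<le> plateau t" "plateau t \<le> 1"
  unfolding plateau_def using ramp_bounds by (auto intro: mult_le_one)

lemma abs_plateau': "\<bar>plateau' t\<bar> \<le> 4"
proof -
  have "0 \<le> ramp' s * ramp u" "ramp' s * ramp u \<le> 2" for s u
    using mult_mono[OF ramp'_bounds(2)[of s] ramp_bounds(2)[of u]] ramp_bounds ramp'_bounds by auto
  from this[of "2 * t + 2" "2 - 2 * t"] this[of "2 - 2 * t" "2 * t + 2"]
  show ?thesis unfolding plateau'_def by linarith
qed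

lemma plateau'_pos: "t \<ge> 0 \<Longrightarrow> plateau' t \<le> 0" "1/2 < t \<Longrightarrow> t < 1 \<Longrightarrow> plateau' t < 0"
  unfolding plateau'_def using ramp_bounds ramp'_bounds(1) ramp'_bounds(3)[of "2 - 2 * t"]
  by (auto simp: ramp'_eq_0 ramp_eq(2))

text \<open>The value \<open>1\<close> is kept slightly beyond the unit interval, so that it covers
  the neighbourhoods of the next generation, and the support \<open>[-1/4, 5/4]\<close> is short
  enough for translates by even integers to be disjoint.\<close>

definition pulse :: "real \<Rightarrow> real" where
  "pulse t = ramp (8 * t + 2) * ramp (10 - 8 * t)"

definition pulse' :: "real \<Rightarrow> real" where
  "pulse' t = 8 * (ramp' (8 * t + 2) * ramp (10 - 8 * t)) - 8 * (ramp' (10 - 8 * t) * ramp (8 * t + 2))"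

lemma DERIV_pulse: "(pulse has_real_derivative pulse' t) (at t)"
proof -
  have "((\<lambda>t. ramp (8 * t + 2)) has_real_derivative ramp' (8 * t + 2) * 8) (at t)"
    by (rule DERIV_chain2[OF DERIV_ramp]) (auto intro!: derivative_eq_intros)
  moreover have "((\<lambda>t. ramp (10 - 8 * t)) has_real_derivative ramp' (10 - 8 * t) * (- 8)) (at t)"
    by (rule DERIV_chain2[OF DERIV_ramp]) (auto intro!: derivative_eq_intros)
  ultimately show ?thesis
    unfolding pulse_def pulse'_def using DERIV_mult by (fastforce simp: algebra_simps)
qed

lemma continuous_on_pulse': "continuous_on S pulse'"
  unfolding pulse'_def
  by (intro continuous_intros continuous_on_compose2[OF continuous_on_ramp[of UNIV]]
      continuous_on_compose2[OF continuous_on_ramp'[of UNIV]]) auto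

lemma pulse_eq:
  "-1/8 \<le> t \<Longrightarrow> t \<le> 9/8 \<Longrightarrow> pulse t = 1" "t \<le> -1/4 \<or> t \<ge> 5/4 \<Longrightarrow> pulse t = 0"
  by (auto simp: pulse_def ramp_eq)

lemma pulse'_eq_0: "-1/8 \<le> t \<and> t \<le> 9/8 \<or> t \<le> -1/4 \<or> t \<ge> 5/4 \<Longrightarrow> pulse' t = 0"
  by (auto simp: pulse'_def ramp_eq ramp'_eq_0)

lemma pulse_bounds: "0 \<le> pulse t" "pulse t \<le> 1"
  unfolding pulse_def using ramp_bounds by (auto intro: mult_le_one)

lemma abs_pulse': "\<bar>pulse' t\<bar> \<le> 16"
proof -
  have "0 \<le> ramp' s * ramp u" "ramp' s * ramp u \<le> 2" for s u
    using mult_mono[OF ramp'_bounds(2)[of s] ramp_bounds(2)[of u]] ramp_bounds ramp'_bounds by auto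
  from this[of "8 * t + 2" "10 - 8 * t"] this[of "10 - 8 * t" "8 * t + 2"]
  show ?thesis unfolding pulse'_def by linarith
qed

text \<open>\<open>p\<close> consists of the partial sums of \<open>b\<close>; a single coefficient
  in transition turns the sum into an interpolation between \<open>p (n - 1)\<close> and
  \<open>p n\<close>. For \<open>n = 0\<close> there is no predecessor.\<close>

lemma suminf_telescope:
  fixes a b p :: "nat \<Rightarrow> real"
  assumes "\<And>j. j < n \<Longrightarrow> a j = 1" "\<And>j. j > n \<Longrightarrow> a j = 0"
    and b: "b 0 = p 0" "\<And>j. b (Suc j) = p (Suc j) - p j"
  shows "(\<Sum>j. a j * b j) = (if n = 0 then a 0 * p 0 else (1 - a n) * p (n - 1) + a n * p n)"
proof -
  have t: "(\<Sum>j\<le>n. b j) = p n" for n by (induction n) (auto simp: b)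
  have "(\<Sum>j. a j * b j) = (\<Sum>j\<le>n. a j * b j)"
    by (rule suminf_finite) (use assms(2) in \<open>auto simp: not_le\<close>)
  also have "\<dots> = (if n = 0 then a 0 * p 0 else (1 - a n) * p (n - 1) + a n * p n)"
  proof (cases n)
    case (Suc m)
    have "(\<Sum>j\<le>m. a j * b j) = (\<Sum>j\<le>m. b j)" using assms(1) Suc by (intro sum.cong) auto
    then show ?thesis using Suc by (simp add: t b algebra_simps)
  qed (simp add: b)
  finally show ?thesis .
qed

lemma suminf_single:
  fixes f :: "nat \<Rightarrow> real"
  assumes "\<And>j. j \<noteq> n \<Longrightarrow> f j = 0" shows "(\<Sum>j. f j) = f n"
proof -
  have "(\<Sum>j. f j) = (\<Sum>j\<in>{n}. f j)" by (rule suminf_finite) (use assms in auto)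
  then show ?thesis by simp
qed

lemma abs_convex_le:
  fixes a x y :: real
  assumes "0 \<le> a" "a \<le> 1" "\<bar>x\<bar> \<le> B" "\<bar>y\<bar> \<le> B" shows "\<bar>(1 - a) * x + a * y\<bar> \<le> B"
proof -
  have "\<bar>(1 - a) * x + a * y\<bar> \<le> (1 - a) * \<bar>x\<bar> + a * \<bar>y\<bar>"
    using abs_triangle_ineq[of "(1 - a) * x" "a * y"] assms by (simp add: abs_mult)
  also have "\<dots> \<le> (1 - a) * B + a * B" using assms by (intro add_mono mult_left_mono) auto
  finally show ?thesis by (simp add: algebra_simps)
qed

text \<open>Each interval is cut into \<open>M\<close> equal parts, of which \<open>br n\<close> at
  even positions are kept. \<open>M\<close> even preserves the parity of the left ends, and
  \<open>2 * br n \<le> M\<close> leaves a gap after the last child. The branching varies with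
  \<open>n\<close> in order to produce polynomial corrections to a geometric growth.\<close>

locale cantor_scheme =
  fixes M :: nat and l0 :: real and br :: "nat \<Rightarrow> nat"
  assumes M: "even M" "4 \<le> M" and l0: "0 < l0"
    and br: "\<And>n. 1 \<le> br n" "\<And>n. 2 * br n \<le> M"
begin

definition l :: "nat \<Rightarrow> real" where "l n = l0 / real M ^ n"

text \<open>The intervals of generation \<open>n\<close> are \<open>[z l\<^sub>n, (z + 1) l\<^sub>n]\<close> with \<open>z \<in> Z n\<close>; their left ends
  are even multiples of \<open>l\<^sub>n\<close>, so they are separated by gaps of length \<open>l\<^sub>n\<close>.\<close>

primrec Z :: "nat \<Rightarrow> nat set" where
  "Z 0 = {0}"
| "Z (Suc n) = (\<lambda>(z, j). M * z + 2 * j) ` (Z n \<times> {..<br n})"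

definition N :: "nat \<Rightarrow> nat" where "N n = card (Z n)"

text \<open>Chosen so that \<open>thin * M * l n = l (Suc n) / 2\<close>: the gradient of the jump
  at generation \<open>n\<close> stays below height \<open>l (Suc n) / 2\<close>, whereas that of
  the Cantor function at generation \<open>m\<close> starts at height
  \<open>l (Suc m)\<close>.\<close>

definition thin :: real where "thin = 1 / (2 * real M ^ 2)"

lemma l_pos: "0 < l n" using M l0 by (simp add: l_def)

lemma l_Suc: "l n = real M * l (Suc n)" using M by (simp add: l_def)

lemma l_0: "l 0 = l0" by (simp add: l_def)

lemma l_antimono: "m \<le> n \<Longrightarrow> l n \<le> l m"
proof (induction n rule: nat_induct_at_least)
  case (Suc n)
  have "l (Suc n) \<le> l n" using l_Suc[of n] l_pos[of "Suc n"] M by simp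
  then show ?case using Suc by simp
qed simp

lemma l_tendsto_0: "l \<longlonglongrightarrow> 0"
proof -
  have "(\<lambda>n. l0 * (1 / real M) ^ n) \<longlonglongrightarrow> l0 * 0"
    using M by (intro tendsto_mult tendsto_const LIMSEQ_power_zero) auto
  then show ?thesis by (simp add: l_def[abs_def] power_divide)
qed

lemma thin: "0 < thin" "thin * real M * real M = 1 / 2" "thin * real M \<le> 1/8" "thin \<le> 1"
proof -
  have m: "4 \<le> real M" using M by simp
  show "0 < thin" "thin * real M * real M = 1 / 2" using m by (auto simp: thin_def power2_eq_square)
  show *: "thin * real M \<le> 1/8" using m by (simp add: thin_def power2_eq_square field_simps)
  have "thin * 1 \<le> thin * real M" using m \<open>0 < thin\<close> by (intro mult_left_mono) auto
  then show "thin \<le> 1" using * by simp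
qed

lemma finite_Z: "finite (Z n)" by (induction n) auto

lemma even_Z: "z \<in> Z n \<Longrightarrow> even z" using M by (cases n) auto

lemma Z_parent:
  assumes "z' \<in> Z (Suc n)"
  obtains z where "z \<in> Z n" "M * z \<le> z'" "z' + 2 \<le> M * z + M"
proof -
  obtain z j where "z \<in> Z n" "j < br n" "z' = M * z + 2 * j" using assms by auto
  then show ?thesis using that[of z] br(2)[of n] by auto
qed

declare Z.simps(2) [simp del]

lemma inj_Z: "inj_on (\<lambda>(z, j). M * z + 2 * j) (Z n \<times> {..<br n})"
proof (rule inj_onI, clarify)
  fix z j z' j' assume j: "j < br n" "j' < br n" and e: "M * z + 2 * j = M * z' + 2 * j'"
  have lt: "2 * j < M" "2 * j' < M" using j br(2)[of n] by auto
  have "(M * z + 2 * j) div M = z" "(M * z' + 2 * j') div M = z'"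
    "(M * z + 2 * j) mod M = 2 * j" "(M * z' + 2 * j') mod M = 2 * j'" using lt M by auto
  then show "z = z' \<and> j = j'" using e by simp
qed

lemma sum_Z_Suc: "(\<Sum>z\<in>Z (Suc n). f z) = (\<Sum>z\<in>Z n. \<Sum>j<br n. f (M * z + 2 * j))"
  unfolding Z.simps by (subst sum.reindex[OF inj_Z]) (simp add: sum.cartesian_product case_prod_unfold)

lemma N_Suc: "N (Suc n) = br n * N n"
  unfolding N_def Z.simps by (subst card_image[OF inj_Z]) (simp add: card_cartesian_product)

lemma N_0: "N 0 = 1" by (simp add: N_def)

lemma N_pos: "0 < N n" using br(1) by (induction n) (auto simp: N_0 N_Suc Suc_le_eq)

lemma N_mono: "N n \<le> N (Suc n)" using br(1)[of n] by (simp add: N_Suc)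

lemma Z_sep:
  assumes "z \<in> Z n" "w \<in> Z n" "z \<noteq> w"
  shows "real w + 2 \<le> real z \<or> real z + 2 \<le> real w"
proof -
  have "even z" "even w" using assms even_Z by auto
  then have "w + 2 \<le> z \<or> z + 2 \<le> w" using assms(3) by presburger
  then show ?thesis by linarith
qed

text \<open>The supports have length \<open>3/2\<close> and the left ends are at least
  \<open>2\<close> apart, so at most one translate is nonzero at \<open>s\<close>.\<close>

lemma sum_Z_one:
  assumes "z \<in> Z n" "-1/4 \<le> s - real z" "s - real z \<le> 5/4"
    and f: "\<And>t. t \<le> -1/4 \<or> t \<ge> 5/4 \<Longrightarrow> f t = 0"
  shows "(\<Sum>z\<in>Z n. f (s - real z)) = (f (s - real z) :: real)"
proof -
  have "(\<Sum>w\<in>Z n - {z}. f (s - real w)) = 0"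
  proof (rule sum.neutral, rule ballI)
    fix w assume "w \<in> Z n - {z}"
    then show "f (s - real w) = 0" using Z_sep[of z n w] assms by (intro f) auto
  qed
  then show ?thesis using sum.remove[OF finite_Z assms(1), of "\<lambda>z. f (s - real z)"] by simp
qed

lemma sum_Z_zero:
  assumes "\<And>z. z \<in> Z n \<Longrightarrow> s - real z \<le> a \<or> b \<le> s - real z"
    and f: "\<And>t. t \<le> a \<or> t \<ge> b \<Longrightarrow> f t = (0::real)"
  shows "(\<Sum>z\<in>Z n. f (s - real z)) = 0"
  by (rule sum.neutral) (use assms in auto)

lemma sum_Z_le:
  assumes f: "\<And>t. t \<le> -1/4 \<or> t \<ge> 5/4 \<Longrightarrow> f t = 0" and B: "\<And>t. \<bar>f t\<bar> \<le> B"
  shows "\<bar>\<Sum>z\<in>Z n. f (s - real z)\<bar> \<le> (B :: real)"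
proof (cases "\<exists>z\<in>Z n. -1/4 \<le> s - real z \<and> s - real z \<le> 5/4")
  case True
  then obtain z where "z \<in> Z n" "-1/4 \<le> s - real z" "s - real z \<le> 5/4" by auto
  from sum_Z_one[where f = f, OF this f] show ?thesis using B by simp
next
  case False
  then have "(\<Sum>z\<in>Z n. f (s - real z)) = 0"
    by (intro sum_Z_zero[of n s "-1/4" "5/4" f]) (use f in auto)
  then show ?thesis using B[of 0] by simp
qed

text \<open>The neighbourhood \<open>outer 0\<close> is the whole line, so that every point either leaves the
  neighbourhoods at some generation or lies in all of them.\<close>

definition inner :: "nat \<Rightarrow> real \<Rightarrow> bool" where
  "inner n t \<longleftrightarrow> (\<exists>z\<in>Z n. 0 < t / l n - real z \<and> t / l n - real z < 1)"

definition outer :: "nat \<Rightarrow> real \<Rightarrow> bool" where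
  "outer n t \<longleftrightarrow> n = 0 \<or> (\<exists>z\<in>Z n. -1/4 < t / l n - real z \<and> t / l n - real z < 5/4)"

lemma parent_position:
  assumes "z' \<in> Z (Suc n)" "c \<le> t / l (Suc n) - real z'" "t / l (Suc n) - real z' \<le> d"
  obtains z where "z \<in> Z n" "c / M \<le> t / l n - real z" "t / l n - real z \<le> 1 + (d - 2) / M"
proof -
  obtain z where z: "z \<in> Z n" "M * z \<le> z'" "z' + 2 \<le> M * z + M" using Z_parent[OF assms(1)] .
  have M0: "0 < real M" using M by simp
  have "real (M * z) \<le> real z'" "real (z' + 2) \<le> real (M * z + M)" using z by linarith+
  then have r: "real M * real z \<le> real z'" "real z' + 2 \<le> real M * real z + real M" by simp_all
  have e: "t / l (Suc n) = real M * (t / l n)" using l_Suc[of n] M0 l_pos[of "Suc n"] by simp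
  have "c \<le> real M * (t / l n - real z)" using assms(2) r(1) unfolding e right_diff_distrib by linarith
  then have "c / M \<le> t / l n - real z" using M0 by (simp add: divide_le_eq mult.commute)
  moreover have "real M * (t / l n - real z) \<le> real M + (d - 2)"
    using assms(3) r(2) unfolding e right_diff_distrib by linarith
  then have "t / l n - real z \<le> (real M + (d - 2)) / M" using M0 by (simp add: le_divide_eq mult.commute)
  then have "t / l n - real z \<le> 1 + (d - 2) / M" using M0 by (simp add: add_divide_distrib)
  ultimately show ?thesis using that z(1) by blast
qed

text \<open>The margin \<open>1/4\<close> shrinks by \<open>M \<ge> 4\<close>, so the neighbourhoods
  of the next generation lie where \<open>pulse\<close> is constant, not merely where it is nonzero.
  This nesting is what makes the series for \<open>F\<close> telescope.\<close>

lemma outer_parent: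
  assumes "outer (Suc n) t"
  obtains z where "z \<in> Z n" "-1/16 \<le> t / l n - real z" "t / l n - real z \<le> 1"
proof -
  have M0: "4 \<le> real M" using M by simp
  obtain z' where z': "z' \<in> Z (Suc n)" "-1/4 \<le> t / l (Suc n) - real z'" "t / l (Suc n) - real z' \<le> 5/4"
    using assms unfolding outer_def by auto
  obtain z where "z \<in> Z n" "(-1/4) / M \<le> t / l n - real z" "t / l n - real z \<le> 1 + (5/4 - 2) / M"
    using parent_position[OF z'] .
  moreover have "-1/16 \<le> (-1/4) / real M" "(5/4 - 2) / real M \<le> 0" using M0 by (simp_all add: field_simps)
  ultimately have "-1/16 \<le> t / l n - real z" "t / l n - real z \<le> 1" by linarith+
  then show ?thesis using that \<open>z \<in> Z n\<close> by blast
qed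

lemma outer_Suc:
  assumes "outer (Suc n) t" shows "outer n t"
proof -
  obtain z where "z \<in> Z n" "-1/16 \<le> t / l n - real z" "t / l n - real z \<le> 1"
    using outer_parent[OF assms] .
  moreover from this have "-1/4 < t / l n - real z" "t / l n - real z < 5/4" by linarith+
  ultimately show ?thesis unfolding outer_def by blast
qed

lemma outer_antimono: "m \<le> n \<Longrightarrow> outer n t \<Longrightarrow> outer m t"
  by (induction n rule: nat_induct_at_least) (auto dest: outer_Suc)

lemma inner_Suc: "inner (Suc n) t \<Longrightarrow> inner n t"
proof -
  assume "inner (Suc n) t"
  then obtain z' where z': "z' \<in> Z (Suc n)" "0 < t / l (Suc n) - real z'" "t / l (Suc n) - real z' < 1"
    unfolding inner_def by auto
  have M0: "4 \<le> real M" using M by simp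
  obtain z where z: "z \<in> Z n" "(t / l (Suc n) - real z') / M \<le> t / l n - real z"
      "t / l n - real z \<le> 1 + ((t / l (Suc n) - real z') - 2) / M"
    using parent_position[OF z'(1) order_refl order_refl] .
  have "0 < (t / l (Suc n) - real z') / M" "((t / l (Suc n) - real z') - 2) / M < 0"
    using z' M0 by (auto simp: divide_less_0_iff)
  then show ?thesis unfolding inner_def using z by (intro bexI[of _ z]) auto
qed

lemma inner_antimono: "m \<le> n \<Longrightarrow> inner n t \<Longrightarrow> inner m t"
  by (induction n rule: nat_induct_at_least) (auto dest: inner_Suc)

text \<open>Along the line \<open>t = 0\<close>, \<open>th n\<close> is a cutoff to the
  neighbourhoods of generation \<open>n\<close> and \<open>gc n\<close> a smoothed Cantor function
  of that generation; across it, \<open>pr n\<close> is a step of width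
  \<open>2 * thin * l n\<close> and \<open>ta n\<close> a cutoff at a height comparable with
  \<open>l n\<close>. The suffix \<open>d\<close> denotes increments between generations, a prime
  the derivative. The value \<open>1\<close> of \<open>th 0\<close> and \<open>ta 0\<close> leaves
  the first term untruncated.\<close>

definition th :: "nat \<Rightarrow> real \<Rightarrow> real" where "th n t = (if n = 0 then 1 else \<Sum>z\<in>Z n. pulse (t / l n - real z))"
definition th' :: "nat \<Rightarrow> real \<Rightarrow> real" where "th' n t = (if n = 0 then 0 else \<Sum>z\<in>Z n. pulse' (t / l n - real z) / l n)"
definition pr :: "nat \<Rightarrow> real \<Rightarrow> real" where "pr n y = ramp (1/2 + y / (2 * thin * l n))"
definition pr' :: "nat \<Rightarrow> real \<Rightarrow> real" where "pr' n y = ramp' (1/2 + y / (2 * thin * l n)) / (2 * thin * l n)"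
definition prd :: "nat \<Rightarrow> real \<Rightarrow> real" where "prd n y = (if n = 0 then pr 0 y else pr n y - pr (n - 1) y)"
definition prd' :: "nat \<Rightarrow> real \<Rightarrow> real" where "prd' n y = (if n = 0 then pr' 0 y else pr' n y - pr' (n - 1) y)"

definition ta :: "nat \<Rightarrow> real \<Rightarrow> real" where "ta n y = (if n = 0 then 1 else plateau (y / (2 * l n)))"
definition ta' :: "nat \<Rightarrow> real \<Rightarrow> real" where "ta' n y = (if n = 0 then 0 else plateau' (y / (2 * l n)) / (2 * l n))"
definition gc :: "nat \<Rightarrow> real \<Rightarrow> real" where "gc n t = (\<Sum>z\<in>Z n. ramp (t / l n - real z)) / real (N n)"
definition gc' :: "nat \<Rightarrow> real \<Rightarrow> real" where "gc' n t = (\<Sum>z\<in>Z n. ramp' (t / l n - real z) / l n) / real (N n)"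
definition gd :: "nat \<Rightarrow> real \<Rightarrow> real" where "gd n t = (if n = 0 then gc 0 t else gc n t - gc (n - 1) t)"
definition gd' :: "nat \<Rightarrow> real \<Rightarrow> real" where "gd' n t = (if n = 0 then gc' 0 t else gc' n t - gc' (n - 1) t)"

lemma DERIV_affine:
  assumes "\<And>s. (f has_real_derivative f' s) (at s)"
  shows "((\<lambda>t. f (t / c - d)) has_real_derivative f' (t / c - d) / c) (at t)"
    "((\<lambda>t. f (d + t / c)) has_real_derivative f' (d + t / c) / c) (at t)"
    "((\<lambda>t. f (t / c)) has_real_derivative f' (t / c) / c) (at t)"
proof -
  have "((\<lambda>t. t / c) has_real_derivative 1 / c) (at t)" by (rule DERIV_cdivide[OF DERIV_ident])
  then have 1: "((\<lambda>t. t / c - d) has_real_derivative 1 / c) (at t)" "((\<lambda>t. d + t / c) has_real_derivative 1 / c) (at t)"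
    "((\<lambda>t. t / c) has_real_derivative 1 / c) (at t)"
    using DERIV_diff[OF _ DERIV_const[of d]] DERIV_add[OF DERIV_const[of d]] by fastforce+
  show "((\<lambda>t. f (t / c - d)) has_real_derivative f' (t / c - d) / c) (at t)"
    "((\<lambda>t. f (d + t / c)) has_real_derivative f' (d + t / c) / c) (at t)"
    "((\<lambda>t. f (t / c)) has_real_derivative f' (t / c) / c) (at t)"
    using DERIV_chain2[OF assms 1(1)] DERIV_chain2[OF assms 1(2)] DERIV_chain2[OF assms 1(3)] by simp_all
qed

lemma DERIV_th: "(th n has_real_derivative th' n t) (at t)"
  by (cases "n = 0") (auto simp: th_def[abs_def] th'_def intro!: DERIV_sum DERIV_affine(1) DERIV_pulse)

lemma DERIV_pr: "(pr n has_real_derivative pr' n t) (at t)"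
  unfolding pr_def[abs_def] pr'_def by (rule DERIV_affine(2)[OF DERIV_ramp])

lemma DERIV_prd: "(prd n has_real_derivative prd' n t) (at t)"
  by (cases "n = 0") (auto simp: prd_def[abs_def] prd'_def intro!: DERIV_diff DERIV_pr)

lemma DERIV_ta: "(ta n has_real_derivative ta' n t) (at t)"
  by (cases "n = 0") (auto simp: ta_def[abs_def] ta'_def intro!: DERIV_affine(3) DERIV_plateau)

lemma DERIV_gc: "(gc n has_real_derivative gc' n t) (at t)"
  unfolding gc_def[abs_def] gc'_def by (intro DERIV_cdivide DERIV_sum DERIV_affine(1) DERIV_ramp)

lemma DERIV_gd: "(gd n has_real_derivative gd' n t) (at t)"
  by (cases "n = 0") (auto simp: gd_def[abs_def] gd'_def intro!: DERIV_diff DERIV_gc)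

lemma continuous_derivs:
  "continuous_on UNIV (th' n)" "continuous_on UNIV (prd' n)" "continuous_on UNIV (ta' n)" "continuous_on UNIV (gd' n)"
proof -
  note c = continuous_on_compose2[OF continuous_on_pulse'[of UNIV]] continuous_on_compose2[OF continuous_on_ramp'[of UNIV]]
    continuous_on_compose2[OF continuous_on_plateau'[of UNIV]]
  have n: "l n \<noteq> 0" "2 * thin * l n \<noteq> 0" "real (N n) \<noteq> 0" for n using l_pos[of n] thin(1) N_pos[of n] by auto
  have gc: "continuous_on UNIV (gc' n)" for n
    unfolding gc'_def[abs_def] by (intro continuous_intros c) (use n in auto)
  have pr: "continuous_on UNIV (pr' n)" for n
    unfolding pr'_def[abs_def] by (intro continuous_intros c) (use n in auto)
  show "continuous_on UNIV (th' n)"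
    by (cases "n = 0") (auto simp: th'_def[abs_def] n intro!: continuous_intros c)
  show "continuous_on UNIV (ta' n)"
    by (cases "n = 0") (auto simp: ta'_def[abs_def] n intro!: continuous_intros c)
  show "continuous_on UNIV (gd' n)" "continuous_on UNIV (prd' n)"
    by (cases "n = 0"; auto simp: gd'_def[abs_def] prd'_def[abs_def] intro!: continuous_intros gc pr)+
qed

lemma not_outer: "\<not> outer n t \<Longrightarrow> z \<in> Z n \<Longrightarrow> t / l n - real z \<le> -1/4 \<or> t / l n - real z \<ge> 5/4"
  unfolding outer_def by (meson not_less)

lemma th_out:
  assumes "\<not> outer n t" shows "th n t = 0" "th' n t = 0"
proof -
  have n: "n \<noteq> 0" using assms by (simp add: outer_def)
  have "pulse (t / l n - real z) = 0" "pulse' (t / l n - real z) = 0" if "z \<in> Z n" for z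
    using not_outer[OF assms that] pulse_eq(2) pulse'_eq_0 by blast+
  then show "th n t = 0" "th' n t = 0" using n by (simp_all add: th_def th'_def)
qed

lemma th_in:
  assumes "outer (Suc n) t" shows "th n t = 1" "th' n t = 0"
proof -
  obtain z where z: "z \<in> Z n" "-1/16 \<le> t / l n - real z" "t / l n - real z \<le> 1"
    using outer_parent[OF assms] .
  have z': "-1/4 \<le> t / l n - real z" "t / l n - real z \<le> 5/4" "-1/8 \<le> t / l n - real z" "t / l n - real z \<le> 9/8"
    using z by linarith+
  have "(\<Sum>z\<in>Z n. pulse (t / l n - real z)) = pulse (t / l n - real z)"
    by (rule sum_Z_one[OF z(1) z'(1,2) pulse_eq(2)])
  also have "\<dots> = 1" by (rule pulse_eq(1)[OF z'(3,4)])
  finally show "th n t = 1" by (simp add: th_def)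
  have "(\<Sum>z\<in>Z n. pulse' (t / l n - real z) / l n) = pulse' (t / l n - real z) / l n"
    by (rule sum_Z_one[OF z(1) z'(1,2), where f = "\<lambda>s. pulse' s / l n"]) (simp add: pulse'_eq_0)
  also have "\<dots> = 0" using pulse'_eq_0[of "t / l n - real z"] z'(3,4) by simp
  finally show "th' n t = 0" by (simp add: th'_def)
qed

lemma th_bounds: "0 \<le> th n t" "th n t \<le> 1" "\<bar>th' n t\<bar> \<le> 16 / l n"
proof -
  show "0 \<le> th n t" using pulse_bounds by (auto simp: th_def intro: sum_nonneg)
  have "\<bar>\<Sum>z\<in>Z n. pulse (t / l n - real z)\<bar> \<le> 1"
    by (rule sum_Z_le) (use pulse_eq pulse_bounds in \<open>auto simp: abs_le_iff intro: order_trans[of _ 0]\<close>)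
  then show "th n t \<le> 1" by (auto simp: th_def abs_le_iff)
  have "\<bar>\<Sum>z\<in>Z n. pulse' (t / l n - real z) / l n\<bar> \<le> 16 / l n"
    by (rule sum_Z_le[where f = "\<lambda>s. pulse' s / l n"])
      (use pulse'_eq_0 abs_pulse' l_pos[of n] in \<open>auto simp: abs_divide intro!: divide_right_mono\<close>)
  then show "\<bar>th' n t\<bar> \<le> 16 / l n" using l_pos[of n] by (auto simp: th'_def)
qed

lemma pr_bounds: "0 \<le> pr n y" "pr n y \<le> 1" "0 \<le> pr' n y" "\<bar>pr' n y\<bar> \<le> 1 / (thin * l n)"
proof -
  show "0 \<le> pr n y" "pr n y \<le> 1" unfolding pr_def by (rule ramp_bounds)+
  have p: "0 < 2 * thin * l n" using l_pos[of n] thin by simp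
  then show "0 \<le> pr' n y" unfolding pr'_def by (intro divide_nonneg_pos ramp'_bounds)
  moreover have "pr' n y \<le> 2 / (2 * thin * l n)"
    unfolding pr'_def using p by (intro divide_right_mono ramp'_bounds) auto
  ultimately show "\<bar>pr' n y\<bar> \<le> 1 / (thin * l n)" by simp
qed

lemma pr_far:
  assumes "thin * l n \<le> \<bar>y\<bar>"
  shows "pr n y = (if y > 0 then 1 else 0)" "pr' n y = 0"
proof -
  have p: "0 < 2 * thin * l n" using l_pos[of n] thin by simp
  have "y / (2 * thin * l n) \<ge> 1/2 \<or> y / (2 * thin * l n) \<le> -1/2"
    using assms p by (simp add: le_divide_eq divide_le_eq abs_if split: if_splits)
  moreover have "y / (2 * thin * l n) \<ge> 0 \<longleftrightarrow> y \<ge> 0" "y \<noteq> 0" using assms p by (auto simp: zero_le_divide_iff)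
  ultimately show "pr n y = (if y > 0 then 1 else 0)" "pr' n y = 0"
    unfolding pr_def pr'_def by (auto simp: ramp_eq ramp'_eq_0)
qed

lemma prd_far:
  assumes "thin * M * l n \<le> \<bar>y\<bar>" "n > 0" shows "prd n y = 0" "prd' n y = 0"
proof -
  have "thin * l (n - 1) \<le> \<bar>y\<bar>" using assms l_Suc[of "n - 1"] by (simp add: mult.assoc)
  moreover have "thin * l n \<le> thin * l (n - 1)" using thin l_antimono[of "n - 1" n] by simp
  ultimately show "prd n y = 0" "prd' n y = 0"
    using pr_far[of n y] pr_far[of "n - 1" y] assms by (auto simp: prd_def prd'_def)
qed

lemma gc_bounds: "0 \<le> gc n t" "gc n t \<le> 1" "0 \<le> gc' n t" "\<bar>gc' n t\<bar> \<le> 2 / (real (N n) * l n)"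
proof -
  have N: "0 < real (N n)" using N_pos by simp
  show "0 \<le> gc n t" unfolding gc_def by (intro divide_nonneg_nonneg sum_nonneg ramp_bounds) auto
  have "(\<Sum>z\<in>Z n. ramp (t / l n - real z)) \<le> (\<Sum>z\<in>Z n. 1)" by (intro sum_mono ramp_bounds)
  then show "gc n t \<le> 1" unfolding gc_def using N by (simp add: N_def divide_le_eq)
  show 0: "0 \<le> gc' n t" unfolding gc'_def
    using l_pos[of n] by (intro divide_nonneg_nonneg sum_nonneg ramp'_bounds) auto
  have "\<bar>\<Sum>z\<in>Z n. ramp' (t / l n - real z) / l n\<bar> \<le> 2 / l n"
    by (rule sum_Z_le[where f = "\<lambda>s. ramp' s / l n"])
      (use ramp'_eq_0 ramp'_bounds l_pos[of n] in \<open>auto simp: abs_divide intro!: divide_right_mono\<close>)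
  then have "\<bar>gc' n t\<bar> \<le> 2 / l n / real (N n)"
    unfolding gc'_def abs_divide[of _ "real (N n)"] abs_of_pos[OF N] using N by (intro divide_right_mono) auto
  then show "\<bar>gc' n t\<bar> \<le> 2 / (real (N n) * l n)" by (simp add: mult.commute)
qed

lemma gc'_out: "\<not> inner n t \<Longrightarrow> gc' n t = 0"
  unfolding gc'_def inner_def
  by (subst sum.neutral) (auto simp: ramp'_eq_0 not_less)

lemma gd_Suc_eq: "gd (Suc n) t =
    (\<Sum>z\<in>Z n. (\<Sum>j<br n. ramp (M * (t / l n - real z) - 2 * real j)) / br n - ramp (t / l n - real z)) / real (N n)"
proof -
  have e: "t / l (Suc n) = real M * (t / l n)" using l_Suc[of n] M l_pos[of "Suc n"] by simp
  have b: "real (br n) \<noteq> 0" using br(1)[of n] by simp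
  have "gc (Suc n) t = (\<Sum>z\<in>Z n. \<Sum>j<br n. ramp (M * (t / l n - real z) - 2 * real j)) / (br n * real (N n))"
    unfolding gc_def e sum_Z_Suc N_Suc by (simp add: algebra_simps)
  also have "\<dots> = (\<Sum>z\<in>Z n. (\<Sum>j<br n. ramp (M * (t / l n - real z) - 2 * real j)) / br n) / real (N n)"
    by (simp add: sum_divide_distrib)
  finally show ?thesis unfolding gd_def gc_def by (simp add: sum_subtractf diff_divide_distrib)
qed

text \<open>Refinement distributes the mass of an interval equally among its children, so parent and
  children agree to the left and to the right of the parent. Hence \<open>gd (Suc n)\<close> is
  confined to \<open>inner n\<close> and bounded by the mass \<open>1 / N n\<close> of one
  interval.\<close>

lemma gd_Suc_term:
  fixes s :: real and n :: nat
  defines "D \<equiv> (\<Sum>j<br n. ramp (real M * s - 2 * real j)) / br n - ramp s"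
  shows "s \<le> 0 \<or> s \<ge> 1 \<Longrightarrow> D = 0" "\<bar>D\<bar> \<le> 1"
proof -
  have b: "0 < real (br n)" using br(1)[of n] by simp
  have M0: "4 \<le> real M" using M by simp
  show "D = 0" if "s \<le> 0 \<or> s \<ge> 1"
    using that
  proof
    assume s: "s \<le> 0"
    have "real M * s - 2 * real j \<le> 0" for j using mult_nonneg_nonpos[of "real M" s] s by linarith
    then show "D = 0" unfolding D_def using s by (simp add: ramp_eq(1))
  next
    assume s: "s \<ge> 1"
    have "real M * s - 2 * real j \<ge> 1" if "j < br n" for j
    proof -
      have "2 * j + 2 \<le> M" using that br(2)[of n] by linarith
      then have "2 * real j + 2 \<le> real M" by linarith
      moreover have "real M * 1 \<le> real M * s" using s by (intro mult_left_mono) auto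
      ultimately show ?thesis by linarith
    qed
    then show "D = 0" unfolding D_def using s b by (simp add: ramp_eq(2))
  qed
  have "(\<Sum>j<br n. ramp (real M * s - 2 * real j)) \<le> (\<Sum>j<br n. 1)" by (intro sum_mono ramp_bounds)
  then have 1: "(\<Sum>j<br n. ramp (real M * s - 2 * real j)) / br n \<le> 1" using b by (simp add: divide_le_eq)
  have 2: "0 \<le> (\<Sum>j<br n. ramp (real M * s - 2 * real j)) / br n" using b by (intro divide_nonneg_nonneg sum_nonneg ramp_bounds) auto
  show "\<bar>D\<bar> \<le> 1" unfolding D_def using 1 2 ramp_bounds[of s] by linarith
qed

lemma gd_Suc_bound: "\<bar>gd (Suc n) t\<bar> \<le> 1 / real (N n)" "\<not> inner n t \<Longrightarrow> gd (Suc n) t = 0"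
proof -
  let ?D = "\<lambda>s::real. (\<Sum>j<br n. ramp (real M * s - 2 * real j)) / br n - ramp s"
  have "\<bar>\<Sum>z\<in>Z n. ?D (t / l n - real z)\<bar> \<le> 1"
    by (rule sum_Z_le[where f = ?D]) (use gd_Suc_term in auto)
  then show "\<bar>gd (Suc n) t\<bar> \<le> 1 / real (N n)"
    unfolding gd_Suc_eq abs_divide using N_pos[of n] by (simp add: divide_right_mono)
  assume "\<not> inner n t"
  then have "(\<Sum>z\<in>Z n. ?D (t / l n - real z)) = 0"
    by (intro sum_Z_zero[of n _ 0 1 ?D]) (use gd_Suc_term in \<open>auto simp: inner_def not_less\<close>)
  then show "gd (Suc n) t = 0" unfolding gd_Suc_eq by simp
qed

lemma inner_0: "inner n t \<Longrightarrow> 0 < t \<and> t < l0"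
proof -
  assume "inner n t"
  then have "inner 0 t" by (rule inner_antimono[rotated]) simp
  then show ?thesis using l0 by (simp add: inner_def l_0 field_simps)
qed

lemma gc_out: "t \<le> 0 \<Longrightarrow> gc n t = 0" "t \<ge> l0 \<Longrightarrow> gc n t = 1"
proof -
  have "gc n t = gc 0 t" if "t \<le> 0 \<or> t \<ge> l0"
  proof (induction n)
    case (Suc n)
    have "\<not> inner n t" using inner_0 that by fastforce
    then show ?case using gd_Suc_bound(2)[of n t] Suc by (simp add: gd_def)
  qed simp
  moreover have "t \<le> 0 \<Longrightarrow> gc 0 t = 0" "t \<ge> l0 \<Longrightarrow> gc 0 t = 1"
    using l0 by (auto simp: gc_def N_0 l_0 ramp_eq divide_le_0_iff)
  ultimately show "t \<le> 0 \<Longrightarrow> gc n t = 0" "t \<ge> l0 \<Longrightarrow> gc n t = 1" by auto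
qed

lemma gc'_0_pos: "0 < t \<Longrightarrow> t < l0 \<Longrightarrow> 0 < gc' 0 t"
  using l0 by (auto simp: gc'_def N_0 l_0 intro!: divide_pos_pos ramp'_bounds(3))

end

section \<open>The two series: values, gradients and stages\<close>

context cantor_scheme begin

text \<open>Both series telescope. If \<open>s\<close> leaves the neighbourhoods of the Cantor set at generation \<open>n\<close>, then
  \<open>F s\<close> is a step of width comparable with \<open>l n\<close> across \<open>0\<close>; if \<open>\<bar>t\<bar>\<close> is comparable with \<open>l n\<close>, then
  \<open>\<lambda>s. G s t\<close> is the approximation of generation \<open>n\<close> to the Cantor function.\<close>

definition F :: "real \<Rightarrow> real \<Rightarrow> real" where "F s t = (\<Sum>n. th n s * prd n t)"
definition F1 :: "real \<Rightarrow> real \<Rightarrow> real" where "F1 s t = (\<Sum>n. th' n s * prd n t)"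
definition F2 :: "real \<Rightarrow> real \<Rightarrow> real" where "F2 s t = (\<Sum>n. th n s * prd' n t)"
definition G :: "real \<Rightarrow> real \<Rightarrow> real" where "G s t = (\<Sum>n. ta n t * gd n s)"
definition G1 :: "real \<Rightarrow> real \<Rightarrow> real" where "G1 s t = (\<Sum>n. ta n t * gd' n s)"
definition G2 :: "real \<Rightarrow> real \<Rightarrow> real" where "G2 s t = (\<Sum>n. ta' n t * gd n s)"

text \<open>\<open>stageF\<close> and \<open>stageG\<close> are the pieces that carry the gradients
  of \<open>F\<close> and of \<open>G\<close>, see \<open>F_grad\<close> and \<open>G_grad\<close>.
  For \<open>n = 0\<close> the latter has no upper bound on \<open>\<bar>t\<bar>\<close>, since
  \<open>ta 0\<close> does not cut off.\<close>

definition stageF :: "nat \<Rightarrow> real \<Rightarrow> real \<Rightarrow> bool" where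
  "stageF n s t \<longleftrightarrow> outer n s \<and> \<not> outer (Suc n) s \<and> \<bar>t\<bar> \<le> thin * M * l n"

definition stageG :: "nat \<Rightarrow> real \<Rightarrow> real \<Rightarrow> bool" where
  "stageG n s t \<longleftrightarrow> inner n s \<and> l (Suc n) \<le> \<bar>t\<bar> \<and> (n = 0 \<or> \<bar>t\<bar> \<le> l n)"

text \<open>A common superset of both stages of generation \<open>n\<close>, a union of
  \<open>N n\<close> slabs that is easy to measure. For \<open>n = 0\<close> it is
  everything.\<close>

definition cell :: "nat \<Rightarrow> real \<Rightarrow> real \<Rightarrow> bool" where
  "cell n s t \<longleftrightarrow> n = 0 \<or> (\<exists>z\<in>Z n. real z - 1 \<le> s / l n \<and> s / l n \<le> real z + 2) \<and> \<bar>t\<bar> \<le> M * l n"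

lemma ex_l_less: "0 < \<epsilon> \<Longrightarrow> \<exists>n. l n < \<epsilon>"
  using order_tendstoD(2)[OF l_tendsto_0] unfolding eventually_sequentially by blast

lemma stopF: "t \<noteq> 0 \<Longrightarrow> \<exists>N. \<forall>n\<ge>N. prd n t = 0 \<and> prd' n t = 0"
proof -
  assume t: "t \<noteq> 0"
  have tm: "0 < thin * M" using thin(1) M by simp
  obtain N where N: "l N < \<bar>t\<bar> / (thin * M)" using ex_l_less[of "\<bar>t\<bar> / (thin * M)"] t tm by auto
  have "prd n t = 0 \<and> prd' n t = 0" if "n \<ge> Suc N" for n
  proof -
    have "l n \<le> l N" using that by (intro l_antimono) simp
    then have "thin * M * l n \<le> thin * M * l N" using tm by (intro mult_left_mono) auto
    also have "\<dots> \<le> \<bar>t\<bar>" using N tm by (simp add: less_divide_eq mult.commute mult.assoc)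
    finally have "thin * M * l n \<le> \<bar>t\<bar>" .
    then show ?thesis using prd_far[of n t] that by simp
  qed
  then show ?thesis by blast
qed

lemma ta_eq:
  "\<bar>t\<bar> \<le> l n \<Longrightarrow> ta n t = 1" "\<bar>t\<bar> \<le> l n \<Longrightarrow> ta' n t = 0"
  "2 * l n \<le> \<bar>t\<bar> \<Longrightarrow> 0 < n \<Longrightarrow> ta n t = 0" "2 * l n \<le> \<bar>t\<bar> \<Longrightarrow> ta' n t = 0"
proof -
  have a: "\<bar>t / (2 * l n)\<bar> = \<bar>t\<bar> / (2 * l n)" using l_pos[of n] by (simp add: abs_divide)
  have 1: "\<bar>t\<bar> \<le> l n \<Longrightarrow> \<bar>t / (2 * l n)\<bar> \<le> 1/2" "2 * l n \<le> \<bar>t\<bar> \<Longrightarrow> \<bar>t / (2 * l n)\<bar> \<ge> 1"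
    unfolding a using l_pos[of n] by (auto simp: divide_le_eq le_divide_eq)
  show "\<bar>t\<bar> \<le> l n \<Longrightarrow> ta n t = 1" "2 * l n \<le> \<bar>t\<bar> \<Longrightarrow> 0 < n \<Longrightarrow> ta n t = 0"
    using 1 plateau_eq by (auto simp: ta_def)
  show "\<bar>t\<bar> \<le> l n \<Longrightarrow> ta' n t = 0" "2 * l n \<le> \<bar>t\<bar> \<Longrightarrow> ta' n t = 0"
    using 1 plateau'_eq_0 by (auto simp: ta'_def)
qed

lemma stopG: "t \<noteq> 0 \<Longrightarrow> \<exists>N. \<forall>n\<ge>N. ta n t = 0 \<and> ta' n t = 0"
proof -
  assume t: "t \<noteq> 0"
  obtain N where N: "l N < \<bar>t\<bar> / 2" using ex_l_less[of "\<bar>t\<bar> / 2"] t by auto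
  have "ta n t = 0 \<and> ta' n t = 0" if "n \<ge> Suc N" for n
  proof -
    have "l n \<le> l N" using that by (intro l_antimono) simp
    then show ?thesis using ta_eq(3,4)[of n t] N that by auto
  qed
  then show ?thesis by blast
qed

lemma F_at:
  assumes "outer n s" "\<not> outer (Suc n) s"
  shows "F s t = (if n = 0 then pr 0 t else (1 - th n s) * pr (n - 1) t + th n s * pr n t)"
    "F2 s t = (if n = 0 then pr' 0 t else (1 - th n s) * pr' (n - 1) t + th n s * pr' n t)"
    "F1 s t = th' n s * prd n t"
proof -
  have in1: "outer (Suc j) s" if "j < n" for j using outer_antimono[of "Suc j" n s] that assms by simp
  have out1: "\<not> outer j s" if "j > n" for j using outer_antimono[of "Suc n" j s] that assms by auto
  have "F s t = (if n = 0 then th 0 s * pr 0 t else (1 - th n s) * pr (n - 1) t + th n s * pr n t)"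
    unfolding F_def by (rule suminf_telescope) (use th_in(1)[OF in1] th_out(1)[OF out1] in \<open>auto simp: prd_def\<close>)
  then show "F s t = (if n = 0 then pr 0 t else (1 - th n s) * pr (n - 1) t + th n s * pr n t)" by (simp add: th_def)
  have "F2 s t = (if n = 0 then th 0 s * pr' 0 t else (1 - th n s) * pr' (n - 1) t + th n s * pr' n t)"
    unfolding F2_def by (rule suminf_telescope) (use th_in(1)[OF in1] th_out(1)[OF out1] in \<open>auto simp: prd'_def\<close>)
  then show "F2 s t = (if n = 0 then pr' 0 t else (1 - th n s) * pr' (n - 1) t + th n s * pr' n t)" by (simp add: th_def)
  show "F1 s t = th' n s * prd n t"
    unfolding F1_def by (rule suminf_single) (use th_in(2)[OF in1] th_out(2)[OF out1] in \<open>auto simp: neq_iff\<close>)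
qed

text \<open>Above the Cantor set every cutoff is \<open>1\<close>, and the series sums to the limit
  of the steps \<open>pr n\<close>, the sharp jump.\<close>

lemma F_all:
  assumes "\<And>n. outer n s" "t \<noteq> 0"
  shows "F s t = (if t > 0 then 1 else 0)" "F1 s t = 0" "F2 s t = 0"
proof -
  obtain n where n: "l n < \<bar>t\<bar> / thin" using ex_l_less[of "\<bar>t\<bar> / thin"] assms thin(1) by auto
  then have far: "thin * l n \<le> \<bar>t\<bar>" using thin(1) by (simp add: less_divide_eq mult.commute less_imp_le)
  have 0: "prd j t = 0" "prd' j t = 0" if "j > n" for j
  proof -
    have "l j \<le> l (Suc n)" using that by (intro l_antimono) simp
    then have "thin * M * l j \<le> thin * M * l (Suc n)" using thin(1) by (intro mult_left_mono) auto
    also have "\<dots> = thin * l n" by (simp add: l_Suc[of n])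
    finally show "prd j t = 0" "prd' j t = 0" using prd_far[of j t] far that by auto
  qed
  \<comment> \<open>Beyond \<open>n\<close> the increments vanish at \<open>t\<close>, so cutting
    off the coefficients there changes nothing and brings the sum into telescoping form.\<close>
  let ?a = "\<lambda>j. if j \<le> n then 1 else 0 :: real"
  have e: "(\<lambda>j. th j s * prd j t) = (\<lambda>j. ?a j * prd j t)" "(\<lambda>j. th j s * prd' j t) = (\<lambda>j. ?a j * prd' j t)"
    using th_in(1)[OF assms(1)] 0 by (auto simp: fun_eq_iff)
  have "F s t = (if n = 0 then ?a 0 * pr 0 t else (1 - ?a n) * pr (n - 1) t + ?a n * pr n t)"
    unfolding F_def e by (rule suminf_telescope) (auto simp: prd_def)
  then show "F s t = (if t > 0 then 1 else 0)" using pr_far(1)[OF far] by (auto split: if_splits)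
  have "F2 s t = (if n = 0 then ?a 0 * pr' 0 t else (1 - ?a n) * pr' (n - 1) t + ?a n * pr' n t)"
    unfolding F2_def e by (rule suminf_telescope) (auto simp: prd'_def)
  then show "F2 s t = 0" using pr_far(2)[OF far] by (auto split: if_splits)
  show "F1 s t = 0" unfolding F1_def by (simp add: th_in(2)[OF assms(1)])
qed

lemma outer_cases: "(\<exists>n. outer n s \<and> \<not> outer (Suc n) s) \<or> (\<forall>n. outer n s)"
proof (rule disjCI)
  assume "\<not> (\<forall>n. outer n s)"
  then obtain m where m: "\<not> outer m s" "\<And>j. j < m \<Longrightarrow> outer j s" using exists_least_iff[of "\<lambda>n. \<not> outer n s"] by blast
  then have "m \<noteq> 0" by (auto simp: outer_def)
  then show "\<exists>n. outer n s \<and> \<not> outer (Suc n) s" using m by (intro exI[of _ "m - 1"]) auto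
qed

lemma F_bounds: assumes "t \<noteq> 0" shows "\<bar>F s t\<bar> \<le> 1"
  using outer_cases[of s]
proof
  assume "\<exists>n. outer n s \<and> \<not> outer (Suc n) s"
  then obtain n where n: "outer n s" "\<not> outer (Suc n) s" by blast
  have "\<bar>pr j t\<bar> \<le> 1" for j using pr_bounds(1,2)[of j t] by simp
  then show ?thesis unfolding F_at(1)[OF n] using th_bounds by (auto intro!: abs_convex_le)
qed (use F_all assms in auto)

text \<open>\<open>F\<close> interpolates between the steps of generations \<open>n - 1\<close> and
  \<open>n\<close>, whose widths are comparable with \<open>l n\<close>, and the cutoff
  \<open>th n\<close> varies on the same scale.\<close>

lemma F_grad:
  assumes "t \<noteq> 0" "F1 s t \<noteq> 0 \<or> F2 s t \<noteq> 0"
  shows "\<exists>n. stageF n s t \<and> \<bar>F1 s t\<bar> \<le> (16 + 1 / thin) / l n \<and> \<bar>F2 s t\<bar> \<le> (16 + 1 / thin) / l n"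
proof -
  obtain n where n: "outer n s" "\<not> outer (Suc n) s" using outer_cases[of s] F_all assms by blast
  have l: "0 < l n" by (rule l_pos)
  have b: "16 / l n \<le> (16 + 1 / thin) / l n" "1 / (thin * l n) \<le> (16 + 1 / thin) / l n"
    using l thin(1) by (auto intro!: divide_right_mono simp: divide_simps)
  have pb: "\<bar>prd n t\<bar> \<le> 1" using pr_bounds(1,2)[of n t] pr_bounds(1,2)[of "n - 1" t] pr_bounds(1,2)[of 0 t] by (auto simp: prd_def)
  have 1: "\<bar>F1 s t\<bar> \<le> 16 / l n * 1"
    unfolding F_at(3)[OF n] abs_mult using pb th_bounds(3)[of n s] l by (intro mult_mono) auto
  have "\<bar>pr' (n - 1) t\<bar> \<le> 1 / (thin * l n)"
  proof -
    have "1 / (thin * l (n - 1)) \<le> 1 / (thin * l n)"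
      using thin(1) l l_antimono[of "n - 1" n] l_pos[of "n - 1"] by (intro divide_left_mono mult_left_mono mult_pos_pos) auto
    then show ?thesis using pr_bounds(4)[of "n - 1" t] by linarith
  qed
  then have 2: "\<bar>F2 s t\<bar> \<le> 1 / (thin * l n)"
    unfolding F_at(2)[OF n] using th_bounds pr_bounds(4) by (auto intro!: abs_convex_le)
  \<comment> \<open>Above this height both steps that enter the interpolation are already
    constant.\<close>
  have "\<bar>t\<bar> \<le> thin * M * l n"
  proof (rule ccontr)
    assume "\<not> \<bar>t\<bar> \<le> thin * M * l n"
    then have far: "thin * M * l n \<le> \<bar>t\<bar>" by simp
    have tl: "thin * l n \<le> thin * M * l n" using thin(1) M l by (simp add: mult_le_cancel_right1)
    have "F1 s t = 0"
      unfolding F_at(3)[OF n] using prd_far(1)[OF far] by (cases "n = 0") (auto simp: th'_def)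
    moreover have "F2 s t = 0"
    proof (cases "n = 0")
      case True
      then show ?thesis using F_at(2)[OF n] pr_far(2)[of 0 t] far tl by simp
    next
      case False
      then have "thin * l (n - 1) \<le> \<bar>t\<bar>" using far l_Suc[of "n - 1"] by (simp add: mult.assoc)
      then show ?thesis using F_at(2)[OF n] pr_far(2)[of n t] pr_far(2)[of "n - 1" t] far tl False by simp
    qed
    ultimately show False using assms(2) by simp
  qed
  then show ?thesis unfolding stageF_def using n 1 2 b by (intro exI[of _ n]) auto
qed

lemma not_outer_1: "\<bar>s\<bar> > l0 \<Longrightarrow> \<not> outer (Suc 0) s"
proof
  assume s: "\<bar>s\<bar> > l0" and "outer (Suc 0) s"
  then obtain z where "z \<in> Z 0" "-1/16 \<le> s / l 0 - real z" "s / l 0 - real z \<le> 1" using outer_parent by blast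
  then have "-1/16 \<le> s / l0" "s / l0 \<le> 1" by (auto simp: l_0)
  then have "- l0 \<le> s" "s \<le> l0" using l0 by (auto simp: divide_le_eq le_divide_eq)
  then show False using s by simp
qed

text \<open>Away from the Cantor set only the step \<open>pr 0\<close> is left. This lemma and its
  companions \<open>F_far2\<close>, \<open>G_far1\<close>, \<open>G_far2\<close> evaluate the
  pairing where the cutoff has nonzero gradient.\<close>

lemma F_far1:
  assumes "\<bar>s\<bar> > l0" shows "F1 s t = 0" "F2 s t = pr' 0 t"
  using F_at[of 0 s t] not_outer_1[OF assms] by (auto simp: outer_def th'_def)

lemma F_far2:
  assumes "\<bar>t\<bar> \<ge> l0" shows "F s t = (if t > 0 then 1 else 0)"
proof -
  have "t \<noteq> 0" using assms l0 by auto
  have "thin * l n \<le> \<bar>t\<bar>" for n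
  proof -
    have "thin * l n \<le> 1 * l 0" using thin l_antimono[of 0 n] l_pos[of n] by (intro mult_mono) auto
    then show ?thesis using assms by (simp add: l_0)
  qed
  then have p: "pr n t = (if t > 0 then 1 else 0)" for n by (rule pr_far)
  show ?thesis using outer_cases[of s]
  proof
    assume "\<exists>n. outer n s \<and> \<not> outer (Suc n) s"
    then obtain n where n: "outer n s" "\<not> outer (Suc n) s" by blast
    show ?thesis unfolding F_at(1)[OF n] by (simp add: p)
  qed (use F_all \<open>t \<noteq> 0\<close> in auto)
qed

lemma pr'_0_pos: "\<bar>t\<bar> < thin * l0 \<Longrightarrow> 0 < pr' 0 t"
proof -
  assume "\<bar>t\<bar> < thin * l0"
  then have "\<bar>t / (2 * thin * l0)\<bar> < 1/2" using thin(1) l0 by (simp add: abs_divide divide_less_eq)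
  then have "0 < 1/2 + t / (2 * thin * l0)" "1/2 + t / (2 * thin * l0) < 1" by linarith+
  then show ?thesis unfolding pr'_def l_0 using thin(1) l0 by (intro divide_pos_pos ramp'_bounds(3)) auto
qed

text \<open>Between the heights \<open>l (Suc m)\<close> and \<open>l m\<close> the cutoffs up to
  index \<open>m\<close> are \<open>1\<close>, those beyond \<open>Suc m\<close> are
  \<open>0\<close> because \<open>2 * l (Suc (Suc m)) \<le> l (Suc m)\<close>, and only
  \<open>ta (Suc m)\<close> is in transition.\<close>

lemma G_at:
  assumes "l (Suc m) \<le> \<bar>t\<bar>" "m = 0 \<or> \<bar>t\<bar> \<le> l m"
  shows "G s t = (1 - ta (Suc m) t) * gc m s + ta (Suc m) t * gc (Suc m) s"
    "G1 s t = (1 - ta (Suc m) t) * gc' m s + ta (Suc m) t * gc' (Suc m) s"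
    "G2 s t = ta' (Suc m) t * gd (Suc m) s"
proof -
  have in1: "ta j t = 1 \<and> ta' j t = 0" if "j < Suc m" for j
  proof (cases "j = 0")
    case False
    then have "\<bar>t\<bar> \<le> l j" using assms(2) l_antimono[of j m] that by auto
    then show ?thesis using ta_eq by blast
  qed (simp add: ta_def ta'_def)
  have out1: "ta j t = 0 \<and> ta' j t = 0" if "j > Suc m" for j
  proof -
    have "l j \<le> l (Suc (Suc m))" using that by (intro l_antimono) simp
    moreover have "2 * l (Suc (Suc m)) \<le> real M * l (Suc (Suc m))" using M l_pos[of "Suc (Suc m)"] by (intro mult_right_mono) auto
    ultimately have "2 * l j \<le> \<bar>t\<bar>" using assms(1) l_Suc[of "Suc m"] by linarith
    then show ?thesis using ta_eq that by auto
  qed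
  have "G s t = (if Suc m = 0 then ta 0 t * gc 0 s else (1 - ta (Suc m) t) * gc (Suc m - 1) s + ta (Suc m) t * gc (Suc m) s)"
    unfolding G_def by (rule suminf_telescope) (use in1 out1 in \<open>auto simp: gd_def\<close>)
  then show "G s t = (1 - ta (Suc m) t) * gc m s + ta (Suc m) t * gc (Suc m) s" by simp
  have "G1 s t = (if Suc m = 0 then ta 0 t * gc' 0 s else (1 - ta (Suc m) t) * gc' (Suc m - 1) s + ta (Suc m) t * gc' (Suc m) s)"
    unfolding G1_def by (rule suminf_telescope) (use in1 out1 in \<open>auto simp: gd'_def\<close>)
  then show "G1 s t = (1 - ta (Suc m) t) * gc' m s + ta (Suc m) t * gc' (Suc m) s" by simp
  show "G2 s t = ta' (Suc m) t * gd (Suc m) s"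
    unfolding G2_def by (rule suminf_single) (use in1 out1 in \<open>auto simp: neq_iff\<close>)
qed

lemma ex_level:
  assumes "t \<noteq> 0" obtains m where "l (Suc m) \<le> \<bar>t\<bar>" "m = 0 \<or> \<bar>t\<bar> \<le> l m"
proof -
  have "\<exists>m. l (Suc m) \<le> \<bar>t\<bar>"
    using ex_l_less[of "\<bar>t\<bar>"] assms l_antimono[of _ "Suc _"] by (metis zero_less_abs_iff less_imp_le order.trans le_SucI order_refl)
  then obtain m where m: "l (Suc m) \<le> \<bar>t\<bar>" "\<And>j. j < m \<Longrightarrow> \<not> l (Suc j) \<le> \<bar>t\<bar>"
    using exists_least_iff[of "\<lambda>m. l (Suc m) \<le> \<bar>t\<bar>"] by blast
  have "m = 0 \<or> \<bar>t\<bar> \<le> l m" using m(2)[of "m - 1"] by (cases m) auto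
  then show ?thesis using that m(1) by blast
qed

lemma ta_bounds: "0 \<le> ta n t" "ta n t \<le> 1" "\<bar>ta' n t\<bar> \<le> 2 / l n"
proof -
  show "0 \<le> ta n t" "ta n t \<le> 1" using plateau_bounds by (auto simp: ta_def)
  have "\<bar>plateau' (t / (2 * l n))\<bar> / (2 * l n) \<le> 4 / (2 * l n)"
    using l_pos[of n] abs_plateau' by (intro divide_right_mono) auto
  then have "\<bar>plateau' (t / (2 * l n)) / (2 * l n)\<bar> \<le> 4 / (2 * l n)"
    using l_pos[of n] by (simp add: abs_divide)
  then show "\<bar>ta' n t\<bar> \<le> 2 / l n" using l_pos[of n] by (auto simp: ta'_def)
qed

lemma G_bounds: assumes "t \<noteq> 0" shows "\<bar>G s t\<bar> \<le> 1"
proof -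
  obtain m where m: "l (Suc m) \<le> \<bar>t\<bar>" "m = 0 \<or> \<bar>t\<bar> \<le> l m" using ex_level[OF assms] .
  have "\<bar>gc j s\<bar> \<le> 1" for j using gc_bounds(1,2)[of j s] by simp
  then show ?thesis unfolding G_at(1)[OF m] using ta_bounds by (intro abs_convex_le)
qed

lemma inv_Nl_Suc: "1 / (real (N (Suc m)) * l (Suc m)) \<le> M / (real (N m) * l m)"
proof -
  have "1 / (real (N (Suc m)) * l (Suc m)) \<le> 1 / (real (N m) * l (Suc m))"
    using N_mono[of m] N_pos[of m] N_pos[of "Suc m"] l_pos[of "Suc m"]
    by (intro divide_left_mono mult_right_mono mult_pos_pos) auto
  also have "\<dots> = M / (real (N m) * l m)" using M l_pos[of "Suc m"] by (simp add: l_Suc[of m])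
  finally show ?thesis .
qed

lemma inv_Nl_le: "1 / (real (N m) * l m) \<le> M / (real (N m) * l m)"
  using M N_pos[of m] l_pos[of m] by (intro divide_right_mono) auto

lemma gc'_bounds2: "\<bar>gc' m s\<bar> \<le> 2 * M / (real (N m) * l m)" "\<bar>gc' (Suc m) s\<bar> \<le> 2 * M / (real (N m) * l m)"
  using gc_bounds(4)[of m s] gc_bounds(4)[of "Suc m" s] inv_Nl_Suc[of m] inv_Nl_le[of m] by simp_all

lemma ta'_gd_bound: "\<bar>ta' (Suc m) t * gd (Suc m) s\<bar> \<le> 2 * M / (real (N m) * l m)"
proof -
  have "\<bar>ta' (Suc m) t * gd (Suc m) s\<bar> \<le> 2 / l (Suc m) * (1 / real (N m))"
    unfolding abs_mult using ta_bounds(3) gd_Suc_bound(1) l_pos[of "Suc m"] by (intro mult_mono) auto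
  also have "\<dots> = 2 * M / (real (N m) * l m)" using M l_pos[of "Suc m"] by (simp add: l_Suc[of m])
  finally show ?thesis .
qed

text \<open>Along the line the slope is that of a mass \<open>1 / N n\<close> spread over the length
  \<open>l n\<close>; across it, an increment of size \<open>1 / N n\<close> is cut off over a
  height comparable with \<open>l n\<close>.\<close>

lemma G_grad:
  assumes "t \<noteq> 0" "G1 s t \<noteq> 0 \<or> G2 s t \<noteq> 0"
  shows "\<exists>n. stageG n s t \<and> \<bar>G1 s t\<bar> \<le> 2 * M / (real (N n) * l n) \<and> \<bar>G2 s t\<bar> \<le> 2 * M / (real (N n) * l n)"
proof -
  obtain m where m: "l (Suc m) \<le> \<bar>t\<bar>" "m = 0 \<or> \<bar>t\<bar> \<le> l m" using ex_level[OF assms(1)] .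
  have 1: "\<bar>G1 s t\<bar> \<le> 2 * M / (real (N m) * l m)"
    unfolding G_at(2)[OF m] using gc'_bounds2 ta_bounds by (intro abs_convex_le)
  have 2: "\<bar>G2 s t\<bar> \<le> 2 * M / (real (N m) * l m)"
    unfolding G_at(3)[OF m] by (rule ta'_gd_bound)
  have "inner m s"
  proof (rule ccontr)
    assume n: "\<not> inner m s"
    then have "\<not> inner (Suc m) s" using inner_Suc by blast
    then have "G1 s t = 0" "G2 s t = 0"
      using n by (auto simp: G_at(2,3)[OF m] gc'_out gd_Suc_bound)
    then show False using assms(2) by simp
  qed
  then show ?thesis unfolding stageG_def using m 1 2 by blast
qed

lemma G_far1:
  assumes "t \<noteq> 0" shows "s \<le> 0 \<Longrightarrow> G s t = 0" "s \<ge> l0 \<Longrightarrow> G s t = 1"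
proof -
  obtain m where m: "l (Suc m) \<le> \<bar>t\<bar>" "m = 0 \<or> \<bar>t\<bar> \<le> l m" using ex_level[OF assms(1)] .
  show "s \<le> 0 \<Longrightarrow> G s t = 0" "s \<ge> l0 \<Longrightarrow> G s t = 1" unfolding G_at(1)[OF m] by (auto simp: gc_out)
qed

lemma G_far2:
  assumes "\<bar>t\<bar> \<ge> l0" shows "G1 s t = gc' 0 s" "G2 s t = 0"
proof -
  have l1: "real M * l (Suc 0) = l0" using l_Suc[of 0] by (simp add: l_0)
  have "2 * l (Suc 0) \<le> real M * l (Suc 0)" "1 * l (Suc 0) \<le> real M * l (Suc 0)"
    using M l_pos[of "Suc 0"] by (intro mult_right_mono; simp)+
  then have "2 * l (Suc 0) \<le> \<bar>t\<bar>" and m: "l (Suc 0) \<le> \<bar>t\<bar>" using l1 assms by linarith+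
  then have "ta (Suc 0) t = 0" "ta' (Suc 0) t = 0" using ta_eq by auto
  then show "G1 s t = gc' 0 s" "G2 s t = 0" using G_at[of 0 t s] m by auto
qed

text \<open>The coarser generation decides. For \<open>m \<le> n\<close> the heights differ, by the
  choice of \<open>thin\<close>. For \<open>n < m\<close> the point \<open>s'\<close> lies in an
  interval of generation \<open>Suc n\<close>, and \<open>s\<close> outside the neighbourhood of
  that interval, whose margin is a quarter of its length. Either way the distance is at least a
  quarter of the next finer length, whence the factor \<open>4 * M\<close>.\<close>

lemma stage_dist:
  assumes A: "stageF n s t" and B: "stageG m s' t'"
  shows "l n / (4 * M) \<le> \<bar>s - s'\<bar> \<or> l n / (4 * M) \<le> \<bar>t - t'\<bar>"
    "l m / (4 * M) \<le> \<bar>s - s'\<bar> \<or> l m / (4 * M) \<le> \<bar>t - t'\<bar>"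
proof -
  have M0: "4 \<le> real M" using M by simp
  have "max (l n) (l m) / (4 * M) \<le> \<bar>s - s'\<bar> \<or> max (l n) (l m) / (4 * M) \<le> \<bar>t - t'\<bar>"
  proof (cases "m \<le> n")
    case True
    have lm: "l m = real M * l (Suc m)" by (rule l_Suc)
    have "\<bar>t\<bar> \<le> thin * M * l n" using A by (simp add: stageF_def)
    also have "\<dots> \<le> thin * M * l m" using thin(1) l_antimono[OF True] by (intro mult_left_mono) auto
    also have "\<dots> = (thin * M * M) * l (Suc m)" by (simp add: lm)
    also have "\<dots> = l (Suc m) / 2" by (simp add: thin(2))
    finally have "\<bar>t - t'\<bar> \<ge> l (Suc m) / 2" using B unfolding stageG_def by linarith
    moreover have "l m / (4 * M) = l (Suc m) / 4" using M0 by (simp add: lm)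
    moreover have "max (l n) (l m) = l m" using l_antimono[OF True] by simp
    ultimately show ?thesis using l_pos[of "Suc m"] by simp
  next
    case False
    then have "inner (Suc n) s'" using B inner_antimono[of "Suc n" m s'] by (simp add: stageG_def)
    then obtain z where z: "z \<in> Z (Suc n)" "0 < s' / l (Suc n) - real z" "s' / l (Suc n) - real z < 1"
      unfolding inner_def by blast
    have "s / l (Suc n) - real z \<le> -1/4 \<or> s / l (Suc n) - real z \<ge> 5/4"
      using not_outer[OF _ z(1)] A by (simp add: stageF_def)
    then have "1/4 \<le> \<bar>s / l (Suc n) - s' / l (Suc n)\<bar>" using z(2,3) by linarith
    also have "\<dots> = \<bar>s - s'\<bar> / l (Suc n)" using l_pos[of "Suc n"] by (simp add: diff_divide_distrib[symmetric] abs_divide)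
    finally have "l (Suc n) / 4 \<le> \<bar>s - s'\<bar>" using l_pos[of "Suc n"] by (simp add: le_divide_eq)
    moreover have "l n / (4 * M) = l (Suc n) / 4" using M0 by (simp add: l_Suc[of n])
    moreover have "max (l n) (l m) = l n" using l_antimono[of n m] False by simp
    ultimately show ?thesis by simp
  qed
  moreover have "l n / (4 * M) \<le> max (l n) (l m) / (4 * M)" "l m / (4 * M) \<le> max (l n) (l m) / (4 * M)"
    using M0 by (auto intro!: divide_right_mono)
  ultimately show "l n / (4 * M) \<le> \<bar>s - s'\<bar> \<or> l n / (4 * M) \<le> \<bar>t - t'\<bar>"
    "l m / (4 * M) \<le> \<bar>s - s'\<bar> \<or> l m / (4 * M) \<le> \<bar>t - t'\<bar>" by linarith+
qed

lemma outer_cell: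
  assumes "outer n s" "\<bar>t\<bar> \<le> M * l n" shows "cell n s t"
proof (cases "n = 0")
  case False
  then obtain z where z: "z \<in> Z n" "-1/4 < s / l n - real z" "s / l n - real z < 5/4"
    using assms(1) unfolding outer_def by blast
  then have "real z - 1 \<le> s / l n" "s / l n \<le> real z + 2" by linarith+
  then show ?thesis using z(1) assms(2) unfolding cell_def by blast
qed (simp add: cell_def)

lemma inner_cell:
  assumes "inner n s" "\<bar>t\<bar> \<le> M * l n" shows "cell n s t"
proof -
  obtain z where z: "z \<in> Z n" "0 < s / l n - real z" "s / l n - real z < 1"
    using assms(1) unfolding inner_def by blast
  then have "real z - 1 \<le> s / l n" "s / l n \<le> real z + 2" by linarith+
  then show ?thesis using z(1) assms(2) unfolding cell_def by blast
qed

lemma stageF_cell: "stageF n s t \<Longrightarrow> cell n s t"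
proof -
  assume a: "stageF n s t"
  have "thin * M * l n \<le> 1 * M * l n"
    using mult_right_mono[OF thin(4), of "M * l n"] l_pos[of n] by (simp add: mult.assoc)
  then show ?thesis using a outer_cell[of n s t] by (simp add: stageF_def)
qed

lemma stageG_cell: "stageG n s t \<Longrightarrow> cell n s t"
proof (cases "n = 0")
  case False
  assume a: "stageG n s t"
  have "1 * l n \<le> real M * l n" using M l_pos[of n] by (intro mult_right_mono) auto
  then show ?thesis using a False inner_cell[of n s t] by (simp add: stageG_def)
qed (simp add: cell_def)

text \<open>Bounds for single terms, as opposed to \<open>F_grad\<close>: they serve the
  \<open>L^1\<close> summability of the series and of its derivatives.\<close>

lemma F_terms:
  "\<bar>th n s * prd n t\<bar> \<le> 1" "\<bar>th' n s * prd n t\<bar> \<le> (16 + 2 / thin) / l n" "\<bar>th n s * prd' n t\<bar> \<le> (16 + 2 / thin) / l n"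
  "\<not> cell n s t \<Longrightarrow> th n s * prd n t = 0 \<and> th' n s * prd n t = 0 \<and> th n s * prd' n t = 0"
proof -
  have l: "0 < l n" by (rule l_pos)
  have th: "\<bar>th n s\<bar> \<le> 1" using th_bounds(1,2)[of n s] by simp
  have p: "\<bar>prd n t\<bar> \<le> 1" using pr_bounds(1,2)[of n t] pr_bounds(1,2)[of "n - 1" t] pr_bounds(1,2)[of 0 t] by (auto simp: prd_def)
  have "1 / (thin * l (n - 1)) \<le> 1 / (thin * l n)"
    using thin(1) l l_antimono[of "n - 1" n] l_pos[of "n - 1"] by (intro divide_left_mono mult_left_mono mult_pos_pos) auto
  then have "pr' (n - 1) t \<le> 1 / (thin * l n)" "pr' n t \<le> 1 / (thin * l n)"
    using pr_bounds(4)[of n t] pr_bounds(4)[of "n - 1" t] by linarith+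
  moreover have "\<bar>prd' n t\<bar> \<le> 2 * X" if "pr' (n - 1) t \<le> X" "pr' n t \<le> X" for X
    using that pr_bounds(3)[of n t] pr_bounds(3)[of "n - 1" t] by (cases "n = 0") (auto simp: prd'_def)
  ultimately have "\<bar>prd' n t\<bar> \<le> 2 * (1 / (thin * l n))" by blast
  then have p': "\<bar>prd' n t\<bar> \<le> 2 / (thin * l n)" by simp
  have b: "16 / l n \<le> (16 + 2 / thin) / l n" "2 / (thin * l n) \<le> (16 + 2 / thin) / l n"
    using l thin(1) by (auto intro!: divide_right_mono simp: divide_simps)
  show "\<bar>th n s * prd n t\<bar> \<le> 1" unfolding abs_mult using th p by (intro mult_le_one) auto
  have "\<bar>th' n s * prd n t\<bar> \<le> 16 / l n * 1"
    unfolding abs_mult using th_bounds(3)[of n s] p l by (intro mult_mono) auto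
  then show "\<bar>th' n s * prd n t\<bar> \<le> (16 + 2 / thin) / l n" using b(1) by linarith
  have "\<bar>th n s * prd' n t\<bar> \<le> 1 * (2 / (thin * l n))"
    unfolding abs_mult using th p' by (intro mult_mono) auto
  then show "\<bar>th n s * prd' n t\<bar> \<le> (16 + 2 / thin) / l n" using b(2) by linarith
  assume c: "\<not> cell n s t"
  then have n: "n > 0" by (simp add: cell_def)
  have "\<not> outer n s \<or> M * l n \<le> \<bar>t\<bar>" using outer_cell c by fastforce
  moreover have "thin * M * l n \<le> 1 * M * l n"
    using mult_right_mono[OF thin(4), of "M * l n"] l by (simp add: mult.assoc)
  ultimately show "th n s * prd n t = 0 \<and> th' n s * prd n t = 0 \<and> th n s * prd' n t = 0"
    using th_out[of n s] prd_far[of n t] n by fastforce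
qed

text \<open>The increment \<open>gd n\<close> lives on the intervals of generation
  \<open>n - 1\<close>, whence the shifted index; \<open>0 - 1 = 0\<close> covers the first
  term.\<close>

lemma G_terms:
  "\<bar>ta n t * gd n s\<bar> \<le> 1"
  "\<bar>ta n t * gd' n s\<bar> \<le> 4 * M / (real (N (n - 1)) * l (n - 1))" "\<bar>ta' n t * gd n s\<bar> \<le> 4 * M / (real (N (n - 1)) * l (n - 1))"
  "\<not> cell (n - 1) s t \<Longrightarrow> ta n t * gd n s = 0 \<and> ta n t * gd' n s = 0 \<and> ta' n t * gd n s = 0"
proof -
  let ?c = "2 * M / (real (N (n - 1)) * l (n - 1))"
  have c0: "0 \<le> ?c" using l_pos[of "n - 1"] by simp
  have ta: "\<bar>ta n t\<bar> \<le> 1" using ta_bounds(1,2)[of n t] by simp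
  have gd: "\<bar>gd n s\<bar> \<le> 1" using gc_bounds(1,2)[of n s] gc_bounds(1,2)[of "n - 1" s] gc_bounds(1,2)[of 0 s] by (auto simp: gd_def)
  show "\<bar>ta n t * gd n s\<bar> \<le> 1" unfolding abs_mult using ta gd by (intro mult_le_one) auto
  have "\<bar>gd' n s\<bar> \<le> 2 * ?c"
  proof (cases n)
    case 0 then show ?thesis using gc'_bounds2(1)[of 0 s] c0 by (simp add: gd'_def)
  next
    case (Suc m) then show ?thesis using gc'_bounds2[of m s] by (simp add: gd'_def)
  qed
  then have "\<bar>ta n t * gd' n s\<bar> \<le> 1 * (2 * ?c)" unfolding abs_mult using ta by (intro mult_mono) auto
  then show "\<bar>ta n t * gd' n s\<bar> \<le> 4 * M / (real (N (n - 1)) * l (n - 1))" by simp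
  have "\<bar>ta' n t * gd n s\<bar> \<le> ?c"
  proof (cases n)
    case 0 then show ?thesis using c0 by (simp add: ta'_def)
  next
    case (Suc m) then show ?thesis using ta'_gd_bound[of m t s] by simp
  qed
  moreover have "4 * M / (real (N (n - 1)) * l (n - 1)) = 2 * ?c" by simp
  ultimately show "\<bar>ta' n t * gd n s\<bar> \<le> 4 * M / (real (N (n - 1)) * l (n - 1))" using c0 by linarith
  assume c: "\<not> cell (n - 1) s t"
  then obtain m where m: "n = Suc m" by (cases n) (auto simp: cell_def)
  have "\<not> inner m s \<or> M * l m \<le> \<bar>t\<bar>" using inner_cell[of m s t] c m by fastforce
  then show "ta n t * gd n s = 0 \<and> ta n t * gd' n s = 0 \<and> ta' n t * gd n s = 0"
  proof
    assume i: "\<not> inner m s"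
    then have "\<not> inner (Suc m) s" using inner_Suc by blast
    then show ?thesis using i m gd_Suc_bound(2) gc'_out by (simp add: gd'_def)
  next
    assume t: "M * l m \<le> \<bar>t\<bar>"
    have "2 * l (Suc m) \<le> M * l m"
    proof -
      have "2 * l m \<le> real M * l m" using l_pos[of m] M by (intro mult_right_mono) auto
      then show ?thesis using l_antimono[of m "Suc m"] by simp
    qed
    then show ?thesis using t m ta_eq by auto
  qed
qed

end

section \<open>Weak derivatives of series of products\<close>

lemma weak_pd_cong_AE:
  assumes S: "\<Omega> \<in> sets lebesgue" and w: "weak_pd \<Omega> j v v'"
    and ae: "AE x in lebesgue. u x = v x" "AE x in lebesgue. u' x = v' x"
  shows "weak_pd \<Omega> j u u'"
proof -
  have r: "AE x in lebesgue_on K. f x = g x" if "AE x in lebesgue. f x = g x" "K \<in> sets lebesgue" for f g :: "real^'a \<Rightarrow> real" and K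
    using that by (subst AE_restrict_space_iff) (auto elim: eventually_mono)
  have li: "loc_int \<Omega> f" if "AE x in lebesgue. f x = g x" "loc_int \<Omega> g" for f g :: "real^'a \<Rightarrow> real"
    unfolding loc_int_def
  proof (intro allI impI, elim conjE)
    fix K assume K: "compact K" "K \<subseteq> \<Omega>"
    have KS: "K \<in> sets lebesgue" using K by (simp add: compact_imp_closed borel_closed)
    have g: "integrable (lebesgue_on K) g" using that(2) K unfolding loc_int_def by blast
    have a: "AE x in lebesgue_on K. f x = g x" by (rule r[OF that(1) KS])
    have "f \<in> borel_measurable (lebesgue_on K)"
      by (rule measurable_cong_AE_lebesgue_on[OF KS _ a]) (use g in auto)
    then show "integrable (lebesgue_on K) f" using integrable_cong_AE[OF _ _ a] g by auto
  qed
  have i: "(LINT x|lebesgue_on \<Omega>. f x * w x) = (LINT x|lebesgue_on \<Omega>. g x * w x)"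
    if "AE x in lebesgue. f x = g x" for f g w :: "real^'a \<Rightarrow> real"
    by (rule integral_cong_AE_lebesgue_on[OF S]) (use r[OF that S] in \<open>auto elim: eventually_mono\<close>)
  show ?thesis using w unfolding weak_pd_def by (auto simp: i[OF ae(1)] i[OF ae(2)] intro: li[OF ae(1)] li[OF ae(2)])
qed

text \<open>The \<open>n\<close>-th term and its derivatives are bounded by \<open>B n\<close> on a
  set of measure at most \<open>\<mu> n\<close> and vanish elsewhere, so
  \<open>weak_pd_suminf\<close> applies. The hyperplane \<open>Y i2 x = 0\<close>, where the series
  need not stop, is a null set; the value \<open>0\<close> there is a convention.\<close>

lemma weak_pd_product_series:
  fixes \<alpha> \<alpha>' \<beta> \<beta>' :: "nat \<Rightarrow> real \<Rightarrow> real" and x0 :: "real^'n::finite" and Q :: "nat \<Rightarrow> (real^'n) set"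
  defines "Y \<equiv> \<lambda>i x. x $ i - x0 $ i"
  assumes ne: "i1 \<noteq> i2"
    and \<alpha>: "\<And>n t. (\<alpha> n has_real_derivative \<alpha>' n t) (at t)" "\<And>n. continuous_on UNIV (\<alpha>' n)"
    and \<beta>: "\<And>n t. (\<beta> n has_real_derivative \<beta>' n t) (at t)" "\<And>n. continuous_on UNIV (\<beta>' n)"
    and Q: "\<And>n. Q n \<in> lmeasurable" "\<And>n. Q n \<subseteq> ball x0 r" "\<And>n. measure lebesgue (Q n) \<le> \<mu> n"
    and B: "\<And>n x. \<bar>\<alpha> n (Y i1 x) * \<beta> n (Y i2 x)\<bar> \<le> B n" "\<And>n x. \<bar>\<alpha>' n (Y i1 x) * \<beta> n (Y i2 x)\<bar> \<le> B n"
      "\<And>n x. \<bar>\<alpha> n (Y i1 x) * \<beta>' n (Y i2 x)\<bar> \<le> B n"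
    and z: "\<And>n x. x \<in> ball x0 r \<Longrightarrow> x \<notin> Q n \<Longrightarrow> \<alpha> n (Y i1 x) * \<beta> n (Y i2 x) = 0 \<and>
        \<alpha>' n (Y i1 x) * \<beta> n (Y i2 x) = 0 \<and> \<alpha> n (Y i1 x) * \<beta>' n (Y i2 x) = 0"
    and s: "summable (\<lambda>n. B n * \<mu> n)"
    and stop: "\<And>t. t \<noteq> 0 \<Longrightarrow> \<exists>N. \<forall>n\<ge>N. \<beta> n t = 0 \<and> \<beta>' n t = 0"
  shows "weak_pd (ball x0 r) j (\<lambda>x. if Y i2 x = 0 then 0 else \<Sum>n. \<alpha> n (Y i1 x) * \<beta> n (Y i2 x))
    (\<lambda>x. if Y i2 x = 0 then 0 else if j = i1 then \<Sum>n. \<alpha>' n (Y i1 x) * \<beta> n (Y i2 x)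
      else if j = i2 then \<Sum>n. \<alpha> n (Y i1 x) * \<beta>' n (Y i2 x) else 0)"
proof -
  let ?\<Omega> = "ball x0 r"
  have S: "?\<Omega> \<in> sets lebesgue" by (rule open_lebesgue) simp
  define W where "W n x = \<alpha> n (Y i1 x) * \<beta> n (Y i2 x)" for n x
  have C: "C1_on UNIV (\<lambda>x. \<alpha> n (Y i1 x))" "C1_on UNIV (\<lambda>x. \<beta> n (Y i2 x))" for n
    unfolding Y_def by (rule C1_on_comp_coord[OF \<alpha>], rule C1_on_comp_coord[OF \<beta>])
  have W: "C1_on UNIV (W n)" for n unfolding W_def[abs_def] by (rule C1_on_mult[OF C])
  have pW: "pd j (W n) x = (if j = i1 then \<alpha>' n (Y i1 x) * \<beta> n (Y i2 x)
      else if j = i2 then \<alpha> n (Y i1 x) * \<beta>' n (Y i2 x) else 0)" for n x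
  proof -
    have "pd j (W n) x = \<alpha> n (Y i1 x) * pd j (\<lambda>x. \<beta> n (Y i2 x)) x + pd j (\<lambda>x. \<alpha> n (Y i1 x)) x * \<beta> n (Y i2 x)"
      unfolding W_def[abs_def] by (rule pd_mult) (use C1_onD(1)[OF C(1)] C1_onD(1)[OF C(2)] in auto)
    also have "pd j (\<lambda>x. \<beta> n (Y i2 x)) x = (if j = i2 then \<beta>' n (Y i2 x) else 0)"
      unfolding Y_def by (rule pd_comp_coord(2)[OF \<beta>(1)])
    also have "pd j (\<lambda>x. \<alpha> n (Y i1 x)) x = (if j = i1 then \<alpha>' n (Y i1 x) else 0)"
      unfolding Y_def by (rule pd_comp_coord(2)[OF \<alpha>(1)])
    finally show ?thesis using ne by auto
  qed
  have B0: "0 \<le> B n" for n using B(1)[of n x0] by linarith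
  have int: "integrable (lebesgue_on ?\<Omega>) (h n)" "summable (\<lambda>n. LINT x|lebesgue_on ?\<Omega>. \<bar>h n x\<bar>)"
    if h: "\<And>n. continuous_on UNIV (h n)" "\<And>n x. x \<in> ?\<Omega> \<Longrightarrow> \<bar>h n x\<bar> \<le> B n" "\<And>n x. x \<in> ?\<Omega> \<Longrightarrow> x \<notin> Q n \<Longrightarrow> h n x = 0"
    for h :: "nat \<Rightarrow> real^'n \<Rightarrow> real" and n
  proof -
    have hm: "h n \<in> borel_measurable (lebesgue_on ?\<Omega>)" for n
      by (rule continuous_imp_measurable_on_sets_lebesgue[OF continuous_on_subset[OF h(1)] S]) simp
    have QS: "Q n \<in> sets lebesgue" for n using Q(1) by auto
    have iQ: "integrable (lebesgue_on ?\<Omega>) (indicat_real (Q n))" for n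
    proof -
      have "integrable lebesgue (indicat_real (Q n))" using Q(1)[of n] by (auto simp: fmeasurable_def intro!: integrable_real_indicator)
      then show ?thesis by (subst integrable_lebesgue_on_eq[OF S]) (use Q(2)[of n] in \<open>auto simp: indicator_def\<close>)
    qed
    have le: "\<bar>h n x\<bar> \<le> B n * indicat_real (Q n) x" if "x \<in> ?\<Omega>" for n x
      using h(2,3)[OF that] by (auto simp: indicator_def)
    show i: "integrable (lebesgue_on ?\<Omega>) (h n)" for n
      by (rule Bochner_Integration.integrable_bound[of _ "\<lambda>x. B n * indicat_real (Q n) x"])
        (use iQ hm le B0 in \<open>auto intro!: AE_I2\<close>)
    have Qm: "(LINT x|lebesgue_on ?\<Omega>. indicat_real (Q n) x) = measure lebesgue (Q n)" for n
    proof -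
      have "(LINT x|lebesgue_on ?\<Omega>. indicat_real (Q n) x) = (LINT x|lebesgue. indicat_real (Q n) x)"
        by (rule integral_lebesgue_on_eq[OF S]) (use Q(2)[of n] in \<open>auto simp: indicator_def\<close>)
      then show ?thesis by simp
    qed
    show "summable (\<lambda>n. LINT x|lebesgue_on ?\<Omega>. \<bar>h n x\<bar>)"
    proof (rule summable_comparison_test'[OF s, of 0])
      fix n
      have "(LINT x|lebesgue_on ?\<Omega>. \<bar>h n x\<bar>) \<le> (LINT x|lebesgue_on ?\<Omega>. B n * indicat_real (Q n) x)"
        by (rule integral_mono) (use i iQ le in auto)
      also have "\<dots> = B n * measure lebesgue (Q n)" unfolding Qm[symmetric] by (rule integral_mult_right_zero)
      also have "\<dots> \<le> B n * \<mu> n" using B0 Q(3) by (intro mult_left_mono)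
      finally show "norm (LINT x|lebesgue_on ?\<Omega>. \<bar>h n x\<bar>) \<le> B n * \<mu> n" by simp
    qed
  qed
  have Wb: "\<bar>W n x\<bar> \<le> B n" "\<bar>pd j (W n) x\<bar> \<le> B n" for n x
    using B B0 by (auto simp: W_def pW)
  have Wz: "x \<in> ?\<Omega> \<Longrightarrow> x \<notin> Q n \<Longrightarrow> W n x = 0" "x \<in> ?\<Omega> \<Longrightarrow> x \<notin> Q n \<Longrightarrow> pd j (W n) x = 0" for n x
    using z[of x n] by (auto simp: W_def pW)
  have "negligible {x::real^'n. axis i2 1 \<bullet> x = x0 $ i2}" by (rule negligible_hyperplane) (auto simp: axis_eq_0_iff)
  then have "{x::real^'n. x $ i2 = x0 $ i2} \<in> null_sets lebesgue"
    by (simp add: negligible_iff_null_sets inner_axis')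
  then have "AE x in lebesgue. x \<notin> {x::real^'n. x $ i2 = x0 $ i2}" by (rule AE_not_in)
  then have ae: "AE x in lebesgue. Y i2 x \<noteq> 0" by eventually_elim (auto simp: Y_def)
  then have aeO: "AE x in lebesgue_on ?\<Omega>. Y i2 x \<noteq> 0"
    using S by (subst AE_restrict_space_iff) (auto elim: eventually_mono)
  have "weak_pd ?\<Omega> j (\<lambda>x. \<Sum>n. W n x) (\<lambda>x. \<Sum>n. pd j (W n) x)"
  proof (rule weak_pd_suminf[OF open_ball W])
    show "integrable (lebesgue_on ?\<Omega>) (W n)" for n by (rule int(1)[of W, OF C1_onD(3)[OF W] Wb(1) Wz(1)])
    show "summable (\<lambda>n. LINT x|lebesgue_on ?\<Omega>. \<bar>W n x\<bar>)" by (rule int(2)[of W, OF C1_onD(3)[OF W] Wb(1) Wz(1)])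
    show "integrable (lebesgue_on ?\<Omega>) (pd j (W n))" for n
      by (rule int(1)[of "\<lambda>n. pd j (W n)", OF C1_onD(2)[OF W] Wb(2) Wz(2)])
    show "summable (\<lambda>n. LINT x|lebesgue_on ?\<Omega>. \<bar>pd j (W n) x\<bar>)"
      by (rule int(2)[of "\<lambda>n. pd j (W n)", OF C1_onD(2)[OF W] Wb(2) Wz(2)])
    show "AE x in lebesgue_on ?\<Omega>. \<exists>N. \<forall>n\<ge>N. W n x = 0"
      using aeO by eventually_elim (use stop in \<open>force simp: W_def\<close>)
    show "AE x in lebesgue_on ?\<Omega>. \<exists>N. \<forall>n\<ge>N. pd j (W n) x = 0"
    proof (use aeO in eventually_elim)
      fix x assume "Y i2 x \<noteq> 0"
      then obtain N where "\<forall>n\<ge>N. \<beta> n (Y i2 x) = 0 \<and> \<beta>' n (Y i2 x) = 0" using stop by blast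
      then show "\<exists>N. \<forall>n\<ge>N. pd j (W n) x = 0" by (intro exI[of _ N]) (auto simp: pW)
    qed
  qed
  then show ?thesis
  proof (rule weak_pd_cong_AE[OF S])
    show "AE x in lebesgue. (if Y i2 x = 0 then 0 else \<Sum>n. \<alpha> n (Y i1 x) * \<beta> n (Y i2 x)) = (\<Sum>n. W n x)"
      using ae by eventually_elim (simp add: W_def)
    show "AE x in lebesgue. (if Y i2 x = 0 then 0 else if j = i1 then \<Sum>n. \<alpha>' n (Y i1 x) * \<beta> n (Y i2 x)
      else if j = i2 then \<Sum>n. \<alpha> n (Y i1 x) * \<beta>' n (Y i2 x) else 0) = (\<Sum>n. pd j (W n) x)"
      using ae by eventually_elim (simp add: pW)
  qed
qed

lemma slab_measure:
  fixes x0 :: "real^'n::finite" and p :: real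
  assumes "0 \<le> r" "0 \<le> s" "0 \<le> t" and ne: "i1 \<noteq> i2"
  defines "S \<equiv> {x \<in> ball x0 r. p \<le> x $ i1 - x0 $ i1 \<and> x $ i1 - x0 $ i1 \<le> p + s \<and> \<bar>x $ i2 - x0 $ i2\<bar> \<le> t}"
  shows "S \<in> lmeasurable" "measure lebesgue S \<le> s * (2 * t) * (2 * r) ^ (CARD('n) - 2)"
proof -
  define A :: "real^'n" where "A = (\<chi> i. x0 $ i + (if i = i1 then p else if i = i2 then - t else - r))"
  define B :: "real^'n" where "B = (\<chi> i. x0 $ i + (if i = i1 then p + s else if i = i2 then t else r))"
  have S_eq: "S = ball x0 r \<inter> ({x. x0 $ i1 + p \<le> x $ i1} \<inter> {x. x $ i1 \<le> x0 $ i1 + p + s} \<inter> {x. \<bar>x $ i2 - x0 $ i2\<bar> \<le> t})"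
    by (auto simp: S_def)
  have "closed ({x::real^'n. x0 $ i1 + p \<le> x $ i1} \<inter> {x. x $ i1 \<le> x0 $ i1 + p + s} \<inter> {x. \<bar>x $ i2 - x0 $ i2\<bar> \<le> t})"
    by (intro closed_Int closed_Collect_le continuous_intros)
  then have "S \<in> sets borel" unfolding S_eq by (intro sets.Int borel_open borel_closed) auto
  then have "S \<in> sets lebesgue" by auto
  moreover have "bounded S" unfolding S_eq by (intro bounded_Int disjI1) simp
  ultimately show Sm: "S \<in> lmeasurable" by (rule bounded_set_imp_lmeasurable[rotated])
  have "S \<subseteq> cbox A B"
  proof
    fix x assume x: "x \<in> S"
    have "\<bar>x $ i - x0 $ i\<bar> \<le> r" for i
      using component_le_norm_cart[of "x - x0" i] x by (simp add: S_def dist_norm norm_minus_commute)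
    then show "x \<in> cbox A B" using x unfolding S_def A_def B_def
      by (auto simp: mem_box_cart abs_le_iff algebra_simps)
  qed
  then have "measure lebesgue S \<le> measure lebesgue (cbox A B)"
    by (intro measure_mono_fmeasurable) (use Sm in auto)
  also have "\<dots> = (\<Prod>i\<in>UNIV. B $ i - A $ i)"
  proof -
    have "cbox A B \<noteq> {}" using assms(1-3) by (auto simp: interval_ne_empty_cart A_def B_def)
    then show ?thesis by (simp add: content_cbox_cart)
  qed
  also have "\<dots> = (\<Prod>i\<in>insert i1 (insert i2 (UNIV - {i1, i2})). if i = i1 then s else if i = i2 then 2 * t else 2 * r)"
    by (intro prod.cong) (auto simp: A_def B_def)
  also have "\<dots> = s * (2 * t) * (2 * r) ^ card (UNIV - {i1, i2})"
    using ne by (simp add: prod.insert)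
  also have "card (UNIV - {i1, i2}) = CARD('n) - 2"
    using ne by (simp add: card_Diff_subset)
  finally show "measure lebesgue S \<le> s * (2 * t) * (2 * r) ^ (CARD('n) - 2)" .
qed

section \<open>Measure of the cells and weak gradients of the two functions\<close>

context cantor_scheme begin

lemma cell_measure:
  fixes x0 :: "real^'n::finite"
  assumes r: "0 < r" and ne: "i1 \<noteq> i2"
  defines "Q \<equiv> \<lambda>n. {x \<in> ball x0 r. cell n (x $ i1 - x0 $ i1) (x $ i2 - x0 $ i2)}"
  obtains C where "0 \<le> C" "\<And>n. Q n \<in> lmeasurable" "\<And>n. measure lebesgue (Q n) \<le> C * (real (N n) * (l n)\<^sup>2)"
proof -
  define S where "S n z = {x \<in> ball x0 r. (real z - 1) * l n \<le> x $ i1 - x0 $ i1 \<and>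
    x $ i1 - x0 $ i1 \<le> (real z - 1) * l n + 3 * l n \<and> \<bar>x $ i2 - x0 $ i2\<bar> \<le> M * l n}" for n z
  define c where "c = 3 * (2 * M) * (2 * r) ^ (CARD('n) - 2)"
  have c: "0 \<le> c" using r by (simp add: c_def)
  have S: "S n z \<in> lmeasurable" "measure lebesgue (S n z) \<le> c * (l n)\<^sup>2" for n z
  proof -
    have "0 \<le> 3 * l n" "0 \<le> M * l n" using l_pos[of n] by auto
    note sm = slab_measure[of r "3 * l n" "M * l n" i1 i2 x0 "(real z - 1) * l n", OF _ this ne]
    show "S n z \<in> lmeasurable" unfolding S_def using sm(1) r by simp
    have "measure lebesgue (S n z) \<le> 3 * l n * (2 * (M * l n)) * (2 * r) ^ (CARD('n) - 2)"
      unfolding S_def using sm(2) r by simp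
    also have "\<dots> = c * (l n)\<^sup>2" by (simp add: c_def power2_eq_square)
    finally show "measure lebesgue (S n z) \<le> c * (l n)\<^sup>2" .
  qed
  have Q0: "Q 0 = ball x0 r" by (auto simp: Q_def cell_def)
  have QS: "Q n = (\<Union>z\<in>Z n. S n z)" if "n \<noteq> 0" for n
  proof -
    have "real z - 1 \<le> s / l n \<and> s / l n \<le> real z + 2 \<longleftrightarrow> (real z - 1) * l n \<le> s \<and> s \<le> (real z - 1) * l n + 3 * l n" for z s
    proof -
      have "(real z - 1) * l n + 3 * l n = (real z + 2) * l n" by (simp add: algebra_simps)
      then show ?thesis using l_pos[of n] by (simp add: le_divide_eq divide_le_eq)
    qed
    then show ?thesis using that unfolding Q_def S_def cell_def by auto
  qed
  \<comment> \<open>The second entry takes care of \<open>n = 0\<close>, where the cell is the whole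
    ball.\<close>
  define C where "C = max c (measure lebesgue (ball x0 r) / l0\<^sup>2)"
  show ?thesis
  proof (rule that[of C])
    show "0 \<le> C" using c by (simp add: C_def)
    show "Q n \<in> lmeasurable" for n
    proof (cases "n = 0")
      case False
      then show ?thesis unfolding QS[OF False] by (intro fmeasurable.finite_UN finite_Z S)
    qed (simp add: Q0)
    show "measure lebesgue (Q n) \<le> C * (real (N n) * (l n)\<^sup>2)" for n
    proof (cases "n = 0")
      case True
      have "measure lebesgue (ball x0 r) = measure lebesgue (ball x0 r) / l0\<^sup>2 * l0\<^sup>2" using l0 by simp
      also have "\<dots> \<le> C * l0\<^sup>2" by (intro mult_right_mono) (auto simp: C_def)
      finally show ?thesis using True by (simp add: Q0 N_0 l_0)
    next
      case False
      have "measure lebesgue (Q n) \<le> (\<Sum>z\<in>Z n. measure lebesgue (S n z))"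
        unfolding QS[OF False] using S(1) by (intro measure_UNION_le finite_Z) auto
      also have "\<dots> \<le> (\<Sum>z\<in>Z n. c * (l n)\<^sup>2)" by (intro sum_mono S)
      also have "\<dots> = c * (real (N n) * (l n)\<^sup>2)" by (simp add: N_def)
      also have "\<dots> \<le> C * (real (N n) * (l n)\<^sup>2)" by (intro mult_right_mono) (auto simp: C_def)
      finally show ?thesis .
    qed
  qed
qed

lemma summable_l: "summable l"
proof -
  have "summable (\<lambda>n. l0 * (1 / real M) ^ n)" using M by (intro summable_mult summable_geometric) auto
  then show ?thesis by (simp add: l_def[abs_def] power_divide)
qed

lemma summable_N_l2:
  assumes "summable (\<lambda>n. real (N n) * l n)" shows "summable (\<lambda>n. real (N n) * (l n)\<^sup>2)"
proof (rule summable_comparison_test'[OF summable_mult[OF assms, of l0], of 0])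
  fix n
  have "l n \<le> l0" using l_antimono[of 0 n] by (simp add: l_0)
  then have "l n * (real (N n) * l n) \<le> l0 * (real (N n) * l n)" using l_pos[of n] by (intro mult_right_mono) auto
  moreover have "real (N n) * (l n)\<^sup>2 = l n * (real (N n) * l n)" by (simp add: power2_eq_square)
  moreover have "0 \<le> l n * (real (N n) * l n)" using l_pos[of n] by simp
  ultimately show "norm (real (N n) * (l n)\<^sup>2) \<le> l0 * (real (N n) * l n)" by (simp only: real_norm_def abs_of_nonneg)
qed

text \<open>A derivative of size \<open>1 / l n\<close> on a set of measure
  \<open>N n * (l n)\<^sup>2\<close> contributes \<open>N n * l n\<close>, which is the source of
  the hypothesis \<open>s\<close>.\<close>

lemma weak_pd_F:
  fixes x0 :: "real^'n::finite"
  defines "Y \<equiv> \<lambda>i x. x $ i - x0 $ i"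
  assumes r: "0 < r" and ne: "i1 \<noteq> i2" and s: "summable (\<lambda>n. real (N n) * l n)"
  shows "weak_pd (ball x0 r) j (\<lambda>x. if Y i2 x = 0 then 0 else F (Y i1 x) (Y i2 x))
    (\<lambda>x. if Y i2 x = 0 then 0 else if j = i1 then F1 (Y i1 x) (Y i2 x) else if j = i2 then F2 (Y i1 x) (Y i2 x) else 0)"
proof -
  obtain C where C: "0 \<le> C" "\<And>n. {x \<in> ball x0 r. cell n (x $ i1 - x0 $ i1) (x $ i2 - x0 $ i2)} \<in> lmeasurable"
    "\<And>n. measure lebesgue {x \<in> ball x0 r. cell n (x $ i1 - x0 $ i1) (x $ i2 - x0 $ i2)} \<le> C * (real (N n) * (l n)\<^sup>2)"
    by (rule cell_measure[OF r ne, of x0]) (rule that)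
  have b: "(16 + 2 / thin) / l n \<le> 1 + (16 + 2 / thin) / l n" "1 \<le> 1 + (16 + 2 / thin) / l n" for n
  proof -
    have "0 \<le> (16 + 2 / thin) / l n" using l_pos[of n] thin(1) by (intro divide_nonneg_pos add_nonneg_nonneg) auto
    then show "(16 + 2 / thin) / l n \<le> 1 + (16 + 2 / thin) / l n" "1 \<le> 1 + (16 + 2 / thin) / l n" by linarith+
  qed
  have "(\<lambda>n. (1 + (16 + 2 / thin) / l n) * (C * (real (N n) * (l n)\<^sup>2))) =
      (\<lambda>n. C * (real (N n) * (l n)\<^sup>2) + (16 + 2 / thin) * C * (real (N n) * l n))"
  proof
    fix n
    have "(1 + K / x) * (C * (m * x\<^sup>2)) = C * (m * x\<^sup>2) + K * C * (m * x)" if "x \<noteq> 0" for K x m :: real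
      using that by (simp add: power2_eq_square field_simps)
    then show "(1 + (16 + 2 / thin) / l n) * (C * (real (N n) * (l n)\<^sup>2)) =
      C * (real (N n) * (l n)\<^sup>2) + (16 + 2 / thin) * C * (real (N n) * l n)"
      using l_pos[of n] by simp
  qed
  then have sm: "summable (\<lambda>n. (1 + (16 + 2 / thin) / l n) * (C * (real (N n) * (l n)\<^sup>2)))"
    using summable_add[OF summable_mult[OF summable_N_l2[OF s]] summable_mult[OF s]] by simp
  show ?thesis
    unfolding Y_def F_def F1_def F2_def
  proof (rule weak_pd_product_series[where \<alpha> = th and \<alpha>' = th' and \<beta> = prd and \<beta>' = prd' and B = "\<lambda>n. 1 + (16 + 2 / thin) / l n" and Q = "\<lambda>n. {x \<in> ball x0 r. cell n (x $ i1 - x0 $ i1) (x $ i2 - x0 $ i2)}" and \<mu> = "\<lambda>n. C * (real (N n) * (l n)\<^sup>2)", OF ne DERIV_th continuous_derivs(1) DERIV_prd continuous_derivs(2) C(2) _ C(3) _ _ _ _ sm stopF])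
    fix n and x :: "real^'n"
    let ?s = "x $ i1 - x0 $ i1" and ?t = "x $ i2 - x0 $ i2"
    show "\<bar>th n ?s * prd n ?t\<bar> \<le> 1 + (16 + 2 / thin) / l n" by (rule order_trans[OF F_terms(1) b(2)])
    show "\<bar>th' n ?s * prd n ?t\<bar> \<le> 1 + (16 + 2 / thin) / l n" by (rule order_trans[OF F_terms(2) b(1)])
    show "\<bar>th n ?s * prd' n ?t\<bar> \<le> 1 + (16 + 2 / thin) / l n" by (rule order_trans[OF F_terms(3) b(1)])
    show "th n ?s * prd n ?t = 0 \<and> th' n ?s * prd n ?t = 0 \<and> th n ?s * prd' n ?t = 0"
      if "x \<in> ball x0 r" "x \<notin> {x \<in> ball x0 r. cell n (x $ i1 - x0 $ i1) (x $ i2 - x0 $ i2)}"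
      by (rule F_terms(4)) (use that in simp)
  qed auto
qed

text \<open>A derivative of size \<open>1 / (N n * l n)\<close> on a set of measure
  \<open>N n * (l n)\<^sup>2\<close> contributes \<open>l n\<close>, a geometric series; the terms
  themselves contribute the measure.\<close>

lemma weak_pd_G:
  fixes x0 :: "real^'n::finite"
  defines "Y \<equiv> \<lambda>i x. x $ i - x0 $ i"
  assumes r: "0 < r" and ne: "i1 \<noteq> i2" and s: "summable (\<lambda>n. real (N n) * l n)"
  shows "weak_pd (ball x0 r) j (\<lambda>x. if Y i2 x = 0 then 0 else G (Y i1 x) (Y i2 x))
    (\<lambda>x. if Y i2 x = 0 then 0 else if j = i1 then G1 (Y i1 x) (Y i2 x) else if j = i2 then G2 (Y i1 x) (Y i2 x) else 0)"
proof -
  obtain C where C: "0 \<le> C" "\<And>n. {x \<in> ball x0 r. cell n (x $ i1 - x0 $ i1) (x $ i2 - x0 $ i2)} \<in> lmeasurable"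
    "\<And>n. measure lebesgue {x \<in> ball x0 r. cell n (x $ i1 - x0 $ i1) (x $ i2 - x0 $ i2)} \<le> C * (real (N n) * (l n)\<^sup>2)"
    by (rule cell_measure[OF r ne, of x0]) (rule that)
  let ?B = "\<lambda>n. 1 + 4 * M / (real (N (n - 1)) * l (n - 1))"
  have b: "4 * M / (real (N (n - 1)) * l (n - 1)) \<le> ?B n" "1 \<le> ?B n" for n
    using l_pos[of "n - 1"] by auto
  have "(\<lambda>n. (1 + 4 * M / (real (N n) * l n)) * (C * (real (N n) * (l n)\<^sup>2))) =
      (\<lambda>n. C * (real (N n) * (l n)\<^sup>2) + 4 * M * C * l n)"
  proof
    fix n
    have "(1 + K / (m * x)) * (C * (m * x\<^sup>2)) = C * (m * x\<^sup>2) + K * C * x" if "x \<noteq> 0" "m \<noteq> 0" for K x m :: real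
      using that by (simp add: power2_eq_square field_simps)
    from this[of "l n" "real (N n)" "4 * real M"]
    show "(1 + 4 * M / (real (N n) * l n)) * (C * (real (N n) * (l n)\<^sup>2)) = C * (real (N n) * (l n)\<^sup>2) + 4 * M * C * l n"
      using l_pos[of n] N_pos[of n] by simp
  qed
  then have "summable (\<lambda>n. (1 + 4 * M / (real (N n) * l n)) * (C * (real (N n) * (l n)\<^sup>2)))"
    using summable_add[OF summable_mult[OF summable_N_l2[OF s]] summable_mult[OF summable_l]] by simp
  \<comment> \<open>Terms of index \<open>n\<close> are measured on cells of index
    \<open>n - 1\<close>; the shift does not affect summability.\<close>
  then have sm: "summable (\<lambda>n. ?B n * (C * (real (N (n - 1)) * (l (n - 1))\<^sup>2)))"
    by (subst summable_Suc_iff[symmetric]) simp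
  show ?thesis
    unfolding Y_def G_def G1_def G2_def mult.commute[of "ta _ _"] mult.commute[of "ta' _ _"]
  proof (rule weak_pd_product_series[where \<alpha> = gd and \<alpha>' = gd' and \<beta> = ta and \<beta>' = ta' and B = ?B and Q = "\<lambda>n. {x \<in> ball x0 r. cell (n - 1) (x $ i1 - x0 $ i1) (x $ i2 - x0 $ i2)}" and \<mu> = "\<lambda>n. C * (real (N (n - 1)) * (l (n - 1))\<^sup>2)", OF ne DERIV_gd continuous_derivs(4) DERIV_ta continuous_derivs(3) C(2) _ C(3) _ _ _ _ sm stopG])
    fix n and x :: "real^'n"
    let ?s = "x $ i1 - x0 $ i1" and ?t = "x $ i2 - x0 $ i2"
    show "\<bar>gd n ?s * ta n ?t\<bar> \<le> ?B n" unfolding mult.commute[of "gd _ _"] by (rule order_trans[OF G_terms(1) b(2)])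
    show "\<bar>gd' n ?s * ta n ?t\<bar> \<le> ?B n" unfolding mult.commute[of "gd' _ _"] by (rule order_trans[OF G_terms(2) b(1)])
    show "\<bar>gd n ?s * ta' n ?t\<bar> \<le> ?B n" unfolding mult.commute[of "gd _ _"] by (rule order_trans[OF G_terms(3) b(1)])
    show "gd n ?s * ta n ?t = 0 \<and> gd' n ?s * ta n ?t = 0 \<and> gd n ?s * ta' n ?t = 0"
      if "x \<in> ball x0 r" "x \<notin> {x \<in> ball x0 r. cell (n - 1) (x $ i1 - x0 $ i1) (x $ i2 - x0 $ i2)}"
      unfolding mult.commute[of "gd _ _"] mult.commute[of "gd' _ _"] by (rule G_terms(4)) (use that in simp)
  qed auto
qed

end

lemma loc_int_ball_measurable:
  fixes v :: "real^'n::finite \<Rightarrow> real"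
  assumes v: "loc_int (ball c r) v"
  shows "v \<in> borel_measurable (lebesgue_on (ball c r))"
proof -
  have S: "ball c r \<in> sets lebesgue" by (rule open_lebesgue) simp
  let ?C = "\<lambda>n. cball c (r - 1 / real (Suc n))"
  let ?v = "\<lambda>n x. if x \<in> ?C n then v x else 0"
  have "integrable lebesgue (?v n)" for n
  proof -
    have "?C n \<subseteq> ball c r"
    proof
      fix x assume "x \<in> ?C n"
      then have "dist c x \<le> r - 1 / real (Suc n)" by simp
      moreover have "0 < 1 / real (Suc n)" by simp
      ultimately have "dist c x < r" by linarith
      then show "x \<in> ball c r" by simp
    qed
    then have "integrable (lebesgue_on (?C n)) v" using v unfolding loc_int_def by auto
    then show ?thesis by (subst Lebesgue_Measure.integrable_restrict_UNIV) auto
  qed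
  then have m: "?v n \<in> borel_measurable (lebesgue_on (ball c r))" for n
    by (intro measurable_restrict_space1) auto
  show ?thesis
  proof (rule borel_measurable_LIMSEQ_real[OF _ m])
    fix x assume "x \<in> space (lebesgue_on (ball c r))"
    then have x: "dist c x < r" by simp
    have "(\<lambda>n. r - 1 / real (Suc n)) \<longlonglongrightarrow> r" by real_asymp
    then have "\<forall>\<^sub>F n in sequentially. dist c x < r - 1 / real (Suc n)" using x by (rule order_tendstoD)
    then have "\<forall>\<^sub>F n in sequentially. v x = ?v n x" by eventually_elim auto
    then show "(\<lambda>n. ?v n x) \<longlonglongrightarrow> v x" by (rule Lim_transform_eventually[OF tendsto_const])
  qed
qed

section \<open>The gap for a pair of functions\<close>

lemma axis_component: "axis J a $ I = (if I = J then a else 0)"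
  by (simp add: axis_def)

lemma dform_single:
  fixes p :: "('n::{finite,linorder}) set \<Rightarrow> 'n \<Rightarrow> 'n space \<Rightarrow> real"
  assumes p: "\<And>I i. I \<noteq> J \<Longrightarrow> p I i x = 0"
  shows "i \<notin> J \<Longrightarrow> dform p x $ insert i J = shuffle_sign {i} J * p J i x"
    "(\<And>i. i \<notin> J \<Longrightarrow> K \<noteq> insert i J) \<Longrightarrow> dform p x $ K = 0"
    "norm (dform p x) \<le> real CARD('n set) * (\<Sum>i\<in>UNIV. \<bar>p J i x\<bar>)"
proof -
  have c: "dform p x $ K = (\<Sum>i\<in>K. if K - {i} = J then shuffle_sign {i} J * p J i x else 0)" for K
    unfolding dform_def vec_lambda_beta by (intro sum.cong refl) (auto simp: p)
  show "dform p x $ insert i J = shuffle_sign {i} J * p J i x" if i: "i \<notin> J"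
  proof -
    have "insert i J - {j} \<noteq> J" if "j \<in> J" for j using that i by auto
    then have "(\<Sum>j\<in>J. if insert i J - {j} = J then shuffle_sign {j} J * p J j x else 0) = 0"
      by (intro sum.neutral) auto
    then show ?thesis unfolding c using i by (subst sum.insert) auto
  qed
  show "dform p x $ K = 0" if "\<And>i. i \<notin> J \<Longrightarrow> K \<noteq> insert i J"
    unfolding c
  proof (rule sum.neutral, rule ballI)
    fix i assume i: "i \<in> K"
    have "K - {i} \<noteq> J"
    proof
      assume "K - {i} = J"
      then have "i \<notin> J" "K = insert i J" using i by auto
      then show False using that by blast
    qed
    then show "(if K - {i} = J then shuffle_sign {i} J * p J i x else 0) = 0" by simp
  qed
  have "\<bar>dform p x $ K\<bar> \<le> (\<Sum>i\<in>UNIV. \<bar>p J i x\<bar>)" for K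
  proof -
    have "\<bar>dform p x $ K\<bar> \<le> (\<Sum>i\<in>K. \<bar>if K - {i} = J then shuffle_sign {i} J * p J i x else 0\<bar>)"
      unfolding c by (rule sum_abs)
    also have "\<dots> \<le> (\<Sum>i\<in>K. \<bar>p J i x\<bar>)" by (intro sum_mono) (auto simp: abs_mult)
    also have "\<dots> \<le> (\<Sum>i\<in>UNIV. \<bar>p J i x\<bar>)" by (intro sum_mono2) auto
    finally show ?thesis .
  qed
  then have "(\<Sum>K\<in>UNIV. \<bar>dform p x $ K\<bar>) \<le> (\<Sum>K\<in>(UNIV :: 'n set set). \<Sum>i\<in>UNIV. \<bar>p J i x\<bar>)" by (intro sum_mono)
  then show "norm (dform p x) \<le> real CARD('n set) * (\<Sum>i\<in>UNIV. \<bar>p J i x\<bar>)"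
    using norm_le_l1_cart[of "dform p x"] by simp
qed

text \<open>Only \<open>dx_i1 \<and> dx_L\<close> against \<open>dx_i2 \<and> dx_J\<close>, and the
  same with \<open>i1\<close> and \<open>i2\<close> exchanged, reach the volume form: any other
  index added to \<open>L\<close> already belongs to \<open>J\<close> and would occur twice.\<close>

lemma wedge_dform_single:
  fixes p q :: "('n::{finite,linorder}) set \<Rightarrow> 'n \<Rightarrow> 'n space \<Rightarrow> real"
  assumes p: "\<And>I i. I \<noteq> L \<Longrightarrow> p I i x = 0" and q: "\<And>I i. I \<noteq> J \<Longrightarrow> q I i x = 0"
    and JL: "J \<inter> L = {}" "J \<union> L = - {i1, i2}" and ne: "i1 \<noteq> i2"
  shows "wedge (dform p x) (dform q x) $ UNIV =
     shuffle_sign (insert i1 L) (insert i2 J) * shuffle_sign {i1} L * shuffle_sign {i2} J * (p L i1 x * q J i2 x) +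
     shuffle_sign (insert i2 L) (insert i1 J) * shuffle_sign {i2} L * shuffle_sign {i1} J * (p L i2 x * q J i1 x)"
proof -
  have n: "i1 \<notin> L" "i2 \<notin> L" "i1 \<notin> J" "i2 \<notin> J" using JL(2) by auto
  have c: "- insert i1 L = insert i2 J" "- insert i2 L = insert i1 J" using JL ne by blast+
  have d: "insert i1 L \<noteq> insert i2 L" using n ne by blast
  have z: "dform p x $ K * dform q x $ (- K) = 0" if "K \<noteq> insert i1 L" "K \<noteq> insert i2 L" for K
  proof (rule ccontr)
    assume a: "dform p x $ K * dform q x $ (- K) \<noteq> 0"
    have "\<exists>i. i \<notin> L \<and> K = insert i L"
    proof (rule ccontr)
      assume "\<not> ?thesis"
      then have "dform p x $ K = 0" by (intro dform_single(2)[of L p x K, OF p]) blast+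
      then show False using a by simp
    qed
    then obtain i where i: "i \<notin> L" "K = insert i L" by blast
    have "\<exists>j. j \<notin> J \<and> - K = insert j J"
    proof (rule ccontr)
      assume "\<not> ?thesis"
      then have "dform q x $ (- K) = 0" by (intro dform_single(2)[of J q x "- K", OF q]) blast+
      then show False using a by simp
    qed
    then obtain j where j: "j \<notin> J" "- K = insert j J" by blast
    have "i \<in> J" using i that JL(2) by blast
    then show False using i(2) j(2) by blast
  qed
  have sum2: "(\<Sum>K\<in>{insert i1 L, insert i2 L}. h K) = h (insert i1 L) + h (insert i2 L)" for h :: "'n set \<Rightarrow> real"
    using d by simp
  have "wedge (dform p x) (dform q x) $ UNIV =
      (\<Sum>K\<in>{insert i1 L, insert i2 L}. shuffle_sign K (- K) * dform p x $ K * dform q x $ (- K))"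
    unfolding wedge_top mult.assoc using z by (intro sum.mono_neutral_right ballI) simp_all
  also have "\<dots> = shuffle_sign (insert i1 L) (insert i2 J) * dform p x $ insert i1 L * dform q x $ insert i2 J +
      shuffle_sign (insert i2 L) (insert i1 J) * dform p x $ insert i2 L * dform q x $ insert i1 J"
    unfolding sum2 by (simp only: c)
  also have "\<dots> = shuffle_sign (insert i1 L) (insert i2 J) * shuffle_sign {i1} L * shuffle_sign {i2} J * (p L i1 x * q J i2 x) +
     shuffle_sign (insert i2 L) (insert i1 J) * shuffle_sign {i2} L * shuffle_sign {i1} J * (p L i2 x * q J i1 x)"
    using dform_single(1)[of L p x i1, OF p n(1)] dform_single(1)[of L p x i2, OF p n(2)]
      dform_single(1)[of J q x i1, OF q n(3)] dform_single(1)[of J q x i2, OF q n(4)] by (simp add: mult_ac)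
  finally show ?thesis .
qed

text \<open>Below \<open>T\<close> the linear function is at most \<open>\<sigma> * T\<close>; above
  \<open>T\<close> convexity keeps \<open>\<psi> t / t\<close> at least \<open>\<psi> T / T\<close>.
  A single point \<open>T\<close> thus replaces the computation of the conjugate function.\<close>

lemma young_convex:
  assumes "orlicz_function \<psi>" "0 < T" "0 \<le> \<sigma>" "0 \<le> t" and le: "ennreal (\<sigma> * T) \<le> w * \<psi> T"
  shows "ennreal (\<sigma> * t) \<le> ennreal (\<sigma> * T) + w * \<psi> t"
proof (cases "t \<le> T")
  case True
  then have "ennreal (\<sigma> * t) \<le> ennreal (\<sigma> * T)" using assms by (intro ennreal_leI mult_left_mono) auto
  then show ?thesis by (rule add_increasing2[rotated]) simp
next
  case False
  then have t: "T < t" "0 < t" using assms by auto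
  have "\<psi> (T / t * t) \<le> ennreal (T / t) * \<psi> t" by (rule orlicz_scale[OF assms(1)]) (use t assms in auto)
  then have "\<psi> T \<le> ennreal (T / t) * \<psi> t" using t by simp
  then have "ennreal (\<sigma> * T) \<le> w * (ennreal (T / t) * \<psi> t)" using le mult_left_mono order_trans by fastforce
  then have "ennreal (t / T) * ennreal (\<sigma> * T) \<le> ennreal (t / T) * (w * (ennreal (T / t) * \<psi> t))"
    by (rule mult_left_mono) simp
  also have "\<dots> = ennreal (t / T) * ennreal (T / t) * (w * \<psi> t)" by (simp add: mult_ac)
  also have "ennreal (t / T) * ennreal (T / t) = 1" using t assms by (simp add: ennreal_mult[symmetric])
  also have "ennreal (t / T) * ennreal (\<sigma> * T) = ennreal (\<sigma> * t)" using t assms by (simp add: ennreal_mult[symmetric])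
  finally show ?thesis by (simp add: add_increasing)
qed

lemma orlicz_superlinear:
  assumes "orlicz_function \<phi>" obtains T where "0 < T" "ennreal (\<sigma> * T) \<le> \<phi> T"
proof -
  have "((\<lambda>t. \<phi> t / ennreal t) \<longlongrightarrow> \<infinity>) at_top" using assms unfolding orlicz_function_def by blast
  then have "\<forall>\<^sub>F t in at_top. ennreal \<sigma> < \<phi> t / ennreal t" by (rule order_tendstoD) simp
  then have "\<forall>\<^sub>F t in at_top. ennreal \<sigma> < \<phi> t / ennreal t \<and> 0 < t"
    using eventually_gt_at_top by (rule eventually_conj)
  then obtain t where t: "ennreal \<sigma> < \<phi> t / ennreal t" "0 < t" by (auto simp: eventually_at_top_linorder)
  have "ennreal (\<sigma> * t) \<le> ennreal \<sigma> * ennreal t" using t(2) by (simp add: ennreal_mult'')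
  also have "\<dots> \<le> \<phi> t / ennreal t * ennreal t" using t by (intro mult_right_mono) auto
  also have "\<dots> = \<phi> t" using t(2) by (simp add: ennreal_divide_times divide_mult_eq ennreal_times_divide mult_divide_eq_ennreal)
  finally show ?thesis using that t(2) by blast
qed

lemma suminf_ennreal_ge: "(f :: nat \<Rightarrow> ennreal) n \<le> (\<Sum>n. f n)"
  using sum_le_suminf[OF summableI, of "{n}" f] by simp

lemma nn_integral_stages:
  fixes Q :: "nat \<Rightarrow> 'a::euclidean_space set" and w :: "nat \<Rightarrow> ennreal"
  assumes S: "\<Omega> \<in> lmeasurable" and Q: "\<And>n. Q n \<in> lmeasurable" "\<And>n. Q n \<subseteq> \<Omega>" "\<And>n. measure lebesgue (Q n) \<le> \<mu> n"
    and K: "K < \<infinity>" and fin: "(\<Sum>n. ennreal (\<mu> n) * w n) < \<infinity>"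
  shows "(\<integral>\<^sup>+ x. (K + (\<Sum>n. w n * indicator (Q n) x)) \<partial>lebesgue_on \<Omega>) < \<infinity>"
    "(\<lambda>x. K + (\<Sum>n. w n * indicator (Q n) x)) \<in> borel_measurable (lebesgue_on \<Omega>)"
proof -
  have SS: "\<Omega> \<in> sets lebesgue" using S by auto
  have Qs: "Q n \<in> sets (lebesgue_on \<Omega>)" for n using Q(1,2)[of n] SS by (auto simp: sets_restrict_space_iff)
  note [measurable] = Qs
  show "(\<lambda>x. K + (\<Sum>n. w n * indicator (Q n) x)) \<in> borel_measurable (lebesgue_on \<Omega>)" by measurable
  have e: "emeasure (lebesgue_on \<Omega>) (Q n) \<le> ennreal (\<mu> n)" for n
  proof -
    have "emeasure (lebesgue_on \<Omega>) (Q n) = emeasure lebesgue (Q n)"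
      by (rule emeasure_restrict_space) (use SS Q(2)[of n] in auto)
    also have "\<dots> = ennreal (measure lebesgue (Q n))" by (rule emeasure_eq_measure2) (use Q(1)[of n] in auto)
    finally show ?thesis using Q(3)[of n] by (simp add: ennreal_leI)
  qed
  have "(\<integral>\<^sup>+ x. (K + (\<Sum>n. w n * indicator (Q n) x)) \<partial>lebesgue_on \<Omega>) =
      K * emeasure (lebesgue_on \<Omega>) (space (lebesgue_on \<Omega>)) + (\<Sum>n. w n * emeasure (lebesgue_on \<Omega>) (Q n))"
    by (simp add: nn_integral_add nn_integral_suminf nn_integral_cmult_indicator Qs)
  also have "\<dots> < \<infinity>"
  proof -
    have "emeasure (lebesgue_on \<Omega>) (space (lebesgue_on \<Omega>)) = emeasure lebesgue \<Omega>"
      using SS by (subst emeasure_restrict_space) (auto simp: space_restrict_space)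
    also have "\<dots> < \<infinity>" using S by (auto simp: fmeasurable_def)
    finally have 1: "K * emeasure (lebesgue_on \<Omega>) (space (lebesgue_on \<Omega>)) < \<infinity>" using K by (simp add: ennreal_mult_less_top)
    have "(\<Sum>n. w n * emeasure (lebesgue_on \<Omega>) (Q n)) \<le> (\<Sum>n. ennreal (\<mu> n) * w n)"
      by (intro suminf_le summableI) (use e in \<open>auto simp: mult.commute intro: mult_left_mono\<close>)
    then have "(\<Sum>n. w n * emeasure (lebesgue_on \<Omega>) (Q n)) < \<infinity>" using fin by (rule le_less_trans)
    then show ?thesis using 1 by simp
  qed
  finally show "(\<integral>\<^sup>+ x. (K + (\<Sum>n. w n * indicator (Q n) x)) \<partial>lebesgue_on \<Omega>) < \<infinity>" .
qed

lemma integral_nonpos_neq_0: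
  fixes q :: "'a::euclidean_space \<Rightarrow> real"
  assumes \<Omega>: "\<Omega> \<in> sets lebesgue" and i: "integrable (lebesgue_on \<Omega>) q" and le: "\<And>x. x \<in> \<Omega> \<Longrightarrow> q x \<le> 0"
    and U: "open U" "U \<noteq> {}" "U \<subseteq> \<Omega>" "\<And>x. x \<in> U \<Longrightarrow> q x \<noteq> 0"
  shows "(LINT x|lebesgue_on \<Omega>. q x) \<noteq> 0"
proof
  assume "(LINT x|lebesgue_on \<Omega>. q x) = 0"
  then have "(LINT x|lebesgue_on \<Omega>. - q x) = 0" by simp
  then have "AE x in lebesgue_on \<Omega>. - q x = 0"
    by (subst (asm) integral_nonneg_eq_0_iff_AE) (use i le in \<open>auto intro!: AE_I2\<close>)
  then have "AE x in lebesgue. x \<in> \<Omega> \<longrightarrow> q x = 0"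
    using \<Omega> by (subst (asm) AE_restrict_space_iff) auto
  then have "AE x in lebesgue. x \<notin> U" by eventually_elim (use U in auto)
  then have "U \<in> null_sets lebesgue" using open_lebesgue[OF U(1)] by (simp add: AE_iff_null_sets)
  then show False using open_not_negligible[OF U(1,2)] by (simp add: negligible_iff_null_sets)
qed

lemma weak_pd_axis:
  assumes "\<And>i. weak_pd \<Omega> i v (dv i)"
  shows "weak_pd \<Omega> i (\<lambda>x. axis J (v x) $ I) (\<lambda>x. if I = J then dv i x else 0)"
  using assms weak_pd_zero by (cases "I = J") (simp_all add: axis_component)

lemma compact_support_bounded:
  fixes h :: "'a::topological_space \<Rightarrow> real"
  assumes "continuous_on UNIV h" "compact K" "\<And>x. x \<notin> K \<Longrightarrow> h x = 0"
  obtains B where "0 \<le> B" "\<And>x. \<bar>h x\<bar> \<le> B"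
proof -
  have "compact (h ` K)" by (rule compact_continuous_image[OF continuous_on_subset[OF assms(1)] assms(2)]) simp
  then have "bounded (h ` K)" by (rule compact_imp_bounded)
  then obtain B0 where B0: "\<And>x. x \<in> K \<Longrightarrow> \<bar>h x\<bar> \<le> B0" unfolding bounded_iff by auto
  have "\<bar>h x\<bar> \<le> max B0 0" for x
    using B0[of x] assms(3)[of x] by (cases "x \<in> K") (auto simp: le_max_iff_disj)
  then show ?thesis using that[of "max B0 0"] by simp
qed

text \<open>An abbreviation, so that the conclusion reached in each case is literally that of the
  theorem.\<close>

abbreviation has_gap_weight ::
  "(real \<Rightarrow> ennreal) \<Rightarrow> (real \<Rightarrow> ennreal) \<Rightarrow> real \<Rightarrow> ('n::{finite,linorder}) space set \<Rightarrow> nat \<Rightarrow> bool" where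
  "has_gap_weight \<phi> \<psi> \<kappa> \<Omega> k \<equiv> \<exists>a :: 'n space \<Rightarrow> real.
    a \<in> borel_measurable (lebesgue_on \<Omega>) \<and>
    (\<forall>x\<in>\<Omega>. a x \<ge> 0) \<and>
    (\<exists>C. has_modulus_near_0 \<Omega> a (\<lambda>t. C * ln (1 / t) powr (- \<kappa>))) \<and>
    (let \<Phi> = (\<lambda>x t. \<phi> t + ennreal (a x) * \<psi> t) in
      H_d \<Phi> \<Omega> k \<noteq> W_d \<Phi> \<Omega> k \<and>
      (\<exists>b\<in>Orlicz_forms (conjugate \<Phi>) \<Omega> (CARD('n) - k - 1).
        (INF \<omega>\<in>W_d_c \<Phi> \<Omega> k. functional \<Phi> b \<Omega> k \<omega>)
          < (INF \<omega>\<in>test_forms \<Omega> k. functional \<Phi> b \<Omega> k \<omega>)))"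

text \<open>The construction for an abstract pair \<open>f\<close>, \<open>g\<close>, so that their
  roles can be exchanged afterwards. \<open>O1\<close> bounds the modular of \<open>du\<close>, and
  \<open>O2\<close> selects for each stage the point \<open>T n\<close> used in Young's inequality.
  The gradients of \<open>f\<close> and \<open>g\<close> are never nonzero at the same point, so
  \<open>b \<and> du\<close> reduces to \<open>g d\<zeta> \<and> df\<close>; by \<open>pair\<close>
  only one of its two components survives, and it has a sign.\<close>

lemma pair_gap:
  fixes x0 :: "('n::{finite,linorder}) space" and r :: real and J L :: "'n set" and i1 i2 :: 'n
    and \<zeta> \<theta> f f1 f2 g g1 g2 :: "'n space \<Rightarrow> real" and Df Dg Q :: "nat \<Rightarrow> 'n space set"
    and \<mu> v s \<rho> :: "nat \<Rightarrow> real" and \<phi> \<psi> :: "real \<Rightarrow> ennreal" and \<omega> :: "real \<Rightarrow> real"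
  assumes \<Omega>: "\<Omega> = ball x0 r" and ne: "i1 \<noteq> i2"
    and JL: "J \<inter> L = {}" "J \<union> L = - {i1, i2}"
    and \<zeta>: "C1_on UNIV \<zeta>" "compact K\<zeta>" "\<And>x. x \<notin> K\<zeta> \<Longrightarrow> \<zeta> x = 0" "\<And>x. \<bar>\<zeta> x\<bar> \<le> 1"
    and \<theta>: "C1_on UNIV \<theta>" "compact K\<theta>" "K\<theta> \<subseteq> \<Omega>" "\<And>x. x \<notin> K\<theta> \<Longrightarrow> \<theta> x = 0" "\<And>x. \<bar>\<theta> x\<bar> \<le> 1"
    and U: "open U" "K\<zeta> \<subseteq> U" "\<And>x. x \<in> U \<Longrightarrow> \<theta> x = 1"
    and wf: "\<And>j. weak_pd \<Omega> j f (\<lambda>x. if j = i1 then f1 x else if j = i2 then f2 x else 0)"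
    and wg: "\<And>j. weak_pd \<Omega> j g (\<lambda>x. if j = i1 then g1 x else if j = i2 then g2 x else 0)"
    and bd: "\<And>x. x \<in> \<Omega> \<Longrightarrow> \<bar>f x\<bar> \<le> 1" "\<And>x. x \<in> \<Omega> \<Longrightarrow> \<bar>g x\<bar> \<le> 1"
    and Df: "\<And>x. x \<in> \<Omega> \<Longrightarrow> f1 x \<noteq> 0 \<or> f2 x \<noteq> 0 \<Longrightarrow> \<exists>n. x \<in> Df n \<and> \<bar>f1 x\<bar> \<le> v n \<and> \<bar>f2 x\<bar> \<le> v n"
    and Dg: "\<And>x. x \<in> \<Omega> \<Longrightarrow> g1 x \<noteq> 0 \<or> g2 x \<noteq> 0 \<Longrightarrow> \<exists>n. x \<in> Dg n \<and> \<bar>g1 x\<bar> \<le> s n \<and> \<bar>g2 x\<bar> \<le> s n"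
    and Q: "\<And>n. Q n \<in> lmeasurable" "\<And>n. Q n \<subseteq> \<Omega>" "\<And>n. measure lebesgue (Q n) \<le> \<mu> n"
      "\<And>n. Df n \<inter> \<Omega> \<subseteq> Q n" "\<And>n. Dg n \<inter> \<Omega> \<subseteq> Q n"
    and dist: "\<And>n m x y. x \<in> Df n \<Longrightarrow> y \<in> Dg m \<Longrightarrow> \<rho> m \<le> dist x y" "\<And>m. 0 < \<rho> m" and Dne: "(\<Union>n. Df n) \<noteq> {}"
    and pos: "\<And>n. 0 \<le> v n" "\<And>n. 0 \<le> s n"
    and or: "orlicz_function \<phi>" "orlicz_function \<psi>" "\<And>t. 0 \<le> t \<Longrightarrow> \<phi> t < \<infinity>" "\<And>t. 0 \<le> t \<Longrightarrow> \<psi> t < \<infinity>"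
    and O1: "\<And>c. 0 < c \<Longrightarrow> (\<Sum>n. ennreal (\<mu> n) * \<phi> (c * (v n + 1))) < \<infinity>"
    and O2: "\<And>c. 0 < c \<Longrightarrow> \<exists>T. (\<forall>n. 0 < T n \<and> ennreal (c * s n * T n) \<le> ennreal (\<omega> (\<rho> n)) * \<psi> (T n)) \<and>
        (\<Sum>n. ennreal (\<mu> n) * ennreal (c * s n * T n)) < \<infinity>"
    and \<omega>: "mono \<omega>" "\<omega> 0 = 0" "\<And>t. \<omega> t \<le> \<omega>m"
      "\<And>s t. 0 \<le> s \<Longrightarrow> 0 \<le> t \<Longrightarrow> \<bar>\<omega> s - \<omega> t\<bar> \<le> \<omega> \<bar>s - t\<bar>"
      "0 < \<delta>" "\<And>t. 0 < t \<Longrightarrow> t < \<delta> \<Longrightarrow> \<omega> t \<le> C * ln (1 / t) powr (- \<kappa>)"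
    and pair: "\<And>x. x \<in> \<Omega> \<Longrightarrow> f1 x * pd i2 \<zeta> x = 0" "\<And>x. x \<in> \<Omega> \<Longrightarrow> g x * pd i1 \<zeta> x * f2 x \<le> 0"
      "open U0" "U0 \<noteq> {}" "U0 \<subseteq> \<Omega>" "\<And>x. x \<in> U0 \<Longrightarrow> g x * pd i1 \<zeta> x * f2 x \<noteq> 0"
  shows "has_gap_weight \<phi> \<psi> \<kappa> \<Omega> (card J)"
proof -
  have op: "open \<Omega>" by (simp add: \<Omega>)
  have S: "\<Omega> \<in> sets lebesgue" by (rule open_lebesgue[OF op])
  have Sm: "\<Omega> \<in> lmeasurable" by (simp add: \<Omega>)
  define D where "D = (\<Union>n. Df n)"
  define a where "a x = \<omega> (infdist x D)" for x
  have \<omega>0: "0 \<le> \<omega> t" if "0 \<le> t" for t using monoD[OF \<omega>(1) that] \<omega>(2) by simp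
  have \<omega>m: "0 \<le> \<omega>m" using \<omega>(3)[of 0] \<omega>(2) by simp
  have a0: "0 \<le> a x" for x unfolding a_def by (rule \<omega>0[OF infdist_nonneg])
  have aD: "a x = 0" if "x \<in> Df n" for x n 
  proof -
    have "x \<in> D" using that by (auto simp: D_def)
    then show ?thesis using \<omega>(2) by (simp add: a_def)
  qed
  have aDg: "\<omega> (\<rho> n) \<le> a x" if "x \<in> Dg n" for x n
  proof -
    have Dn: "D \<noteq> {}" unfolding D_def by (rule Dne)
    have "\<rho> n \<le> (INF y\<in>D. dist x y)"
    proof (rule cINF_greatest[OF Dn])
      fix y assume "y \<in> D"
      then obtain m where m: "y \<in> Df m" unfolding D_def by blast
      show "\<rho> n \<le> dist x y" unfolding dist_commute[of x y] by (rule dist(1)[OF m that])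
    qed
    then have "\<rho> n \<le> infdist x D" by (simp only: infdist_notempty[OF Dn])
    then show ?thesis unfolding a_def by (rule monoD[OF \<omega>(1)])
  qed
  have am: "a \<in> borel_measurable (lebesgue_on \<Omega>)"
  proof -
    have "(\<lambda>x. infdist x D) \<in> borel_measurable borel"
      by (intro borel_measurable_continuous_onI continuous_intros)
    from measurable_compose[OF this borel_measurable_mono[OF \<omega>(1)]]
    have "a \<in> borel_measurable lborel" unfolding a_def[abs_def] by simp
    then have "a \<in> borel_measurable lebesgue" by (rule measurable_completion)
    then show ?thesis by (rule measurable_restrict_space1)
  qed
  have mod: "has_modulus_near_0 \<Omega> a (\<lambda>t. C * ln (1 / t) powr (- \<kappa>))"
    unfolding has_modulus_near_0_def
  proof (intro exI[of _ \<delta>] conjI ballI impI \<omega>(5))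
    fix x y :: "'n space" assume xy: "0 < dist x y \<and> dist x y < \<delta>"
    have "\<bar>a x - a y\<bar> \<le> \<omega> \<bar>infdist x D - infdist y D\<bar>"
      unfolding a_def by (rule \<omega>(4)[OF infdist_nonneg infdist_nonneg])
    also have "\<dots> \<le> \<omega> (dist x y)"
      using infdist_triangle[of x D y] infdist_triangle[of y D x] dist_commute[of x y]
      by (intro monoD[OF \<omega>(1)]) linarith
    also have "\<dots> \<le> C * ln (1 / dist x y) powr (- \<kappa>)" using xy by (intro \<omega>(6)) auto
    finally show "\<bar>a x - a y\<bar> \<le> C * ln (1 / dist x y) powr (- \<kappa>)" .
  qed
  define \<Phi> where "\<Phi> = (\<lambda>x t. \<phi> t + ennreal (a x) * \<psi> t)"
  define df where "df j x = (if j = i1 then f1 x else if j = i2 then f2 x else 0)" for j x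
  define dg where "dg j x = (if j = i1 then g1 x else if j = i2 then g2 x else 0)" for j x
  have wf': "weak_pd \<Omega> j f (df j)" and wg': "weak_pd \<Omega> j g (dg j)" for j
    using wf[of j] wg[of j] by (simp_all add: df_def[abs_def] dg_def[abs_def])
  have lif: "loc_int \<Omega> f" "loc_int \<Omega> g" "loc_int \<Omega> (df j)" "loc_int \<Omega> (dg j)" for j
    using wf'[of j] wg'[of j] unfolding weak_pd_def by auto
  have ms: "f \<in> borel_measurable (lebesgue_on \<Omega>)" "g \<in> borel_measurable (lebesgue_on \<Omega>)"
    "df j \<in> borel_measurable (lebesgue_on \<Omega>)" "dg j \<in> borel_measurable (lebesgue_on \<Omega>)" for j
    using lif unfolding \<Omega> by (auto intro: loc_int_ball_measurable)
  have cm: "h \<in> borel_measurable (lebesgue_on \<Omega>)" if "continuous_on UNIV h" for h :: "'n space \<Rightarrow> real"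
    by (rule continuous_imp_measurable_on_sets_lebesgue[OF continuous_on_subset[OF that] S]) simp
  define vu where "vu x = \<theta> x * f x" for x
  define vb where "vb x = \<zeta> x * g x" for x
  define dvu where "dvu j x = \<theta> x * df j x + pd j \<theta> x * f x" for j x
  define dvb where "dvb j x = \<zeta> x * dg j x + pd j \<zeta> x * g x" for j x
  have wu: "weak_pd \<Omega> j vu (dvu j)" and wb: "weak_pd \<Omega> j vb (dvb j)" for j
    unfolding vu_def[abs_def] vb_def[abs_def] dvu_def[abs_def] dvb_def[abs_def]
    by (rule weak_pd_mult_C1[OF wf' \<theta>(1) S], rule weak_pd_mult_C1[OF wg' \<zeta>(1) S])
  have mdv: "dvu j \<in> borel_measurable (lebesgue_on \<Omega>)" "dvb j \<in> borel_measurable (lebesgue_on \<Omega>)" for j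
    unfolding dvu_def[abs_def] dvb_def[abs_def]
    by (intro borel_measurable_add borel_measurable_times ms cm C1_onD(2,3) \<theta>(1) \<zeta>(1))+
  define pu where "pu I i x = (if I = J then dvu i x else 0)" for I i x
  define pb where "pb I i x = (if I = L then dvb i x else 0)" for I i x
  define u :: "'n form" where "u x = axis J (vu x)" for x
  define du where "du = dform pu"
  define b where "b = dform pb"
  define w :: "'n form" where "w x = axis L (vb x)" for x
  have wu': "weak_pd \<Omega> i (\<lambda>x. u x $ I) (pu I i)" and wb': "weak_pd \<Omega> i (\<lambda>x. w x $ I) (pb I i)" for I i
    using weak_pd_axis[of \<Omega> vu dvu i J I, OF wu] weak_pd_axis[of \<Omega> vb dvb i L I, OF wb]
    by (simp_all add: u_def w_def pu_def[abs_def] pb_def[abs_def])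
  have ucov: "u x \<in> covectors (card J)" for x by (auto simp: u_def covectors_def axis_component)
  have hw: "has_weak_d \<Omega> (card J) u du"
    unfolding du_def by (rule has_weak_d_dform[OF S wu' _ ucov]) (auto simp: pu_def)
  have dm: "dform p \<in> borel_measurable (lebesgue_on \<Omega>)"
    if "\<And>I i. p I i \<in> borel_measurable (lebesgue_on \<Omega>)" for p :: "'n set \<Rightarrow> 'n \<Rightarrow> 'n space \<Rightarrow> real"
    by (rule measurable_vec_components) (use that in \<open>auto simp: dform_def intro!: borel_measurable_sum borel_measurable_times\<close>)
  have dum: "du \<in> borel_measurable (lebesgue_on \<Omega>)" and bm: "b \<in> borel_measurable (lebesgue_on \<Omega>)"
  proof -
    have "pu I i \<in> borel_measurable (lebesgue_on \<Omega>)" for I i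
      by (cases "I = J") (simp_all add: pu_def[abs_def] mdv)
    then show "du \<in> borel_measurable (lebesgue_on \<Omega>)" unfolding du_def by (rule dm)
    have "pb I i \<in> borel_measurable (lebesgue_on \<Omega>)" for I i
      by (cases "I = L") (simp_all add: pb_def[abs_def] mdv)
    then show "b \<in> borel_measurable (lebesgue_on \<Omega>)" unfolding b_def by (rule dm)
  qed
  have cardN: "card L + 1 = CARD('n) - card J - 1"
  proof -
    have "card (J \<union> L) = card J + card L" by (rule card_Un_disjoint) (use JL in auto)
    moreover have "card (- {i1, i2}) = CARD('n) - 2" using ne by (simp add: Compl_eq_Diff_UNIV card_Diff_subset)
    moreover have "2 \<le> CARD('n)" using card_mono[of UNIV "{i1, i2}"] ne by simp
    ultimately show ?thesis using JL(2) by simp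
  qed
  have bcov: "b x \<in> covectors (CARD('n) - card J - 1)" if "x \<in> \<Omega>" for x
    unfolding b_def cardN[symmetric] by (rule dform_covectors) (auto simp: pb_def)
  have uL1: "u \<in> L1_forms \<Omega> (card J)"
  proof -
    have "integrable (lebesgue_on \<Omega>) (\<lambda>x. f x * \<theta> x)"
      by (rule integrable_test[OF lif(1) S \<theta>(2,3) continuous_on_subset[OF C1_onD(3)[OF \<theta>(1)]] \<theta>(4)]) auto
    then have "integrable (lebesgue_on \<Omega>) (\<lambda>x. u x $ I)" for I
      by (cases "I = J") (simp_all add: u_def axis_component vu_def mult.commute)
    then show ?thesis unfolding L1_forms_def using ucov by (auto intro: integrable_vec_components)
  qed
  obtain B\<theta> where B\<theta>: "\<And>j. 0 \<le> B\<theta> j" "\<And>j x. \<bar>pd j \<theta> x\<bar> \<le> B\<theta> j"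
  proof -
    have "\<exists>B. 0 \<le> B \<and> (\<forall>x. \<bar>pd j \<theta> x\<bar> \<le> B)" for j
      by (rule compact_support_bounded[OF C1_onD(2)[OF \<theta>(1)] \<theta>(2)])
        (use pd_zero_outside[OF open_UNIV \<theta>(1,2)] \<theta>(4) in auto)
    then show ?thesis using that by metis
  qed
  have pd\<zeta>0: "pd j \<zeta> x = 0" if "x \<notin> K\<zeta>" for j x
    using pd_zero_outside[OF open_UNIV \<zeta>(1,2) _ _ _ that] \<zeta>(3) by auto
  obtain B\<zeta> where B\<zeta>: "\<And>j. 0 \<le> B\<zeta> j" "\<And>j x. \<bar>pd j \<zeta> x\<bar> \<le> B\<zeta> j"
  proof -
    have "\<exists>B. 0 \<le> B \<and> (\<forall>x. \<bar>pd j \<zeta> x\<bar> \<le> B)" for j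
      by (rule compact_support_bounded[OF C1_onD(2)[OF \<zeta>(1)] \<zeta>(2)]) (use pd\<zeta>0 in auto)
    then show ?thesis using that by metis
  qed
  define Cn where "Cn = real CARD('n set)"
  have Cn: "1 \<le> Cn" by (simp add: Cn_def Suc_le_eq)
  define B where "B = 1 + (\<Sum>j\<in>UNIV. B\<theta> j) + (\<Sum>j\<in>UNIV. B\<zeta> j)"
  have B: "1 \<le> B" using B\<theta> B\<zeta> by (simp add: B_def sum_nonneg)
  have sum2: "(\<Sum>j\<in>UNIV. \<bar>if j = i1 then p else if j = i2 then q else 0\<bar>) = \<bar>p\<bar> + \<bar>q\<bar>" for p q :: real
  proof -
    have "(\<Sum>j\<in>UNIV. \<bar>if j = i1 then p else if j = i2 then q else 0\<bar>) =
      (\<Sum>j\<in>UNIV. (if j = i1 then \<bar>p\<bar> else 0) + (if j = i2 then \<bar>q\<bar> else 0))"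
      using ne by (intro sum.cong) auto
    then show ?thesis by (simp add: sum.distrib)
  qed
  have ndu: "norm (du x) \<le> Cn * (\<bar>f1 x\<bar> + \<bar>f2 x\<bar> + B)" if x: "x \<in> \<Omega>" for x
  proof -
    have "norm (du x) \<le> Cn * (\<Sum>j\<in>UNIV. \<bar>pu J j x\<bar>)"
      unfolding du_def Cn_def by (rule dform_single(3)) (simp add: pu_def)
    also have "(\<Sum>j\<in>UNIV. \<bar>pu J j x\<bar>) \<le> (\<Sum>j\<in>UNIV. \<bar>df j x\<bar> + B\<theta> j)"
    proof (rule sum_mono)
      fix j
      have "\<bar>\<theta> x * df j x\<bar> \<le> 1 * \<bar>df j x\<bar>" unfolding abs_mult using \<theta>(5) by (intro mult_right_mono) auto
      moreover have "\<bar>pd j \<theta> x * f x\<bar> \<le> B\<theta> j * 1" unfolding abs_mult using B\<theta> bd(1)[OF x] by (intro mult_mono) auto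
      ultimately show "\<bar>pu J j x\<bar> \<le> \<bar>df j x\<bar> + B\<theta> j" unfolding pu_def dvu_def by simp
    qed
    also have "\<dots> = \<bar>f1 x\<bar> + \<bar>f2 x\<bar> + (\<Sum>j\<in>UNIV. B\<theta> j)" unfolding sum.distrib df_def sum2 ..
    also have "\<dots> \<le> \<bar>f1 x\<bar> + \<bar>f2 x\<bar> + B" using B\<zeta> by (simp add: B_def sum_nonneg)
    finally show ?thesis using Cn by simp
  qed
  have nb: "norm (b x) \<le> Cn * (\<bar>g1 x\<bar> + \<bar>g2 x\<bar> + B)" if x: "x \<in> \<Omega>" for x
  proof -
    have "norm (b x) \<le> Cn * (\<Sum>j\<in>UNIV. \<bar>pb L j x\<bar>)"
      unfolding b_def Cn_def by (rule dform_single(3)) (simp add: pb_def)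
    also have "(\<Sum>j\<in>UNIV. \<bar>pb L j x\<bar>) \<le> (\<Sum>j\<in>UNIV. \<bar>dg j x\<bar> + B\<zeta> j)"
    proof (rule sum_mono)
      fix j
      have "\<bar>\<zeta> x * dg j x\<bar> \<le> 1 * \<bar>dg j x\<bar>" unfolding abs_mult using \<zeta>(4) by (intro mult_right_mono) auto
      moreover have "\<bar>pd j \<zeta> x * g x\<bar> \<le> B\<zeta> j * 1" unfolding abs_mult using B\<zeta> bd(2)[OF x] by (intro mult_mono) auto
      ultimately show "\<bar>pb L j x\<bar> \<le> \<bar>dg j x\<bar> + B\<zeta> j" unfolding pb_def dvb_def by simp
    qed
    also have "\<dots> = \<bar>g1 x\<bar> + \<bar>g2 x\<bar> + (\<Sum>j\<in>UNIV. B\<zeta> j)" unfolding sum.distrib dg_def sum2 ..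
    also have "\<dots> \<le> \<bar>g1 x\<bar> + \<bar>g2 x\<bar> + B" using B\<theta> by (simp add: B_def sum_nonneg)
    finally show ?thesis using Cn by simp
  qed
  \<comment> \<open>Absorbs \<open>Cn * (2 * v n + B)\<close> into \<open>c * (v n + 1)\<close>, the
    shape of the argument in \<open>O1\<close>.\<close>
  define c where "c = Cn * (2 + B)"
  have c: "0 < c" using Cn B by (simp add: c_def)
  \<comment> \<open>On the stages of \<open>f\<close> the weight vanishes and only
    \<open>\<phi>\<close> counts; where the gradient of \<open>f\<close> is zero, \<open>du\<close>
    comes from the gradient of \<open>\<theta>\<close> alone and is bounded.\<close>
  have du_fin: "(\<integral>\<^sup>+ x. \<Phi> x (norm (du x)) \<partial>lebesgue_on \<Omega>) < \<infinity>"
  proof -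
    define K0 where "K0 = \<phi> (Cn * B) + ennreal \<omega>m * \<psi> (Cn * B)"
    define wt where "wt n = \<phi> (c * (v n + 1))" for n
    have "0 \<le> Cn * B" using Cn B by simp
    then have K0: "K0 < \<infinity>" using or(3,4) by (simp add: K0_def ennreal_mult_less_top)
    have "(\<integral>\<^sup>+ x. \<Phi> x (norm (du x)) \<partial>lebesgue_on \<Omega>) \<le> (\<integral>\<^sup>+ x. (K0 + (\<Sum>n. wt n * indicator (Q n) x)) \<partial>lebesgue_on \<Omega>)"
    proof (rule nn_integral_mono)
      fix x assume "x \<in> space (lebesgue_on \<Omega>)"
      then have x: "x \<in> \<Omega>" by simp
      show "\<Phi> x (norm (du x)) \<le> K0 + (\<Sum>n. wt n * indicator (Q n) x)"
      proof (cases "f1 x \<noteq> 0 \<or> f2 x \<noteq> 0")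
        case True
        then obtain n where n: "x \<in> Df n" "\<bar>f1 x\<bar> \<le> v n" "\<bar>f2 x\<bar> \<le> v n" using Df[OF x] by blast
        have "norm (du x) \<le> Cn * (2 * v n + B)" by (rule order_trans[OF ndu[OF x]]) (use n Cn in simp)
        also have "\<dots> \<le> c * (v n + 1)"
        proof -
          have "2 * v n + B \<le> (2 + B) * (v n + 1)" using pos(1)[of n] B by (simp add: algebra_simps)
          then show ?thesis unfolding c_def mult.assoc using Cn by (intro mult_left_mono) auto
        qed
        finally have "\<phi> (norm (du x)) \<le> wt n" unfolding wt_def by (intro orlicz_mono[OF or(1)]) auto
        also have "\<dots> = wt n * indicator (Q n) x" using Q(4)[of n] n x by auto
        also have "\<dots> \<le> (\<Sum>n. wt n * indicator (Q n) x)" by (rule suminf_ennreal_ge)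
        finally show ?thesis using aD[OF n(1)] by (simp add: \<Phi>_def add_increasing)
      next
        case False
        then have n: "norm (du x) \<le> Cn * B" using ndu[OF x] by simp
        have "\<phi> (norm (du x)) \<le> \<phi> (Cn * B)" "\<psi> (norm (du x)) \<le> \<psi> (Cn * B)" using n or by (auto intro: orlicz_mono)
        moreover have "ennreal (a x) \<le> ennreal \<omega>m" unfolding a_def by (intro ennreal_leI \<omega>(3))
        ultimately have "\<Phi> x (norm (du x)) \<le> K0" unfolding \<Phi>_def K0_def by (intro add_mono mult_mono) auto
        then show ?thesis by (rule add_increasing2[rotated]) simp
      qed
    qed
    also have "\<dots> < \<infinity>"
      by (rule nn_integral_stages(1)[OF Sm Q(1-3) K0]) (use O1[OF c] in \<open>simp add: wt_def\<close>)
    finally show ?thesis .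
  qed
  obtain T where T: "\<And>n. 0 < T n" "\<And>n. ennreal (2 * Cn * s n * T n) \<le> ennreal (\<omega> (\<rho> n)) * \<psi> (T n)"
    "(\<Sum>n. ennreal (\<mu> n) * ennreal (2 * Cn * s n * T n)) < \<infinity>"
    using O2[of "2 * Cn"] Cn by auto
  obtain T' where T': "0 < T'" "ennreal (Cn * B * T') \<le> \<phi> T'" using orlicz_superlinear[OF or(1)] .
  define H where "H x = ennreal (Cn * B * T') + (\<Sum>n. ennreal (2 * Cn * s n * T n) * indicator (Q n) x)" for x
  have H: "(\<integral>\<^sup>+ x. H x \<partial>lebesgue_on \<Omega>) < \<infinity>" "H \<in> borel_measurable (lebesgue_on \<Omega>)"
    unfolding H_def[abs_def] by (rule nn_integral_stages[OF Sm Q(1-3) _ T(3)], simp)+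
  \<comment> \<open>The bounded part of \<open>b\<close>, due to the gradient of
    \<open>\<zeta>\<close>, is paired with \<open>\<phi>\<close>, and the singular part with
    \<open>a x * \<psi>\<close>; so each summand of \<open>\<Phi>\<close> is used once.\<close>
  have young: "ennreal (norm (b x) * t) \<le> H x + \<Phi> x t" if x: "x \<in> \<Omega>" and t: "0 \<le> t" for x t
  proof -
    have CB: "0 \<le> Cn * B" using Cn B by simp
    have 1: "ennreal (Cn * B * t) \<le> ennreal (Cn * B * T') + 1 * \<phi> t"
      by (rule young_convex[OF or(1) T'(1) CB t]) (simp add: T'(2))
    show ?thesis
    proof (cases "g1 x \<noteq> 0 \<or> g2 x \<noteq> 0")
      case True
      then obtain n where n: "x \<in> Dg n" "\<bar>g1 x\<bar> \<le> s n" "\<bar>g2 x\<bar> \<le> s n" using Dg[OF x] by blast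
      have sn: "0 \<le> 2 * Cn * s n" using Cn pos(2)[of n] by simp
      have "norm (b x) \<le> Cn * (2 * s n + B)" by (rule order_trans[OF nb[OF x]]) (use n Cn in simp)
      also have "\<dots> = 2 * Cn * s n + Cn * B" by (simp add: algebra_simps)
      finally have "norm (b x) * t \<le> (2 * Cn * s n + Cn * B) * t" using t by (intro mult_right_mono)
      then have "ennreal (norm (b x) * t) \<le> ennreal (2 * Cn * s n * t + Cn * B * t)"
        by (intro ennreal_leI) (simp add: distrib_right)
      also have "\<dots> = ennreal (2 * Cn * s n * t) + ennreal (Cn * B * t)"
        by (rule ennreal_plus[OF mult_nonneg_nonneg[OF sn t] mult_nonneg_nonneg[OF CB t]])
      also have "\<dots> \<le> (ennreal (2 * Cn * s n * T n) + ennreal (\<omega> (\<rho> n)) * \<psi> t) + (ennreal (Cn * B * T') + 1 * \<phi> t)"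
        by (intro add_mono 1 young_convex[OF or(2) T(1) sn t T(2)])
      also have "\<dots> \<le> ((\<Sum>n. ennreal (2 * Cn * s n * T n) * indicator (Q n) x) + ennreal (a x) * \<psi> t) + (ennreal (Cn * B * T') + 1 * \<phi> t)"
      proof (intro add_mono order_refl mult_right_mono ennreal_leI aDg[OF n(1)])
        have "ennreal (2 * Cn * s n * T n) = ennreal (2 * Cn * s n * T n) * indicator (Q n) x"
          using Q(5)[of n] n x by auto
        also have "\<dots> \<le> (\<Sum>n. ennreal (2 * Cn * s n * T n) * indicator (Q n) x)"
          by (rule suminf_ennreal_ge[of "\<lambda>n. ennreal (2 * Cn * s n * T n) * indicator (Q n) x"])
        finally show "ennreal (2 * Cn * s n * T n) \<le> (\<Sum>n. ennreal (2 * Cn * s n * T n) * indicator (Q n) x)" .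
      qed simp
      also have "\<dots> = H x + \<Phi> x t" by (simp add: H_def \<Phi>_def add_ac)
      finally show ?thesis .
    next
      case False
      then have "norm (b x) * t \<le> Cn * B * t" using nb[OF x] t by (intro mult_right_mono) auto
      then have "ennreal (norm (b x) * t) \<le> ennreal (Cn * B * T') + 1 * \<phi> t"
        using 1 ennreal_leI order_trans by blast
      also have "\<dots> \<le> H x + \<Phi> x t" unfolding H_def \<Phi>_def by (intro add_mono) auto
      finally show ?thesis .
    qed
  qed
  have K\<zeta>\<Omega>: "K\<zeta> \<subseteq> \<Omega>"
  proof
    fix x assume "x \<in> K\<zeta>"
    then have "\<theta> x = 1" using U by auto
    then have "x \<in> K\<theta>" using \<theta>(4)[of x] by (cases "x \<in> K\<theta>") auto
    then show "x \<in> \<Omega>" using \<theta>(3) by auto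
  qed
  have zero: "integral_top \<Omega> (\<lambda>x. wedge (b x) (ext_d \<eta> x)) = 0" if "\<eta> \<in> smooth_forms \<Omega> (card J)" for \<eta>
  proof -
    have sm: "smooth_on \<Omega> \<eta>" using that by (simp add: smooth_forms_def)
    have w0: "w x = 0" if "x \<notin> K\<zeta>" for x using \<zeta>(3)[OF that] by (simp add: w_def vb_def vec_eq_iff axis_component)
    have pb0: "pb I i x = 0" if "x \<notin> K\<zeta>" for I i x using \<zeta>(3)[OF that] pd\<zeta>0[OF that] by (simp add: pb_def dvb_def)
    have pbc: "pb I i x = 0" if "card I \<noteq> card L" for I i x using that by (auto simp: pb_def)
    show ?thesis unfolding b_def
      by (rule integral_dform_wedge_ext_d_eq_0[OF op wb' pbc w0 pb0 \<theta>(1-4) U sm])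
  qed
  define \<epsilon> where "\<epsilon> = shuffle_sign (insert i1 L) (insert i2 J) * shuffle_sign {i1} L * shuffle_sign {i2} J"
  have \<epsilon>: "\<epsilon> \<noteq> 0" using abs_shuffle_sign by (metis \<epsilon>_def abs_zero mult_eq_0_iff zero_neq_one)
  define q where "q x = g x * pd i1 \<zeta> x * f2 x" for x
  have "wedge (b x) (du x) $ UNIV = \<epsilon> * q x" if x: "x \<in> \<Omega>" for x
  proof -
    have eq: "wedge (b x) (du x) $ UNIV = \<epsilon> * (dvb i1 x * dvu i2 x) +
       shuffle_sign (insert i2 L) (insert i1 J) * shuffle_sign {i2} L * shuffle_sign {i1} J * (dvb i2 x * dvu i1 x)"
      unfolding b_def du_def \<epsilon>_def
      by (subst wedge_dform_single[OF _ _ JL ne]) (auto simp: pb_def pu_def)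
    show ?thesis
    proof (cases "x \<in> K\<zeta>")
      case False
      then show ?thesis unfolding eq by (simp add: dvb_def \<zeta>(3) pd\<zeta>0 q_def)
    next
      case True
      then have xU: "x \<in> U" using U by auto
      have "pd j \<theta> x = 0" for j using pd_cong_open[OF U(1) xU, of \<theta> "\<lambda>_. 1" j] U(3) by simp
      then have dvu: "dvu j x = df j x" for j using U(3)[OF xU] by (simp add: dvu_def)
      \<comment> \<open>A common point of two stages would have distance at least
        \<open>\<rho> m > 0\<close> from itself.\<close>
      have disj: "dg j x * df j' x = 0" for j j'
      proof (rule ccontr)
        assume "dg j x * df j' x \<noteq> 0"
        then have "g1 x \<noteq> 0 \<or> g2 x \<noteq> 0" "f1 x \<noteq> 0 \<or> f2 x \<noteq> 0" by (auto simp: dg_def df_def split: if_splits)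
        then obtain n m where "x \<in> Df n" "x \<in> Dg m" using Df[OF x] Dg[OF x] by blast
        then show False using dist(1)[of x n x m] dist(2)[of m] by simp
      qed
      have p: "dvb j x * dvu j' x = g x * pd j \<zeta> x * df j' x" for j j'
      proof -
        have "dvb j x * dvu j' x = \<zeta> x * (dg j x * df j' x) + g x * pd j \<zeta> x * df j' x"
          unfolding dvu dvb_def by (simp add: algebra_simps)
        then show ?thesis using disj by simp
      qed
      have "g x * pd i2 \<zeta> x * f1 x = 0" using pair(1)[OF x] by auto
      then show ?thesis unfolding eq p q_def using ne by (simp add: df_def)
    qed
  qed
  then have top: "integral_top \<Omega> (\<lambda>x. wedge (b x) (du x)) = \<epsilon> * (LINT x|lebesgue_on \<Omega>. q x)"
    unfolding integral_top_def by (subst Bochner_Integration.integral_cong[OF refl, of _ _ "\<lambda>x. \<epsilon> * q x"]) auto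
  have iq: "integrable (lebesgue_on \<Omega>) q"
  proof (rule Bochner_Integration.integrable_bound[of _ "\<lambda>x. df i2 x * pd i1 \<zeta> x"])
    show "integrable (lebesgue_on \<Omega>) (\<lambda>x. df i2 x * pd i1 \<zeta> x)"
      by (rule integrable_test[OF lif(3) S \<zeta>(2) K\<zeta>\<Omega> continuous_on_subset[OF C1_onD(2)[OF \<zeta>(1)]] pd\<zeta>0]) auto
    have f2: "f2 = df i2" using ne by (auto simp: df_def fun_eq_iff)
    show "q \<in> borel_measurable (lebesgue_on \<Omega>)"
      unfolding q_def[abs_def] f2 by (intro borel_measurable_times ms cm C1_onD(2) \<zeta>(1))
    have "norm (q x) \<le> norm (df i2 x * pd i1 \<zeta> x)" if "x \<in> \<Omega>" for x
    proof -
      have "norm (q x) = \<bar>g x\<bar> * \<bar>df i2 x * pd i1 \<zeta> x\<bar>" unfolding q_def f2 by (simp add: abs_mult)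
      also have "\<dots> \<le> 1 * \<bar>df i2 x * pd i1 \<zeta> x\<bar>" using bd(2)[OF that] by (intro mult_right_mono) auto
      finally show ?thesis by simp
    qed
    then show "AE x in lebesgue_on \<Omega>. norm (q x) \<le> norm (df i2 x * pd i1 \<zeta> x)" by (auto intro!: AE_I2)
  qed
  have nonzero: "integral_top \<Omega> (\<lambda>x. wedge (b x) (du x)) \<noteq> 0"
  proof -
    have "(LINT x|lebesgue_on \<Omega>. q x) \<noteq> 0"
      by (rule integral_nonpos_neq_0[OF S iq _ pair(3-5)]; unfold q_def; rule pair(2,6))
    then show ?thesis unfolding top using \<epsilon> by simp
  qed
  have u0: "u x = 0" if "x \<notin> K\<theta>" for x using \<theta>(4)[OF that] by (simp add: u_def vu_def vec_eq_iff axis_component)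
  have "H_d \<Phi> \<Omega> (card J) \<noteq> W_d \<Phi> \<Omega> (card J) \<and>
      (\<exists>b\<in>Orlicz_forms (conjugate \<Phi>) \<Omega> (CARD('n) - card J - 1).
        (INF \<omega>\<in>W_d_c \<Phi> \<Omega> (card J). functional \<Phi> b \<Omega> (card J) \<omega>)
          < (INF \<omega>\<in>test_forms \<Omega> (card J). functional \<Phi> b \<Omega> (card J) \<omega>))"
    by (rule gap_criterion[OF \<Omega> or(1,2) am \<Phi>_def uL1 hw \<theta>(2,3) u0 dum du_fin bm bcov H(2,1) young zero nonzero])
  then show ?thesis using am a0 mod unfolding \<Phi>_def by (intro exI[of _ a]) (auto simp: Let_def)
qed

section \<open>The logarithmic modulus of continuity\<close>

text \<open>A modulus that behaves like \<open>ln\<^sup>-\<^sup>\<kappa> (1/t)\<close> at \<open>0\<close> and is constant for large \<open>t\<close>. It is subadditive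
  because \<open>t \<mapsto> \<omega>(t)/t\<close> is nonincreasing.\<close>

definition log_cap :: "real \<Rightarrow> real" where "log_cap \<kappa> = exp (- (\<kappa> + 1))"

definition log_modulus :: "real \<Rightarrow> real \<Rightarrow> real" where
  "log_modulus \<kappa> t = (if t \<le> 0 then 0 else ln (1 / min t (log_cap \<kappa>)) powr (- \<kappa>))"

lemma ln_inverse_antimono: "0 < x \<Longrightarrow> x \<le> y \<Longrightarrow> ln (1 / y) \<le> ln (1 / x)" for x y :: real
  by (intro ln_mono divide_left_mono mult_pos_pos) auto

lemma log_cap: "0 < log_cap \<kappa>" "0 < t \<Longrightarrow> \<kappa> + 1 \<le> ln (1 / min t (log_cap \<kappa>))"
proof -
  show c: "0 < log_cap \<kappa>" by (simp add: log_cap_def)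
  assume t: "0 < t"
  have "ln (1 / log_cap \<kappa>) = \<kappa> + 1" by (simp add: log_cap_def ln_div)
  moreover have "ln (1 / log_cap \<kappa>) \<le> ln (1 / min t (log_cap \<kappa>))" using t c by (intro ln_inverse_antimono) auto
  ultimately show "\<kappa> + 1 \<le> ln (1 / min t (log_cap \<kappa>))" by simp
qed

lemma log_modulus_mono:
  assumes "0 \<le> \<kappa>" shows "mono (log_modulus \<kappa>)"
proof (rule monoI)
  fix s t :: real assume st: "s \<le> t"
  show "log_modulus \<kappa> s \<le> log_modulus \<kappa> t"
  proof (cases "s \<le> 0")
    case False
    then have p: "0 < s" "0 < t" using st by auto
    have "0 < ln (1 / min t (log_cap \<kappa>))" using log_cap(2)[OF p(2), of \<kappa>] assms by linarith
    moreover have "ln (1 / min t (log_cap \<kappa>)) \<le> ln (1 / min s (log_cap \<kappa>))"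
      using p st log_cap(1)[of \<kappa>] by (intro ln_inverse_antimono) auto
    ultimately show ?thesis using p assms by (simp add: log_modulus_def powr_mono2')
  qed (simp add: log_modulus_def)
qed

lemma log_modulus_le: "0 \<le> \<kappa> \<Longrightarrow> log_modulus \<kappa> t \<le> (\<kappa> + 1) powr (- \<kappa>)"
proof (cases "t \<le> 0")
  case False
  assume "0 \<le> \<kappa>"
  then show ?thesis using False log_cap(2)[of t \<kappa>] by (simp add: log_modulus_def powr_mono2')
qed (simp add: log_modulus_def)

text \<open>With \<open>a = ln (1 / s)\<close> and \<open>b = ln (1 / t')\<close> the main case is
  \<open>(a / b) powr \<kappa> \<le> exp (a - b)\<close>, which follows from
  \<open>ln x \<le> x - 1\<close> as soon as \<open>\<kappa> \<le> b\<close>. The cap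
  \<open>exp (- (\<kappa> + 1))\<close> guarantees this.\<close>

lemma log_modulus_star:
  assumes k: "0 \<le> \<kappa>" and st: "0 < s" "s \<le> t"
  shows "s * log_modulus \<kappa> t \<le> t * log_modulus \<kappa> s"
proof (cases "s \<le> log_cap \<kappa>")
  case False
  then show ?thesis using st by (simp add: log_modulus_def mult_right_mono)
next
  case True
  define t' where "t' = min t (log_cap \<kappa>)"
  have t': "s \<le> t'" "t' \<le> t" "0 < t'" using st True log_cap(1)[of \<kappa>] by (auto simp: t'_def)
  define a where "a = ln (1 / s)"
  define b where "b = ln (1 / t')"
  have b: "\<kappa> + 1 \<le> b" using log_cap(2)[of t \<kappa>] st by (simp add: b_def t'_def)
  have ab: "b \<le> a" unfolding a_def b_def using t' st by (simp add: ln_div)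
  have "\<kappa> * ln (a / b) \<le> \<kappa> * (a / b - 1)" using k b ab by (intro mult_left_mono ln_le_minus_one) auto
  also have "\<dots> = (a - b) * (\<kappa> / b)" using b k by (simp add: field_simps)
  also have "\<dots> \<le> (a - b) * 1" using ab b k by (intro mult_left_mono) auto
  also have "\<dots> = ln (t' / s)" unfolding a_def b_def using st t' by (simp add: ln_div)
  finally have "exp (\<kappa> * ln (a / b)) \<le> exp (ln (t' / s))" by simp
  then have "(a / b) powr \<kappa> \<le> t' / s" using st t' b ab k by (simp add: powr_def)
  then have "a powr \<kappa> / b powr \<kappa> \<le> t' / s" using b ab k by (simp add: powr_divide)
  then have "s * b powr (- \<kappa>) \<le> t' * a powr (- \<kappa>)"
    using st b ab k by (simp add: powr_minus field_simps)
  also have "\<dots> \<le> t * a powr (- \<kappa>)" using t' by (intro mult_right_mono) auto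
  finally show ?thesis using st True by (simp add: log_modulus_def a_def b_def t'_def)
qed

lemma log_modulus_nonneg: "0 \<le> log_modulus \<kappa> t" by (simp add: log_modulus_def)

lemma log_modulus_diff:
  assumes k: "0 \<le> \<kappa>" and "0 \<le> s" "0 \<le> t"
  shows "\<bar>log_modulus \<kappa> s - log_modulus \<kappa> t\<bar> \<le> log_modulus \<kappa> \<bar>s - t\<bar>"
proof -
  have *: "log_modulus \<kappa> t - log_modulus \<kappa> s \<le> log_modulus \<kappa> (t - s)" if st: "0 \<le> s" "s \<le> t" for s t
  proof (cases "s = 0 \<or> s = t")
    case True
    have "log_modulus \<kappa> 0 = 0" by (simp add: log_modulus_def)
    then show ?thesis using True log_modulus_nonneg[of \<kappa> "t - s"] by auto
  next
    case False
    define h where "h = t - s"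
    have p: "0 < s" "0 < h" "t = s + h" using False st by (auto simp: h_def)
    \<comment> \<open>The two inequalities, for \<open>s\<close> and for \<open>h\<close>, are
      added; as \<open>t = s + h\<close>, the sum is subadditivity multiplied by
      \<open>t\<close>.\<close>
    have "s * log_modulus \<kappa> t \<le> t * log_modulus \<kappa> s" "h * log_modulus \<kappa> t \<le> t * log_modulus \<kappa> h"
      using p by (intro log_modulus_star k; simp)+
    then have "t * log_modulus \<kappa> t \<le> t * (log_modulus \<kappa> s + log_modulus \<kappa> h)"
      unfolding p(3) by (simp only: distrib_left distrib_right) 
    moreover have "0 < t" using p by linarith
    ultimately show ?thesis unfolding h_def by (simp only: mult_le_cancel_left_pos)
  qed
  have m: "log_modulus \<kappa> a \<le> log_modulus \<kappa> b" if "a \<le> b" for a b using monoD[OF log_modulus_mono[OF k] that] .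
  show ?thesis
  proof (cases "s \<le> t")
    case True
    have e: "\<bar>s - t\<bar> = t - s" using True by simp
    show ?thesis unfolding e using *[OF assms(2) True] m[OF True] log_modulus_nonneg[of \<kappa> "t - s"] by (intro abs_leI) linarith+
  next
    case False
    then have ts: "t \<le> s" by simp
    have e: "\<bar>s - t\<bar> = s - t" using ts by simp
    show ?thesis unfolding e using *[OF assms(3) ts] m[OF ts] log_modulus_nonneg[of \<kappa> "s - t"] by (intro abs_leI) linarith+
  qed
qed

lemma log_modulus_eq: "0 < t \<Longrightarrow> t < log_cap \<kappa> \<Longrightarrow> log_modulus \<kappa> t = ln (1 / t) powr (- \<kappa>)"
  by (simp add: log_modulus_def)

text \<open>At scale \<open>c / M ^ n\<close> the logarithm is at most linear in \<open>n\<close>,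
  which turns the modulus into a power of \<open>n\<close>.\<close>

lemma log_modulus_geometric:
  assumes k: "0 \<le> \<kappa>" and c: "0 < c" and M: "1 < M"
  obtains d where "0 < d" "\<And>n::nat. d * (real n + 1) powr (- \<kappa>) \<le> log_modulus \<kappa> (c / M ^ n)"
proof -
  \<comment> \<open>Large enough for the slope \<open>ln M\<close>, the offset
    \<open>\<bar>ln c\<bar>\<close> and the capped value \<open>\<kappa> + 1\<close> alike.\<close>
  define e where "e = ln M + \<bar>ln c\<bar> + \<kappa> + 1"
  have lM: "0 < ln M" using M by simp
  have e: "0 < e" unfolding e_def using k lM by linarith
  have "e powr (- \<kappa>) * (real n + 1) powr (- \<kappa>) \<le> log_modulus \<kappa> (c / M ^ n)" for n :: nat
  proof -
    define t where "t = c / M ^ n"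
    have t: "0 < t" using c M by (simp add: t_def)
    have "ln (1 / min t (log_cap \<kappa>)) \<le> e * (real n + 1)"
    proof (cases "t \<le> log_cap \<kappa>")
      case True
      have "ln (1 / t) = real n * ln M - ln c" using c M by (simp add: t_def ln_div ln_realpow)
      also have "\<dots> \<le> real n * ln M + \<bar>ln c\<bar>" by simp
      also have "\<dots> \<le> real n * e + e"
      proof (intro add_mono mult_left_mono)
        show "ln M \<le> e" "\<bar>ln c\<bar> \<le> e" unfolding e_def using k lM by linarith+
      qed simp
      finally show ?thesis using True by (simp add: algebra_simps)
    next
      case False
      then have "ln (1 / min t (log_cap \<kappa>)) = \<kappa> + 1" by (simp add: log_cap_def ln_div)
      also have "\<dots> \<le> e * 1" unfolding e_def mult_1_right using lM by linarith
      also have "\<dots> \<le> e * (real n + 1)" using e by (intro mult_left_mono) auto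
      finally show ?thesis .
    qed
    then have "(e * (real n + 1)) powr (- \<kappa>) \<le> ln (1 / min t (log_cap \<kappa>)) powr (- \<kappa>)"
      using log_cap(2)[OF t, of \<kappa>] k by (intro powr_mono2') auto
    then show ?thesis using t e by (simp add: log_modulus_def t_def powr_mult)
  qed
  then show ?thesis using that[of "e powr (- \<kappa>)"] e by simp
qed

section \<open>Growth of the stage sums\<close>

lemma suminf_ennreal_eventually:
  fixes x :: "nat \<Rightarrow> ennreal" and y :: "nat \<Rightarrow> real"
  assumes "\<And>n. x n < \<infinity>" "\<forall>\<^sub>F n in sequentially. x n \<le> ennreal (y n)" "summable y" "\<And>n. 0 \<le> y n"
  shows "(\<Sum>n. x n) < \<infinity>"
proof -
  obtain n0 where n0: "\<And>n. n \<ge> n0 \<Longrightarrow> x n \<le> ennreal (y n)" using assms(2) unfolding eventually_sequentially by blast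
  have "(\<Sum>n. x n) = (\<Sum>n. x (n + n0)) + (\<Sum>n<n0. x n)" by (rule suminf_offset) simp
  also have "(\<Sum>n. x (n + n0)) \<le> (\<Sum>n. ennreal (y (n + n0)))" by (intro suminf_le summableI n0) simp
  also have "\<dots> = ennreal (\<Sum>n. y (n + n0))"
    using assms(3,4) by (intro suminf_ennreal2) (auto simp: summable_iff_shift)
  finally have "(\<Sum>n. x n) \<le> ennreal (\<Sum>n. y (n + n0)) + (\<Sum>n<n0. x n)" by (simp add: add_right_mono)
  also have "\<dots> < \<infinity>"
  proof -
    have "(\<Sum>n<n0. x n) < \<infinity>" using assms(1) by (induction n0) auto
    then show ?thesis by simp
  qed
  finally show ?thesis .
qed

lemma powr_two_sided:
  fixes d1 d2 e :: real
  assumes "0 < d1" "0 < d2"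
  obtains c1 c2 where "0 < c1" "0 < c2"
    "\<And>y L. 0 < y \<Longrightarrow> d1 * y \<le> L \<Longrightarrow> L \<le> d2 * y \<Longrightarrow> c1 * y powr e \<le> L powr e \<and> L powr e \<le> c2 * y powr e"
proof (cases "e \<ge> 0")
  case True
  have "d1 powr e * y powr e \<le> L powr e \<and> L powr e \<le> d2 powr e * y powr e"
    if "0 < y" "d1 * y \<le> L" "L \<le> d2 * y" for y L
  proof -
    have p: "0 < d1 * y" using assms that by simp
    then have "0 < L" using that by linarith
    then have "(d1 * y) powr e \<le> L powr e" "L powr e \<le> (d2 * y) powr e"
      using that True p by (auto intro: powr_mono2)
    then show ?thesis using that assms by (simp add: powr_mult)
  qed
  then show ?thesis using that[of "d1 powr e" "d2 powr e"] assms by auto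
next
  case False
  have "d2 powr e * y powr e \<le> L powr e \<and> L powr e \<le> d1 powr e * y powr e"
    if "0 < y" "d1 * y \<le> L" "L \<le> d2 * y" for y L
  proof -
    have p: "0 < d1 * y" using assms that by simp
    then have "0 < L" using that by linarith
    then have "L powr e \<le> (d1 * y) powr e" "(d2 * y) powr e \<le> L powr e"
      using that False p by (auto intro: powr_mono2')
    then show ?thesis using that assms by (simp add: powr_mult)
  qed
  then show ?thesis using that[of "d2 powr e" "d1 powr e"] assms by auto
qed

text \<open>The power of \<open>n\<close> and the constants change the logarithm only by
  \<open>O(ln n)\<close>, so \<open>ln (x n)\<close> is comparable with \<open>n\<close> whatever
  the exponent \<open>\<eta>\<close>.\<close>

lemma ln_growth:
  assumes \<theta>: "0 < \<theta>" and c: "0 < c1" "0 < c2"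
    and x: "\<And>n. c1 * (exp (\<theta> * real n) * (real n + 1) powr \<eta>) \<le> x n" "\<And>n. x n \<le> c2 * (exp (\<theta> * real n) * (real n + 1) powr \<eta>)"
  shows "\<forall>\<^sub>F n in sequentially. \<theta> / 2 * (real n + 1) \<le> ln (x n) \<and> ln (x n) \<le> 2 * \<theta> * (real n + 1)"
    "filterlim x at_top sequentially"
proof -
  have l: "ln (c * (exp (\<theta> * real n) * (real n + 1) powr \<eta>)) = ln c + \<theta> * real n + \<eta> * ln (real n + 1)" if "0 < c" for c n
    using that by (simp add: ln_mult ln_powr)
  have o: "(\<lambda>n. (ln c + \<eta> * ln (real n + 1)) / (real n + 1)) \<longlonglongrightarrow> 0" for c :: real by real_asymp
  have pos: "0 < c1 * (exp (\<theta> * real n) * (real n + 1) powr \<eta>)" for n :: nat using c by simp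
  have "\<forall>\<^sub>F n in sequentially. - (\<theta> / 4) < (ln c1 + \<eta> * ln (real n + 1)) / (real n + 1)"
    "\<forall>\<^sub>F n in sequentially. (ln c2 + \<eta> * ln (real n + 1)) / (real n + 1) < \<theta>"
    using \<theta> by (intro order_tendstoD[OF o]; simp)+
  then show ev: "\<forall>\<^sub>F n in sequentially. \<theta> / 2 * (real n + 1) \<le> ln (x n) \<and> ln (x n) \<le> 2 * \<theta> * (real n + 1)"
    using eventually_ge_at_top[of 3]
  proof eventually_elim
    case (elim n)
    have "- (\<theta> / 4) * (real n + 1) < ln c1 + \<eta> * ln (real n + 1)" "ln c2 + \<eta> * ln (real n + 1) < \<theta> * (real n + 1)"
      using elim(1,2) by (simp_all add: less_divide_eq divide_less_eq)
    moreover have "ln (c1 * (exp (\<theta> * real n) * (real n + 1) powr \<eta>)) \<le> ln (x n)"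
      using x(1)[of n] pos[of n] by (intro ln_mono) auto
    moreover have "ln (x n) \<le> ln (c2 * (exp (\<theta> * real n) * (real n + 1) powr \<eta>))"
      using x[of n] pos[of n] by (intro ln_mono) auto
    moreover have "\<theta> * 3 \<le> \<theta> * real n" using elim(3) \<theta> by (intro mult_left_mono) auto
    moreover have "- (\<theta> / 4) * (real n + 1) = - (\<theta> * real n) / 4 - \<theta> / 4" "\<theta> * (real n + 1) = \<theta> * real n + \<theta>"
      "\<theta> / 2 * (real n + 1) = \<theta> * real n / 2 + \<theta> / 2" "2 * \<theta> * (real n + 1) = 2 * (\<theta> * real n) + 2 * \<theta>"
      by (simp_all add: algebra_simps)
    ultimately show ?case unfolding l[OF c(1)] l[OF c(2)] using \<theta> by linarith
  qed
  show "filterlim x at_top sequentially"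
  proof (rule filterlim_at_top_mono)
    show "filterlim (\<lambda>n. exp (\<theta> / 2 * (real n + 1))) at_top sequentially" using \<theta> by real_asymp
    show "\<forall>\<^sub>F n in sequentially. exp (\<theta> / 2 * (real n + 1)) \<le> x n"
      using ev
    proof eventually_elim
      case (elim n)
      have "0 < x n" using x(1)[of n] pos[of n] by linarith
      then show ?case using elim by (metis exp_le_cancel_iff exp_ln)
    qed
  qed
qed

lemma comparable_at_topD:
  assumes "comparable_at_top \<phi> h"
  shows "\<exists>C>0. \<forall>\<^sub>F t in at_top. \<phi> t \<le> ennreal (C * h t)" "\<exists>C>0. \<forall>\<^sub>F t in at_top. ennreal (h t) \<le> ennreal C * \<phi> t"
  using assms unfolding comparable_at_top_def eventually_conj_iff by blast+

lemma orlicz_finite: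
  assumes "orlicz_function \<phi>" "comparable_at_top \<phi> h" "0 \<le> t" shows "\<phi> t < \<infinity>"
proof -
  obtain C where "\<forall>\<^sub>F s in at_top. \<phi> s \<le> ennreal (C * h s)" using comparable_at_topD(1)[OF assms(2)] by blast
  then have "\<forall>\<^sub>F s in at_top. \<phi> s \<le> ennreal (C * h s) \<and> t \<le> s" using eventually_ge_at_top by (rule eventually_conj)
  then obtain s where s: "\<phi> s \<le> ennreal (C * h s)" "t \<le> s" by (auto simp: eventually_at_top_linorder)
  have "\<phi> t \<le> ennreal (C * h s)" using orlicz_mono[OF assms(1,3) s(2)] s(1) by (rule order_trans)
  then show ?thesis by (rule le_less_trans) simp
qed

text \<open>As \<open>ln (V n)\<close> is comparable with \<open>n\<close>, the \<open>n\<close>-th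
  term is at most of order \<open>\<mu> n * V n powr p0 * n powr (- \<beta>)\<close>, hence of order
  \<open>n powr (\<sigma> - \<beta>)\<close>, with an exponent below \<open>-1\<close>.\<close>

lemma upper_sum:
  assumes \<phi>: "orlicz_function \<phi>" "comparable_at_top \<phi> (\<lambda>t. t powr p0 * ln t powr (- \<beta>))"
    and p0: "1 < p0" and \<theta>: "0 < \<theta>" and c: "0 < c1" "0 < c2"
    and V: "\<And>n. c1 * (exp (\<theta> * real n) * (real n + 1) powr \<eta>) \<le> V n" "\<And>n. V n \<le> c2 * (exp (\<theta> * real n) * (real n + 1) powr \<eta>)"
    and \<mu>: "\<And>n. 0 \<le> \<mu> n" "\<And>n. \<mu> n * V n powr p0 \<le> c3 * (real n + 1) powr \<sigma>" and \<sigma>: "\<sigma> < \<beta> - 1"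
    and cc: "0 < cv" "0 < c"
  shows "(\<Sum>n. ennreal (\<mu> n) * \<phi> (c * (cv * V n + 1))) < \<infinity>"
proof -
  have Vpos: "0 < V n" for n
  proof -
    have "0 < c1 * (exp (\<theta> * real n) * (real n + 1) powr \<eta>)" using c by simp
    then show ?thesis using V(1)[of n] by linarith
  qed
  \<comment> \<open>As soon as \<open>V n \<ge> 1\<close>, the argument
    \<open>c * (cv * V n + 1)\<close> is at most \<open>k * V n\<close>.\<close>
  define k where "k = c * (cv + 1)"
  have k: "0 < k" using cc by (simp add: k_def)
  obtain C where C: "0 < C" "\<forall>\<^sub>F t in at_top. \<phi> t \<le> ennreal (C * (t powr p0 * ln t powr (- \<beta>)))"
    using comparable_at_topD(1)[OF \<phi>(2)] by blast
  have kV: "k * c1 * (exp (\<theta> * real n) * (real n + 1) powr \<eta>) \<le> k * V n" "k * V n \<le> k * c2 * (exp (\<theta> * real n) * (real n + 1) powr \<eta>)" for n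
    using V[of n] k by (simp_all add: mult.assoc)
  have k12: "0 < k * c1" "0 < k * c2" using k c by simp_all
  note gr = ln_growth[OF \<theta> k12 kV]
  obtain d1 d2 where d: "0 < d1" "0 < d2"
    "\<And>y L. 0 < y \<Longrightarrow> \<theta> / 2 * y \<le> L \<Longrightarrow> L \<le> 2 * \<theta> * y \<Longrightarrow> d1 * y powr (- \<beta>) \<le> L powr (- \<beta>) \<and> L powr (- \<beta>) \<le> d2 * y powr (- \<beta>)"
    using powr_two_sided[of "\<theta> / 2" "2 * \<theta>" "- \<beta>"] \<theta> by auto
  have V1: "\<forall>\<^sub>F n in sequentially. 1 \<le> V n"
    using ln_growth(2)[OF \<theta> c V] unfolding filterlim_at_top by blast
  define K where "K = C * k powr p0 * \<bar>c3\<bar> * d2"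
  show ?thesis
  proof (rule suminf_ennreal_eventually[where y = "\<lambda>n. K * (real n + 1) powr (\<sigma> - \<beta>)"])
    show "ennreal (\<mu> n) * \<phi> (c * (cv * V n + 1)) < \<infinity>" for n
      using orlicz_finite[OF \<phi>, of "c * (cv * V n + 1)"] cc Vpos[of n] by (simp add: ennreal_mult_less_top)
    have "summable (\<lambda>n. real (Suc n) powr (\<sigma> - \<beta>))"
      using summable_real_powr_iff[of "\<sigma> - \<beta>"] \<sigma> by (subst summable_Suc_iff) simp
    then show "summable (\<lambda>n. K * (real n + 1) powr (\<sigma> - \<beta>))" by (intro summable_mult) (simp add: add.commute)
    show "0 \<le> K * (real n + 1) powr (\<sigma> - \<beta>)" for n using C(1) d by (simp add: K_def)
    show "\<forall>\<^sub>F n in sequentially. ennreal (\<mu> n) * \<phi> (c * (cv * V n + 1)) \<le> ennreal (K * (real n + 1) powr (\<sigma> - \<beta>))"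
      using gr(1) V1 filterlim_iff[THEN iffD1, OF gr(2), rule_format, OF C(2)]
    proof eventually_elim
      case (elim n)
      have "c * (cv * V n + 1) \<le> k * V n" unfolding k_def using elim(2) cc by (simp add: algebra_simps)
      then have "\<phi> (c * (cv * V n + 1)) \<le> \<phi> (k * V n)"
        using cc Vpos[of n] by (intro orlicz_mono[OF \<phi>(1)]) (auto intro!: mult_nonneg_nonneg add_nonneg_nonneg)
      also have "\<dots> \<le> ennreal (C * ((k * V n) powr p0 * ln (k * V n) powr (- \<beta>)))" by (rule elim(3))
      finally have "ennreal (\<mu> n) * \<phi> (c * (cv * V n + 1)) \<le> ennreal (\<mu> n) * ennreal (C * ((k * V n) powr p0 * ln (k * V n) powr (- \<beta>)))"
        by (rule mult_left_mono) simp
      also have "\<dots> = ennreal (\<mu> n * (C * ((k * V n) powr p0 * ln (k * V n) powr (- \<beta>))))"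
        by (rule ennreal_mult'[OF \<mu>(1), symmetric])
      also have "\<dots> \<le> ennreal (K * (real n + 1) powr (\<sigma> - \<beta>))"
      proof (rule ennreal_leI)
        have 1: "ln (k * V n) powr (- \<beta>) \<le> d2 * (real n + 1) powr (- \<beta>)" using d(3)[of "real n + 1" "ln (k * V n)"] elim(1) by simp
        have 2: "\<mu> n * V n powr p0 \<le> \<bar>c3\<bar> * (real n + 1) powr \<sigma>"
          by (rule order_trans[OF \<mu>(2)]) (simp add: mult_right_mono)
        have "\<mu> n * (C * ((k * V n) powr p0 * ln (k * V n) powr (- \<beta>))) =
            (C * k powr p0) * ((\<mu> n * V n powr p0) * ln (k * V n) powr (- \<beta>))"
          using k Vpos[of n] by (simp add: powr_mult mult_ac)
        also have "\<dots> \<le> (C * k powr p0) * ((\<bar>c3\<bar> * (real n + 1) powr \<sigma>) * (d2 * (real n + 1) powr (- \<beta>)))"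
          using C(1) \<mu>(1) by (intro mult_left_mono mult_mono 1 2) auto
        also have "\<dots> = K * (real n + 1) powr (\<sigma> - \<beta>)" by (simp add: K_def powr_diff powr_minus divide_inverse mult_ac)
        finally show "\<mu> n * (C * ((k * V n) powr p0 * ln (k * V n) powr (- \<beta>))) \<le> K * (real n + 1) powr (\<sigma> - \<beta>)" .
      qed
      finally show ?case .
    qed
  qed
qed

text \<open>With \<open>T n = (n + 1) powr \<delta> * V n\<close> the sum becomes that of
  \<open>(n + 1) powr \<delta>\<close>, and the pointwise inequality follows once
  \<open>(n + 1) powr \<tau>\<close> exceeds a constant. The hypothesis on \<open>\<sigma>\<close>
  makes \<open>\<delta> < -1\<close> and \<open>\<tau> > 0\<close> compatible.\<close>

lemma lower_sum:
  assumes \<psi>: "orlicz_function \<psi>" "comparable_at_top \<psi> (\<lambda>t. t powr p0 * ln t powr \<alpha>)"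
    and p0: "1 < p0" and \<theta>: "0 < \<theta>" and c: "0 < c1" "0 < c2"
    and V: "\<And>n. c1 * (exp (\<theta> * real n) * (real n + 1) powr \<eta>) \<le> V n" "\<And>n. V n \<le> c2 * (exp (\<theta> * real n) * (real n + 1) powr \<eta>)"
    and \<mu>: "\<And>n. 0 < \<mu> n" "\<And>n. c3 * (real n + 1) powr \<sigma> \<le> \<mu> n * V n powr p0" "0 < c3"
    and \<sigma>: "\<kappa> - \<alpha> + p0 - 1 < \<sigma>"
    and w: "\<And>n. c4 * (real n + 1) powr (- \<kappa>) \<le> w n" "0 < c4"
    and s: "\<And>n. s n = cs / (\<mu> n * V n)" "0 < cs"
  shows "\<exists>T. (\<forall>n. 0 < T n \<and> ennreal (s n * T n) \<le> ennreal (w n) * \<psi> (T n)) \<and>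
      (\<Sum>n. ennreal (\<mu> n) * ennreal (s n * T n)) < \<infinity>"
proof -
  have Vpos: "0 < V n" for n
  proof -
    have "0 < c1 * (exp (\<theta> * real n) * (real n + 1) powr \<eta>)" using c by simp
    then show ?thesis using V(1)[of n] by linarith
  qed
  have wpos: "0 < w n" for n
  proof -
    have "0 < c4 * (real n + 1) powr (- \<kappa>)" using w(2) by simp
    then show ?thesis using w(1)[of n] by linarith
  qed
  have spos: "0 < s n" for n using s \<mu>(1) Vpos by simp
  \<comment> \<open>Half of the available room: \<open>\<delta> = -1 - e\<close> keeps the sum
    finite, and the other half remains for \<open>\<tau> > 0\<close>.\<close>
  define e where "e = (\<sigma> + \<alpha> - \<kappa> - (p0 - 1)) / (2 * (p0 - 1))"
  have e: "0 < e" using \<sigma> p0 by (simp add: e_def)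
  define \<delta> where "\<delta> = - 1 - e"
  define \<tau> where "\<tau> = \<sigma> + \<alpha> - \<kappa> + \<delta> * (p0 - 1)"
  have "x / (2 * y) * y = x / 2" if "y \<noteq> 0" for x y :: real using that by simp
  from this[of "p0 - 1"] have "e * (p0 - 1) = (\<sigma> + \<alpha> - \<kappa> - (p0 - 1)) / 2" unfolding e_def using p0 by auto
  then have \<tau>: "0 < \<tau>" using \<sigma> by (simp add: \<tau>_def \<delta>_def algebra_simps)
  define T0 where "T0 n = (real n + 1) powr \<delta> * V n" for n :: nat
  have T0pos: "0 < T0 n" for n using Vpos by (simp add: T0_def)
  have T0: "c1 * (exp (\<theta> * real n) * (real n + 1) powr (\<eta> + \<delta>)) \<le> T0 n"
      "T0 n \<le> c2 * (exp (\<theta> * real n) * (real n + 1) powr (\<eta> + \<delta>))" for n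
  proof -
    have "(real n + 1) powr \<delta> * (c1 * (exp (\<theta> * real n) * (real n + 1) powr \<eta>)) \<le> T0 n"
      "T0 n \<le> (real n + 1) powr \<delta> * (c2 * (exp (\<theta> * real n) * (real n + 1) powr \<eta>))"
      unfolding T0_def by (intro mult_left_mono V; simp)+
    then show "c1 * (exp (\<theta> * real n) * (real n + 1) powr (\<eta> + \<delta>)) \<le> T0 n"
      "T0 n \<le> c2 * (exp (\<theta> * real n) * (real n + 1) powr (\<eta> + \<delta>))" by (simp_all add: powr_add mult_ac)
  qed
  note gr = ln_growth[OF \<theta> c T0]
  obtain d1 d2 where d: "0 < d1" "0 < d2"
    "\<And>y L. 0 < y \<Longrightarrow> \<theta> / 2 * y \<le> L \<Longrightarrow> L \<le> 2 * \<theta> * y \<Longrightarrow> d1 * y powr \<alpha> \<le> L powr \<alpha> \<and> L powr \<alpha> \<le> d2 * y powr \<alpha>"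
    using powr_two_sided[of "\<theta> / 2" "2 * \<theta>" \<alpha>] \<theta> by auto
  obtain C where C: "0 < C" "\<forall>\<^sub>F t in at_top. ennreal (t powr p0 * ln t powr \<alpha>) \<le> ennreal C * \<psi> t"
    using comparable_at_topD(2)[OF \<psi>(2)] by blast
  have "filterlim (\<lambda>n. c4 * c3 * d1 / C * (real n + 1) powr \<tau>) at_top sequentially"
    using \<tau> w(2) \<mu>(3) d(1) C(1) by real_asymp
  then have big: "\<forall>\<^sub>F n in sequentially. cs \<le> c4 * c3 * d1 / C * (real n + 1) powr \<tau>"
    unfolding filterlim_at_top by blast
  have good: "\<forall>\<^sub>F n in sequentially. ennreal (s n * T0 n) \<le> ennreal (w n) * \<psi> (T0 n)"
    using gr(1) big filterlim_iff[THEN iffD1, OF gr(2), rule_format, OF C(2)]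
  proof eventually_elim
    case (elim n)
    have L: "d1 * (real n + 1) powr \<alpha> \<le> ln (T0 n) powr \<alpha>" using d(3)[of "real n + 1" "ln (T0 n)"] elim(1) by simp
    have "s n * T0 n * (\<mu> n * V n) = cs * T0 n" using s(1)[of n] \<mu>(1)[of n] Vpos[of n] by simp
    also have "\<dots> \<le> (c4 * c3 * d1 / C * (real n + 1) powr \<tau>) * T0 n" using elim(2) T0pos[of n] by (intro mult_right_mono) auto
    \<comment> \<open>The exponent is distributed over the weight, the product
      \<open>\<mu> n * V n powr p0\<close>, the logarithm, and the factor by which
      \<open>T0 n\<close> differs from \<open>V n\<close>.\<close>
    also have "(real n + 1) powr \<tau> = (real n + 1) powr (- \<kappa>) * ((real n + 1) powr \<sigma> * ((real n + 1) powr \<alpha> * (real n + 1) powr (\<delta> * (p0 - 1))))"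
      unfolding powr_add[symmetric] \<tau>_def by (rule arg_cong[where f = "\<lambda>x. (real n + 1) powr x"]) simp
    also have "c4 * c3 * d1 / C * ((real n + 1) powr (- \<kappa>) * ((real n + 1) powr \<sigma> * ((real n + 1) powr \<alpha> * (real n + 1) powr (\<delta> * (p0 - 1))))) * T0 n
       = (c4 * (real n + 1) powr (- \<kappa>)) * ((c3 * (real n + 1) powr \<sigma>) * ((d1 * (real n + 1) powr \<alpha>) * ((real n + 1) powr (\<delta> * (p0 - 1)) * T0 n / C)))"
      by (simp add: mult_ac)
    also have "\<dots> \<le> w n * ((\<mu> n * V n powr p0) * (ln (T0 n) powr \<alpha> * ((real n + 1) powr (\<delta> * (p0 - 1)) * T0 n / C)))"
      using w(2) \<mu>(1)[of n] \<mu>(3) d(1) C(1) T0pos[of n] wpos[of n]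
      by (intro mult_mono[OF w(1)] mult_mono[OF \<mu>(2)] mult_mono[OF L] mult_nonneg_nonneg divide_nonneg_nonneg order_refl)
        (auto simp: less_imp_le)
    also have "\<dots> = w n * ((1 / C) * (T0 n powr p0 * ln (T0 n) powr \<alpha>)) * (\<mu> n * V n)"
    proof -
      have a: "V n powr p0 = V n powr (p0 - 1) * V n" "T0 n powr p0 = T0 n powr (p0 - 1) * T0 n"
        using Vpos[of n] T0pos[of n] by (simp_all add: powr_diff)
      have b: "T0 n powr (p0 - 1) = (real n + 1) powr (\<delta> * (p0 - 1)) * V n powr (p0 - 1)"
        unfolding T0_def using Vpos[of n] by (simp add: powr_mult powr_powr)
      show ?thesis unfolding a b by (simp add: mult_ac)
    qed
    finally have "s n * T0 n \<le> w n * ((1 / C) * (T0 n powr p0 * ln (T0 n) powr \<alpha>))"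
      by (rule mult_right_le_imp_le) (use \<mu>(1)[of n] Vpos[of n] in simp)
    then have "ennreal (s n * T0 n) \<le> ennreal (w n * ((1 / C) * (T0 n powr p0 * ln (T0 n) powr \<alpha>)))" by (rule ennreal_leI)
    also have "\<dots> = ennreal (w n) * (ennreal (1 / C) * ennreal (T0 n powr p0 * ln (T0 n) powr \<alpha>))"
    proof -
      have "ennreal (a * ((1 / C) * X)) = ennreal a * (ennreal (1 / C) * ennreal X)" if "0 \<le> a" for a X
        using that C(1) by (subst ennreal_mult', simp, subst ennreal_mult', simp_all)
      then show ?thesis using wpos[of n] by simp
    qed
    also have "\<dots> \<le> ennreal (w n) * (ennreal (1 / C) * (ennreal C * \<psi> (T0 n)))"
      by (intro mult_left_mono elim(3)) auto
    also have "ennreal (1 / C) * (ennreal C * \<psi> (T0 n)) = \<psi> (T0 n)"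
      using C(1) by (simp add: mult.assoc[symmetric] ennreal_mult[symmetric])
    finally show ?case .
  qed
  \<comment> \<open>For the finitely many \<open>n\<close> where \<open>T0 n\<close> may fail,
    superlinear growth of \<open>\<psi>\<close> supplies some point; this does not affect
    convergence.\<close>
  have "\<exists>T. 0 < T \<and> ennreal (s n * T) \<le> ennreal (w n) * \<psi> T" for n
  proof -
    obtain T where T: "0 < T" "ennreal (s n / w n * T) \<le> \<psi> T" using orlicz_superlinear[OF \<psi>(1)] .
    have "ennreal (s n * T) = ennreal (w n) * ennreal (s n / w n * T)"
      using wpos[of n] spos[of n] T by (simp add: ennreal_mult[symmetric])
    also have "\<dots> \<le> ennreal (w n) * \<psi> T" by (intro mult_left_mono T) simp
    finally show ?thesis using T by blast
  qed
  then obtain T1 where T1: "\<And>n. 0 < T1 n" "\<And>n. ennreal (s n * T1 n) \<le> ennreal (w n) * \<psi> (T1 n)" by metis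
  define T where "T n = (if ennreal (s n * T0 n) \<le> ennreal (w n) * \<psi> (T0 n) then T0 n else T1 n)" for n
  have "0 < T n \<and> ennreal (s n * T n) \<le> ennreal (w n) * \<psi> (T n)" for n
    using T0pos T1 by (simp add: T_def)
  moreover have "(\<Sum>n. ennreal (\<mu> n) * ennreal (s n * T n)) < \<infinity>"
  proof (rule suminf_ennreal_eventually[where y = "\<lambda>n. cs * (real n + 1) powr \<delta>"])
    show "ennreal (\<mu> n) * ennreal (s n * T n) < \<infinity>" for n by (simp add: ennreal_mult_less_top)
    have "summable (\<lambda>n. real (Suc n) powr \<delta>)"
      using summable_real_powr_iff[of \<delta>] e by (subst summable_Suc_iff) (simp add: \<delta>_def)
    then show "summable (\<lambda>n. cs * (real n + 1) powr \<delta>)" by (intro summable_mult) (simp add: add.commute)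
    show "0 \<le> cs * (real n + 1) powr \<delta>" for n using s(2) by simp
    show "\<forall>\<^sub>F n in sequentially. ennreal (\<mu> n) * ennreal (s n * T n) \<le> ennreal (cs * (real n + 1) powr \<delta>)"
      using good
    proof eventually_elim
      case (elim n)
      then have "T n = T0 n" by (simp add: T_def)
      then have "\<mu> n * (s n * T n) = cs * (real n + 1) powr \<delta>"
        using s(1)[of n] \<mu>(1)[of n] Vpos[of n] by (simp add: T0_def)
      then show ?case using \<mu>(1)[of n] by (simp add: ennreal_mult'[symmetric])
    qed
  qed
  ultimately show ?thesis by blast
qed

section \<open>Choice of the parameters\<close>

text \<open>The number of children is chosen so that the number of intervals of generation \<open>n\<close> is, up to
  a factor \<open>2\<close>, equal to \<open>M\<^bsup>D n\<^esup> (n + 1)\<^bsup>\<gamma>\<^esup>\<close>.\<close>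

lemma branching_exists:
  fixes D \<gamma> :: real
  assumes D: "0 \<le> D" "D < 1" and D\<gamma>: "0 < D \<or> 0 \<le> \<gamma>"
  obtains M :: nat and br :: "nat \<Rightarrow> nat" where "even M" "4 \<le> M" "\<And>n. 1 \<le> br n" "\<And>n. 2 * br n \<le> M"
    "\<And>n. exp (D * ln (real M) * real n) * (real n + 1) powr \<gamma> \<le> real (\<Prod>i<n. br i)"
    "\<And>n. real (\<Prod>i<n. br i) \<le> 2 * (exp (D * ln (real M) * real n) * (real n + 1) powr \<gamma>)"
proof -
  \<comment> \<open>The ratio of consecutive values of \<open>real n + 1\<close> lies between
    \<open>1\<close> and \<open>2\<close>, so the polynomial factor changes by at most
    \<open>q\<close> per generation, upwards or downwards.\<close>
  define q where "q = (2::real) powr \<bar>\<gamma>\<bar>"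
  have q: "1 \<le> q" unfolding q_def by (rule ge_one_powr_ge_zero) auto
  \<comment> \<open>Makes \<open>M powr D * (q + 1)\<close>, a bound for the number of children, at
    most \<open>M / 2\<close>.\<close>
  have "filterlim (\<lambda>m::nat. real m powr (1 - D)) at_top sequentially" using D by real_asymp
  then have e1: "\<forall>\<^sub>F m in sequentially. 2 * (q + 1) \<le> real m powr (1 - D)" unfolding filterlim_at_top by blast
  have e2: "\<forall>\<^sub>F m in sequentially. 0 < D \<longrightarrow> q \<le> real m powr D"
  proof (cases "0 < D")
    case True
    then have "filterlim (\<lambda>m::nat. real m powr D) at_top sequentially" by real_asymp
    then show ?thesis unfolding filterlim_at_top by (auto elim: eventually_mono)
  qed simp
  obtain m0 where m0: "\<And>m. m \<ge> m0 \<Longrightarrow> 2 * (q + 1) \<le> real m powr (1 - D) \<and> (0 < D \<longrightarrow> q \<le> real m powr D)"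
    using eventually_conj[OF e1 e2] unfolding eventually_sequentially by blast
  define M where "M = 2 * (m0 + 2)"
  have M: "even M" "4 \<le> M" and MD: "2 * (q + 1) \<le> real M powr (1 - D)" "0 < D \<Longrightarrow> q \<le> real M powr D"
    using m0[of M] by (auto simp: M_def)
  have M1: "1 \<le> real M powr D" using M D by (intro ge_one_powr_ge_zero) auto
  define T where "T n = exp (D * ln (real M) * real n) * (real n + 1) powr \<gamma>" for n :: nat
  define \<rho> where "\<rho> n = (real n + 2) / (real n + 1)" for n :: nat
  have \<rho>: "1 \<le> \<rho> n" "\<rho> n \<le> 2" for n by (simp_all add: \<rho>_def field_simps)
  have T_Suc: "T (Suc n) = real M powr D * \<rho> n powr \<gamma> * T n" for n
  proof -
    have "(real n + 2) powr \<gamma> = \<rho> n powr \<gamma> * (real n + 1) powr \<gamma>"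
      by (simp add: \<rho>_def powr_mult[symmetric])
    moreover have "exp (D * ln (real M) * real (Suc n)) = real M powr D * exp (D * ln (real M) * real n)"
      using M by (simp add: powr_def exp_add[symmetric] algebra_simps)
    ultimately show ?thesis by (simp add: T_def add.commute)
  qed
  have Tpos: "0 < T n" for n by (simp add: T_def)
  \<comment> \<open>Products of positive integers cannot decrease, so the target must not either.
    For \<open>\<gamma> < 0\<close> the loss is compensated by \<open>M powr D \<ge> q\<close>,
    which is where \<open>0 < D\<close> enters.\<close>
  have fac: "1 \<le> real M powr D * \<rho> n powr \<gamma> \<and> \<rho> n powr \<gamma> \<le> q" for n
  proof (cases "0 \<le> \<gamma>")
    case True
    have "1 \<le> \<rho> n powr \<gamma>" using \<rho> True by (intro ge_one_powr_ge_zero) auto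
    moreover have "\<rho> n powr \<gamma> \<le> q" unfolding q_def using True \<rho>[of n] by (simp add: powr_mono2)
    moreover have "1 * 1 \<le> real M powr D * \<rho> n powr \<gamma>" using calculation M1 by (intro mult_mono) auto
    ultimately show ?thesis by simp
  next
    case False
    then have "0 < D" using D\<gamma> by simp
    then have "q \<le> real M powr D" by (rule MD)
    moreover have "2 powr \<gamma> \<le> \<rho> n powr \<gamma>" using False \<rho>[of n] by (intro powr_mono2') auto
    ultimately have "q * 2 powr \<gamma> \<le> real M powr D * \<rho> n powr \<gamma>" using q by (intro mult_mono) auto
    moreover have "q * 2 powr \<gamma> = 1" using False by (simp add: q_def powr_add[symmetric])
    moreover have "\<rho> n powr \<gamma> \<le> 1 powr \<gamma>" using False \<rho>[of n] by (intro powr_mono2') auto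
    ultimately show ?thesis using q by simp
  qed
  have T_mono: "T n \<le> T (Suc n)" for n
    using mult_right_mono[OF conjunct1[OF fac[of n]], of "T n"] Tpos[of n] by (simp add: T_Suc)
  \<comment> \<open>Greedy choice: \<open>br n\<close> is the least natural number for which the
    product reaches the target \<open>T (Suc n)\<close>.\<close>
  define P where "P = rec_nat (1::nat) (\<lambda>n p. nat \<lceil>T (Suc n) / real p\<rceil> * p)"
  define br where "br n = nat \<lceil>T (Suc n) / real (P n)\<rceil>" for n
  have P0: "P 0 = 1" and PS: "P (Suc n) = br n * P n" for n by (simp_all add: P_def br_def)
  have P: "T n \<le> real (P n) \<and> real (P n) \<le> 2 * T n \<and> 0 < P n" for n
  proof (induction n)
    case 0
    then show ?case by (simp add: P0 T_def)
  next
    case (Suc n)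
    have p: "0 < real (P n)" using Suc by simp
    have b: "T (Suc n) / real (P n) \<le> real (br n)" "real (br n) < T (Suc n) / real (P n) + 1"
      using p Tpos[of "Suc n"] unfolding br_def by (simp_all add: less_le_trans[OF _ real_nat_ceiling_ge]) linarith
    have lo: "T (Suc n) \<le> real (P (Suc n))" using b(1) p by (simp add: PS field_simps)
    moreover have "real (P (Suc n)) \<le> 2 * T (Suc n)"
    proof (cases "real (P n) \<le> T (Suc n)")
      case True
      have "real (P (Suc n)) \<le> (T (Suc n) / real (P n) + 1) * real (P n)"
        unfolding PS of_nat_mult using b(2) p by (intro mult_right_mono) auto
      also have "\<dots> = T (Suc n) + real (P n)" using p by (simp add: field_simps)
      finally show ?thesis using True by simp
    next
      case False
      \<comment> \<open>The target has already been reached, so the product is not enlarged and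
        stays below twice the nondecreasing target.\<close>
      then have "T (Suc n) / real (P n) < 1" using p by simp
      then have "real (br n) < 2" using b(2) by linarith
      then have "br n \<le> 1" by simp
      then have "P (Suc n) \<le> 1 * P n" unfolding PS by (rule mult_right_mono) simp
      then have "real (P (Suc n)) \<le> real (P n)" by simp
      then show ?thesis using Suc T_mono[of n] by linarith
    qed
    ultimately show ?case using Tpos[of "Suc n"] by (auto intro: gr0I)
  qed
  have br1: "1 \<le> br n" for n using P[of "Suc n"] unfolding PS by (cases "br n") auto
  have br2: "2 * br n \<le> M" for n
  proof -
    have p: "0 < real (P n)" using P[of n] by simp
    have "real (br n) < T (Suc n) / real (P n) + 1"
      using p Tpos[of "Suc n"] unfolding br_def by simp linarith
    also have "T (Suc n) / real (P n) \<le> T (Suc n) / T n"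
      using P[of n] Tpos[of n] Tpos[of "Suc n"] by (intro divide_left_mono) auto
    also have "\<dots> = real M powr D * \<rho> n powr \<gamma>" using Tpos[of n] by (simp add: T_Suc)
    also have "\<dots> \<le> real M powr D * q" using fac[of n] by (intro mult_left_mono) auto
    finally have "real (br n) < real M powr D * q + 1" by simp
    also have "\<dots> \<le> real M powr D * (q + 1)" using M1 by (simp add: algebra_simps)
    finally have "2 * real (br n) \<le> 2 * (real M powr D * (q + 1))" by linarith
    also have "\<dots> = real M powr D * (2 * (q + 1))" by (simp only: mult.left_commute)
    also have "\<dots> \<le> real M powr D * real M powr (1 - D)" by (rule mult_left_mono[OF MD(1)]) simp
    also have "\<dots> = real M" using M by (simp add: powr_add[symmetric])
    finally show ?thesis by linarith
  qed
  have prod: "(\<Prod>i<n. br i) = P n" for n by (induction n) (simp_all add: P0 PS mult.commute)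
  show ?thesis
  proof (rule that[OF M br1 br2])
    show "exp (D * ln (real M) * real n) * (real n + 1) powr \<gamma> \<le> real (\<Prod>i<n. br i)"
      "real (\<Prod>i<n. br i) \<le> 2 * (exp (D * ln (real M) * real n) * (real n + 1) powr \<gamma>)" for n
      using P[of n] unfolding prod T_def by blast+
  qed
qed

lemma summable_exp_powr:
  fixes a \<gamma> :: real
  assumes "0 < a" shows "summable (\<lambda>n. exp (- (a * real n)) * (real n + 1) powr \<gamma>)"
proof (rule summable_comparison_test_bigo)
  have "(\<lambda>n. exp (- (a / 2)) ^ n) = (\<lambda>n. exp (- (a / 2) * real n))" by (rule ext) (simp only: exp_of_nat2_mult)
  moreover have "summable (\<lambda>n. exp (- (a / 2)) ^ n)" using assms by (intro summable_geometric) simp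
  ultimately show "summable (\<lambda>n. norm (exp (- (a / 2) * real n)))" by simp
  show "(\<lambda>n. exp (- (a * real n)) * (real n + 1) powr \<gamma>) \<in> O(\<lambda>n. exp (- (a / 2) * real n))"
    using assms by real_asymp
qed

section \<open>Cutoff functions\<close>

text \<open>A product over the coordinates, not a radial function: its \<open>j\<close>-th partial
  derivative vanishes wherever \<open>x $ j\<close> is close to \<open>c $ j\<close>, which kills
  one component of \<open>d\<zeta>\<close> where a gradient is concentrated, and it is nonpositive
  for \<open>x $ j \<ge> c $ j\<close>.\<close>

definition cutoff :: "real ^ 'n::finite \<Rightarrow> real \<Rightarrow> real ^ 'n \<Rightarrow> real" where
  "cutoff c \<rho> x = (\<Prod>i\<in>UNIV. plateau ((x $ i - c $ i) / \<rho>))"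

lemma DERIV_plateau_scaled:
  "((\<lambda>t. plateau (t / \<rho>)) has_real_derivative plateau' (t / \<rho>) / \<rho>) (at t)"
proof -
  have "((\<lambda>t. t / \<rho>) has_real_derivative 1 / \<rho>) (at t)" by (auto intro!: derivative_eq_intros simp: divide_inverse)
  from DERIV_chain2[OF DERIV_plateau this] show ?thesis by simp
qed

lemma C1_on_cutoff: "C1_on S (cutoff c \<rho>)"
  unfolding cutoff_def[abs_def]
proof (intro C1_on_prod)
  show "C1_on S (\<lambda>x. plateau ((x $ i - c $ i) / \<rho>))" for i
    by (rule C1_on_comp_coord[where \<alpha> = "\<lambda>t. plateau (t / \<rho>)", OF DERIV_plateau_scaled])
      (cases "\<rho> = 0", auto intro!: continuous_intros continuous_on_compose2[OF continuous_on_plateau'[of UNIV]])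
qed simp

lemma pd_cutoff: "pd j (cutoff c \<rho>) x =
    plateau' ((x $ j - c $ j) / \<rho>) / \<rho> * (\<Prod>i\<in>-{j}. plateau ((x $ i - c $ i) / \<rho>))"
proof -
  let ?f = "\<lambda>i x. plateau ((x $ i - c $ i) / \<rho>)"
  note d = pd_comp_coord[where \<alpha> = "\<lambda>t. plateau (t / \<rho>)", OF DERIV_plateau_scaled]
  have c1: "C1_on UNIV (?f i)" for i
    by (rule C1_on_comp_coord[where \<alpha> = "\<lambda>t. plateau (t / \<rho>)", OF DERIV_plateau_scaled])
      (cases "\<rho> = 0", auto intro!: continuous_intros continuous_on_compose2[OF continuous_on_plateau'[of UNIV]])
  have "cutoff c \<rho> = (\<lambda>x. ?f j x * (\<Prod>i\<in>-{j}. ?f i x))"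
    unfolding cutoff_def[abs_def] Compl_eq_Diff_UNIV by (rule ext, rule prod.remove) simp_all
  then have "pd j (cutoff c \<rho>) x = ?f j x * pd j (\<lambda>x. \<Prod>i\<in>-{j}. ?f i x) x + pd j (?f j) x * (\<Prod>i\<in>-{j}. ?f i x)"
    by (simp only: pd_mult[OF C1_onD(1)[OF c1 UNIV_I] C1_onD(1)[OF C1_on_prod[OF c1 finite] UNIV_I]])
  moreover have "pd j (\<lambda>x. \<Prod>i\<in>-{j}. ?f i x) x = 0"
    by (rule pd_prod_0[OF c1]) (auto simp: d(2))
  ultimately show ?thesis by (simp add: d(2))
qed

lemma cutoff_bounds: "0 \<le> cutoff c \<rho> x" "cutoff c \<rho> x \<le> 1"
  unfolding cutoff_def by (auto intro!: prod_nonneg prod_le_1 plateau_bounds)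

lemma cutoff_eq_1:
  assumes "0 < \<rho>" "\<And>i. \<bar>x $ i - c $ i\<bar> \<le> \<rho> / 2" shows "cutoff c \<rho> x = 1"
  unfolding cutoff_def using assms by (intro prod.neutral ballI plateau_eq(1)) (auto simp: abs_divide field_simps)

lemma cutoff_eq_0:
  assumes "0 < \<rho>" "\<rho> \<le> \<bar>x $ i - c $ i\<bar>" shows "cutoff c \<rho> x = 0"
  unfolding cutoff_def using assms by (intro prod_zero) (auto intro!: bexI[of _ i] plateau_eq(2) simp: abs_divide field_simps)

lemma pd_cutoff_eq_0:
  assumes "0 < \<rho>" "\<bar>x $ j - c $ j\<bar> \<le> \<rho> / 2" shows "pd j (cutoff c \<rho>) x = 0"
  unfolding pd_cutoff using assms by (subst plateau'_eq_0) (auto simp: abs_divide field_simps)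

lemma pd_cutoff_nonpos:
  assumes "0 < \<rho>" "0 \<le> x $ j - c $ j" shows "pd j (cutoff c \<rho>) x \<le> 0"
  unfolding pd_cutoff using assms
  by (intro mult_nonpos_nonneg divide_nonpos_pos plateau'_pos prod_nonneg ballI plateau_bounds) auto

lemma pd_cutoff_neg:
  assumes "0 < \<rho>" "\<rho> / 2 < x $ j - c $ j" "x $ j - c $ j < \<rho>" "\<And>i. i \<noteq> j \<Longrightarrow> \<bar>x $ i - c $ i\<bar> \<le> \<rho> / 2"
  shows "pd j (cutoff c \<rho>) x < 0"
proof -
  have "(\<Prod>i\<in>-{j}. plateau ((x $ i - c $ i) / \<rho>)) = 1"
    using assms by (intro prod.neutral ballI plateau_eq(1)) (auto simp: abs_divide field_simps)
  moreover have "plateau' ((x $ j - c $ j) / \<rho>) < 0"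
    using assms by (intro plateau'_pos(2)) (auto simp: field_simps)
  ultimately show ?thesis unfolding pd_cutoff using assms(1) by (simp add: divide_neg_pos)
qed

definition box_around :: "real ^ 'n::finite \<Rightarrow> real \<Rightarrow> (real ^ 'n) set" where
  "box_around c \<rho> = {x. \<forall>i. \<bar>x $ i - c $ i\<bar> \<le> \<rho>}"

lemma compact_box_around: "compact (box_around c \<rho>)"
proof -
  have "box_around c \<rho> = cbox (c - (\<chi> i. \<rho>)) (c + (\<chi> i. \<rho>))"
    by (auto simp: box_around_def cbox_def Basis_vec_def inner_axis abs_le_iff) (smt (verit))+
  then show ?thesis by simp
qed

lemma box_around_subset_ball:
  fixes c :: "real ^ 'n::finite"
  assumes "\<rho> * real CARD('n) < r" shows "box_around c \<rho> \<subseteq> ball c r"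
proof
  fix x assume x: "x \<in> box_around c \<rho>"
  have "norm (x - c) \<le> (\<Sum>i\<in>UNIV. \<bar>(x - c) $ i\<bar>)" by (rule norm_le_l1_cart)
  also have "\<dots> \<le> (\<Sum>i\<in>(UNIV::'n set). \<rho>)" using x by (intro sum_mono) (auto simp: box_around_def)
  finally show "x \<in> ball c r" using assms by (simp add: dist_norm norm_minus_commute mult.commute)
qed

lemma open_coord_less:
  fixes lo hi :: "'n::finite \<Rightarrow> real"
  shows "open {x :: real ^ 'n. \<forall>i. lo i < x $ i - c $ i \<and> x $ i - c $ i < hi i}"
proof -
  have "{x :: real ^ 'n. \<forall>i. lo i < x $ i - c $ i \<and> x $ i - c $ i < hi i} =
      (\<Inter>i. {x. lo i < x $ i - c $ i} \<inter> {x. x $ i - c $ i < hi i})" by auto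
  then show ?thesis by (auto intro!: open_INT open_Int open_Collect_less continuous_intros)
qed

lemma coord_less_nonempty:
  fixes lo hi :: "'n::finite \<Rightarrow> real"
  assumes "\<And>i. lo i < hi i"
  shows "{x :: real ^ 'n. \<forall>i. lo i < x $ i - c $ i \<and> x $ i - c $ i < hi i} \<noteq> {}"
proof -
  have "(\<chi> i. c $ i + (lo i + hi i) / 2) \<in> {x :: real ^ 'n. \<forall>i. lo i < x $ i - c $ i \<and> x $ i - c $ i < hi i}"
    using assms by simp
  then show ?thesis by blast
qed

section \<open>Assigning the roles of jump and Cantor function\<close>

context cantor_scheme begin

lemma N_eq_prod: "N n = (\<Prod>i<n. br i)"
  by (induction n) (simp_all add: N_0 N_Suc mult.commute)

lemma l_le: "l n \<le> l0" using l_antimono[of 0 n] by (simp add: l_0)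

text \<open>\<open>infdist\<close> to the empty set is \<open>0\<close>, so a weight built on an
  empty union would vanish; this and \<open>stageG_nonempty\<close> rule that out.\<close>

lemma stageF_nonempty: "stageF 0 (2 * l0) 0"
  using not_outer_1[of "2 * l0"] l0 thin l_pos[of 0] by (simp add: stageF_def outer_def)

lemma stageG_nonempty: "stageG 0 (l0 / 2) l0"
  using l_pos l_le[of "Suc 0"] l0 by (simp add: stageG_def inner_def l_0)

definition region :: "real ^ 'n::finite \<Rightarrow> real \<Rightarrow> 'n \<Rightarrow> 'n \<Rightarrow> nat \<Rightarrow> (real ^ 'n) set" where
  "region x0 r i1 i2 n = {x \<in> ball x0 r. cell n (x $ i1 - x0 $ i1) (x $ i2 - x0 $ i2)}"

text \<open>Both statements instantiate \<open>pair_gap\<close>, with the jump \<open>F\<close> as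
  \<open>f\<close> in the first and the Cantor series \<open>G\<close> as \<open>f\<close> in the
  second, where the two coordinates change places as well. \<open>stage_dist\<close> bounds the
  distance by the length of either stage, so either family can carry the zeros of the
  weight.\<close>

lemma
  fixes x0 :: "('n::{finite,linorder}) space" and i1 i2 :: 'n and J L :: "'n set"
  assumes r: "16 * l0 * real CARD('n) < r" and ne: "i1 \<noteq> i2"
    and JL: "J \<inter> L = {}" "J \<union> L = - {i1, i2}"
    and sN: "summable (\<lambda>n. real (N n) * l n)" and \<kappa>: "0 \<le> \<kappa>"
    and \<mu>: "\<And>n. region x0 r i1 i2 n \<in> lmeasurable" "\<And>n. measure lebesgue (region x0 r i1 i2 n) \<le> \<mu> n"
    and or: "orlicz_function \<phi>" "orlicz_function \<psi>" "\<And>t. 0 \<le> t \<Longrightarrow> \<phi> t < \<infinity>" "\<And>t. 0 \<le> t \<Longrightarrow> \<psi> t < \<infinity>"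
    and O1: "\<And>c. 0 < c \<Longrightarrow> (\<Sum>n. ennreal (\<mu> n) * \<phi> (c * (v n + 1))) < \<infinity>"
    and O2: "\<And>c. 0 < c \<Longrightarrow> \<exists>T. (\<forall>n. 0 < T n \<and> ennreal (c * s n * T n) \<le> ennreal (log_modulus \<kappa> (l n / (4 * real M))) * \<psi> (T n)) \<and>
        (\<Sum>n. ennreal (\<mu> n) * ennreal (c * s n * T n)) < \<infinity>"
  shows has_gap_weight_F: "(\<And>n. v n = (16 + 1 / thin) / l n) \<Longrightarrow> (\<And>n. s n = 2 * real M / (real (N n) * l n)) \<Longrightarrow>
      has_gap_weight \<phi> \<psi> \<kappa> (ball x0 r) (card J)"
    and has_gap_weight_G: "(\<And>n. v n = 2 * real M / (real (N n) * l n)) \<Longrightarrow> (\<And>n. s n = (16 + 1 / thin) / l n) \<Longrightarrow>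
      has_gap_weight \<phi> \<psi> \<kappa> (ball x0 r) (card J)"
proof -
  define Y where "Y i x = x $ i - x0 $ i" for i and x :: "'n space"
  let ?f = "\<lambda>x. if Y i2 x = 0 then 0 else F (Y i1 x) (Y i2 x)"
  let ?f1 = "\<lambda>x. if Y i2 x = 0 then 0 else F1 (Y i1 x) (Y i2 x)"
  let ?f2 = "\<lambda>x. if Y i2 x = 0 then 0 else F2 (Y i1 x) (Y i2 x)"
  let ?g = "\<lambda>x. if Y i2 x = 0 then 0 else G (Y i1 x) (Y i2 x)"
  let ?g1 = "\<lambda>x. if Y i2 x = 0 then 0 else G1 (Y i1 x) (Y i2 x)"
  let ?g2 = "\<lambda>x. if Y i2 x = 0 then 0 else G2 (Y i1 x) (Y i2 x)"
  let ?A = "\<lambda>n. {x. stageF n (Y i1 x) (Y i2 x)}"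
  let ?B = "\<lambda>n. {x. stageG n (Y i1 x) (Y i2 x)}"
  \<comment> \<open>The \<open>j\<close>-th partial derivative of \<open>\<zeta>\<close> lives where
    the \<open>j\<close>-th coordinate is between \<open>2 * l0\<close> and \<open>4 * l0\<close> in
    absolute value, beyond the Cantor set of extent \<open>l0\<close>. \<open>\<theta>\<close> is
    \<open>1\<close> up to \<open>8 * l0\<close>, and its support fits into the ball by
    \<open>r\<close>.\<close>
  define \<zeta> where "\<zeta> = cutoff x0 (4 * l0)"
  define \<theta> where "\<theta> = cutoff x0 (16 * l0)"
  have "0 \<le> 16 * l0 * real CARD('n)" using l0 by simp
  then have r0: "0 < r" using r by linarith
  have thin8: "thin * l0 \<le> l0"
    using thin(4) l0 by (simp add: mult_le_cancel_right1)
  have Mthin: "thin * real M * l n \<le> 2 * l0" for n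
  proof -
    have "thin * real M * l n \<le> 1 / 8 * l0" using thin(1,3) l_le[of n] l_pos[of n] by (intro mult_mono) auto
    then show ?thesis using l0 by linarith
  qed
  have bdf: "\<bar>?f x\<bar> \<le> 1" and bdg: "\<bar>?g x\<bar> \<le> 1" for x using F_bounds G_bounds by auto
  have A: "\<exists>n. x \<in> ?A n \<and> \<bar>?f1 x\<bar> \<le> (16 + 1 / thin) / l n \<and> \<bar>?f2 x\<bar> \<le> (16 + 1 / thin) / l n"
    if "?f1 x \<noteq> 0 \<or> ?f2 x \<noteq> 0" for x
    using F_grad[of "Y i2 x" "Y i1 x"] that by (cases "Y i2 x = 0") simp_all
  have B: "\<exists>n. x \<in> ?B n \<and> \<bar>?g1 x\<bar> \<le> 2 * real M / (real (N n) * l n) \<and> \<bar>?g2 x\<bar> \<le> 2 * real M / (real (N n) * l n)"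
    if "?g1 x \<noteq> 0 \<or> ?g2 x \<noteq> 0" for x
    using G_grad[of "Y i2 x" "Y i1 x"] that by (cases "Y i2 x = 0") simp_all
  have dY: "\<bar>Y i x - Y i y\<bar> \<le> dist x y" for i x y
    using component_le_norm_cart[of "x - y" i] by (simp add: Y_def dist_norm)
  have dist: "l n / (4 * real M) \<le> dist x y" "l m / (4 * real M) \<le> dist x y" if "x \<in> ?A n" "y \<in> ?B m" for n m x y
    using stage_dist[of n "Y i1 x" "Y i2 x" m "Y i1 y" "Y i2 y"] that dY[of i1 x y] dY[of i2 x y] by (auto intro: order_trans)
  have \<rho>0: "0 < l n / (4 * real M)" for n using l_pos[of n] M by simp
  have R: "region x0 r i1 i2 n \<subseteq> ball x0 r" "?A n \<inter> ball x0 r \<subseteq> region x0 r i1 i2 n"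
    "?B n \<inter> ball x0 r \<subseteq> region x0 r i1 i2 n" for n
    using stageF_cell stageG_cell by (auto simp: region_def Y_def)
  have wf: "weak_pd (ball x0 r) j ?f (\<lambda>x. if j = i1 then ?f1 x else if j = i2 then ?f2 x else 0)" for j
    using weak_pd_F[OF r0 ne sN, of x0 j] unfolding Y_def
    by (rule back_subst[where P = "weak_pd (ball x0 r) j _"]) auto
  have wg: "weak_pd (ball x0 r) j ?g (\<lambda>x. if j = i1 then ?g1 x else if j = i2 then ?g2 x else 0)" for j
    using weak_pd_G[OF r0 ne sN, of x0 j] unfolding Y_def
    by (rule back_subst[where P = "weak_pd (ball x0 r) j _"]) auto
  have z0: "\<zeta> x = 0" if "x \<notin> box_around x0 (4 * l0)" for x
    using that l0 by (auto simp: box_around_def \<zeta>_def not_le intro!: cutoff_eq_0 less_imp_le)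
  have t0: "\<theta> x = 0" if "x \<notin> box_around x0 (16 * l0)" for x
    using that l0 by (auto simp: box_around_def \<theta>_def not_le intro!: cutoff_eq_0 less_imp_le)
  have b1: "\<bar>\<zeta> x\<bar> \<le> 1" "\<bar>\<theta> x\<bar> \<le> 1" for x
    unfolding \<zeta>_def \<theta>_def using cutoff_bounds[of x0 _ x] by (simp_all only: abs_of_nonneg)
  have sub: "box_around x0 (16 * l0) \<subseteq> ball x0 r" by (rule box_around_subset_ball[OF r])
  have in_ball: "x \<in> ball x0 r" if "\<And>i. \<bar>Y i x\<bar> \<le> 16 * l0" for x
    using that by (intro subsetD[OF sub]) (simp add: box_around_def Y_def)
  define U where "U = {x :: 'n space. \<forall>i. - (8 * l0) < x $ i - x0 $ i \<and> x $ i - x0 $ i < 8 * l0}"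
  have oU: "open U" unfolding U_def by (rule open_coord_less)
  have KU: "box_around x0 (4 * l0) \<subseteq> U"
  proof
    fix x assume "x \<in> box_around x0 (4 * l0)"
    then have "\<bar>x $ i - x0 $ i\<bar> \<le> 4 * l0" for i by (simp add: box_around_def)
    then show "x \<in> U" using l0 unfolding U_def by (auto simp: abs_le_iff) (smt (verit))+
  qed
  have U1: "\<theta> x = 1" if "x \<in> U" for x
    unfolding \<theta>_def
  proof (rule cutoff_eq_1)
    fix i
    have "- (8 * l0) < x $ i - x0 $ i \<and> x $ i - x0 $ i < 8 * l0" using that by (simp add: U_def)
    then show "\<bar>x $ i - x0 $ i\<bar> \<le> 16 * l0 / 2" by (simp add: abs_le_iff)
  qed (use l0 in simp)
  note cut = C1_on_cutoff[of UNIV x0 "4 * l0", folded \<zeta>_def] compact_box_around[of x0 "4 * l0"] z0 b1(1)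
    C1_on_cutoff[of UNIV x0 "16 * l0", folded \<theta>_def] compact_box_around[of x0 "16 * l0"] sub t0 b1(2) oU KU U1
  have pd0: "pd j \<zeta> x = 0" if "\<bar>Y j x\<bar> \<le> 2 * l0" for j x
    unfolding \<zeta>_def by (rule pd_cutoff_eq_0) (use that l0 in \<open>auto simp: Y_def\<close>)
  have pd1: "pd j \<zeta> x \<le> 0" if "0 \<le> Y j x" for j x
    unfolding \<zeta>_def by (rule pd_cutoff_nonpos) (use that l0 in \<open>auto simp: Y_def\<close>)
  have pd2: "pd j \<zeta> x < 0" if "2 * l0 < Y j x" "Y j x < 4 * l0" "\<And>i. i \<noteq> j \<Longrightarrow> \<bar>Y i x\<bar> \<le> 2 * l0" for j x
    unfolding \<zeta>_def by (rule pd_cutoff_neg) (use that l0 in \<open>auto simp: Y_def\<close>)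
  note modulus = log_modulus_mono[OF \<kappa>] _ log_modulus_le[OF \<kappa>] log_modulus_diff[OF \<kappa>] log_cap(1)[of \<kappa>]
  have m0: "log_modulus \<kappa> 0 = 0" by (simp add: log_modulus_def)
  have m1: "log_modulus \<kappa> t \<le> 1 * ln (1 / t) powr (- \<kappa>)" if "0 < t" "t < log_cap \<kappa>" for t
    using log_modulus_eq[OF that] by simp
  have pt: "\<exists>x. \<forall>i. Y i x = y i" for y
    by (rule exI[of _ "\<chi> i. x0 $ i + y i"]) (simp add: Y_def)
  show "has_gap_weight \<phi> \<psi> \<kappa> (ball x0 r) (card J)"
    if v: "\<And>n. v n = (16 + 1 / thin) / l n" and s: "\<And>n. s n = 2 * real M / (real (N n) * l n)"
  proof -
    \<comment> \<open>To the right of the Cantor set and slightly above the line,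
      \<open>G = 1\<close>, the step \<open>pr 0\<close> has positive slope and
      \<open>pd i1 \<zeta>\<close> is negative.\<close>
    define lo where "lo i = (if i = i1 then 2 * l0 else if i = i2 then 0 else - (2 * l0))" for i
    define hi where "hi i = (if i = i1 then 4 * l0 else if i = i2 then thin * l0 else 2 * l0)" for i
    define U0 where "U0 = {x :: 'n space. \<forall>i. lo i < x $ i - x0 $ i \<and> x $ i - x0 $ i < hi i}"
    have U0: "2 * l0 < Y i1 x" "Y i1 x < 4 * l0" "0 < Y i2 x" "Y i2 x < thin * l0" "\<And>i. i \<noteq> i1 \<Longrightarrow> \<bar>Y i x\<bar> \<le> 2 * l0"
      if x: "x \<in> U0" for x
    proof -
      have *: "lo i < Y i x" "Y i x < hi i" for i using x by (auto simp: U0_def Y_def)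
      show 1: "2 * l0 < Y i1 x" "Y i1 x < 4 * l0" "0 < Y i2 x" "Y i2 x < thin * l0"
        using *[of i1] *[of i2] ne by (auto simp: lo_def hi_def)
      have "\<bar>Y i2 x\<bar> \<le> 2 * l0" using 1 thin8 l0 by linarith
      fix i assume "i \<noteq> i1"
      with \<open>\<bar>Y i2 x\<bar> \<le> 2 * l0\<close> show "\<bar>Y i x\<bar> \<le> 2 * l0"
        using *[of i] by (cases "i = i2") (auto simp: lo_def hi_def)
    qed
    have U0sub: "U0 \<subseteq> ball x0 r"
    proof (intro subsetI in_ball)
      fix x i assume x: "x \<in> U0"
      show "\<bar>Y i x\<bar> \<le> 16 * l0" using U0(1,2)[OF x] U0(5)[OF x, of i] l0 by (cases "i = i1") (simp; linarith)+
    qed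
    have lohi: "lo i < hi i" for i using l0 thin(1) by (simp add: lo_def hi_def)
    have U0ne: "U0 \<noteq> {}" unfolding U0_def by (rule coord_less_nonempty[OF lohi])
    have Ane: "(\<Union>n. ?A n) \<noteq> {}"
    proof -
      obtain x where "\<forall>i. Y i x = (if i = i1 then 2 * l0 else 0)" using pt[of "\<lambda>i. if i = i1 then 2 * l0 else 0"] by blast
      then have "x \<in> ?A 0" using stageF_nonempty ne by simp
      then show ?thesis by blast
    qed
    have pos: "0 \<le> v n" "0 \<le> s n" for n using thin(1) l_pos[of n] by (simp_all add: v s)
    \<comment> \<open>The gradient of the jump lies at heights below \<open>2 * l0\<close>, where
      \<open>pd i2 \<zeta>\<close> vanishes.\<close>
    have pair1: "?f1 x * pd i2 \<zeta> x = 0" for x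
    proof (cases "?f1 x = 0")
      case False
      then obtain n where "stageF n (Y i1 x) (Y i2 x)" using A[of x] by auto
      then have "\<bar>Y i2 x\<bar> \<le> 2 * l0" using Mthin[of n] unfolding stageF_def by linarith
      then show ?thesis by (simp add: pd0)
    qed simp
    \<comment> \<open>Where \<open>pd i1 \<zeta>\<close> can be nonzero, \<open>Y i1 x\<close> is
      outside \<open>[- l0, l0]\<close>: to the left \<open>G\<close> vanishes, to the right
      \<open>G = 1\<close> and the slope of \<open>pr 0\<close> is nonnegative.\<close>
    have pair2: "?g x * pd i1 \<zeta> x * ?f2 x \<le> 0" for x
    proof (cases "Y i2 x = 0 \<or> \<bar>Y i1 x\<bar> \<le> 2 * l0")
      case True
      then show ?thesis using pd0[of i1 x] by auto
    next
      case False
      then have y: "Y i2 x \<noteq> 0" "l0 < \<bar>Y i1 x\<bar>" using l0 by auto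
      show ?thesis
      proof (cases "Y i1 x \<le> 0")
        case True
        then show ?thesis using G_far1(1)[OF y(1) True] by simp
      next
        case False
        then have "G (Y i1 x) (Y i2 x) = 1" using G_far1(2)[OF y(1)] y(2) by simp
        moreover have "pd i1 \<zeta> x \<le> 0" using False by (intro pd1) simp
        ultimately show ?thesis using F_far1(2)[OF y(2)] y(1) pr_bounds(3)[of 0 "Y i2 x"] by (simp add: mult_nonpos_nonneg)
      qed
    qed
    have pair3: "?g x * pd i1 \<zeta> x * ?f2 x \<noteq> 0" if "x \<in> U0" for x
    proof -
      note u = U0[OF that]
      have y: "Y i2 x \<noteq> 0" "l0 < \<bar>Y i1 x\<bar>" "l0 \<le> Y i1 x" using u l0 by auto
      have "0 < pr' 0 (Y i2 x)" using u by (intro pr'_0_pos) simp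
      moreover have "pd i1 \<zeta> x < 0" by (rule pd2) (use u in auto)
      ultimately show ?thesis using y F_far1(2)[OF y(2)] G_far1(2)[OF y(1,3)] by simp
    qed
    have stg: "\<exists>n. x \<in> ?A n \<and> \<bar>?f1 x\<bar> \<le> v n \<and> \<bar>?f2 x\<bar> \<le> v n" if "?f1 x \<noteq> 0 \<or> ?f2 x \<noteq> 0" for x
      unfolding v by (rule A[OF that])
    have stg': "\<exists>n. x \<in> ?B n \<and> \<bar>?g1 x\<bar> \<le> s n \<and> \<bar>?g2 x\<bar> \<le> s n" if "?g1 x \<noteq> 0 \<or> ?g2 x \<noteq> 0" for x
      unfolding s by (rule B[OF that])
    have oU0: "open U0" unfolding U0_def by (rule open_coord_less)
    show ?thesis
      by (rule pair_gap[where J = J and L = L and ?i1.0 = i1 and ?i2.0 = i2 and f = ?f and ?f1.0 = ?f1 and ?f2.0 = ?f2 and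
          g = ?g and ?g1.0 = ?g1 and ?g2.0 = ?g2 and Df = ?A and Dg = ?B and Q = "region x0 r i1 i2" and ?U0.0 = U0 and
          v = v and s = s and \<mu> = \<mu> and \<zeta> = \<zeta> and \<theta> = \<theta> and K\<zeta> = "box_around x0 (4 * l0)" and
          K\<theta> = "box_around x0 (16 * l0)" and U = U and \<rho> = "\<lambda>m. l m / (4 * real M)" and \<omega> = "log_modulus \<kappa>" and
          \<omega>m = "(\<kappa> + 1) powr (- \<kappa>)" and \<delta> = "log_cap \<kappa>" and C = 1];
        (fact | rule refl JL cut wf wg bdf bdg stg stg' \<mu> R dist(2) \<rho>0 or modulus m0 m1 pair1 pair2 pair3, assumption+ | rule refl JL cut wf wg bdf bdg stg stg' \<mu> R dist(2) \<rho>0 or modulus m0 m1 pair1 pair2 pair3))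
  qed
  show "has_gap_weight \<phi> \<psi> \<kappa> (ball x0 r) (card J)"
    if v: "\<And>n. v n = 2 * real M / (real (N n) * l n)" and s: "\<And>n. s n = (16 + 1 / thin) / l n"
  proof -
    \<comment> \<open>Over the interval \<open>(0, l0)\<close>, at heights where
      \<open>F = 1\<close> and the slope of \<open>G\<close> along the line is that of the single
      ramp \<open>gc 0\<close>, \<open>pd i2 \<zeta>\<close> is negative.\<close>
    define lo where "lo i = (if i = i1 then 0 else if i = i2 then 2 * l0 else - (2 * l0))" for i
    define hi where "hi i = (if i = i1 then l0 else if i = i2 then 4 * l0 else 2 * l0)" for i
    define U0 where "U0 = {x :: 'n space. \<forall>i. lo i < x $ i - x0 $ i \<and> x $ i - x0 $ i < hi i}"
    have U0: "2 * l0 < Y i2 x" "Y i2 x < 4 * l0" "0 < Y i1 x" "Y i1 x < l0" "\<And>i. i \<noteq> i2 \<Longrightarrow> \<bar>Y i x\<bar> \<le> 2 * l0"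
      if x: "x \<in> U0" for x
    proof -
      have *: "lo i < Y i x" "Y i x < hi i" for i using x by (auto simp: U0_def Y_def)
      show 1: "2 * l0 < Y i2 x" "Y i2 x < 4 * l0" "0 < Y i1 x" "Y i1 x < l0"
        using *[of i1] *[of i2] ne by (auto simp: lo_def hi_def)
      have "\<bar>Y i1 x\<bar> \<le> 2 * l0" using 1 l0 by linarith
      fix i assume "i \<noteq> i2"
      with \<open>\<bar>Y i1 x\<bar> \<le> 2 * l0\<close> show "\<bar>Y i x\<bar> \<le> 2 * l0"
        using *[of i] by (cases "i = i1") (auto simp: lo_def hi_def)
    qed
    have U0sub: "U0 \<subseteq> ball x0 r"
    proof (intro subsetI in_ball)
      fix x i assume x: "x \<in> U0"
      show "\<bar>Y i x\<bar> \<le> 16 * l0" using U0(1,2)[OF x] U0(5)[OF x, of i] l0 by (cases "i = i2") (simp; linarith)+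
    qed
    have lohi: "lo i < hi i" for i using l0 by (simp add: lo_def hi_def)
    have U0ne: "U0 \<noteq> {}" unfolding U0_def by (rule coord_less_nonempty[OF lohi])
    have Bne: "(\<Union>n. ?B n) \<noteq> {}"
    proof -
      obtain x where "\<forall>i. Y i x = (if i = i1 then l0 / 2 else l0)" using pt[of "\<lambda>i. if i = i1 then l0 / 2 else l0"] by blast
      then have "x \<in> ?B 0" using stageG_nonempty ne by simp
      then show ?thesis by blast
    qed
    have pos: "0 \<le> v n" "0 \<le> s n" for n using thin(1) l_pos[of n] by (simp_all add: v s)
    \<comment> \<open>The gradient of \<open>G\<close> lies over the interval
      \<open>(0, l0)\<close>, where \<open>pd i1 \<zeta>\<close> vanishes.\<close>
    have pair1: "?g2 x * pd i1 \<zeta> x = 0" for x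
    proof (cases "?g2 x = 0")
      case False
      then obtain n where "stageG n (Y i1 x) (Y i2 x)" using B[of x] by auto
      then have "\<bar>Y i1 x\<bar> \<le> 2 * l0" using inner_0[of n "Y i1 x"] unfolding stageG_def by auto
      then show ?thesis by (simp add: pd0)
    qed simp
    \<comment> \<open>At these heights \<open>F\<close> is \<open>1\<close> above the line and
      \<open>0\<close> below, so only the half contributes where \<open>pd i2 \<zeta>\<close> is
      nonpositive.\<close>
    have pair2: "?f x * pd i2 \<zeta> x * ?g1 x \<le> 0" for x
    proof (cases "\<bar>Y i2 x\<bar> \<le> 2 * l0")
      case True
      then show ?thesis using pd0[of i2 x] by auto
    next
      case False
      then have y: "Y i2 x \<noteq> 0" "l0 \<le> \<bar>Y i2 x\<bar>" using l0 by auto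
      have "?g1 x = gc' 0 (Y i1 x)" using G_far2(1)[OF y(2)] y(1) by simp
      moreover have "0 \<le> gc' 0 (Y i1 x)" by (rule gc_bounds(3))
      moreover have "?f x * pd i2 \<zeta> x \<le> 0" using F_far2[OF y(2)] pd1[of i2 x] by auto
      ultimately show ?thesis by (simp only: mult_nonpos_nonneg)
    qed
    have pair3: "?f x * pd i2 \<zeta> x * ?g1 x \<noteq> 0" if "x \<in> U0" for x
    proof -
      note u = U0[OF that]
      have y: "0 < Y i2 x" "l0 \<le> \<bar>Y i2 x\<bar>" using u l0 by auto
      have "0 < gc' 0 (Y i1 x)" using u by (intro gc'_0_pos) 
      moreover have "pd i2 \<zeta> x < 0" by (rule pd2) (use u in auto)
      ultimately show ?thesis using y(1) F_far2[OF y(2)] G_far2(1)[OF y(2)] by simp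
    qed
    have sw: "(if j = i1 then a else if j = i2 then b else c) = (if j = i2 then b else if j = i1 then a else c)"
      for j and a b c :: real using ne by auto
    have wf': "weak_pd (ball x0 r) j ?f (\<lambda>x. if j = i2 then ?f2 x else if j = i1 then ?f1 x else 0)" for j
      using wf[of j] by (rule back_subst[where P = "weak_pd (ball x0 r) j _"]) (rule ext, rule sw)
    have wg': "weak_pd (ball x0 r) j ?g (\<lambda>x. if j = i2 then ?g2 x else if j = i1 then ?g1 x else 0)" for j
      using wg[of j] by (rule back_subst[where P = "weak_pd (ball x0 r) j _"]) (rule ext, rule sw)
    have JL': "J \<union> L = - {i2, i1}" using JL(2) by (simp add: insert_commute)
    have dist': "l m / (4 * real M) \<le> dist x y" if "x \<in> ?B n" "y \<in> ?A m" for n m x y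
      using dist(1)[OF that(2,1)] by (simp add: dist_commute)
    have stg: "\<exists>n. x \<in> ?B n \<and> \<bar>?g2 x\<bar> \<le> v n \<and> \<bar>?g1 x\<bar> \<le> v n" if "?g2 x \<noteq> 0 \<or> ?g1 x \<noteq> 0" for x
      unfolding v by (rule ex_forward[OF B[OF disj_commute[THEN iffD1, OF that]]]) (elim conjE, intro conjI)
    have stg': "\<exists>n. x \<in> ?A n \<and> \<bar>?f2 x\<bar> \<le> s n \<and> \<bar>?f1 x\<bar> \<le> s n" if "?f2 x \<noteq> 0 \<or> ?f1 x \<noteq> 0" for x
      unfolding s by (rule ex_forward[OF A[OF disj_commute[THEN iffD1, OF that]]]) (elim conjE, intro conjI)
    have oU0: "open U0" unfolding U0_def by (rule open_coord_less)
    show ?thesis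
      by (rule pair_gap[where J = J and L = L and ?i1.0 = i2 and ?i2.0 = i1 and f = ?g and ?f1.0 = ?g2 and ?f2.0 = ?g1 and
          g = ?f and ?g1.0 = ?f2 and ?g2.0 = ?f1 and Df = ?B and Dg = ?A and Q = "region x0 r i1 i2" and ?U0.0 = U0 and
          v = v and s = s and \<mu> = \<mu> and \<zeta> = \<zeta> and \<theta> = \<theta> and K\<zeta> = "box_around x0 (4 * l0)" and
          K\<theta> = "box_around x0 (16 * l0)" and U = U and \<rho> = "\<lambda>m. l m / (4 * real M)" and \<omega> = "log_modulus \<kappa>" and
          \<omega>m = "(\<kappa> + 1) powr (- \<kappa>)" and \<delta> = "log_cap \<kappa>" and C = 1];
        (fact | rule refl JL(1) JL' ne[symmetric] cut wf' wg' bdf bdg stg stg' \<mu> R dist' \<rho>0 or modulus m0 m1 pair1 pair2 pair3, assumption+ | rule refl JL(1) JL' ne[symmetric] cut wf' wg' bdf bdg stg stg' \<mu> R dist' \<rho>0 or modulus m0 m1 pair1 pair2 pair3))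
  qed
qed

end

lemma powr_mult_exp:
  fixes a x p :: real
  assumes "0 < a" shows "(a * exp x) powr p = a powr p * exp (p * x)"
  using assms by (simp add: powr_def ln_mult exp_add[symmetric] distrib_left)

section \<open>Matching the number of intervals with the exponents\<close>

context cantor_scheme begin

lemma l_exp: "l n = l0 * exp (- (ln (real M) * real n))"
proof -
  have "exp (ln (real M) * real n) = real M ^ n" using M by (simp only: exp_of_nat2_mult) simp
  then show ?thesis by (simp add: l_def exp_minus divide_inverse)
qed

lemma log_modulus_stages:
  assumes "0 \<le> \<kappa>"
  obtains d where "0 < d" "\<And>n. d * (real n + 1) powr (- \<kappa>) \<le> log_modulus \<kappa> (l n / (4 * real M))"
proof -
  have p: "0 < l0 / (4 * real M)" "1 < real M" using M l0 by simp_all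
  obtain d where d: "0 < d" "\<And>n. d * (real n + 1) powr (- \<kappa>) \<le> log_modulus \<kappa> (l0 / (4 * real M) / real M ^ n)"
    using log_modulus_geometric[OF assms p] by blast
  have "l0 / (4 * real M) / real M ^ n = l n / (4 * real M)" for n by (simp add: l_def)
  with d show ?thesis using that by metis
qed

text \<open>\<open>upper_sum\<close> and \<open>lower_sum\<close> are applied with
  \<open>V n = 1 / l n\<close> and rate \<open>ln M\<close> in the first case, and with
  \<open>V n = 1 / (N n * l n)\<close> and rate \<open>(1 - D) * ln M\<close> in the second,
  \<open>D\<close> being the growth exponent of \<open>N n\<close>. The assumed size of
  \<open>N n\<close> is what makes \<open>\<mu> n * V n powr p0\<close> of order
  \<open>(n + 1) powr \<sigma>\<close>.\<close>

lemma
  fixes x0 :: "('n::{finite,linorder}) space" and i1 i2 :: 'n and J L :: "'n set" and p0 \<alpha> \<beta> \<kappa> \<sigma> :: real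
  assumes r: "16 * l0 * real CARD('n) < r" and ne: "i1 \<noteq> i2"
    and JL: "J \<inter> L = {}" "J \<union> L = - {i1, i2}"
    and \<kappa>: "0 \<le> \<kappa>" and p0: "1 < p0" and \<sigma>: "\<kappa> - \<alpha> + p0 - 1 < \<sigma>" "\<sigma> < \<beta> - 1"
    and or: "orlicz_function \<phi>" "orlicz_function \<psi>"
    and comp: "comparable_at_top \<phi> (\<lambda>t. t powr p0 * ln t powr (- \<beta>))" "comparable_at_top \<psi> (\<lambda>t. t powr p0 * ln t powr \<alpha>)"
  shows gap_subquadratic: "(\<And>n. exp ((2 - p0) * ln (real M) * real n) * (real n + 1) powr \<sigma> \<le> real (N n)) \<Longrightarrow>
      (\<And>n. real (N n) \<le> 2 * (exp ((2 - p0) * ln (real M) * real n) * (real n + 1) powr \<sigma>)) \<Longrightarrow>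
      has_gap_weight \<phi> \<psi> \<kappa> (ball x0 r) (card J)"
    and gap_superquadratic: "(\<And>n. exp ((p0 - 2) / (p0 - 1) * ln (real M) * real n) * (real n + 1) powr (- \<sigma> / (p0 - 1)) \<le> real (N n)) \<Longrightarrow>
      (\<And>n. real (N n) \<le> 2 * (exp ((p0 - 2) / (p0 - 1) * ln (real M) * real n) * (real n + 1) powr (- \<sigma> / (p0 - 1)))) \<Longrightarrow>
      has_gap_weight \<phi> \<psi> \<kappa> (ball x0 r) (card J)"
proof -
  have "0 \<le> 16 * l0 * real CARD('n)" using l0 by simp
  then have r0: "0 < r" using r by linarith
  define lM where "lM = ln (real M)"
  have lM: "0 < lM" using M by (simp add: lM_def)
  have l: "l n = l0 * exp (- (lM * real n))" for n by (simp add: l_exp lM_def)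
  obtain C where C: "0 \<le> C" "\<And>n. region x0 r i1 i2 n \<in> lmeasurable"
    "\<And>n. measure lebesgue (region x0 r i1 i2 n) \<le> C * (real (N n) * (l n)\<^sup>2)"
    using cell_measure[OF r0 ne, of x0, folded region_def] by blast
  \<comment> \<open>The constant \<open>C\<close> may be \<open>0\<close>, whereas
    \<open>lower_sum\<close> needs \<open>\<mu> n\<close> positive.\<close>
  define Cm where "Cm = C + 1"
  have Cm: "0 < Cm" using C(1) by (simp add: Cm_def)
  define \<mu> where "\<mu> n = Cm * (real (N n) * (l n)\<^sup>2)" for n
  have Np: "0 < real (N n)" for n using N_pos[of n] by simp
  have \<mu>: "0 < \<mu> n" for n using Cm Np[of n] l_pos[of n] by (simp add: \<mu>_def)
  have m\<mu>: "measure lebesgue (region x0 r i1 i2 n) \<le> \<mu> n" for n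
    by (rule order_trans[OF C(3)]) (simp add: \<mu>_def Cm_def mult_right_mono)
  have fin: "\<phi> t < \<infinity>" "\<psi> t < \<infinity>" if "0 \<le> t" for t
    using orlicz_finite[OF or(1) comp(1) that] orlicz_finite[OF or(2) comp(2) that] .
  obtain d where d: "0 < d" "\<And>n. d * (real n + 1) powr (- \<kappa>) \<le> log_modulus \<kappa> (l n / (4 * real M))"
    using log_modulus_stages[OF \<kappa>] by blast
  define cF where "cF = 16 + 1 / thin"
  define cG where "cG = 2 * real M"
  have cFG: "0 < cF" "0 < cG" using thin(1) M by (simp_all add: cF_def cG_def add_pos_pos)
  have l2: "l0 powr (2 - p0) * exp (- ((2 - p0) * (lM * real n))) = l n powr (2 - p0)" for n
    unfolding l using l0 by (simp add: powr_mult_exp)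
  note geo = r ne JL
  show "has_gap_weight \<phi> \<psi> \<kappa> (ball x0 r) (card J)"
    if N: "\<And>n. exp ((2 - p0) * ln (real M) * real n) * (real n + 1) powr \<sigma> \<le> real (N n)"
      "\<And>n. real (N n) \<le> 2 * (exp ((2 - p0) * ln (real M) * real n) * (real n + 1) powr \<sigma>)"
  proof -
    define E where "E n = exp ((2 - p0) * (lM * real n))" for n :: nat
    have E: "0 < E n" for n by (simp add: E_def)
    have N': "E n * (real n + 1) powr \<sigma> \<le> real (N n)" "real (N n) \<le> 2 * (E n * (real n + 1) powr \<sigma>)" for n
      using N[of n] by (simp_all add: E_def lM_def mult.assoc)
    have sN: "summable (\<lambda>n. real (N n) * l n)"
    proof (rule summable_comparison_test')
      show "summable (\<lambda>n. 2 * l0 * (exp (- ((p0 - 1) * lM * real n)) * (real n + 1) powr \<sigma>))"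
        using p0 lM by (intro summable_mult summable_exp_powr) simp
      fix n :: nat
      have "real (N n) * l n \<le> 2 * (E n * (real n + 1) powr \<sigma>) * l n" using N'(2) l_pos[of n] by (intro mult_right_mono) auto
      also have "\<dots> = 2 * l0 * ((E n * exp (- (lM * real n))) * (real n + 1) powr \<sigma>)" by (simp add: l)
      also have "E n * exp (- (lM * real n)) = exp (- ((p0 - 1) * lM * real n))"
        by (simp add: E_def exp_add[symmetric] algebra_simps)
      finally show "norm (real (N n) * l n) \<le> 2 * l0 * (exp (- ((p0 - 1) * lM * real n)) * (real n + 1) powr \<sigma>)"
        using l_pos[of n] by simp
    qed
    define V where "V n = 1 / l n" for n
    have V: "1 / l0 * (exp (lM * real n) * (real n + 1) powr 0) = V n" for n
      by (simp add: V_def l exp_minus divide_inverse)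
    have eV: "\<mu> n * V n powr p0 = Cm * l0 powr (2 - p0) * (real (N n) / E n)" for n
    proof -
      have "(l n)\<^sup>2 * V n powr p0 = l n powr (2 - p0)"
        using l_pos[of n] by (simp add: V_def powr_diff powr_divide powr_numeral)
      also have "\<dots> = l0 powr (2 - p0) / E n" by (simp add: l2[symmetric] E_def exp_minus divide_inverse)
      finally have "(l n)\<^sup>2 * V n powr p0 = l0 powr (2 - p0) / E n" .
      moreover have "\<mu> n * V n powr p0 = Cm * real (N n) * ((l n)\<^sup>2 * V n powr p0)" by (simp add: \<mu>_def)
      ultimately show ?thesis by simp
    qed
    have NE: "(real n + 1) powr \<sigma> \<le> real (N n) / E n" "real (N n) / E n \<le> 2 * (real n + 1) powr \<sigma>" for n
      using N'[of n] E[of n] by (simp_all add: le_divide_eq divide_le_eq mult_ac)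
    have c3: "0 < Cm * l0 powr (2 - p0)" using Cm l0 by simp
    have lo: "Cm * l0 powr (2 - p0) * (real n + 1) powr \<sigma> \<le> \<mu> n * V n powr p0"
      and hi: "\<mu> n * V n powr p0 \<le> Cm * l0 powr (2 - p0) * 2 * (real n + 1) powr \<sigma>" for n
      using mult_left_mono[OF NE(1)[of n] less_imp_le[OF c3]] mult_left_mono[OF NE(2)[of n] less_imp_le[OF c3]]
      by (simp_all add: eV mult.assoc)
    have c0: "0 < 1 / l0" using l0 by simp
    show ?thesis
    proof (rule has_gap_weight_F[OF geo sN \<kappa> C(2) m\<mu> or fin])
      show "(\<Sum>n. ennreal (\<mu> n) * \<phi> (c * (cF * V n + 1))) < \<infinity>" if "0 < c" for c
        by (rule upper_sum[OF or(1) comp(1) p0 lM c0 c0 eq_refl[OF V] eq_refl[OF V[symmetric]] less_imp_le[OF \<mu>] hi \<sigma>(2) cFG(1) that])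
      show "\<exists>T. (\<forall>n. 0 < T n \<and> ennreal (c * (cG / (real (N n) * l n)) * T n) \<le> ennreal (log_modulus \<kappa> (l n / (4 * real M))) * \<psi> (T n)) \<and>
          (\<Sum>n. ennreal (\<mu> n) * ennreal (c * (cG / (real (N n) * l n)) * T n)) < \<infinity>" if c: "0 < c" for c
      proof (rule lower_sum[OF or(2) comp(2) p0 lM c0 c0 eq_refl[OF V] eq_refl[OF V[symmetric]] \<mu> lo c3 \<sigma>(1) d(2) d(1)])
        show "c * (cG / (real (N n) * l n)) = (c * cG * Cm) / (\<mu> n * V n)" for n
          using Cm l_pos[of n] by (simp add: \<mu>_def V_def power2_eq_square)
        show "0 < c * cG * Cm" using c cFG Cm by simp
      qed
    qed (simp_all add: V_def cF_def cG_def)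
  qed
  show "has_gap_weight \<phi> \<psi> \<kappa> (ball x0 r) (card J)"
    if N: "\<And>n. exp ((p0 - 2) / (p0 - 1) * ln (real M) * real n) * (real n + 1) powr (- \<sigma> / (p0 - 1)) \<le> real (N n)"
      "\<And>n. real (N n) \<le> 2 * (exp ((p0 - 2) / (p0 - 1) * ln (real M) * real n) * (real n + 1) powr (- \<sigma> / (p0 - 1)))"
  proof -
    define D where "D = (p0 - 2) / (p0 - 1)"
    define \<gamma> where "\<gamma> = - \<sigma> / (p0 - 1)"
    \<comment> \<open>\<open>D\<close> and \<open>\<gamma>\<close> are the solutions of these two
      equations; they make \<open>B n powr (1 - p0)\<close> compensate
      \<open>l n powr (2 - p0)\<close> up to a constant and
      \<open>(n + 1) powr \<sigma>\<close>.\<close>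
    have D1: "0 < 1 - D" and Dp: "D * (1 - p0) = 2 - p0" and gp: "\<gamma> * (1 - p0) = \<sigma>"
      using p0 by (simp_all add: D_def \<gamma>_def field_simps)
    define B where "B n = exp (D * (lM * real n)) * (real n + 1) powr \<gamma>" for n :: nat
    have B: "0 < B n" for n by (simp add: B_def)
    have N': "B n \<le> real (N n)" "real (N n) \<le> 2 * B n" for n
      using N[of n] by (simp_all only: B_def D_def \<gamma>_def lM_def mult.assoc)
    define E where "E n = exp ((1 - D) * lM * real n) * (real n + 1) powr (- \<gamma>)" for n :: nat
    have E: "0 < E n" for n by (simp add: E_def)
    have BE: "B n * l n = l0 / E n" for n
      by (simp add: B_def l E_def powr_minus exp_diff exp_minus left_diff_distrib field_simps)
    have NlE: "l0 / E n \<le> real (N n) * l n" "real (N n) * l n \<le> 2 * (l0 / E n)" for n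
      using mult_right_mono[OF N'(1)[of n], of "l n"] mult_right_mono[OF N'(2)[of n], of "l n"] l_pos[of n]
      by (simp_all add: BE[symmetric])
    have sN: "summable (\<lambda>n. real (N n) * l n)"
    proof (rule summable_comparison_test')
      show "summable (\<lambda>n. 2 * l0 * (exp (- ((1 - D) * lM * real n)) * (real n + 1) powr \<gamma>))"
        using D1 lM by (intro summable_mult summable_exp_powr) simp
      fix n :: nat
      have "2 * (l0 / E n) = 2 * l0 * (exp (- ((1 - D) * lM * real n)) * (real n + 1) powr \<gamma>)"
        unfolding E_def exp_minus powr_minus by (simp add: field_simps)
      then show "norm (real (N n) * l n) \<le> 2 * l0 * (exp (- ((1 - D) * lM * real n)) * (real n + 1) powr \<gamma>)"
        using NlE(2)[of n] l_pos[of n] by simp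
    qed
    define V where "V n = 1 / (real (N n) * l n)" for n
    have Nl: "0 < real (N n) * l n" for n using Np l_pos by simp
    have V: "1 / (2 * l0) * E n \<le> V n" "V n \<le> 1 / l0 * E n" for n
    proof -
      have "1 / (2 * (l0 / E n)) \<le> V n"
        unfolding V_def by (rule frac_le[OF zero_le_one order_refl Nl NlE(2)])
      moreover have "V n \<le> 1 / (l0 / E n)"
        unfolding V_def by (rule frac_le[OF zero_le_one order_refl divide_pos_pos[OF l0 E] NlE(1)])
      ultimately show "1 / (2 * l0) * E n \<le> V n" "V n \<le> 1 / l0 * E n" by simp_all
    qed
    have c0: "0 < 1 / (2 * l0)" "0 < 1 / l0" using l0 by simp_all
    have eV: "\<mu> n * V n powr p0 = Cm * (real (N n) powr (1 - p0) * l n powr (2 - p0))" for n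
      using l_pos[of n] Np[of n] by (simp add: V_def \<mu>_def powr_diff powr_divide powr_mult powr_numeral)
    have Bl: "B n powr (1 - p0) * l n powr (2 - p0) = l0 powr (2 - p0) * (real n + 1) powr \<sigma>" for n
    proof -
      have "B n powr (1 - p0) = exp ((2 - p0) * (lM * real n)) * (real n + 1) powr \<sigma>"
        unfolding B_def using gp Dp by (simp add: powr_mult powr_powr exp_powr_real mult.commute mult.left_commute)
      then show ?thesis by (simp add: l2[symmetric] exp_minus)
    qed
    \<comment> \<open>As \<open>1 - p0 < 0\<close>, taking powers reverses the bounds on
      \<open>N n\<close>, and the factor \<open>2\<close> becomes
      \<open>2 powr (1 - p0)\<close>.\<close>
    have Nl2: "2 powr (1 - p0) * (l0 powr (2 - p0) * (real n + 1) powr \<sigma>) \<le> real (N n) powr (1 - p0) * l n powr (2 - p0)"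
        "real (N n) powr (1 - p0) * l n powr (2 - p0) \<le> l0 powr (2 - p0) * (real n + 1) powr \<sigma>" for n
    proof -
      have "real (N n) powr (1 - p0) \<le> B n powr (1 - p0)" using N'(1)[of n] B[of n] p0 by (intro powr_mono2') auto
      then show "real (N n) powr (1 - p0) * l n powr (2 - p0) \<le> l0 powr (2 - p0) * (real n + 1) powr \<sigma>"
        unfolding Bl[symmetric] by (rule mult_right_mono) simp
      have "2 powr (1 - p0) * B n powr (1 - p0) = (2 * B n) powr (1 - p0)" using B[of n] by (simp add: powr_mult)
      also have "\<dots> \<le> real (N n) powr (1 - p0)" using N'(2)[of n] Np[of n] p0 by (intro powr_mono2') auto
      finally show "2 powr (1 - p0) * (l0 powr (2 - p0) * (real n + 1) powr \<sigma>) \<le> real (N n) powr (1 - p0) * l n powr (2 - p0)"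
        unfolding Bl[symmetric] mult.assoc[symmetric] by (rule mult_right_mono) simp
    qed
    have c3: "0 < Cm * (2 powr (1 - p0) * l0 powr (2 - p0))" using Cm l0 by simp
    have lo: "Cm * (2 powr (1 - p0) * l0 powr (2 - p0)) * (real n + 1) powr \<sigma> \<le> \<mu> n * V n powr p0"
      and hi: "\<mu> n * V n powr p0 \<le> Cm * l0 powr (2 - p0) * (real n + 1) powr \<sigma>" for n
      unfolding eV using mult_left_mono[OF Nl2(1)[of n] less_imp_le[OF Cm]] mult_left_mono[OF Nl2(2)[of n] less_imp_le[OF Cm]]
      by (simp_all only: mult.assoc)
    have \<theta>: "0 < (1 - D) * lM" using D1 lM by simp
    show ?thesis
    proof (rule has_gap_weight_G[OF geo sN \<kappa> C(2) m\<mu> or fin])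
      show "(\<Sum>n. ennreal (\<mu> n) * \<phi> (c * (cG * V n + 1))) < \<infinity>" if "0 < c" for c
        by (rule upper_sum[OF or(1) comp(1) p0 \<theta> c0 V[unfolded E_def] less_imp_le[OF \<mu>] hi \<sigma>(2) cFG(2) that])
      show "\<exists>T. (\<forall>n. 0 < T n \<and> ennreal (c * (cF / l n) * T n) \<le> ennreal (log_modulus \<kappa> (l n / (4 * real M))) * \<psi> (T n)) \<and>
          (\<Sum>n. ennreal (\<mu> n) * ennreal (c * (cF / l n) * T n)) < \<infinity>" if c: "0 < c" for c
      proof (rule lower_sum[OF or(2) comp(2) p0 \<theta> c0 V[unfolded E_def] \<mu> lo c3 \<sigma>(1) d(2) d(1)])
        show "c * (cF / l n) = (c * cF * Cm) / (\<mu> n * V n)" for n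
          using Cm l_pos[of n] Np[of n] by (simp add: \<mu>_def V_def power2_eq_square)
        show "0 < c * cF * Cm" using c cFG Cm by simp
      qed
    qed (simp_all add: V_def cF_def cG_def)
  qed
qed

end

lemma gap_weight_exists:
  fixes x0 :: "('n::{finite,linorder}) space" and r p0 \<alpha> \<beta> \<kappa> :: real
  assumes N2: "2 \<le> CARD('n)" and r: "0 < r" and k: "k \<le> CARD('n) - 2"
    and p0: "1 < p0" and \<kappa>: "0 \<le> \<kappa>" and ab: "p0 + \<kappa> < \<alpha> + \<beta>"
    and or: "orlicz_function \<phi>" "orlicz_function \<psi>"
    and comp: "comparable_at_top \<phi> (\<lambda>t. t powr p0 * ln t powr (- \<beta>))" "comparable_at_top \<psi> (\<lambda>t. t powr p0 * ln t powr \<alpha>)"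
  shows "has_gap_weight \<phi> \<psi> \<kappa> (ball x0 r) k"
proof -
  \<comment> \<open>The only place where the condition on \<open>\<alpha> + \<beta>\<close> enters:
    it makes the interval for \<open>\<sigma>\<close> nonempty.\<close>
  have "\<kappa> - \<alpha> + p0 - 1 < \<beta> - 1" using ab by linarith
  then obtain \<sigma> where \<sigma>: "\<kappa> - \<alpha> + p0 - 1 < \<sigma>" "\<sigma> < \<beta> - 1" by (rule dense[THEN exE]) blast
  have "\<not> CARD('n) \<le> Suc 0" using N2 by simp
  then obtain i1 i2 :: 'n where ne: "i1 \<noteq> i2" using card_le_Suc0_iff_eq[of "UNIV :: 'n set"] by auto
  have "card (- {i1, i2}) = CARD('n) - 2" using ne by (simp add: Compl_eq_Diff_UNIV card_Diff_subset)
  then obtain J where J: "J \<subseteq> - {i1, i2}" "card J = k" using k obtain_subset_with_card_n[of k "- {i1, i2}"] by metis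
  define L where "L = - {i1, i2} - J"
  have JL: "J \<inter> L = {}" "J \<union> L = - {i1, i2}" using J(1) by (auto simp: L_def)
  \<comment> \<open>\<open>20\<close> instead of \<open>16\<close> makes the bound by
    \<open>r\<close> strict.\<close>
  define l0 where "l0 = r / (20 * real CARD('n))"
  have l0: "0 < l0" "16 * l0 * real CARD('n) < r" using r by (simp_all add: l0_def)
  note args = l0(2) ne JL \<kappa> p0 \<sigma> or comp
  show ?thesis
  \<comment> \<open>The dichotomy makes the exponent \<open>D\<close> of
    \<open>branching_exists\<close> nonnegative. At \<open>p0 = 2\<close> it is \<open>0\<close> in
    both constructions, and the power of \<open>n\<close> has to be nondecreasing, which the sign of
    \<open>\<sigma>\<close> decides.\<close>
  proof (cases "p0 < 2 \<or> p0 = 2 \<and> 0 \<le> \<sigma>")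
    case True
    then have D: "0 \<le> 2 - p0" "2 - p0 < 1" "0 < 2 - p0 \<or> 0 \<le> \<sigma>" using p0 by auto
    show ?thesis
    proof (rule branching_exists[OF D])
      fix M :: nat and br :: "nat \<Rightarrow> nat"
      assume M: "even M" "4 \<le> M" "\<And>n. 1 \<le> br n" "\<And>n. 2 * br n \<le> M"
        and b: "\<And>n. exp ((2 - p0) * ln (real M) * real n) * (real n + 1) powr \<sigma> \<le> real (\<Prod>i<n. br i)"
        "\<And>n. real (\<Prod>i<n. br i) \<le> 2 * (exp ((2 - p0) * ln (real M) * real n) * (real n + 1) powr \<sigma>)"
      interpret cantor_scheme M l0 br using M l0 by unfold_locales
      show ?thesis
        unfolding J(2)[symmetric] by (rule gap_subquadratic[OF args b[folded N_eq_prod]])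
    qed
  next
    case False
    then have p2: "2 \<le> p0" by auto
    have D: "0 \<le> (p0 - 2) / (p0 - 1)" "(p0 - 2) / (p0 - 1) < 1" using p2 by simp_all
    have D\<gamma>: "0 < (p0 - 2) / (p0 - 1) \<or> 0 \<le> - \<sigma> / (p0 - 1)"
      using False p2 by (cases "p0 = 2") (auto simp: divide_nonpos_pos)
    show ?thesis
    proof (rule branching_exists[OF D D\<gamma>])
      fix M :: nat and br :: "nat \<Rightarrow> nat"
      assume M: "even M" "4 \<le> M" "\<And>n. 1 \<le> br n" "\<And>n. 2 * br n \<le> M"
        and b: "\<And>n. exp ((p0 - 2) / (p0 - 1) * ln (real M) * real n) * (real n + 1) powr (- \<sigma> / (p0 - 1)) \<le> real (\<Prod>i<n. br i)"
        "\<And>n. real (\<Prod>i<n. br i) \<le> 2 * (exp ((p0 - 2) / (p0 - 1) * ln (real M) * real n) * (real n + 1) powr (- \<sigma> / (p0 - 1)))"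
      interpret cantor_scheme M l0 br using M l0 by unfold_locales
      show ?thesis
        unfolding J(2)[symmetric] by (rule gap_superquadratic[OF args b[folded N_eq_prod]])
    qed
  qed
qed

theorem theorem2:
  fixes x0 :: "('n::{finite,linorder}) space" and r :: real
    and \<Omega> :: "'n space set"
    and k :: nat
    and p0 \<alpha> \<beta> \<kappa> :: real
    and \<phi> \<psi> :: "real \<Rightarrow> ennreal"
  assumes "CARD('n) \<ge> 2"
    and "r > 0" and "\<Omega> = ball x0 r"
    and "k \<le> CARD('n) - 2"
    and "p0 > 1" and "\<kappa> \<ge> 0" and "\<alpha> + \<beta> > p0 + \<kappa>"
    and "orlicz_function \<phi>" and "orlicz_function \<psi>"
    and "comparable_at_top \<phi> (\<lambda>t. t powr p0 * ln t powr (- \<beta>))"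
    and "comparable_at_top \<psi> (\<lambda>t. t powr p0 * ln t powr \<alpha>)"
  shows "\<exists>a :: 'n space \<Rightarrow> real.
    a \<in> borel_measurable (lebesgue_on \<Omega>) \<and>
    (\<forall>x\<in>\<Omega>. a x \<ge> 0) \<and>
    (\<exists>C. has_modulus_near_0 \<Omega> a (\<lambda>t. C * ln (1 / t) powr (- \<kappa>))) \<and>
    (let \<Phi> = (\<lambda>x t. \<phi> t + ennreal (a x) * \<psi> t) in
      H_d \<Phi> \<Omega> k \<noteq> W_d \<Phi> \<Omega> k \<and>
      (\<exists>b\<in>Orlicz_forms (conjugate \<Phi>) \<Omega> (CARD('n) - k - 1).
        (INF \<omega>\<in>W_d_c \<Phi> \<Omega> k. functional \<Phi> b \<Omega> k \<omega>)
          < (INF \<omega>\<in>test_forms \<Omega> k. functional \<Phi> b \<Omega> k \<omega>)))"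
  using gap_weight_exists[OF assms(1,2,4-)] unfolding assms(3) .

end
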